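(* Let $d\ge1$, $N\ge 2$, $s\in(0,1)$, let $\Omega\subset\mathbb{R}^d$ be a bounded polyhedral Lipschitz domain, and let $\{u_h\}_{h>0}$ be a sequence of discrete fractional harmonic maps $u_h\in\mathcal{A}_h$ on a sequence of quasiuniform triangulations with maximal mesh sizes $h\to0$, such that $\|(-\Delta)^{\frac s2}u_h\|\le c$ for all $h>0$ with a constant $c$ independent of $h$. Then every weak accumulation point $u\in\vec N+\widetilde H^s(\Omega;\mathbb{R}^N)$ of $\{u_h\}$ as $h\to0$ satisfies $u\in\mathcal{A}$, i.e. $|u(x)|^2=1$ for almost every $x\in\Omega$, and $$\big((-\Delta)^{\frac s2}u,(-\Delta)^{\frac s2}v\big)=0$$ for all $v\in C_c^\infty(\Omega;\mathbb{R}^N)$ with $u\cdot v=0$ almost everywhere in $\Omega$.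
   Context: $(-\Delta)^{s/2}$ is the integral fractional Laplacian on $\mathbb{R}^d$, i.e. the Fourier multiplier with symbol $|\xi|^s$, acting componentwise; $(\cdot,\cdot)$ and $\|\cdot\|$ are the $L^2$ inner product and norm, taken over $\mathbb{R}^d$ for expressions involving $(-\Delta)^{s/2}$. $\widetilde H^s(\Omega;\mathbb{R}^N)=\{f\in H^s(\mathbb{R}^d;\mathbb{R}^N): f=0\text{ a.e. in }\mathbb{R}^d\setminus\Omega\}$. Exterior data: $\widetilde\Omega\subset\mathbb{R}^d$ is a bounded polyhedral domain with $\overline\Omega\subset\widetilde\Omega$, and $\vec N\in C_c^\infty(\widetilde\Omega;\mathbb{R}^N)$ is a fixed vector field with $|\vec N|=1$ on $\partial\Omega$. $\mathcal{A}=\{v: v-\vec N\in\widetilde H^s(\Omega;\mathbb{R}^N),\ |v(x)|^2=1\text{ for a.e. }x\in\Omega\}$. Triangulations: $\{\mathcal{T}_h\}_{h>0}$ are conforming simplicial triangulations of $\Omega$, uniformly shape regular and quasiuniform (all element diameters comparable to $h$, uniformly in $h$); each is extended to a conforming triangulation $\widetilde{\mathcal{T}}_h$ of $\widetilde\Omega$, uniformly shape regular with maximal mesh size tending to $0$. $\mathcal{S}^1(\widetilde{\mathcal{T}}_h)$ is the space of continuous functions on $\widetilde\Omega$ that are affine on every element; $\mathcal{S}^1_0(\mathcal{T}_h)$ is its subspace of functions vanishing in $\widetilde\Omega\setminus\Omega$. $\mathcal{N}_h$ is the set of vertices of $\mathcal{T}_h$ and $\widetilde{\mathcal{I}}_h$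 is the nodal interpolation operator on $\widetilde{\mathcal{T}}_h$. Finite element functions considered here vanish on $\partial\widetilde\Omega$ and are extended by zero to $\mathbb{R}^d$. $\mathcal{A}_h=\{u_h: u_h-\widetilde{\mathcal{I}}_h\vec N\in\mathcal{S}^1_0(\mathcal{T}_h)^N,\ |u_h(z)|^2=1\ \forall z\in\mathcal{N}_h\}$ and $\mathcal{F}_h[u_h]=\{v_h\in\mathcal{S}^1_0(\mathcal{T}_h)^N: v_h(z)\cdot u_h(z)=0\ \forall z\in\mathcal{N}_h\}$. A discrete fractional harmonic map is a $u_h\in\mathcal{A}_h$ with $((-\Delta)^{s/2}u_h,(-\Delta)^{s/2}v_h)=0$ for all $v_h\in\mathcal{F}_h[u_h]$. Weak accumulation point means: weak limit in $L^2(\mathbb{R}^d;\mathbb{R}^N)$ (equivalently, by boundedness, in $H^s(\mathbb{R}^d;\mathbb{R}^N)$) of a subsequence $u_{h'}$, $h'\to0$. *)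

theory Defs
  imports "HOL-Analysis.Analysis"
begin

section \<open>The space $L^2$ and the fractional Laplacian\<close>

text \<open>Elements of $L^2$ are represented by Borel measurable functions; every Lebesgue class has such a
  representative.\<close>

definition L2 :: "('a::euclidean_space \<Rightarrow> 'b::euclidean_space) set" where
  "L2 = {f. f \<in> borel_measurable lborel \<and> integrable lborel (\<lambda>x. (norm (f x))\<^sup>2)}"

definition L2_inner :: "('a::euclidean_space \<Rightarrow> 'b::euclidean_space) \<Rightarrow> ('a \<Rightarrow> 'b) \<Rightarrow> real" where
  "L2_inner f g = (LINT x|lborel. f x \<bullet> g x)"

definition L2_norm :: "('a::euclidean_space \<Rightarrow> 'b::euclidean_space) \<Rightarrow> real" where
  "L2_norm f = sqrt (L2_inner f f)"

definition weakly_converges_L2 ::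
  "(nat \<Rightarrow> 'a::euclidean_space \<Rightarrow> 'b::euclidean_space) \<Rightarrow> ('a \<Rightarrow> 'b) \<Rightarrow> bool" where
  "weakly_converges_L2 w u \<longleftrightarrow>
     (\<forall>n. w n \<in> L2) \<and> u \<in> L2 \<and> (\<forall>\<phi>\<in>L2. (\<lambda>n. L2_inner (w n) \<phi>) \<longlonglongrightarrow> L2_inner u \<phi>)"

definition weak_accumulation_point ::
  "(nat \<Rightarrow> 'a::euclidean_space \<Rightarrow> 'b::euclidean_space) \<Rightarrow> ('a \<Rightarrow> 'b) \<Rightarrow> bool" where
  "weak_accumulation_point w u \<longleftrightarrow>
     (\<exists>r :: nat \<Rightarrow> nat. strict_mono r \<and> weakly_converges_L2 (w \<circ> r) u)"

definition fourier_integral :: "('a::euclidean_space \<Rightarrow> complex) \<Rightarrow> 'a \<Rightarrow> complex" where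
  "fourier_integral f \<xi> = complex_of_real ((2 * pi) powr (- real DIM('a) / 2)) *
     (LINT x|lborel. exp (- \<i> * complex_of_real (x \<bullet> \<xi>)) * f x)"

text \<open>The unitary (Plancherel) Fourier transform on $L^2$: the $L^2$ limit, as $R \to \infty$, of the
  Fourier integrals of $f$ restricted to the balls of radius $R$. It is determined up to null sets.\<close>

definition L2_fourier :: "('a::euclidean_space \<Rightarrow> complex) \<Rightarrow> 'a \<Rightarrow> complex" where
  "L2_fourier f = (SOME F. F \<in> L2 \<and>
     ((\<lambda>R::real. \<integral>\<^sup>+ \<xi>. ennreal ((norm (F \<xi> -
         fourier_integral (\<lambda>x. indicator (cball 0 R) x * f x) \<xi>))\<^sup>2) \<partial>lborel)
       \<longlongrightarrow> 0) at_top)"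

definition L2_fourier_inv :: "('a::euclidean_space \<Rightarrow> complex) \<Rightarrow> 'a \<Rightarrow> complex" where
  "L2_fourier_inv F x = L2_fourier F (- x)"

text \<open>$(-\Delta)^\sigma$ has symbol $|\xi|^{2\sigma}$. For real-valued $f$ the result is real-valued
  almost everywhere, by Hermitian symmetry of the Fourier transform; the codomain is kept complex. Hence
  on such results \<^const>\<open>L2_inner\<close>, which uses the real inner product of the codomain, is the $L^2$ inner
  product.\<close>

definition frac_laplacian ::
  "real \<Rightarrow> ('a::euclidean_space \<Rightarrow> real ^ 'n) \<Rightarrow> 'a \<Rightarrow> complex ^ 'n" where
  "frac_laplacian \<sigma> f x =
     (\<chi> i. L2_fourier_inv (\<lambda>\<xi>. complex_of_real (norm \<xi> powr (2 * \<sigma>)) *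
                               L2_fourier (\<lambda>y. complex_of_real (f y $ i)) \<xi>) x)"


section \<open>Function spaces\<close>

definition Hs :: "real \<Rightarrow> ('a::euclidean_space \<Rightarrow> real ^ 'n) set" where
  "Hs s = {f. f \<in> L2 \<and> (\<forall>i. integrable lborel (\<lambda>\<xi>. (1 + (norm \<xi>)\<^sup>2) powr s *
                              (norm (L2_fourier (\<lambda>y. complex_of_real (f y $ i)) \<xi>))\<^sup>2))}"

definition Hs_tilde :: "real \<Rightarrow> 'a::euclidean_space set \<Rightarrow> ('a \<Rightarrow> real ^ 'n) set" where
  "Hs_tilde s \<Omega> = {f \<in> Hs s. AE x in lborel. x \<notin> \<Omega> \<longrightarrow> f x = 0}"

primrec C_k :: "nat \<Rightarrow> ('a::euclidean_space \<Rightarrow> 'b::euclidean_space) \<Rightarrow> bool" where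
  "C_k 0 f = continuous_on UNIV f"
| "C_k (Suc k) f = ((\<forall>x. f differentiable (at x)) \<and>
                    (\<forall>e\<in>Basis. C_k k (\<lambda>x. frechet_derivative f (at x) e)))"

definition Cc_infty :: "'a::euclidean_space set \<Rightarrow> ('a \<Rightarrow> 'b::euclidean_space) set" where
  "Cc_infty \<Omega> = {f. (\<forall>k. C_k k f) \<and> compact (closure {x. f x \<noteq> 0}) \<and> closure {x. f x \<noteq> 0} \<subseteq> \<Omega>}"

definition admissible ::
  "real \<Rightarrow> 'a::euclidean_space set \<Rightarrow> ('a \<Rightarrow> real ^ 'n) \<Rightarrow> ('a \<Rightarrow> real ^ 'n) set" where
  "admissible s \<Omega> Nv = {v. (\<lambda>x. v x - Nv x) \<in> Hs_tilde s \<Omega> \<and>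
                           (AE x in lborel. x \<in> \<Omega> \<longrightarrow> (norm (v x))\<^sup>2 = 1)}"


section \<open>Domains\<close>

definition bounded_polyhedral_domain :: "'a::euclidean_space set \<Rightarrow> bool" where
  "bounded_polyhedral_domain \<Omega> \<longleftrightarrow>
     open \<Omega> \<and> connected \<Omega> \<and> \<Omega> \<noteq> {} \<and> bounded \<Omega> \<and> interior (closure \<Omega>) = \<Omega> \<and>
     (\<exists>\<P>. finite \<P> \<and> (\<forall>P\<in>\<P>. polytope P) \<and> closure \<Omega> = \<Union>\<P>)"

text \<open>Locally, \<open>\<Omega>\<close> is the strict epigraph in direction \<open>e\<close> of a Lipschitz function \<open>\<phi>\<close> on the
  hyperplane orthogonal to \<open>e\<close>.\<close>

definition Lipschitz_boundary :: "'a::euclidean_space set \<Rightarrow> bool" where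
  "Lipschitz_boundary \<Omega> \<longleftrightarrow>
     (\<forall>p\<in>frontier \<Omega>. \<exists>r>0. \<exists>e. norm e = 1 \<and> (\<exists>L \<phi>. L-lipschitz_on {y. y \<bullet> e = 0} \<phi> \<and>
        \<Omega> \<inter> ball p r = {x \<in> ball p r. x \<bullet> e > \<phi> (x - (x \<bullet> e) *\<^sub>R e)}))"


section \<open>Triangulations and finite element spaces\<close>

definition conforming_triangulation :: "'a::euclidean_space set \<Rightarrow> 'a set set \<Rightarrow> bool" where
  "conforming_triangulation \<Omega> \<T> \<longleftrightarrow>
     triangulation \<T> \<and> (\<forall>K\<in>\<T>. int DIM('a) simplex K) \<and> \<Union>\<T> = closure \<Omega>"

definition uniformly_shape_regular :: "(nat \<Rightarrow> 'a::euclidean_space set set) \<Rightarrow> bool" where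
  "uniformly_shape_regular \<T> \<longleftrightarrow>
     (\<exists>\<kappa>>0. \<forall>n. \<forall>K\<in>\<T> n. \<exists>z. cball z (\<kappa> * diameter K) \<subseteq> K)"

definition quasiuniform :: "(nat \<Rightarrow> real) \<Rightarrow> (nat \<Rightarrow> 'a::euclidean_space set set) \<Rightarrow> bool" where
  "quasiuniform h \<T> \<longleftrightarrow>
     (\<exists>c\<^sub>1>0. \<exists>c\<^sub>2. \<forall>n. \<forall>K\<in>\<T> n. c\<^sub>1 * h n \<le> diameter K \<and> diameter K \<le> c\<^sub>2 * h n)"

definition mesh_size :: "'a::euclidean_space set set \<Rightarrow> real" where
  "mesh_size \<T> = Max (diameter ` \<T>)"

definition nodes :: "'a::euclidean_space set set \<Rightarrow> 'a set" where
  "nodes \<T> = {z. \<exists>K\<in>\<T>. z extreme_point_of K}"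

definition affine_map_on ::
  "'a::euclidean_space set \<Rightarrow> ('a \<Rightarrow> 'b::euclidean_space) \<Rightarrow> bool" where
  "affine_map_on K f \<longleftrightarrow> (\<exists>A b. linear A \<and> (\<forall>x\<in>K. f x = A x + b))"

text \<open>Functions on the triangulated set \<open>\<Union>\<T>\<close> are represented by their extensions by zero.\<close>

definition S1 :: "'a::euclidean_space set set \<Rightarrow> ('a \<Rightarrow> 'b::euclidean_space) set" where
  "S1 \<T> = {w. continuous_on (\<Union>\<T>) w \<and> (\<forall>K\<in>\<T>. affine_map_on K w) \<and> (\<forall>x. x \<notin> \<Union>\<T> \<longrightarrow> w x = 0)}"

text \<open>Given a triangulation \<open>\<T>\<close> of \<open>\<Omega>\<close> extended by a triangulation \<open>\<T>'\<close> of a larger domain, the space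
  $\mathcal S^1_0(\mathcal T)$ consists of the elements of $\mathcal S^1(\mathcal T')$ that vanish
  outside \<open>\<Omega>\<close>; in it, \<open>\<T>\<close> enters only through \<open>\<Omega>\<close> and \<open>\<T>'\<close>.\<close>

definition S1_0 ::
  "'a::euclidean_space set \<Rightarrow> 'a set set \<Rightarrow> ('a \<Rightarrow> 'b::euclidean_space) set" where
  "S1_0 \<Omega> \<T>' = {w \<in> S1 \<T>'. \<forall>x. x \<notin> \<Omega> \<longrightarrow> w x = 0}"

definition nodal_interpolant ::
  "'a::euclidean_space set set \<Rightarrow> ('a \<Rightarrow> 'b::euclidean_space) \<Rightarrow> 'a \<Rightarrow> 'b" where
  "nodal_interpolant \<T> f = (THE w. w \<in> S1 \<T> \<and> (\<forall>z\<in>nodes \<T>. w z = f z))"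

definition discrete_admissible ::
  "'a::euclidean_space set \<Rightarrow> 'a set set \<Rightarrow> 'a set set \<Rightarrow> ('a \<Rightarrow> real ^ 'n) \<Rightarrow> ('a \<Rightarrow> real ^ 'n) set" where
  "discrete_admissible \<Omega> \<T> \<T>' Nv =
     {w. (\<lambda>x. w x - nodal_interpolant \<T>' Nv x) \<in> S1_0 \<Omega> \<T>' \<and> (\<forall>z\<in>nodes \<T>. (norm (w z))\<^sup>2 = 1)}"

definition discrete_tangent ::
  "'a::euclidean_space set \<Rightarrow> 'a set set \<Rightarrow> 'a set set \<Rightarrow> ('a \<Rightarrow> real ^ 'n) \<Rightarrow> ('a \<Rightarrow> real ^ 'n) set" where
  "discrete_tangent \<Omega> \<T> \<T>' w = {v \<in> S1_0 \<Omega> \<T>'. \<forall>z\<in>nodes \<T>. v z \<bullet> w z = 0}"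

definition discrete_fractional_harmonic_map ::
  "real \<Rightarrow> 'a::euclidean_space set \<Rightarrow> 'a set set \<Rightarrow> 'a set set \<Rightarrow> ('a \<Rightarrow> real ^ 'n) \<Rightarrow>
     ('a \<Rightarrow> real ^ 'n) \<Rightarrow> bool" where
  "discrete_fractional_harmonic_map s \<Omega> \<T> \<T>' Nv w \<longleftrightarrow>
     w \<in> discrete_admissible \<Omega> \<T> \<T>' Nv \<and>
     (\<forall>v\<in>discrete_tangent \<Omega> \<T> \<T>' w.
        L2_inner (frac_laplacian (s / 2) w) (frac_laplacian (s / 2) v) = 0)"

end

theory Submission
  imports Defs "HOL-Probability.Characteristic_Functions"
begin

text \<open>Nodal test fields that are tangent to \<open>u\<^sub>h\<close> are produced by skew maps: for fixed fields \<open>v, p\<close> the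
  field \<open>(p \<bullet> u\<^sub>h) v - (v \<bullet> u\<^sub>h) p\<close> is pointwise orthogonal to \<open>u\<^sub>h\<close>, so its interpolant is admissible.
  As \<open>\<bar>u\<^sub>h\<bar> \<le> 1\<close> and \<open>\<bar>\<nabla>u\<^sub>h\<bar> \<le> C/h\<close> on \<open>\<Omega>\<close>, the interpolation error is uniformly Lipschitz and of
  size \<open>O(h)\<close>, hence tends to zero in the fractional energy. Written as an integral over translations
  \<open>y\<close>, the form against the skew field contains a factor \<open>v(x + y) - v(x)\<close> or \<open>p(x + y) - p(x)\<close>, which
  removes the critical part of the kernel; strong \<open>L\<^sup>2\<close> convergence then suffices to pass to the
  limit and \<open>u\<close> is orthogonal to \<open>(p \<bullet> u) v\<close> whenever \<open>u \<bullet> v = 0\<close>. Finally \<open>p\<close> runs through the \<open>u\<^sub>h\<close>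
  themselves: \<open>(p \<bullet> u) v\<close> tends to \<open>\<bar>u\<bar>\<^sup>2 v = v\<close> in \<open>L\<^sup>2\<close> with bounded energy.\<close>

section \<open>The space \<open>L\<^sup>2\<close>\<close>

text \<open>The identity to be passed to the limit is quadratic in \<open>u\<^sub>h\<close>, so weak
  convergence in the energy space is not enough, and a fixed \<open>v\<close> with
  \<open>u \<bullet> v = 0\<close> is not tangent to \<open>u\<^sub>h\<close>. The skew fields meet
  both difficulties but ask for a Lipschitz \<open>p\<close>, in the interpolation estimate and in
  the integrable majorant alike, and the natural choice \<open>p = u\<close> need not be Lipschitz.
  Each discrete map is, with a constant that may blow up under refinement. Hence two limits in a
  fixed order: first the index of the form with \<open>p = w j\<close> frozen, then
  \<open>j\<close>, where only an energy bound uniform in \<open>j\<close> and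
  \<open>L\<^sup>2\<close> convergence are used. Unit length of the limit is a separate matter,
  because the constraint holds at nodes only. On an element the defect
  \<open>1 - \<bar>u\<^sub>h\<bar>\<^sup>2\<close> is controlled by diameter times gradient; the
  gradient is read off from a translation of length comparable to \<open>h\<close>, and the energy
  bound makes such differences \<open>O(h\<^sup>s)\<close> in \<open>L\<^sup>2\<close>. This is the
  main use of quasiuniformity. Differences and Fourier multiplier are linked by the Plancherel
  theorem, which is derived from the Gaussian.\<close>

lemma L2_measurable[measurable_dest]: "f \<in> L2 \<Longrightarrow> f \<in> borel_measurable borel"
  by (simp add: L2_def)

lemma L2_integrable_sq: "f \<in> L2 \<Longrightarrow> integrable lborel (\<lambda>x. (norm (f x))\<^sup>2)"
  by (simp add: L2_def)

lemma L2I: "f \<in> borel_measurable borel \<Longrightarrow> integrable lborel (\<lambda>x. (norm (f x))\<^sup>2) \<Longrightarrow> f \<in> L2"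
  by (simp add: L2_def)

lemma L2_dominated:
  assumes "g \<in> L2" "f \<in> borel_measurable borel" "AE x in lborel. norm (f x) \<le> c * norm (g x)"
  shows "f \<in> L2"
proof (rule L2I)
  show "integrable lborel (\<lambda>x. (norm (f x))\<^sup>2)"
  proof (rule Bochner_Integration.integrable_bound)
    show "integrable lborel (\<lambda>x. c\<^sup>2 * (norm (g x))\<^sup>2)"
      using L2_integrable_sq[OF assms(1)] by simp
    show "AE x in lborel. norm ((norm (f x))\<^sup>2) \<le> norm (c\<^sup>2 * (norm (g x))\<^sup>2)"
      using assms(3) by eventually_elim (simp flip: power_mult_distrib add: power_mono)
  qed (use assms in measurable)
qed (use assms in auto)

lemma L2_inner_integrable:
  assumes "f \<in> L2" "g \<in> L2"
  shows "integrable lborel (\<lambda>x. f x \<bullet> g x)"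
proof (rule Bochner_Integration.integrable_bound)
  show "integrable lborel (\<lambda>x. (norm (f x))\<^sup>2 + (norm (g x))\<^sup>2)"
    by (intro Bochner_Integration.integrable_add L2_integrable_sq assms)
  have "\<bar>f x \<bullet> g x\<bar> \<le> (norm (f x))\<^sup>2 + (norm (g x))\<^sup>2" for x
  proof -
    have "\<bar>f x \<bullet> g x\<bar> \<le> norm (f x) * norm (g x)" by (rule Cauchy_Schwarz_ineq2)
    moreover have "2 * (norm (f x) * norm (g x)) \<le> (norm (f x))\<^sup>2 + (norm (g x))\<^sup>2"
      using sum_squares_bound[of "norm (f x)" "norm (g x)"] by simp
    moreover have "0 \<le> norm (f x) * norm (g x)" by simp
    ultimately show ?thesis by linarith
  qed
  then show "AE x in lborel. norm (f x \<bullet> g x) \<le> norm ((norm (f x))\<^sup>2 + (norm (g x))\<^sup>2)"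
    by (auto intro!: AE_I2 simp: abs_of_nonneg)
qed (use assms in measurable)

lemma L2_add[intro]:
  assumes "f \<in> L2" "g \<in> L2" shows "(\<lambda>x. f x + g x) \<in> L2"
proof (rule L2I)
  have "(norm (f x + g x))\<^sup>2 = (norm (f x))\<^sup>2 + 2 * (f x \<bullet> g x) + (norm (g x))\<^sup>2" for x
    by (simp add: power2_norm_eq_inner algebra_simps inner_commute)
  then show "integrable lborel (\<lambda>x. (norm (f x + g x))\<^sup>2)"
    by (simp only:) (intro Bochner_Integration.integrable_add integrable_mult_right L2_integrable_sq L2_inner_integrable assms)
qed (use assms in measurable)

lemma L2_scaleR[intro]:
  assumes "f \<in> L2" shows "(\<lambda>x. c *\<^sub>R f x) \<in> L2"
  by (rule L2_dominated[OF assms, where c="\<bar>c\<bar>"]) (use assms in \<open>auto\<close>)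

lemma L2_uminus[intro]:
  assumes "f \<in> L2" shows "(\<lambda>x. - f x) \<in> L2"
  using L2_scaleR[OF assms, of "-1"] by simp

lemma L2_diff[intro]:
  assumes "f \<in> L2" "g \<in> L2" shows "(\<lambda>x. f x - g x) \<in> L2"
  using L2_add[OF assms(1) L2_uminus[OF assms(2)]] by simp

lemma L2_inner_commute: "L2_inner f g = L2_inner g f"
  by (simp add: L2_inner_def inner_commute)

lemma L2_inner_add_left:
  assumes "f \<in> L2" "g \<in> L2" "k \<in> L2"
  shows "L2_inner (\<lambda>x. f x + g x) k = L2_inner f k + L2_inner g k"
  by (simp add: L2_inner_def inner_add_left L2_inner_integrable assms)

lemma L2_inner_diff_left:
  assumes "f \<in> L2" "g \<in> L2" "k \<in> L2"
  shows "L2_inner (\<lambda>x. f x - g x) k = L2_inner f k - L2_inner g k"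
  by (simp add: L2_inner_def inner_diff_left L2_inner_integrable assms)

lemma L2_inner_add_right:
  assumes "f \<in> L2" "g \<in> L2" "k \<in> L2"
  shows "L2_inner k (\<lambda>x. f x + g x) = L2_inner k f + L2_inner k g"
  by (simp add: L2_inner_def inner_add_right L2_inner_integrable assms)

lemma L2_inner_diff_right:
  assumes "f \<in> L2" "g \<in> L2" "k \<in> L2"
  shows "L2_inner k (\<lambda>x. f x - g x) = L2_inner k f - L2_inner k g"
  by (simp add: L2_inner_def inner_diff_right L2_inner_integrable assms)

lemma L2_inner_scaleR_left: "L2_inner (\<lambda>x. c *\<^sub>R f x) g = c * L2_inner f g"
  by (simp add: L2_inner_def)

lemma L2_inner_scaleR_right: "L2_inner f (\<lambda>x. c *\<^sub>R g x) = c * L2_inner f g"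
  by (simp add: L2_inner_def)

lemma L2_inner_self: "L2_inner f f = (LINT x|lborel. (norm (f x))\<^sup>2)"
  by (simp add: L2_inner_def power2_norm_eq_inner)

lemma L2_inner_self_nonneg[simp]: "0 \<le> L2_inner f f"
  by (simp add: L2_inner_self)

lemma L2_norm_nonneg[simp]: "0 \<le> L2_norm f"
  by (simp add: L2_norm_def)

lemma L2_norm_square: "(L2_norm f)\<^sup>2 = L2_inner f f"
  by (simp add: L2_norm_def)

lemma L2_inner_cong_AE:
  assumes "AE x in lborel. f x = f' x" "AE x in lborel. g x = g' x"
    "f \<in> borel_measurable borel" "f' \<in> borel_measurable borel"
    "g \<in> borel_measurable borel" "g' \<in> borel_measurable borel"
  shows "L2_inner f g = L2_inner f' g'"
  unfolding L2_inner_def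
  by (rule integral_cong_AE) (use assms in auto)

lemma L2_polarization:
  assumes "f \<in> L2" "g \<in> L2"
  shows "4 * L2_inner f g = L2_inner (\<lambda>x. f x + g x) (\<lambda>x. f x + g x) - L2_inner (\<lambda>x. f x - g x) (\<lambda>x. f x - g x)"
  using assms L2_inner_commute[of g f]
  by (simp add: L2_inner_add_left L2_inner_add_right L2_inner_diff_left L2_inner_diff_right L2_add L2_diff)

lemma L2_Cauchy_Schwarz:
  assumes "f \<in> L2" "g \<in> L2"
  shows "\<bar>L2_inner f g\<bar> \<le> L2_norm f * L2_norm g"
proof -
  have "(L2_inner f g)\<^sup>2 \<le> L2_inner f f * L2_inner g g"
  proof -
    have q: "0 \<le> L2_inner f f + 2 * t * L2_inner f g + t\<^sup>2 * L2_inner g g" for t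
    proof -
      have "0 \<le> L2_inner (\<lambda>x. f x + t *\<^sub>R g x) (\<lambda>x. f x + t *\<^sub>R g x)" by simp
      also have "\<dots> = L2_inner f f + 2 * t * L2_inner f g + t\<^sup>2 * L2_inner g g"
        using assms L2_inner_commute[of g f] L2_inner_scaleR_left[of t g] L2_inner_commute[of _ "\<lambda>x. t *\<^sub>R g x"]
        by (simp add: L2_inner_add_left L2_inner_add_right L2_add L2_scaleR algebra_simps power2_eq_square)
      finally show ?thesis .
    qed
    show ?thesis
    proof (cases "L2_inner g g = 0")
      case True
      \<comment> \<open>With \<open>L2_inner g g = 0\<close> the quadratic \<open>q\<close> is
        affine in \<open>t\<close>; were its slope nonzero, the \<open>t\<close> chosen below would
        give it the value -1.\<close>
      have "L2_inner f g = 0"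
      proof (rule ccontr)
        assume n: "L2_inner f g \<noteq> 0"
        show False
          using q[of "- (L2_inner f f + 1) / (2 * L2_inner f g)"] True n by (simp add: field_simps)
      qed
      then show ?thesis using True by simp
    next
      case False
      then have p: "L2_inner g g > 0" using L2_inner_self_nonneg[of g] by linarith
      have "0 \<le> (L2_inner f f - (L2_inner f g)\<^sup>2 / L2_inner g g)"
        using q[of "- L2_inner f g / L2_inner g g"] p by (simp add: field_simps power2_eq_square)
      then show ?thesis using p by (simp add: field_simps)
    qed
  qed
  also have "\<dots> = (L2_norm f * L2_norm g)\<^sup>2" by (simp add: power_mult_distrib L2_norm_square)
  finally show ?thesis using abs_le_square_iff[of "L2_inner f g" "L2_norm f * L2_norm g"] by simp
qed

lemma L2_norm_triangle:
  assumes "f \<in> L2" "g \<in> L2"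
  shows "L2_norm (\<lambda>x. f x + g x) \<le> L2_norm f + L2_norm g"
proof (rule power2_le_imp_le)
  have "(L2_norm (\<lambda>x. f x + g x))\<^sup>2 = (L2_norm f)\<^sup>2 + 2 * L2_inner f g + (L2_norm g)\<^sup>2"
    using assms L2_inner_commute[of g f]
    by (simp add: L2_norm_square L2_inner_add_left L2_inner_add_right L2_add)
  also have "\<dots> \<le> (L2_norm f + L2_norm g)\<^sup>2"
    using L2_Cauchy_Schwarz[OF assms] by (simp add: power2_sum)
  finally show "(L2_norm (\<lambda>x. f x + g x))\<^sup>2 \<le> (L2_norm f + L2_norm g)\<^sup>2" .
qed simp

lemma L2_norm_uminus[simp]: "L2_norm (\<lambda>x. - f x) = L2_norm f"
  by (simp add: L2_norm_def L2_inner_def)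

lemma L2_norm_triangle_diff:
  assumes "f \<in> L2" "g \<in> L2"
  shows "L2_norm (\<lambda>x. f x - g x) \<le> L2_norm f + L2_norm g"
  using L2_norm_triangle[OF assms(1) L2_uminus[OF assms(2)]] by simp

lemma L2_inner_mono:
  assumes "g \<in> L2" "f \<in> borel_measurable borel" "AE x in lborel. norm (f x) \<le> norm (g x)"
  shows "L2_inner f f \<le> L2_inner g g"
proof -
  have "f \<in> L2" by (rule L2_dominated[where c=1, OF assms(1)]) (use assms in auto)
  then show ?thesis
    unfolding L2_inner_self using assms(3)
    by (intro integral_mono_AE) (auto simp: L2_integrable_sq assms(1) intro: power_mono elim: eventually_mono)
qed

lemma nn_integral_L2_norm:
  assumes "f \<in> L2"
  shows "(\<integral>\<^sup>+ x. ennreal ((norm (f x))\<^sup>2) \<partial>lborel) = ennreal (L2_inner f f)"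
  unfolding L2_inner_self by (rule nn_integral_eq_integral) (auto simp: assms L2_integrable_sq)

lemma L2I_nn_integral:
  assumes "f \<in> borel_measurable borel" "(\<integral>\<^sup>+ x. ennreal ((norm (f x))\<^sup>2) \<partial>lborel) < \<infinity>"
  shows "f \<in> L2"
  by (rule L2I) (use assms in \<open>auto intro!: integrableI_nonneg\<close>)

lemma L2_inner_tendsto:
  assumes f: "\<And>k. f k \<in> L2" "f0 \<in> L2" "((\<lambda>k. L2_norm (\<lambda>x. f k x - f0 x)) \<longlongrightarrow> 0) F"
    and g: "\<And>k. g k \<in> L2" "g0 \<in> L2" "((\<lambda>k. L2_norm (\<lambda>x. g k x - g0 x)) \<longlongrightarrow> 0) F"
  shows "((\<lambda>k. L2_inner (f k) (g k)) \<longlongrightarrow> L2_inner f0 g0) F"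
proof -
  let ?a = "\<lambda>k. L2_norm (\<lambda>x. f k x - f0 x)" and ?b = "\<lambda>k. L2_norm (\<lambda>x. g k x - g0 x)"
  have "\<bar>L2_inner (f k) (g k) - L2_inner f0 g0\<bar> \<le> ?a k * ?b k + ?a k * L2_norm g0 + L2_norm f0 * ?b k" for k
  proof -
    have "L2_inner (f k) (g k) - L2_inner f0 g0 =
      L2_inner (\<lambda>x. f k x - f0 x) (\<lambda>x. g k x - g0 x) + L2_inner (\<lambda>x. f k x - f0 x) g0 + L2_inner f0 (\<lambda>x. g k x - g0 x)"
      by (simp add: f g L2_inner_diff_left L2_inner_diff_right L2_diff)
    moreover have "\<bar>L2_inner (\<lambda>x. f k x - f0 x) (\<lambda>x. g k x - g0 x)\<bar> \<le> ?a k * ?b k"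
      "\<bar>L2_inner (\<lambda>x. f k x - f0 x) g0\<bar> \<le> ?a k * L2_norm g0"
      "\<bar>L2_inner f0 (\<lambda>x. g k x - g0 x)\<bar> \<le> L2_norm f0 * ?b k"
      by (rule L2_Cauchy_Schwarz; use f g in auto)+
    ultimately show ?thesis by linarith
  qed
  moreover have "((\<lambda>k. ?a k * ?b k + ?a k * L2_norm g0 + L2_norm f0 * ?b k) \<longlongrightarrow> 0 * 0 + 0 * L2_norm g0 + L2_norm f0 * 0) F"
    by (intro tendsto_intros f g)
  ultimately have "((\<lambda>k. L2_inner (f k) (g k) - L2_inner f0 g0) \<longlongrightarrow> 0) F"
    by - (rule Lim_null_comparison[of _ "\<lambda>k. ?a k * ?b k + ?a k * L2_norm g0 + L2_norm f0 * ?b k"], simp_all add: always_eventually)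
  then show ?thesis by (rule LIM_zero_cancel)
qed

section \<open>Translation invariance\<close>

lemma lborel_shift_integral:
  fixes f :: "'a::euclidean_space \<Rightarrow> 'b::{banach, second_countable_topology}"
  assumes [measurable]: "f \<in> borel_measurable borel"
  shows "(LINT x|lborel. f (x + y)) = (LINT x|lborel. f x)"
  by (subst (2) lborel_distr_plus[of y, symmetric]) (simp add: integral_distr add.commute)

lemma lborel_shift_integrable:
  fixes f :: "'a::euclidean_space \<Rightarrow> 'b::{banach, second_countable_topology}"
  assumes "integrable lborel f"
  shows "integrable lborel (\<lambda>x. f (x + y))"
proof -
  have [measurable]: "f \<in> borel_measurable borel" using assms by auto
  have "integrable (distr lborel borel ((+) y)) f" using assms by (simp add: lborel_distr_plus)
  then show ?thesis by (simp add: integrable_distr_eq add.commute)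
qed

lemma L2_shift[intro]: "f \<in> L2 \<Longrightarrow> (\<lambda>x. f (x + y)) \<in> L2"
  using lborel_shift_integrable[of "\<lambda>x. (norm (f x))\<^sup>2" y]
  by (intro L2I) (auto simp: L2_integrable_sq dest: L2_measurable)

lemma L2_inner_shift: 
  assumes [measurable]: "f \<in> borel_measurable borel" "g \<in> borel_measurable borel" 
  shows "L2_inner (\<lambda>x. f (x + y)) (\<lambda>x. g (x + y)) = L2_inner f g"
  unfolding L2_inner_def by (rule lborel_shift_integral) simp

section \<open>Continuity of translations\<close>

definition shift_diff :: "'a::euclidean_space \<Rightarrow> ('a \<Rightarrow> 'b::euclidean_space) \<Rightarrow> 'a \<Rightarrow> 'b" where
  "shift_diff y f x = f (x + y) - f x"

lemma shift_diff_measurable[measurable]: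
  assumes [measurable]: "f \<in> borel_measurable borel"
  shows "shift_diff y f \<in> borel_measurable borel"
  unfolding shift_diff_def[abs_def] by measurable

lemma L2_shift_diff[intro]: "f \<in> L2 \<Longrightarrow> shift_diff y f \<in> L2"
  unfolding shift_diff_def[abs_def] by auto

lemma L2_norm_shift_diff_le:
  assumes "f \<in> L2"
  shows "L2_norm (shift_diff y f) \<le> 2 * L2_norm f"
proof -
  have "L2_norm (\<lambda>x. f (x + y)) = L2_norm f"
    unfolding L2_norm_def using assms by (simp add: L2_inner_shift L2_measurable)
  then show ?thesis
    unfolding shift_diff_def[abs_def] using L2_norm_triangle_diff[OF L2_shift[OF assms] assms, of y] by simp
qed

text \<open>The inequality \<open>\<bar>a - b\<bar>\<^sup>2 \<le> 2 \<bar>a\<bar>a\<bar> - b\<bar>b\<bar>\<bar>\<close> transfers continuity of translations from \<open>L\<^sup>1\<close> to \<open>L\<^sup>2\<close>.\<close>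

lemma diff_square_le: "(a - b)\<^sup>2 \<le> 2 * \<bar>a * \<bar>a\<bar> - b * \<bar>b\<bar>\<bar>" for a b :: real
proof -
  have *: "(a - b)\<^sup>2 \<le> 2 * \<bar>a * \<bar>a\<bar> - b * \<bar>b\<bar>\<bar>" if "b \<le> a" for a b :: real
  proof (cases "0 \<le> b")
    case True
    have "(a - b) * (a - b) \<le> (a - b) * (a + b)" by (rule mult_left_mono) (use that True in auto)
    moreover have "0 \<le> (a - b) * (a + b)" using that True by simp
    ultimately show ?thesis using that True by (simp add: power2_eq_square algebra_simps abs_if)
  next
    case False
    show ?thesis
    proof (cases "0 \<le> a")
      case True
      have "0 \<le> (a + b)\<^sup>2" by simp
      then have "(a - b)\<^sup>2 \<le> 2 * (a * a + b * b)" by (simp add: power2_eq_square algebra_simps)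
      then show ?thesis using True False by (simp add: abs_of_nonneg)
    next
      case a: False
      have "(a - b) * (a - b) \<le> (a - b) * (- a - b)" by (rule mult_left_mono) (use that a in auto)
      moreover have "0 \<le> (a - b) * (- a - b)" using that a by (intro mult_nonneg_nonneg) auto
      moreover have "\<bar>a * \<bar>a\<bar> - b * \<bar>b\<bar>\<bar> = (a - b) * (- a - b)"
        using calculation(2) a False by (simp add: algebra_simps)
      ultimately show ?thesis by (simp only: power2_eq_square)
    qed
  qed
  show ?thesis
    using *[of a b] *[of b a] by (cases "b \<le> a") (auto simp: power2_commute abs_minus_commute)
qed

text \<open>Openness says that points of \<open>U\<close> stay in \<open>U\<close> under small
  shifts, but nothing about points outside. Since a shift preserves the measure of \<open>U\<close>,
  the two one-sided differences have the same integral, so it is enough to treat the one living on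
  \<open>U\<close>, which is dominated by the indicator of \<open>U\<close>.\<close>

lemma L1_shift_open:
  fixes U :: "'a::euclidean_space set"
  assumes U: "open U" "emeasure lborel U < \<infinity>" and y: "y \<longlonglongrightarrow> 0"
  shows "(\<lambda>n. LINT x|lborel. \<bar>indicator U (x + y n) - indicator U x :: real\<bar>) \<longlonglongrightarrow> 0"
proof -
  have [measurable]: "U \<in> sets borel" using U by simp
  have iU: "integrable lborel (indicator U :: 'a \<Rightarrow> real)" using U by simp
  have iUy: "integrable lborel (\<lambda>x. indicator U (x + z) :: real)" for z
    using lborel_shift_integrable[OF iU] .
  have iUU: "integrable lborel (\<lambda>x. indicator U x * (1 - indicator U (x + z)) :: real)" for z
    by (rule Bochner_Integration.integrable_bound[OF iU]) (auto simp: indicator_def)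
  have eq: "(LINT x|lborel. \<bar>indicator U (x + z) - indicator U x :: real\<bar>) = 2 * (LINT x|lborel. indicator U x * (1 - indicator U (x + z)))" for z
  proof -
    have "\<bar>indicator U (x + z) - indicator U x :: real\<bar> = 2 * (indicator U x * (1 - indicator U (x + z))) + (indicator U (x + z) - indicator U x)" for x
      by (auto simp: indicator_def)
    then show ?thesis
      using iU iUy[of z] iUU[of z] lborel_shift_integral[of "indicator U :: 'a \<Rightarrow> real" z] by simp
  qed
  have "(\<lambda>n. LINT x|lborel. indicator U x * (1 - indicator U (x + y n)) :: real) \<longlonglongrightarrow> (LINT x|(lborel :: 'a measure). (0 :: real))"
  proof (rule integral_dominated_convergence[OF _ _ iU])
    show "AE x in lborel. (\<lambda>n. indicator U x * (1 - indicator U (x + y n)) :: real) \<longlonglongrightarrow> 0"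
    proof (rule AE_I2)
      fix x
      show "(\<lambda>n. indicator U x * (1 - indicator U (x + y n)) :: real) \<longlonglongrightarrow> 0"
      proof (cases "x \<in> U")
        case True
        have "(\<lambda>n. x + y n) \<longlonglongrightarrow> x + 0" by (intro tendsto_intros y)
        then have "\<forall>\<^sub>F n in sequentially. x + y n \<in> U"
          using U True by (auto simp: tendsto_def)
        then show ?thesis using True by (intro tendsto_eventually) (auto elim!: eventually_mono)
      qed auto
    qed
  qed (auto simp: indicator_def)
  then show ?thesis unfolding eq using tendsto_mult_left[of _ 0 sequentially 2] by fastforce
qed

text \<open>Functions with continuous translations form a closed set in \<open>L\<^sup>1\<close>
  (this is \<open>approx\<close>). Outer regularity reduces indicators of Borel sets to indicators
  of open sets of finite measure, and induction over integrable functions does the rest.\<close>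

lemma L1_shift_continuous:
  fixes f :: "'a::euclidean_space \<Rightarrow> real"
  assumes "integrable lborel f" and y: "y \<longlonglongrightarrow> 0"
  shows "(\<lambda>n. LINT x|lborel. \<bar>f (x + y n) - f x\<bar>) \<longlonglongrightarrow> 0"
proof -
  have approx: "(\<lambda>n. LINT x|lborel. \<bar>f (x + y n) - f x\<bar>) \<longlonglongrightarrow> 0"
    if f: "integrable lborel f"
      and ex: "\<And>e. e > 0 \<Longrightarrow> \<exists>g. integrable lborel g \<and> (LINT x|lborel. \<bar>f x - g x\<bar>) < e \<and>
        (\<lambda>n. LINT x|lborel. \<bar>g (x + y n) - g x\<bar>) \<longlonglongrightarrow> 0" for f :: "'a \<Rightarrow> real"
  proof (rule LIMSEQ_I)
    fix r :: real assume r: "r > 0"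
    obtain g where g: "integrable lborel g" "(LINT x|lborel. \<bar>f x - g x\<bar>) < r/3"
      "(\<lambda>n. LINT x|lborel. \<bar>g (x + y n) - g x\<bar>) \<longlonglongrightarrow> 0"
      using ex[of "r/3"] r by auto
    obtain N where N: "\<And>n. n \<ge> N \<Longrightarrow> norm ((LINT x|lborel. \<bar>g (x + y n) - g x\<bar>) - 0) < r / 3"
      using LIMSEQ_D[OF g(3), of "r/3"] r by auto
    have "norm ((LINT x|lborel. \<bar>f (x + y n) - f x\<bar>) - 0) < r" if "n \<ge> N" for n
    proof -
      note i = f g(1) lborel_shift_integrable[OF f, of "y n"] lborel_shift_integrable[OF g(1), of "y n"]
      have [measurable]: "f \<in> borel_measurable borel" "g \<in> borel_measurable borel" using f g by auto
      have "(LINT x|lborel. \<bar>f (x + y n) - f x\<bar>) \<le>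
        (LINT x|lborel. \<bar>f (x + y n) - g (x + y n)\<bar> + \<bar>g (x + y n) - g x\<bar> + \<bar>f x - g x\<bar>)"
        by (rule integral_mono) (use i in \<open>auto\<close>)
      also have "\<dots> = (LINT x|lborel. \<bar>f (x + y n) - g (x + y n)\<bar>) + (LINT x|lborel. \<bar>g (x + y n) - g x\<bar>) + (LINT x|lborel. \<bar>f x - g x\<bar>)"
        using i by simp
      also have "(LINT x|lborel. \<bar>f (x + y n) - g (x + y n)\<bar>) = (LINT x|lborel. \<bar>f x - g x\<bar>)"
        by (rule lborel_shift_integral) simp
      finally have "(LINT x|lborel. \<bar>f (x + y n) - f x\<bar>) < r"
        using g(2) N[OF that] by simp
      then show ?thesis by simp
    qed
    then show "\<exists>no. \<forall>n\<ge>no. norm ((LINT x|lborel. \<bar>f (x + y n) - f x\<bar>) - 0) < r" by blast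
  qed
  show ?thesis using assms(1)
  proof (induction rule: integrable_induct)
    case (base A c)
    have cA: "integrable lborel (\<lambda>x. indicator A x *\<^sub>R c)" using base by simp
    show ?case
    proof (rule approx[OF cA])
      fix e :: real assume e: "e > 0"
      \<comment> \<open>The \<open>+ 1\<close> keeps the quotient meaningful when
        \<open>c = 0\<close>.\<close>
      define e' where "e' = e / (\<bar>c\<bar> + 1)"
      have e': "e' > 0" "\<bar>c\<bar> * e' < e" unfolding e'_def using e by (auto simp: field_simps)
      obtain U where U: "open U" "A \<subseteq> U" "emeasure lborel (U - A) < e'"
        using outer_regular_lborel[OF _ e'(1), of A] base by auto
      have [measurable]: "A \<in> sets borel" "U \<in> sets borel" using base U by auto
      note m = U(3)
      have "emeasure lborel U \<le> emeasure lborel A + emeasure lborel (U - A)"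
        using U(2) by (intro order_trans[OF emeasure_mono emeasure_subadditive]) auto
      also have "\<dots> < \<infinity>" using base m by (auto simp: less_top[symmetric] top_unique)
      finally have Ufin: "emeasure lborel U < \<infinity>" .
      have iU: "integrable lborel (\<lambda>x. indicator U x *\<^sub>R c)" using Ufin by simp
      have "(LINT x|lborel. \<bar>indicator A x *\<^sub>R c - indicator U x *\<^sub>R c\<bar>) = (LINT x|lborel. \<bar>c\<bar> * indicator (U - A) x)"
        using U(2) by (intro Bochner_Integration.integral_cong) (auto simp: indicator_def)
      also have "\<dots> = \<bar>c\<bar> * measure lborel (U - A)" using m by (simp add: less_top)
      also have "\<dots> \<le> \<bar>c\<bar> * e'"
        using m e' by (intro mult_left_mono) (auto simp: measure_def intro!: enn2real_leI)
      finally have "(LINT x|lborel. \<bar>indicator A x *\<^sub>R c - indicator U x *\<^sub>R c\<bar>) < e" using e' by simp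
      moreover have "(\<lambda>n. LINT x|lborel. \<bar>indicator U (x + y n) *\<^sub>R c - indicator U x *\<^sub>R c\<bar>) \<longlonglongrightarrow> 0"
      proof -
        have "\<bar>indicator U (x + z) *\<^sub>R c - indicator U x *\<^sub>R c\<bar> = \<bar>c\<bar> * \<bar>indicator U (x + z) - indicator U x\<bar>" for x z
          by (auto simp: indicator_def)
        then show ?thesis
          using tendsto_mult_left[OF L1_shift_open[OF U(1) Ufin y], of "\<bar>c\<bar>"] by simp
      qed
      ultimately show "\<exists>g. integrable lborel g \<and> (LINT x|lborel. \<bar>indicator A x *\<^sub>R c - g x\<bar>) < e \<and>
        (\<lambda>n. LINT x|lborel. \<bar>g (x + y n) - g x\<bar>) \<longlonglongrightarrow> 0"
        using iU by blast
    qed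
  next
    case (add f g)
    have "(\<lambda>n. (LINT x|lborel. \<bar>f (x + y n) - f x\<bar>) + (LINT x|lborel. \<bar>g (x + y n) - g x\<bar>)) \<longlonglongrightarrow> 0"
      using tendsto_add[OF add(3,4)] by simp
    then show ?case
    proof (rule Lim_null_comparison[rotated], intro always_eventually allI)
      fix n
      note i = add(1,2) lborel_shift_integrable[OF add(1), of "y n"] lborel_shift_integrable[OF add(2), of "y n"]
      have "(LINT x|lborel. \<bar>(f (x + y n) + g (x + y n)) - (f x + g x)\<bar>) \<le> (LINT x|lborel. \<bar>f (x + y n) - f x\<bar> + \<bar>g (x + y n) - g x\<bar>)"
        by (rule integral_mono) (use i in auto)
      also have "\<dots> = (LINT x|lborel. \<bar>f (x + y n) - f x\<bar>) + (LINT x|lborel. \<bar>g (x + y n) - g x\<bar>)"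
        using i by simp
      finally show "norm (LINT x|lborel. \<bar>(f (x + y n) + g (x + y n)) - (f x + g x)\<bar>) \<le> (LINT x|lborel. \<bar>f (x + y n) - f x\<bar>) + (LINT x|lborel. \<bar>g (x + y n) - g x\<bar>)"
        by simp
    qed
  next
    case (lim f s)
    have [measurable]: "f \<in> borel_measurable borel" "\<And>i. s i \<in> borel_measurable borel" using lim by auto
    \<comment> \<open>The approximants of the induction satisfy
      \<open>\<bar>s i x\<bar> \<le> 2 * \<bar>f x\<bar>\<close>, whence the majorant with factor
      3.\<close>
    have "(\<lambda>i. LINT x|lborel. \<bar>f x - s i x\<bar>) \<longlonglongrightarrow> (LINT x|(lborel::'a measure). 0)"
    proof (rule integral_dominated_convergence[where w="\<lambda>x. 3 * \<bar>f x\<bar>"])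
      show "AE x in lborel. (\<lambda>i. \<bar>f x - s i x\<bar>) \<longlonglongrightarrow> 0"
      proof (rule AE_I2)
        fix x
        have "(\<lambda>i. \<bar>f x - s i x\<bar>) \<longlonglongrightarrow> \<bar>f x - f x\<bar>" using lim(2)[of x] by (intro tendsto_intros) simp
        then show "(\<lambda>i. \<bar>f x - s i x\<bar>) \<longlonglongrightarrow> 0" by simp
      qed
      show "AE x in lborel. norm \<bar>f x - s i x\<bar> \<le> 3 * \<bar>f x\<bar>" for i
      proof (rule AE_I2)
        fix x show "norm \<bar>f x - s i x\<bar> \<le> 3 * \<bar>f x\<bar>" using lim(3)[of x i] by (simp)
      qed
    qed (use lim in auto)
    then have l: "(\<lambda>i. LINT x|lborel. \<bar>f x - s i x\<bar>) \<longlonglongrightarrow> 0" by simp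
    show ?case
    proof (rule approx[OF lim(4)])
      fix e :: real assume "e > 0"
      then obtain i where "(LINT x|lborel. \<bar>f x - s i x\<bar>) < e"
        using order_tendstoD(2)[OF l, of e] by (auto simp: eventually_sequentially)
      then show "\<exists>g. integrable lborel g \<and> (LINT x|lborel. \<bar>f x - g x\<bar>) < e \<and> (\<lambda>n. LINT x|lborel. \<bar>g (x + y n) - g x\<bar>) \<longlonglongrightarrow> 0"
        using lim(1,5) by blast
    qed
  qed
qed

lemma L2_shift_continuous_real:
  fixes f :: "'a::euclidean_space \<Rightarrow> real"
  assumes f: "f \<in> L2" and y: "y \<longlonglongrightarrow> 0"
  shows "(\<lambda>n. LINT x|lborel. (f (x + y n) - f x)\<^sup>2) \<longlonglongrightarrow> 0"
proof -
  have [measurable]: "f \<in> borel_measurable borel" using f by (rule L2_measurable)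
  have i: "integrable lborel (\<lambda>x. f x * \<bar>f x\<bar>)"
    by (rule Bochner_Integration.integrable_bound[OF L2_integrable_sq[OF f]]) (auto simp: power2_eq_square abs_mult)
  have "(\<lambda>n. 2 * (LINT x|lborel. \<bar>f (x + y n) * \<bar>f (x + y n)\<bar> - f x * \<bar>f x\<bar>\<bar>)) \<longlonglongrightarrow> 0"
    using tendsto_mult_left[OF L1_shift_continuous[OF i y], of 2] by simp
  then show ?thesis
  proof (rule Lim_null_comparison[rotated], intro always_eventually allI)
    fix n
    have "integrable lborel (\<lambda>x. (norm (shift_diff (y n) f x))\<^sup>2)"
      by (rule L2_integrable_sq) (rule L2_shift_diff[OF f])
    then have "(LINT x|lborel. (f (x + y n) - f x)\<^sup>2) \<le> (LINT x|lborel. 2 * \<bar>f (x + y n) * \<bar>f (x + y n)\<bar> - f x * \<bar>f x\<bar>\<bar>)"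
      using i lborel_shift_integrable[OF i, of "y n"]
      by (intro integral_mono diff_square_le) (auto simp: shift_diff_def)
    then show "norm (LINT x|lborel. (f (x + y n) - f x)\<^sup>2) \<le> 2 * (LINT x|lborel. \<bar>f (x + y n) * \<bar>f (x + y n)\<bar> - f x * \<bar>f x\<bar>\<bar>)"
      by simp
  qed
qed

lemma L2_shift_continuous:
  fixes f :: "'a::euclidean_space \<Rightarrow> 'b::euclidean_space"
  assumes f: "f \<in> L2" and y: "y \<longlonglongrightarrow> 0"
  shows "(\<lambda>n. L2_norm (shift_diff (y n) f)) \<longlonglongrightarrow> 0"
proof -
  have fb: "(\<lambda>x. f x \<bullet> b) \<in> L2" if "b \<in> Basis" for b
    by (rule L2_dominated[OF f, where c=1]) (use that f Basis_le_norm in \<open>auto dest: L2_measurable\<close>)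
  have "L2_inner (shift_diff (y n) f) (shift_diff (y n) f) = (\<Sum>b\<in>Basis. LINT x|lborel. (f (x + y n) \<bullet> b - f x \<bullet> b)\<^sup>2)" for n
  proof -
    have "integrable lborel (\<lambda>x. (f (x + y n) \<bullet> b - f x \<bullet> b)\<^sup>2)" if "b \<in> Basis" for b
      using L2_integrable_sq[OF L2_shift_diff[OF fb[OF that], of "y n"]] by (simp add: shift_diff_def)
    then have "(\<Sum>b\<in>Basis. LINT x|lborel. (f (x + y n) \<bullet> b - f x \<bullet> b)\<^sup>2) = (LINT x|lborel. (\<Sum>b\<in>Basis. (f (x + y n) \<bullet> b - f x \<bullet> b)\<^sup>2))"
      by simp
    also have "\<dots> = L2_inner (shift_diff (y n) f) (shift_diff (y n) f)"
      unfolding L2_inner_def shift_diff_def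
      by (subst euclidean_inner) (simp add: inner_diff_left power2_eq_square)
    finally show ?thesis ..
  qed
  moreover have "(\<lambda>n. \<Sum>b\<in>Basis. LINT x|lborel. (f (x + y n) \<bullet> b - f x \<bullet> b)\<^sup>2) \<longlonglongrightarrow> (\<Sum>b\<in>(Basis :: 'b set). 0)"
    by (intro tendsto_sum L2_shift_continuous_real fb y)
  ultimately have "(\<lambda>n. L2_inner (shift_diff (y n) f) (shift_diff (y n) f)) \<longlonglongrightarrow> 0" by simp
  then show ?thesis unfolding L2_norm_def using tendsto_real_sqrt by fastforce
qed

section \<open>Gaussian integrals\<close>

lemma
  fixes f :: "'a::euclidean_space \<Rightarrow> real \<Rightarrow> 'b::{real_normed_field,banach,second_countable_topology}"
  assumes f: "\<And>b. b \<in> Basis \<Longrightarrow> integrable lborel (f b)"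
  shows lborel_integrable_prod: "integrable lborel (\<lambda>x::'a. \<Prod>b\<in>Basis. f b (x \<bullet> b))"
    and lborel_integral_prod: "(LINT x|lborel. (\<Prod>b\<in>Basis. f b (x \<bullet> b))) = (\<Prod>b\<in>Basis. (LINT t|lborel. f b t))"
proof -
  interpret product_sigma_finite "\<lambda>_::'a. lborel :: real measure" ..
  have [measurable]: "\<And>b. b \<in> Basis \<Longrightarrow> f b \<in> borel_measurable borel" using f by auto
  have eq: "(\<Prod>b\<in>Basis. f b ((\<Sum>c\<in>Basis. g c *\<^sub>R c) \<bullet> b)) = (\<Prod>b\<in>Basis. f b (g b))" for g
    by (intro prod.cong refl) (simp add: inner_sum_left inner_Basis if_distrib sum.If_cases)
  show "integrable lborel (\<lambda>x::'a. \<Prod>b\<in>Basis. f b (x \<bullet> b))"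
    by (subst lborel_eq) (auto simp: integrable_distr_eq eq f intro!: product_integrable_prod)
  show "(LINT x|lborel. (\<Prod>b\<in>Basis. f b (x \<bullet> b))) = (\<Prod>b\<in>Basis. (LINT t|lborel. f b t))"
    by (subst lborel_eq) (auto simp: integral_distr eq f intro!: product_integral_prod)
qed

lemma gaussian_integrable_real: "integrable lborel (\<lambda>x::real. exp (- x\<^sup>2 / 2))"
proof -
  have "integrable lborel (\<lambda>x. sqrt (2 * pi) * std_normal_density x)"
    by (intro integrable_mult_right integrable_normal_density) simp
  then show ?thesis by (simp add: std_normal_density_def)
qed

text \<open>This is the characteristic function of the standard normal distribution, taken at
  \<open>- t\<close> because the Fourier kernel has the opposite sign, and freed of the normalising
  factor \<open>sqrt (2 * pi)\<close>.\<close>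

lemma
  fixes t :: real
  shows gaussian_fourier_real_integrable: "integrable lborel (\<lambda>x::real. exp (- \<i> * (x * t)) * complex_of_real (exp (- x\<^sup>2 / 2)))" (is "integrable _ ?f")
    and gaussian_fourier_real: "(LINT x|lborel. exp (- \<i> * (x * t)) * complex_of_real (exp (- x\<^sup>2 / 2))) = complex_of_real (sqrt (2 * pi) * exp (- t\<^sup>2 / 2))"
proof -
  show "integrable lborel ?f"
    by (rule Bochner_Integration.integrable_bound[OF gaussian_integrable_real]) (auto simp: norm_mult norm_exp_eq_Re)
  have "complex_of_real (exp (- t\<^sup>2 / 2)) = char std_normal_distribution (- t)"
    by (simp add: char_std_normal_distribution)
  also have "\<dots> = (LINT x|lborel. std_normal_density x *\<^sub>R iexp (- t * x))"
    unfolding char_def by (subst integral_density) (auto simp: std_normal_density_def)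
  also have "\<dots> = (LINT x|lborel. (1 / sqrt (2 * pi)) * (exp (- \<i> * (x * t)) * complex_of_real (exp (- x\<^sup>2 / 2))))"
    by (intro Bochner_Integration.integral_cong) (auto simp: std_normal_density_def scaleR_conv_of_real mult_ac)
  also have "\<dots> = (1 / sqrt (2 * pi)) * (LINT x|lborel. (exp (- \<i> * (x * t)) * complex_of_real (exp (- x\<^sup>2 / 2))))"
    by (rule integral_mult_right_zero)
  finally show "(LINT x|lborel. exp (- \<i> * (x * t)) * complex_of_real (exp (- x\<^sup>2 / 2))) = complex_of_real (sqrt (2 * pi) * exp (- t\<^sup>2 / 2))"
    by (simp add: field_simps)
qed

lemma norm_square_Basis: "(norm x)\<^sup>2 = (\<Sum>b\<in>Basis. (x \<bullet> b)\<^sup>2)"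
  unfolding power2_norm_eq_inner by (subst euclidean_inner) (simp add: power2_eq_square)

text \<open>Both the phase and the Gaussian factor over the coordinates, so the one-dimensional
  formula tensorises.\<close>

lemma
  fixes \<xi> :: "'a::euclidean_space"
  shows gaussian_fourier_integrable: "integrable lborel (\<lambda>x::'a. exp (- \<i> * (x \<bullet> \<xi>)) * complex_of_real (exp (- (norm x)\<^sup>2 / 2)))"
    and gaussian_fourier: "(LINT x|lborel. exp (- \<i> * (x \<bullet> \<xi>)) * complex_of_real (exp (- (norm x)\<^sup>2 / 2))) =
      complex_of_real ((2 * pi) powr (DIM('a) / 2) * exp (- (norm \<xi>)\<^sup>2 / 2))"
proof -
  have eq: "exp (- \<i> * (x \<bullet> \<xi>)) * complex_of_real (exp (- (norm x)\<^sup>2 / 2)) =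
      (\<Prod>b\<in>Basis. exp (- \<i> * ((x \<bullet> b) * (\<xi> \<bullet> b))) * complex_of_real (exp (- (x \<bullet> b)\<^sup>2 / 2)))" for x
  proof -
    have "- \<i> * complex_of_real (x \<bullet> \<xi>) = (\<Sum>b\<in>Basis. - \<i> * ((x \<bullet> b) * (\<xi> \<bullet> b)))"
      by (subst euclidean_inner) (simp add: sum_distrib_left sum_negf)
    moreover have "- (norm x)\<^sup>2 / 2 = (\<Sum>b\<in>Basis. - (x \<bullet> b)\<^sup>2 / 2)"
      by (simp add: norm_square_Basis sum_divide_distrib sum_negf)
    ultimately show ?thesis
      by (simp only: exp_sum[OF finite_Basis] prod.distrib of_real_prod)
  qed
  show "integrable lborel (\<lambda>x::'a. exp (- \<i> * (x \<bullet> \<xi>)) * complex_of_real (exp (- (norm x)\<^sup>2 / 2)))"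
    unfolding eq by (rule lborel_integrable_prod) (rule gaussian_fourier_real_integrable)
  have "(LINT x|lborel. exp (- \<i> * (x \<bullet> \<xi>)) * complex_of_real (exp (- (norm x)\<^sup>2 / 2))) = (\<Prod>b\<in>Basis. complex_of_real (sqrt (2 * pi) * exp (- (\<xi> \<bullet> b)\<^sup>2 / 2)))"
    unfolding eq by (subst lborel_integral_prod) (use gaussian_fourier_real_integrable gaussian_fourier_real in auto)
  also have "\<dots> = complex_of_real ((sqrt (2 * pi)) ^ DIM('a) * exp (\<Sum>b\<in>Basis. - (\<xi> \<bullet> b)\<^sup>2 / 2))"
    by (simp add: prod.distrib exp_sum)
  also have "(\<Sum>b\<in>Basis. - (\<xi> \<bullet> b)\<^sup>2 / 2) = - (norm \<xi>)\<^sup>2 / 2"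
    by (simp add: norm_square_Basis sum_divide_distrib sum_negf)
  also have "sqrt (2 * pi) ^ DIM('a) = (2 * pi) powr (DIM('a) / 2)"
    by (simp add: powr_half_sqrt[symmetric] powr_realpow[symmetric] powr_powr)
  finally show "(LINT x|lborel. exp (- \<i> * (x \<bullet> \<xi>)) * complex_of_real (exp (- (norm x)\<^sup>2 / 2))) =
      complex_of_real ((2 * pi) powr (DIM('a) / 2) * exp (- (norm \<xi>)\<^sup>2 / 2))" .
qed

lemma gaussian_integrable: "integrable lborel (\<lambda>x::'a::euclidean_space. exp (- (norm x)\<^sup>2 / 2))"
  using integrable_norm[OF gaussian_fourier_integrable[of "0::'a"]] by simp

lemma gaussian_integral: "(LINT x|lborel. exp (- (norm (x::'a))\<^sup>2 / 2)) = (2 * pi) powr (DIM('a::euclidean_space) / 2)"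
proof -
  have "complex_of_real (LINT (x::'a)|lborel. exp (- (norm x)\<^sup>2 / 2)) = complex_of_real ((2 * pi) powr (DIM('a) / 2))"
    using gaussian_fourier[of "0::'a"] by simp
  then show ?thesis by (simp only: of_real_eq_iff)
qed

section \<open>Affine changes of variables\<close>

lemma lborel_integral_affine:
  fixes f :: "'a::euclidean_space \<Rightarrow> 'b::{banach, second_countable_topology}"
  assumes [measurable]: "f \<in> borel_measurable borel" and "t \<noteq> 0"
  shows "(LINT x|lborel. f x) = \<bar>t\<bar> ^ DIM('a) *\<^sub>R (LINT x|lborel. f (a + t *\<^sub>R x))"
  by (subst lborel_affine[OF assms(2), of a]) (simp add: integral_density integral_distr)

lemma lborel_integrable_affine:
  fixes f :: "'a::euclidean_space \<Rightarrow> 'b::{banach, second_countable_topology}"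
  assumes f: "integrable lborel f" and "t \<noteq> 0"
  shows "integrable lborel (\<lambda>x. f (a + t *\<^sub>R x))"
proof -
  have [measurable]: "f \<in> borel_measurable borel" using f by auto
  have "integrable (density (distr lborel borel (\<lambda>x. a + t *\<^sub>R x)) (\<lambda>_. \<bar>t\<bar> ^ DIM('a))) f"
    using f lborel_affine[OF assms(2), of a] by simp
  then have "integrable lborel (\<lambda>x. \<bar>t\<bar> ^ DIM('a) *\<^sub>R f (a + t *\<^sub>R x))"
    by (simp add: integrable_density integrable_distr_eq)
  then have "integrable lborel (\<lambda>x. inverse (\<bar>t\<bar> ^ DIM('a)) *\<^sub>R \<bar>t\<bar> ^ DIM('a) *\<^sub>R f (a + t *\<^sub>R x))"
    by (rule integrable_scaleR_right)
  then show ?thesis using assms(2) by simp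
qed

lemma lborel_nn_integral_affine:
  fixes f :: "'a::euclidean_space \<Rightarrow> ennreal"
  assumes [measurable]: "f \<in> borel_measurable borel" and "t \<noteq> 0"
  shows "(\<integral>\<^sup>+x. f x \<partial>lborel) = ennreal (\<bar>t\<bar> ^ DIM('a)) * (\<integral>\<^sup>+x. f (a + t *\<^sub>R x) \<partial>lborel)"
  by (subst lborel_affine[OF assms(2), of a]) (simp add: nn_integral_density nn_integral_distr nn_integral_cmult)

lemma
  fixes z :: "'a::euclidean_space"
  assumes t: "t > 0"
  shows scaled_gaussian_integrable: "integrable lborel (\<lambda>\<xi>::'a. exp (- (norm (t *\<^sub>R \<xi>))\<^sup>2 / 2))"
    and scaled_gaussian_fourier: "(LINT \<xi>|lborel. exp (- \<i> * (\<xi> \<bullet> (t *\<^sub>R z))) * complex_of_real (exp (- (norm (t *\<^sub>R \<xi>))\<^sup>2 / 2))) =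
      complex_of_real ((2 * pi) powr (DIM('a) / 2) * exp (- (norm z)\<^sup>2 / 2) / t ^ DIM('a))"
proof -
  show "integrable lborel (\<lambda>\<xi>::'a. exp (- (norm (t *\<^sub>R \<xi>))\<^sup>2 / 2))"
    using lborel_integrable_affine[OF gaussian_integrable, of t 0] t by simp
  have "complex_of_real ((2 * pi) powr (DIM('a) / 2) * exp (- (norm z)\<^sup>2 / 2)) =
    t ^ DIM('a) *\<^sub>R (LINT \<xi>|lborel. exp (- \<i> * ((0 + t *\<^sub>R \<xi>) \<bullet> z)) * complex_of_real (exp (- (norm (0 + t *\<^sub>R \<xi>))\<^sup>2 / 2)))"
    unfolding gaussian_fourier[symmetric] using t by (subst lborel_integral_affine[of _ t 0]) auto
  then show "(LINT \<xi>|lborel. exp (- \<i> * (\<xi> \<bullet> (t *\<^sub>R z))) * complex_of_real (exp (- (norm (t *\<^sub>R \<xi>))\<^sup>2 / 2))) =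
      complex_of_real ((2 * pi) powr (DIM('a) / 2) * exp (- (norm z)\<^sup>2 / 2) / t ^ DIM('a))"
    using t by (simp add: scaleR_conv_of_real field_simps)
qed

section \<open>The Plancherel theorem\<close>

lemma fourier_integrand_integrable:
  fixes f :: "'a::euclidean_space \<Rightarrow> complex"
  assumes "integrable lborel f"
  shows "integrable lborel (\<lambda>x. exp (- \<i> * complex_of_real (x \<bullet> \<xi>)) * f x)"
proof -
  have [measurable]: "f \<in> borel_measurable borel" using assms by auto
  show ?thesis
    by (rule Bochner_Integration.integrable_bound[OF assms]) (auto simp: norm_mult norm_exp_eq_Re)
qed

lemma fourier_integral_measurable[measurable]:
  assumes [measurable]: "f \<in> borel_measurable borel"
  shows "fourier_integral f \<in> borel_measurable borel"
  unfolding fourier_integral_def[abs_def] by measurable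

lemma fourier_integral_bound:
  fixes f :: "'a::euclidean_space \<Rightarrow> complex"
  shows "norm (fourier_integral f \<xi>) \<le> (2 * pi) powr (- real DIM('a) / 2) * (LINT x|lborel. norm (f x))"
proof -
  have "norm (LINT x|lborel. exp (- \<i> * complex_of_real (x \<bullet> \<xi>)) * f x) \<le> (LINT x|lborel. norm (exp (- \<i> * complex_of_real (x \<bullet> \<xi>)) * f x))"
    by (rule integral_norm_bound)
  also have "\<dots> = (LINT x|lborel. norm (f x))" by (simp add: norm_mult norm_exp_eq_Re)
  finally show ?thesis
    unfolding fourier_integral_def norm_mult by (intro mult_mono) auto
qed

lemma borel_measurable_cnj[measurable]: "cnj \<in> borel_measurable borel"
  by (intro borel_measurable_continuous_onI continuous_intros)

text \<open>The hypothesis of Fubini's theorem for oscillatory kernels: a factor of modulus at most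
  1 does no harm to a product of integrable functions.\<close>

lemma lborel_pair_integrable_mult:
  fixes u :: "'a::euclidean_space \<Rightarrow> complex" and v :: "'b::euclidean_space \<Rightarrow> complex"
  assumes u: "integrable lborel u" and v: "integrable lborel v"
    and h[measurable]: "h \<in> borel_measurable (lborel \<Otimes>\<^sub>M lborel)" and h1: "\<And>x y. norm (h (x, y)) \<le> 1"
  shows "integrable (lborel \<Otimes>\<^sub>M lborel) (\<lambda>(x, y). u x * v y * h (x, y))"
proof (rule Bochner_Integration.integrable_bound)
  have [measurable]: "u \<in> borel_measurable borel" "v \<in> borel_measurable borel" using u v by auto
  show "integrable (lborel \<Otimes>\<^sub>M lborel) (\<lambda>(x, y). u x * v y)"
    using u v by (intro lborel_pair.Fubini_integrable) (auto simp: norm_mult)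
  show "AE p in lborel \<Otimes>\<^sub>M lborel. norm (case p of (x, y) \<Rightarrow> u x * v y * h (x, y)) \<le> norm (case p of (x, y) \<Rightarrow> u x * v y)"
    using h1 by (auto intro!: AE_I2 simp: norm_mult mult_left_le)
  show "(\<lambda>(x, y). u x * v y * h (x, y)) \<in> borel_measurable (lborel \<Otimes>\<^sub>M lborel)"
    by measurable
qed

text \<open>A damped Plancherel identity. The Gaussian factor makes the interchanges of integrals
  legitimate; doing the frequency integral first turns the energy into a Gaussian average of
  autocorrelations of \<open>f\<close> at shifts of size \<open>t\<close>. For \<open>t\<close>
  tending to 0 the damping disappears on one side and the shifts on the other.\<close>

lemma fourier_gaussian_energy:
  fixes f :: "'a::euclidean_space \<Rightarrow> complex"
  assumes f1: "integrable lborel f" and f2: "f \<in> L2" and t: "t > 0"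
  shows "(LINT \<xi>|lborel. exp (- (norm (t *\<^sub>R \<xi>))\<^sup>2 / 2) * (norm (fourier_integral f \<xi>))\<^sup>2) =
    (2 * pi) powr (- real DIM('a) / 2) * (LINT w|lborel. exp (- (norm (w::'a))\<^sup>2 / 2) * L2_inner f (\<lambda>x. f (x + (- t) *\<^sub>R w)))"
proof -
  define c where "c = (2 * pi) powr (- real DIM('a) / 2)"
  define F where "F = fourier_integral f"
  define G where "G = (\<lambda>\<xi>::'a. exp (- (norm (t *\<^sub>R \<xi>))\<^sup>2 / 2))"
  define g where "g = (\<lambda>w::'a. exp (- (norm w)\<^sup>2 / 2))"
  define e where "e = (\<lambda>x \<xi> :: 'a. exp (- \<i> * complex_of_real (x \<bullet> \<xi>)))"
  have cc: "c * (2 * pi) powr (DIM('a) / 2) = 1"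
    by (simp add: c_def powr_minus field_simps)
  have [measurable]: "f \<in> borel_measurable borel" "F \<in> borel_measurable borel" "G \<in> borel_measurable borel"
      "g \<in> borel_measurable borel"
    using f1 by (auto simp: F_def G_def g_def)
  have [measurable]: "(\<lambda>(x, \<xi>). e x \<xi>) \<in> borel_measurable (lborel \<Otimes>\<^sub>M lborel)"
    unfolding e_def by measurable
  have ne: "norm (e x \<xi>) = 1" for x \<xi> by (simp add: e_def norm_exp_eq_Re)
  have F: "F \<xi> = c * (LINT x|lborel. e x \<xi> * f x)" for \<xi>
    by (simp add: F_def fourier_integral_def c_def e_def)
  have iG: "integrable lborel (\<lambda>\<xi>. complex_of_real (G \<xi>))"
    unfolding G_def by (intro integrable_of_real scaled_gaussian_integrable t)
  have ig: "integrable lborel (\<lambda>\<xi>. complex_of_real (g \<xi>))"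
    unfolding g_def by (intro integrable_of_real gaussian_integrable)
  obtain B where B: "\<And>\<xi>. norm (F \<xi>) \<le> B" "B > 0"
    using fourier_integral_bound[of f] unfolding F_def by (meson gt_ex le_less_trans less_imp_le linorder_not_less order.trans zero_less_one)
  have iGF: "integrable lborel (\<lambda>\<xi>. complex_of_real (G \<xi>) * cnj (F \<xi>))"
  proof (rule Bochner_Integration.integrable_bound)
    show "integrable lborel (\<lambda>\<xi>. B * G \<xi>)"
      using iG unfolding complex_of_real_integrable_eq by (intro integrable_mult_right)
    show "AE x in lborel. norm (complex_of_real (G x) * cnj (F x)) \<le> norm (B * G x)"
      using B by (auto intro!: AE_I2 simp: norm_mult abs_mult mult.commute[of B] intro: mult_mono order.trans)
  qed measurable
  have cf: "integrable lborel (\<lambda>x. cnj (f x))"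
    using f1 by simp
  \<comment> \<open>What remains of the double integral when the frequency variable is integrated
    first. The fact \<open>A\<close> below identifies it as a Gaussian mean of \<open>cnj f\<close>
    around \<open>x\<close> at scale \<open>t\<close>.\<close>
  define A where "A = (\<lambda>x. LINT \<xi>|lborel. complex_of_real (G \<xi>) * cnj (F \<xi>) * e x \<xi>)"
  have "(LINT \<xi>|lborel. complex_of_real (G \<xi> * (norm (F \<xi>))\<^sup>2)) = (LINT \<xi>|lborel. (complex_of_real (G \<xi>) * cnj (F \<xi>)) * F \<xi>)"
    by (intro Bochner_Integration.integral_cong refl) (simp only: of_real_mult complex_norm_square mult_ac)
  also have "\<dots> = (LINT \<xi>|lborel. (complex_of_real (G \<xi>) * cnj (F \<xi>)) * (c * (LINT x|lborel. e x \<xi> * f x)))"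
    by (intro Bochner_Integration.integral_cong refl arg_cong2[where f=times] F)
  also have "\<dots> = c * (LINT \<xi>|lborel. (LINT x|lborel. f x * (complex_of_real (G \<xi>) * cnj (F \<xi>)) * e x \<xi>))"
    by (simp flip: integral_mult_right_zero integral_mult_left_zero add: mult_ac)
  also have "(LINT \<xi>|lborel. (LINT x|lborel. f x * (complex_of_real (G \<xi>) * cnj (F \<xi>)) * e x \<xi>)) =
      (LINT x|lborel. (LINT \<xi>|lborel. f x * (complex_of_real (G \<xi>) * cnj (F \<xi>)) * e x \<xi>))"
    by (rule lborel_pair.Fubini_integral)
      (use lborel_pair_integrable_mult[OF f1 iGF, of "\<lambda>(x, \<xi>). e x \<xi>"] in \<open>simp add: ne\<close>)
  also have "\<dots> = (LINT x|lborel. f x * A x)"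
    unfolding A_def by (simp flip: integral_mult_right_zero add: mult_ac)
  finally have *: "(LINT \<xi>|lborel. complex_of_real (G \<xi> * (norm (F \<xi>))\<^sup>2)) = c * (LINT x|lborel. f x * A x)" .
  have A: "A x = (LINT w|lborel. complex_of_real (g w) * cnj (f (x + (- t) *\<^sub>R w)))" for x
  proof -
    have cF: "cnj (F \<xi>) = c * (LINT y|lborel. cnj (e y \<xi>) * cnj (f y))" for \<xi>
      unfolding F by (simp only: complex_cnj_mult complex_cnj_complex_of_real Bochner_Integration.integral_cnj[symmetric])
    have ce: "cnj (e y \<xi>) * e x \<xi> = e (x - y) \<xi>" for y \<xi>
      by (simp add: e_def exp_cnj inner_diff_left algebra_simps flip: exp_add)
    have "A x = (LINT \<xi>|lborel. c * (LINT y|lborel. cnj (f y) * complex_of_real (G \<xi>) * e (x - y) \<xi>))"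
      unfolding A_def cF by (intro Bochner_Integration.integral_cong refl)
        (simp flip: integral_mult_right_zero integral_mult_left_zero ce add: mult_ac)
    also have "\<dots> = c * (LINT \<xi>|lborel. (LINT y|lborel. cnj (f y) * complex_of_real (G \<xi>) * e (x - y) \<xi>))"
      by simp
    also have "(LINT \<xi>|lborel. (LINT y|lborel. cnj (f y) * complex_of_real (G \<xi>) * e (x - y) \<xi>)) =
      (LINT y|lborel. (LINT \<xi>|lborel. cnj (f y) * complex_of_real (G \<xi>) * e (x - y) \<xi>))"
    proof (rule lborel_pair.Fubini_integral)
      have [measurable]: "(\<lambda>(y, \<xi>). e (x - y) \<xi>) \<in> borel_measurable (lborel \<Otimes>\<^sub>M lborel)"
        unfolding e_def by measurable
      show "integrable (lborel \<Otimes>\<^sub>M lborel) (\<lambda>(y, \<xi>). cnj (f y) * complex_of_real (G \<xi>) * e (x - y) \<xi>)"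
        using lborel_pair_integrable_mult[OF cf iG, of "\<lambda>(y, \<xi>). e (x - y) \<xi>"] by (simp add: ne)
    qed
    also have "\<dots> = (LINT y|lborel. cnj (f y) * (LINT \<xi>|lborel. complex_of_real (G \<xi>) * e (x - y) \<xi>))"
      by (simp flip: integral_mult_right_zero add: mult_ac)
    \<comment> \<open>The substitution \<open>y = x - t w\<close> makes the Gaussian independent of
      \<open>t\<close>; its Jacobian cancels the power of \<open>t\<close> in
      \<open>scaled_gaussian_fourier\<close>.\<close>
    also have "\<dots> = \<bar>- t\<bar> ^ DIM('a) *\<^sub>R (LINT w|lborel. cnj (f (x + (- t) *\<^sub>R w)) * (LINT \<xi>|lborel. complex_of_real (G \<xi>) * e (x - (x + (- t) *\<^sub>R w)) \<xi>))"
    proof (rule lborel_integral_affine)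
      have [measurable]: "(\<lambda>(y, \<xi>). e (x - y) \<xi>) \<in> borel_measurable (lborel \<Otimes>\<^sub>M lborel)"
        unfolding e_def by measurable
      show "(\<lambda>y. cnj (f y) * (LINT \<xi>|lborel. complex_of_real (G \<xi>) * e (x - y) \<xi>)) \<in> borel_measurable borel"
        by measurable
    qed (use t in auto)
    also have "(\<lambda>w. LINT \<xi>|lborel. complex_of_real (G \<xi>) * e (x - (x + (- t) *\<^sub>R w)) \<xi>) =
      (\<lambda>w. complex_of_real ((2 * pi) powr (DIM('a) / 2) * g w / t ^ DIM('a)))"
    proof
      fix w
      have "(LINT \<xi>|lborel. complex_of_real (G \<xi>) * e (x - (x + (- t) *\<^sub>R w)) \<xi>) = 
        (LINT \<xi>|lborel. exp (- \<i> * (\<xi> \<bullet> (t *\<^sub>R w))) * complex_of_real (exp (- (norm (t *\<^sub>R \<xi>))\<^sup>2 / 2)))"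
        by (simp add: e_def G_def inner_commute mult_ac)
      then show "(LINT \<xi>|lborel. complex_of_real (G \<xi>) * e (x - (x + (- t) *\<^sub>R w)) \<xi>) =
          complex_of_real ((2 * pi) powr (DIM('a) / 2) * g w / t ^ DIM('a))"
        unfolding scaled_gaussian_fourier[OF t] by (simp add: g_def)
    qed
    also have "complex_of_real c * \<bar>- t\<bar> ^ DIM('a) *\<^sub>R (LINT w|lborel. cnj (f (x + (- t) *\<^sub>R w)) * complex_of_real ((2 * pi) powr (DIM('a) / 2) * g w / t ^ DIM('a)))
      = (LINT w|lborel. (c * \<bar>t\<bar> ^ DIM('a)) * (cnj (f (x + (- t) *\<^sub>R w)) * complex_of_real ((2 * pi) powr (DIM('a) / 2) * g w / t ^ DIM('a))))"
      by (simp only: integral_mult_right_zero) (simp add: scaleR_conv_of_real)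
    also have "\<dots> = (LINT w|lborel. complex_of_real (c * (2 * pi) powr (DIM('a) / 2)) * (complex_of_real (g w) * cnj (f (x + (- t) *\<^sub>R w))))"
      using t by (intro Bochner_Integration.integral_cong refl) (simp add: field_simps)
    finally show ?thesis unfolding cc by simp
  qed
  have if2: "integrable lborel (\<lambda>x. f x * cnj (f (x + z)))" for z
  proof (rule Bochner_Integration.integrable_bound)
    have n: "(\<lambda>x. norm (f x)) \<in> L2" "(\<lambda>x. norm (f (x + z))) \<in> L2"
      using f2 L2_shift[OF f2, of z] by (auto intro: L2_dominated[where c=1])
    show "integrable lborel (\<lambda>x. norm (f x) * norm (f (x + z)))"
      using L2_inner_integrable[OF n] by simp
    show "AE x in lborel. norm (f x * cnj (f (x + z))) \<le> norm (norm (f x) * norm (f (x + z)))"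
      by (auto simp: norm_mult)
  qed measurable
  have nn: "(LINT x|lborel. norm (f x * cnj (f (x + z)))) \<le> L2_inner f f" for z
  proof -
    have n: "(\<lambda>x. norm (f x)) \<in> L2" "(\<lambda>x. norm (f (x + z))) \<in> L2"
      using f2 L2_shift[OF f2, of z] by (auto intro: L2_dominated[where c=1])
    have m: "(\<lambda>x. norm (f x)) \<in> borel_measurable borel" by measurable
    have "(LINT x|lborel. norm (f x * cnj (f (x + z)))) = L2_inner (\<lambda>x. norm (f x)) (\<lambda>x. norm (f (x + z)))"
      unfolding L2_inner_def by (simp add: norm_mult)
    also have "\<dots> \<le> L2_norm (\<lambda>x. norm (f x)) * L2_norm (\<lambda>x. norm (f (x + z)))"
      using L2_Cauchy_Schwarz[OF n] by simp
    also have "L2_norm (\<lambda>x. norm (f (x + z))) = L2_norm (\<lambda>x. norm (f x))"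
      unfolding L2_norm_def L2_inner_shift[OF m m] ..
    also have "L2_norm (\<lambda>x. norm (f x)) * L2_norm (\<lambda>x. norm (f x)) = L2_inner (\<lambda>x. norm (f x)) (\<lambda>x. norm (f x))"
      by (simp flip: power2_eq_square add: L2_norm_square)
    also have "\<dots> = L2_inner f f" by (simp add: L2_inner_self)
    finally show ?thesis .
  qed
  \<comment> \<open>The second interchange rests on \<open>nn\<close>: by Cauchy-Schwarz the
    autocorrelation is bounded by \<open>L2_inner f f\<close> for every shift, so the Gaussian in
    \<open>w\<close> alone provides integrability.\<close>
  have i3: "integrable (lborel \<Otimes>\<^sub>M lborel) (\<lambda>(w, x). complex_of_real (g w) * (f x * cnj (f (x + (- t) *\<^sub>R w))))"
  proof (rule lborel_pair.Fubini_integrable)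
    have "integrable lborel (\<lambda>w. g w * (LINT x|lborel. norm (f x * cnj (f (x + (- t) *\<^sub>R w)))))"
    proof (rule Bochner_Integration.integrable_bound)
      show "integrable lborel (\<lambda>w. g w * L2_inner f f)"
        using ig unfolding complex_of_real_integrable_eq by (intro integrable_mult_left)
      show "AE w in lborel. norm (g w * (LINT x|lborel. norm (f x * cnj (f (x + (- t) *\<^sub>R w))))) \<le> norm (g w * L2_inner f f)"
      proof (rule AE_I2)
        fix w
        have "0 \<le> (LINT x|lborel. norm (f x * cnj (f (x + (- t) *\<^sub>R w))))" by (rule Bochner_Integration.integral_nonneg) simp
        then show "norm (g w * (LINT x|lborel. norm (f x * cnj (f (x + (- t) *\<^sub>R w))))) \<le> norm (g w * L2_inner f f)"
          unfolding real_norm_def abs_mult using nn[of "(- t) *\<^sub>R w"] L2_inner_self_nonneg[of f]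
          by (intro mult_left_mono) linarith+
      qed
    qed measurable
    moreover have "\<bar>g w\<bar> = g w" for w by (simp add: g_def)
    ultimately show "integrable lborel (\<lambda>w. LINT x|lborel. norm (case (w, x) of (w, x) \<Rightarrow> complex_of_real (g w) * (f x * cnj (f (x + (- t) *\<^sub>R w)))))"
      by (simp add: norm_mult)
    show "AE w in lborel. integrable lborel (\<lambda>x. case (w, x) of (w, x) \<Rightarrow> complex_of_real (g w) * (f x * cnj (f (x + (- t) *\<^sub>R w))))"
      by (intro AE_I2) (simp only: prod.case, intro integrable_mult_right if2)
  qed measurable
  have "(LINT x|lborel. f x * A x) = (LINT x|lborel. (LINT w|lborel. complex_of_real (g w) * (f x * cnj (f (x + (- t) *\<^sub>R w)))))"
    unfolding A by (simp flip: integral_mult_right_zero add: mult_ac)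
  also have "\<dots> = (LINT w|lborel. (LINT x|lborel. complex_of_real (g w) * (f x * cnj (f (x + (- t) *\<^sub>R w)))))"
    by (rule lborel_pair.Fubini_integral[OF i3])
  also have "\<dots> = (LINT w|lborel. complex_of_real (g w) * (LINT x|lborel. f x * cnj (f (x + (- t) *\<^sub>R w))))"
    by simp
  finally have **: "(LINT x|lborel. f x * A x) = (LINT w|lborel. complex_of_real (g w) * (LINT x|lborel. f x * cnj (f (x + (- t) *\<^sub>R w))))" .
  have iw: "integrable lborel (\<lambda>w. complex_of_real (g w) * (LINT x|lborel. f x * cnj (f (x + (- t) *\<^sub>R w))))"
    using lborel_pair.integrable_fst'[OF i3] by simp
  have "complex_of_real (LINT \<xi>|lborel. G \<xi> * (norm (F \<xi>))\<^sup>2) = c * (LINT w|lborel. complex_of_real (g w) * (LINT x|lborel. f x * cnj (f (x + (- t) *\<^sub>R w))))"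
    using * ** by (simp flip: integral_complex_of_real)
  \<comment> \<open>The real inner product of complex numbers \<open>a\<close> and \<open>b\<close>
    is \<open>Re (a * cnj b)\<close>; taking real parts therefore turns the Hermitian
    autocorrelation into \<open>L2_inner\<close>.\<close>
  then have "Re (complex_of_real (LINT \<xi>|lborel. G \<xi> * (norm (F \<xi>))\<^sup>2)) = Re (c * (LINT w|lborel. complex_of_real (g w) * (LINT x|lborel. f x * cnj (f (x + (- t) *\<^sub>R w)))))"
    by simp
  then have "(LINT \<xi>|lborel. G \<xi> * (norm (F \<xi>))\<^sup>2) = c * (LINT w|lborel. Re (complex_of_real (g w) * (LINT x|lborel. f x * cnj (f (x + (- t) *\<^sub>R w)))))"
    unfolding integral_Re[OF iw] by simp
  also have "(\<lambda>w. Re (complex_of_real (g w) * (LINT x|lborel. f x * cnj (f (x + (- t) *\<^sub>R w))))) = (\<lambda>w. g w * L2_inner f (\<lambda>x. f (x + (- t) *\<^sub>R w)))"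
  proof
    fix w
    have "Re (LINT x|lborel. f x * cnj (f (x + (- t) *\<^sub>R w))) = (LINT x|lborel. Re (f x * cnj (f (x + (- t) *\<^sub>R w))))"
      by (rule integral_Re[OF if2, symmetric])
    also have "\<dots> = L2_inner f (\<lambda>x. f (x + (- t) *\<^sub>R w))"
      unfolding L2_inner_def by (simp add: inner_complex_def)
    finally show "Re (complex_of_real (g w) * (LINT x|lborel. f x * cnj (f (x + (- t) *\<^sub>R w)))) = g w * L2_inner f (\<lambda>x. f (x + (- t) *\<^sub>R w))"
      by simp
  qed
  finally show ?thesis unfolding c_def F_def G_def g_def .
qed

text \<open>The damping in \<open>fourier_gaussian_energy\<close> is removed along
  \<open>t n = 1 / (n + 1)\<close>. The side of the autocorrelations converges by continuity of
  translations in \<open>L\<^sup>2\<close> under a Gaussian majorant. On the frequency side the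
  integrands increase, so monotone convergence yields square integrability of the transform together
  with the value of its norm.\<close>

theorem fourier_integral_Plancherel:
  fixes f :: "'a::euclidean_space \<Rightarrow> complex"
  assumes f1: "integrable lborel f" and f2: "f \<in> L2"
  shows fourier_integral_L2: "fourier_integral f \<in> L2"
    and L2_inner_fourier_integral: "L2_inner (fourier_integral f) (fourier_integral f) = L2_inner f f"
proof -
  define F where "F = fourier_integral f"
  define c where "c = (2 * pi) powr (- real DIM('a) / 2)"
  define t where "t = (\<lambda>n. 1 / real (Suc n))"
  define G where "G = (\<lambda>n \<xi>::'a. exp (- (norm (t n *\<^sub>R \<xi>))\<^sup>2 / 2))"
  have t: "t n > 0" for n by (simp add: t_def)
  have t0: "t \<longlonglongrightarrow> 0" unfolding t_def by (rule LIMSEQ_Suc[OF lim_1_over_n])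
  have [measurable]: "f \<in> borel_measurable borel" "F \<in> borel_measurable borel" "\<And>n. G n \<in> borel_measurable borel"
    using f1 by (auto simp: F_def G_def)
  define b where "b = (\<lambda>n. LINT w|lborel. exp (- (norm (w::'a))\<^sup>2 / 2) * L2_inner f (\<lambda>x. f (x + (- t n) *\<^sub>R w)))"
  have "b \<longlonglongrightarrow> (LINT w|lborel. exp (- (norm (w::'a))\<^sup>2 / 2) * L2_inner f f)"
    unfolding b_def
  proof (rule integral_dominated_convergence)
    show "integrable lborel (\<lambda>w::'a. exp (- (norm w)\<^sup>2 / 2) * L2_inner f f)"
      by (intro integrable_mult_left gaussian_integrable)
    show "(\<lambda>w. exp (- (norm (w::'a))\<^sup>2 / 2) * L2_inner f (\<lambda>x. f (x + (- t n) *\<^sub>R w))) \<in> borel_measurable lborel" for n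
      unfolding L2_inner_def by measurable
    show "AE w in lborel. norm (exp (- (norm (w::'a))\<^sup>2 / 2) * L2_inner f (\<lambda>x. f (x + (- t n) *\<^sub>R w))) \<le> exp (- (norm w)\<^sup>2 / 2) * L2_inner f f" for n
    proof (rule AE_I2)
      fix w :: 'a
      have "\<bar>L2_inner f (\<lambda>x. f (x + (- t n) *\<^sub>R w))\<bar> \<le> L2_norm f * L2_norm (\<lambda>x. f (x + (- t n) *\<^sub>R w))"
        by (intro L2_Cauchy_Schwarz f2 L2_shift)
      also have "L2_norm (\<lambda>x. f (x + (- t n) *\<^sub>R w)) = L2_norm f"
        unfolding L2_norm_def by (subst L2_inner_shift) auto
      also have "L2_norm f * L2_norm f = L2_inner f f"
        by (simp flip: power2_eq_square add: L2_norm_square)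
      finally show "norm (exp (- (norm w)\<^sup>2 / 2) * L2_inner f (\<lambda>x. f (x + (- t n) *\<^sub>R w))) \<le> exp (- (norm w)\<^sup>2 / 2) * L2_inner f f"
        by (simp add: abs_mult)
    qed
    show "AE w in lborel. (\<lambda>n. exp (- (norm (w::'a))\<^sup>2 / 2) * L2_inner f (\<lambda>x. f (x + (- t n) *\<^sub>R w))) \<longlonglongrightarrow> exp (- (norm w)\<^sup>2 / 2) * L2_inner f f"
    proof (rule AE_I2)
      fix w :: 'a
      have "(\<lambda>n. (- t n) *\<^sub>R w) \<longlonglongrightarrow> (- 0) *\<^sub>R w" by (intro tendsto_intros t0)
      then have "(\<lambda>n. L2_norm (shift_diff ((- t n) *\<^sub>R w) f)) \<longlonglongrightarrow> 0"
        by (intro L2_shift_continuous[OF f2]) simp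
      then have "(\<lambda>n. L2_norm (\<lambda>x. f (x + (- t n) *\<^sub>R w) - f x)) \<longlonglongrightarrow> 0"
        by (simp add: shift_diff_def[abs_def])
      then have "(\<lambda>n. L2_inner f (\<lambda>x. f (x + (- t n) *\<^sub>R w))) \<longlonglongrightarrow> L2_inner f f"
        by (intro L2_inner_tendsto L2_shift f2) (simp_all add: L2_norm_def L2_inner_def)
      then show "(\<lambda>n. exp (- (norm w)\<^sup>2 / 2) * L2_inner f (\<lambda>x. f (x + (- t n) *\<^sub>R w))) \<longlonglongrightarrow> exp (- (norm w)\<^sup>2 / 2) * L2_inner f f"
        by (intro tendsto_intros)
    qed
  qed auto
  also have "(LINT w|lborel. exp (- (norm (w::'a))\<^sup>2 / 2) * L2_inner f f) = (2 * pi) powr (DIM('a) / 2) * L2_inner f f"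
    by (simp only: integral_mult_left_zero gaussian_integral)
  finally have "(\<lambda>n. c * b n) \<longlonglongrightarrow> c * ((2 * pi) powr (DIM('a) / 2) * L2_inner f f)"
    by (intro tendsto_intros)
  also have "c * ((2 * pi) powr (DIM('a) / 2) * L2_inner f f) = L2_inner f f"
    by (simp add: c_def powr_minus field_simps)
  also have "(\<lambda>n. c * b n) = (\<lambda>n. LINT \<xi>|lborel. G n \<xi> * (norm (F \<xi>))\<^sup>2)"
    unfolding c_def b_def G_def F_def fourier_gaussian_energy[OF f1 f2 t] ..
  finally have lim: "(\<lambda>n. LINT \<xi>|lborel. G n \<xi> * (norm (F \<xi>))\<^sup>2) \<longlonglongrightarrow> L2_inner f f" .
  obtain B where B: "\<And>\<xi>. norm (F \<xi>) \<le> B"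
    using fourier_integral_bound[of f] unfolding F_def by blast
  have int: "integrable lborel (\<lambda>\<xi>. G n \<xi> * (norm (F \<xi>))\<^sup>2)" for n
  proof (rule Bochner_Integration.integrable_bound)
    show "integrable lborel (\<lambda>\<xi>. G n \<xi> * B\<^sup>2)"
      unfolding G_def by (intro integrable_mult_left scaled_gaussian_integrable t)
    show "AE \<xi> in lborel. norm (G n \<xi> * (norm (F \<xi>))\<^sup>2) \<le> norm (G n \<xi> * B\<^sup>2)"
      using B by (auto intro!: AE_I2 mult_left_mono power_mono simp: abs_mult)
  qed measurable
  have mono: "AE \<xi> in lborel. mono (\<lambda>n. G n \<xi> * (norm (F \<xi>))\<^sup>2)"
  proof (intro AE_I2 monoI mult_right_mono)
    fix \<xi> :: 'a and m n :: nat assume "m \<le> n"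
    then have "t n \<le> t m" by (auto simp: t_def field_simps)
    then have "(norm (t n *\<^sub>R \<xi>))\<^sup>2 \<le> (norm (t m *\<^sub>R \<xi>))\<^sup>2"
      using t[of n] t[of m] by (intro power_mono) (auto intro: mult_right_mono)
    then show "G m \<xi> \<le> G n \<xi>" by (simp add: G_def)
  qed auto
  have ptw: "AE \<xi> in lborel. (\<lambda>n. G n \<xi> * (norm (F \<xi>))\<^sup>2) \<longlonglongrightarrow> (norm (F \<xi>))\<^sup>2"
  proof (rule AE_I2)
    fix \<xi> :: 'a
    have "(\<lambda>n. exp (- (norm (t n *\<^sub>R \<xi>))\<^sup>2 / 2) * (norm (F \<xi>))\<^sup>2) \<longlonglongrightarrow> exp (- (norm (0 *\<^sub>R \<xi>))\<^sup>2 / 2) * (norm (F \<xi>))\<^sup>2"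
      by (intro tendsto_intros t0) simp
    then show "(\<lambda>n. G n \<xi> * (norm (F \<xi>))\<^sup>2) \<longlonglongrightarrow> (norm (F \<xi>))\<^sup>2" by (simp add: G_def)
  qed
  have "(\<lambda>\<xi>. (norm (F \<xi>))\<^sup>2) \<in> borel_measurable lborel" by measurable
  note mc = int mono ptw lim this
  show "fourier_integral f \<in> L2"
    using integrable_monotone_convergence[OF mc] by (intro L2I) (auto simp: F_def)
  show "L2_inner (fourier_integral f) (fourier_integral f) = L2_inner f f"
    using integral_monotone_convergence[OF mc] by (simp add: L2_inner_self F_def)
qed

text \<open>Fatou's lemma along an almost everywhere convergent subsequence: a bound between members
  of the sequence survives when one of them is replaced by the limit.\<close>

lemma L2_norm_tail:
  fixes F :: "nat \<Rightarrow> 'a::euclidean_space \<Rightarrow> 'b::euclidean_space"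
  assumes "\<And>n. F n \<in> L2" "F0 \<in> borel_measurable borel" "e \<ge> 0"
    and r: "strict_mono r" and lim: "AE x in lborel. (\<lambda>k. F (r k) x) \<longlonglongrightarrow> F0 x"
    and N: "\<And>m. m \<ge> N \<Longrightarrow> L2_norm (\<lambda>x. F m x - F n x) \<le> e"
  shows "(\<lambda>x. F0 x - F n x) \<in> L2" "L2_norm (\<lambda>x. F0 x - F n x) \<le> e"
proof -
  have [measurable]: "\<And>n. F n \<in> borel_measurable borel" "F0 \<in> borel_measurable borel"
    using assms by (auto dest: L2_measurable)
  have "(\<integral>\<^sup>+ x. ennreal ((norm (F0 x - F n x))\<^sup>2) \<partial>lborel) = (\<integral>\<^sup>+ x. liminf (\<lambda>k. ennreal ((norm (F (r k) x - F n x))\<^sup>2)) \<partial>lborel)"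
  proof (rule nn_integral_cong_AE, use lim in eventually_elim)
    fix x assume "(\<lambda>k. F (r k) x) \<longlonglongrightarrow> F0 x"
    then have "(\<lambda>k. ennreal ((norm (F (r k) x - F n x))\<^sup>2)) \<longlonglongrightarrow> ennreal ((norm (F0 x - F n x))\<^sup>2)"
      by (intro tendsto_intros)
    then show "ennreal ((norm (F0 x - F n x))\<^sup>2) = liminf (\<lambda>k. ennreal ((norm (F (r k) x - F n x))\<^sup>2))"
      by (rule lim_imp_Liminf[OF sequentially_bot, symmetric])
  qed
  also have "\<dots> \<le> liminf (\<lambda>k. \<integral>\<^sup>+ x. ennreal ((norm (F (r k) x - F n x))\<^sup>2) \<partial>lborel)"
    by (rule nn_integral_liminf) measurable
  also have "\<dots> \<le> limsup (\<lambda>k. \<integral>\<^sup>+ x. ennreal ((norm (F (r k) x - F n x))\<^sup>2) \<partial>lborel)"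
    by (rule Liminf_le_Limsup) simp
  also have "\<dots> \<le> ennreal (e\<^sup>2)"
  proof (rule Limsup_bounded, rule eventually_mono[OF eventually_ge_at_top[of N]])
    fix k assume "N \<le> k"
    then have "N \<le> r k" using seq_suble[OF r, of k] by simp
    from N[OF this] have "(L2_norm (\<lambda>x. F (r k) x - F n x))\<^sup>2 \<le> e\<^sup>2"
      by (intro power_mono) auto
    then show "(\<integral>\<^sup>+ x. ennreal ((norm (F (r k) x - F n x))\<^sup>2) \<partial>lborel) \<le> ennreal (e\<^sup>2)"
      by (simp add: nn_integral_L2_norm[OF L2_diff] assms L2_norm_square ennreal_leI)
  qed
  finally have *: "(\<integral>\<^sup>+ x. ennreal ((norm (F0 x - F n x))\<^sup>2) \<partial>lborel) \<le> ennreal (e\<^sup>2)" .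
  show L: "(\<lambda>x. F0 x - F n x) \<in> L2"
    by (rule L2I_nn_integral) (use * in \<open>auto intro: order.strict_trans1\<close>)
  have "(L2_norm (\<lambda>x. F0 x - F n x))\<^sup>2 \<le> e\<^sup>2"
    using * by (simp add: nn_integral_L2_norm[OF L] L2_norm_square ennreal_le_iff)
  then show "L2_norm (\<lambda>x. F0 x - F n x) \<le> e"
    using assms(3) by (rule power2_le_imp_le)
qed

text \<open>The Riesz-Fischer argument: a fast subsequence converges almost everywhere, and
  \<open>L2_norm_tail\<close> upgrades this to convergence of the whole sequence in norm.\<close>

theorem L2_complete:
  fixes F :: "nat \<Rightarrow> 'a::euclidean_space \<Rightarrow> 'b::euclidean_space"
  assumes F: "\<And>n. F n \<in> L2"
    and Cauchy: "\<And>e. e > 0 \<Longrightarrow> \<exists>N. \<forall>m\<ge>N. \<forall>n\<ge>N. L2_norm (\<lambda>x. F m x - F n x) \<le> e"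
  obtains F0 where "F0 \<in> L2" "(\<lambda>n. L2_norm (\<lambda>x. F n x - F0 x)) \<longlonglongrightarrow> 0"
proof -
  have [measurable]: "\<And>n. F n \<in> borel_measurable borel"
    using F by (auto dest: L2_measurable)
  have "\<exists>N. \<forall>k. \<forall>m\<ge>N k. \<forall>n\<ge>N k. L2_norm (\<lambda>x. F m x - F n x) \<le> (1/2)^k"
    using Cauchy[of "(1/2)^k" for k] by (intro choice allI) simp
  then obtain N where N: "\<And>k m n. m \<ge> N k \<Longrightarrow> n \<ge> N k \<Longrightarrow> L2_norm (\<lambda>x. F m x - F n x) \<le> (1/2)^k"
    by blast
  \<comment> \<open>The recursion keeps \<open>r\<close> strictly increasing and above
    \<open>N k\<close>, so consecutive members differ by at most \<open>(1/2)^k\<close> in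
    norm.\<close>
  define r where "r = rec_nat (N 0) (\<lambda>k rk. Suc (max rk (N (Suc k))))"
  have r: "strict_mono r" by (auto simp: strict_mono_Suc_iff r_def)
  have rN: "r k \<ge> N k" for k by (cases k) (auto simp: r_def)
  have rs: "L2_norm (\<lambda>x. F (r (Suc k)) x - F (r k) x) \<le> (1/2)^k" for k
    using N[of k "r (Suc k)" "r k"] rN[of k] strict_monoD[OF r, of k "Suc k"] by simp
  define d where "d = (\<lambda>k x. norm (F (r (Suc k)) x - F (r k) x))"
  have [measurable]: "\<And>k. d k \<in> borel_measurable borel" unfolding d_def by measurable
  \<comment> \<open>The squared norms are at most \<open>(1/4)^k\<close>, which leaves room for the
    weight \<open>2^k\<close>. Finiteness of the weighted sum at a point then forces the increments
    there to decay like \<open>(1 / sqrt 2)^k\<close>, hence to be summable.\<close>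
  have "(\<integral>\<^sup>+x. (\<Sum>k. ennreal (2^k * (d k x)\<^sup>2)) \<partial>lborel) = (\<Sum>k. \<integral>\<^sup>+x. ennreal (2^k * (d k x)\<^sup>2) \<partial>lborel)"
    by (rule nn_integral_suminf) measurable
  also have "\<dots> \<le> (\<Sum>k. ennreal ((1/2)^k))"
  proof (rule suminf_le)
    fix k
    have "(\<integral>\<^sup>+x. ennreal (2^k * (d k x)\<^sup>2) \<partial>lborel) = ennreal (2^k) * (\<integral>\<^sup>+x. ennreal ((d k x)\<^sup>2) \<partial>lborel)"
      by (simp add: ennreal_mult nn_integral_cmult)
    also have "(\<integral>\<^sup>+x. ennreal ((d k x)\<^sup>2) \<partial>lborel) = ennreal ((L2_norm (\<lambda>x. F (r (Suc k)) x - F (r k) x))\<^sup>2)"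
      unfolding d_def L2_norm_square by (rule nn_integral_L2_norm) (use F in auto)
    also have "ennreal (2^k) * \<dots> = ennreal (2^k * (L2_norm (\<lambda>x. F (r (Suc k)) x - F (r k) x))\<^sup>2)"
      by (simp add: ennreal_mult)
    also have "\<dots> \<le> ennreal (2^k * ((1/2)^k)\<^sup>2)"
      by (intro ennreal_leI mult_left_mono power_mono rs) auto
    also have "2^k * ((1/2)^k)\<^sup>2 = (1/2 :: real)^k"
      by (simp add: power2_eq_square power_one_over field_simps)
    finally show "(\<integral>\<^sup>+x. ennreal (2^k * (d k x)\<^sup>2) \<partial>lborel) \<le> ennreal ((1/2)^k)" .
  qed auto
  also have "\<dots> = ennreal (\<Sum>k. (1/2)^k)"
    by (rule suminf_ennreal2) (auto simp: summable_geometric)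
  finally have "(\<integral>\<^sup>+x. (\<Sum>k. ennreal (2^k * (d k x)\<^sup>2)) \<partial>lborel) < \<infinity>"
    by (auto intro: order.strict_trans1)
  then have "AE x in lborel. (\<Sum>k. ennreal (2^k * (d k x)\<^sup>2)) \<noteq> \<infinity>"
    by (intro nn_integral_noteq_infinite) auto
  then have conv: "AE x in lborel. convergent (\<lambda>k. F (r k) x)"
  proof eventually_elim
    fix x assume fin: "(\<Sum>k. ennreal (2^k * (d k x)\<^sup>2)) \<noteq> \<infinity>"
    then obtain C where C: "(\<Sum>k. ennreal (2^k * (d k x)\<^sup>2)) = ennreal C" "C \<ge> 0"
      by (metis ennreal_cases infinity_ennreal_def)
    have "d k x \<le> sqrt C * (1 / sqrt 2)^k" for k
    proof (rule power2_le_imp_le)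
      have "ennreal (2^k * (d k x)\<^sup>2) \<le> ennreal C"
        using sum_le_suminf[OF summableI, of "{k}" "\<lambda>k. ennreal (2^k * (d k x)\<^sup>2)"] C by simp
      then have "2^k * (d k x)\<^sup>2 \<le> C" using C by (simp add: ennreal_le_iff)
      then have "(d k x)\<^sup>2 \<le> C / 2^k" by (simp add: field_simps)
      also have "C / 2^k = (sqrt C)\<^sup>2 * ((1 / sqrt 2)\<^sup>2)^k"
        using C by (simp add: power_divide)
      also have "((1 / sqrt 2)\<^sup>2)^k = ((1 / sqrt 2)^k)\<^sup>2"
        by (metis power_mult mult.commute)
      also have "(sqrt C)\<^sup>2 * ((1 / sqrt 2)^k)\<^sup>2 = (sqrt C * (1 / sqrt 2)^k)\<^sup>2"
        by (rule power_mult_distrib[symmetric])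
      finally show "(d k x)\<^sup>2 \<le> (sqrt C * (1 / sqrt 2)^k)\<^sup>2" .
    qed (use C in auto)
    moreover have "summable (\<lambda>k. sqrt C * (1 / sqrt 2)^k)"
      by (intro summable_mult summable_geometric) simp
    ultimately have "summable (\<lambda>k. F (r (Suc k)) x - F (r k) x)"
      by - (rule summable_comparison_test'[where N=0], assumption, simp add: d_def)
    then have "convergent (\<lambda>n. \<Sum>k<n. F (r (Suc k)) x - F (r k) x)"
      by (simp add: summable_iff_convergent)
    then have "convergent (\<lambda>n. F (r n) x - F (r 0) x)"
      by (simp only: sum_lessThan_telescope[of "\<lambda>k. F (r k) x"])
    then have "convergent (\<lambda>n. (F (r n) x - F (r 0) x) + F (r 0) x)"
      by (intro convergent_add convergent_const)
    then show "convergent (\<lambda>k. F (r k) x)" by simp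
  qed
  define F0 where "F0 x = lim (\<lambda>k. F (r k) x)" for x
  have F0: "F0 \<in> borel_measurable borel"
    unfolding F0_def by (intro borel_measurable_lim_metric) measurable
  have lim: "AE x in lborel. (\<lambda>k. F (r k) x) \<longlonglongrightarrow> F0 x"
    using conv unfolding F0_def by eventually_elim (simp add: convergent_LIMSEQ_iff)
  note tail = L2_norm_tail[OF F F0 _ r lim]
  have "F0 \<in> L2"
  proof -
    have "(\<lambda>x. (F0 x - F (N 0) x) + F (N 0) x) \<in> L2"
      by (intro L2_add F tail(1)[where e=1 and N="N 0"]) (use N[of 0] in auto)
    then show ?thesis by simp
  qed
  moreover have "(\<lambda>n. L2_norm (\<lambda>x. F n x - F0 x)) \<longlonglongrightarrow> 0"
  proof (rule LIMSEQ_I)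
    fix e :: real assume e: "e > 0"
    then obtain M where M: "\<And>m n. m \<ge> M \<Longrightarrow> n \<ge> M \<Longrightarrow> L2_norm (\<lambda>x. F m x - F n x) \<le> e/2"
      using Cauchy[of "e/2"] by auto
    have "norm (L2_norm (\<lambda>x. F n x - F0 x) - 0) < e" if "n \<ge> M" for n
    proof -
      have "L2_norm (\<lambda>x. F0 x - F n x) \<le> e/2"
        by (rule tail(2)[where N=M]) (use M that e in auto)
      moreover have "L2_norm (\<lambda>x. F0 x - F n x) = L2_norm (\<lambda>x. F n x - F0 x)"
        using L2_norm_uminus[of "\<lambda>x. F n x - F0 x"] by simp
      ultimately show ?thesis using e by simp
    qed
    then show "\<exists>no. \<forall>n\<ge>no. norm (L2_norm (\<lambda>x. F n x - F0 x) - 0) < e" by blast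
  qed
  ultimately show thesis by (rule that)
qed

section \<open>The Fourier transform on \<open>L\<^sup>2\<close>\<close>

text \<open>The predicate under the choice operator in \<open>L2_fourier\<close>. Naming it lets
  properties be shown for some representative and carried over by almost everywhere
  uniqueness.\<close>

definition is_L2_fourier :: "('a::euclidean_space \<Rightarrow> complex) \<Rightarrow> ('a \<Rightarrow> complex) \<Rightarrow> bool" where
  "is_L2_fourier f F \<longleftrightarrow> F \<in> L2 \<and>
     ((\<lambda>R::real. \<integral>\<^sup>+ \<xi>. ennreal ((norm (F \<xi> -
         fourier_integral (\<lambda>x. indicator (cball 0 R) x * f x) \<xi>))\<^sup>2) \<partial>lborel)
       \<longlongrightarrow> 0) at_top"

lemma L2_fourier_alt: "L2_fourier f = (SOME F. is_L2_fourier f F)"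
  by (simp add: L2_fourier_def is_L2_fourier_def)

section \<open>Truncation to balls\<close>

lemma L2_norm_L2:
  assumes "f \<in> L2"
  shows "(\<lambda>x. norm (f x)) \<in> L2"
  by (rule L2_dominated[OF assms, where c=1]) (use L2_measurable[OF assms] in auto)

lemma cball_measurable[measurable]: "cball a R \<in> sets (borel :: 'a::euclidean_space measure)"
  by simp

lemma indicator_L2:
  fixes S :: "'a::euclidean_space set"
  assumes [measurable]: "S \<in> sets borel" and "emeasure lborel S < \<infinity>"
  shows "(\<lambda>x. indicator S x :: real) \<in> L2"
proof (rule L2I)
  have "(\<lambda>x::'a. (norm (indicator S x :: real))\<^sup>2) = indicator S"
    by (auto simp: indicator_def)
  then show "integrable lborel (\<lambda>x::'a. (norm (indicator S x :: real))\<^sup>2)" using assms by simp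
qed simp

lemma L2_bounded_support_integrable:
  fixes u :: "'a::euclidean_space \<Rightarrow> 'b::euclidean_space"
  assumes u: "u \<in> L2" and S: "AE x in lborel. norm x > R \<longrightarrow> u x = 0"
  shows "integrable lborel u"
proof -
  have [measurable]: "u \<in> borel_measurable borel" using u by (rule L2_measurable)
  have i: "(\<lambda>x::'a. indicator (cball 0 R) x :: real) \<in> L2"
    using emeasure_lborel_cball_finite[of "0::'a" R] by (intro indicator_L2) auto
  have *: "AE x in lborel. norm (u x) \<le> norm (indicator (cball 0 R) x \<bullet> norm (u x))"
    using S by eventually_elim (auto simp: indicator_def)
  show ?thesis
    by (rule Bochner_Integration.integrable_bound[OF L2_inner_integrable[OF i L2_norm_L2[OF u]] _ *]) measurable
qed

lemma indicator_cball_measurable[measurable]: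
  "(\<lambda>x::'a::euclidean_space. indicator (cball 0 R) x :: complex) \<in> borel_measurable borel"
  by (intro borel_measurable_indicator) simp

lemma truncation_L2:
  fixes f :: "'a::euclidean_space \<Rightarrow> complex"
  assumes f: "f \<in> L2"
  shows "(\<lambda>x. indicator (cball 0 R) x * f x) \<in> L2" (is "?f \<in> L2") and "integrable lborel (\<lambda>x. indicator (cball 0 R) x * f x)"
proof -
  have [measurable]: "f \<in> borel_measurable borel" using f by (rule L2_measurable)
  show t: "?f \<in> L2"
    by (rule L2_dominated[OF f, where c=1]) (auto simp: indicator_def)
  show "integrable lborel ?f"
    by (rule L2_bounded_support_integrable[OF t, of R]) (auto simp: indicator_def)
qed

lemma truncation_tendsto:
  fixes f :: "'a::euclidean_space \<Rightarrow> complex"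
  assumes f: "f \<in> L2"
  shows "((\<lambda>R. L2_norm (\<lambda>x. f x - indicator (cball 0 R) x * f x)) \<longlongrightarrow> 0) at_top"
proof -
  have [measurable]: "f \<in> borel_measurable borel" using f by (rule L2_measurable)
  have "((\<lambda>R. LINT x|lborel. (norm (f x - indicator (cball 0 R) x * f x))\<^sup>2) \<longlongrightarrow> (LINT x|(lborel :: 'a measure). 0)) at_top"
  proof (rule integral_dominated_convergence_at_top)
    show "integrable lborel (\<lambda>x. (norm (f x))\<^sup>2)" by (rule L2_integrable_sq[OF f])
    show "\<forall>\<^sub>F R in at_top. AE x in lborel. norm ((norm (f x - indicator (cball 0 R) x * f x))\<^sup>2) \<le> (norm (f x))\<^sup>2"
      by (intro always_eventually allI AE_I2) (auto simp: indicator_def)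
    show "AE x in lborel. ((\<lambda>R. (norm (f x - indicator (cball 0 R) x * f x))\<^sup>2) \<longlongrightarrow> 0) at_top"
    proof (rule AE_I2)
      fix x
      show "((\<lambda>R. (norm (f x - indicator (cball 0 R) x * f x))\<^sup>2) \<longlongrightarrow> 0) at_top"
        by (rule tendsto_eventually, rule eventually_mono[OF eventually_ge_at_top[of "norm x"]]) (auto simp: indicator_def)
    qed
  qed simp_all
  then have "((\<lambda>R. L2_inner (\<lambda>x. f x - indicator (cball 0 R) x * f x) (\<lambda>x. f x - indicator (cball 0 R) x * f x)) \<longlongrightarrow> 0) at_top"
    by (simp add: L2_inner_self)
  then show ?thesis unfolding L2_norm_def using tendsto_real_sqrt by fastforce
qed

lemma fourier_integral_diff:
  assumes "integrable lborel f" "integrable lborel g"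
  shows "fourier_integral (\<lambda>x. f x - g x) \<xi> = fourier_integral f \<xi> - fourier_integral g \<xi>"
  using fourier_integrand_integrable[OF assms(1)] fourier_integrand_integrable[OF assms(2)]
  by (simp add: fourier_integral_def right_diff_distrib)

lemma fourier_integral_add:
  assumes "integrable lborel f" "integrable lborel g"
  shows "fourier_integral (\<lambda>x. f x + g x) \<xi> = fourier_integral f \<xi> + fourier_integral g \<xi>"
  using fourier_integrand_integrable[OF assms(1)] fourier_integrand_integrable[OF assms(2)]
  by (simp add: fourier_integral_def distrib_left)

lemma L2_norm_fourier_integral_diff:
  assumes "integrable lborel f" "f \<in> L2" "integrable lborel g" "g \<in> L2"
  shows "L2_norm (\<lambda>\<xi>. fourier_integral f \<xi> - fourier_integral g \<xi>) = L2_norm (\<lambda>x. f x - g x)"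
proof -
  have "(\<lambda>\<xi>. fourier_integral f \<xi> - fourier_integral g \<xi>) = fourier_integral (\<lambda>x. f x - g x)"
    using assms by (simp add: fourier_integral_diff fun_eq_iff)
  then show ?thesis
    using L2_inner_fourier_integral[of "\<lambda>x. f x - g x"] assms by (simp add: L2_norm_def L2_diff)
qed

lemma L2_norm_minus_commute: "L2_norm (\<lambda>x. f x - g x) = L2_norm (\<lambda>x. g x - f x)"
  using L2_norm_uminus[of "\<lambda>x. f x - g x"] by simp

lemma L2_norm_triangle3:
  assumes "f \<in> L2" "g \<in> L2" "h \<in> L2"
  shows "L2_norm (\<lambda>x. f x - h x) \<le> L2_norm (\<lambda>x. f x - g x) + L2_norm (\<lambda>x. g x - h x)"
  using L2_norm_triangle[of "\<lambda>x. f x - g x" "\<lambda>x. g x - h x"] assms by (simp add: L2_diff)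

text \<open>Passing from integrals of squares in \<open>ennreal\<close> to \<open>L2_norm\<close>
  makes the triangle inequality available for the limits below.\<close>

lemma is_L2_fourier_iff:
  assumes f: "f \<in> L2"
  shows "is_L2_fourier f F \<longleftrightarrow> F \<in> L2 \<and>
    ((\<lambda>R. L2_norm (\<lambda>\<xi>. F \<xi> - fourier_integral (\<lambda>x. indicator (cball 0 R) x * f x) \<xi>)) \<longlongrightarrow> 0) at_top"
proof (cases "F \<in> L2")
  case True
  define N where "N = (\<lambda>R. L2_norm (\<lambda>\<xi>. F \<xi> - fourier_integral (\<lambda>x. indicator (cball 0 R) x * f x) \<xi>))"
  have "(\<integral>\<^sup>+ \<xi>. ennreal ((norm (F \<xi> - fourier_integral (\<lambda>x. indicator (cball 0 R) x * f x) \<xi>))\<^sup>2) \<partial>lborel) = ennreal ((N R)\<^sup>2)" for R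
    unfolding N_def L2_norm_square
    by (intro nn_integral_L2_norm L2_diff True fourier_integral_L2 truncation_L2 f)
  moreover have "((\<lambda>R. ennreal ((N R)\<^sup>2)) \<longlongrightarrow> 0) at_top \<longleftrightarrow> (N \<longlongrightarrow> 0) at_top"
  proof
    assume "((\<lambda>R. ennreal ((N R)\<^sup>2)) \<longlongrightarrow> 0) at_top"
    then have "((\<lambda>R. (N R)\<^sup>2) \<longlongrightarrow> 0) at_top"
      using tendsto_ennrealD[of "\<lambda>R. (N R)\<^sup>2" 0 at_top] by (simp add: always_eventually)
    then have "((\<lambda>R. sqrt ((N R)\<^sup>2)) \<longlongrightarrow> sqrt 0) at_top" by (rule tendsto_real_sqrt)
    then show "(N \<longlongrightarrow> 0) at_top" by (simp add: N_def)
  next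
    assume "(N \<longlongrightarrow> 0) at_top"
    then have "((\<lambda>R. ennreal ((N R)\<^sup>2)) \<longlongrightarrow> ennreal (0\<^sup>2)) at_top" by (intro tendsto_intros)
    then show "((\<lambda>R. ennreal ((N R)\<^sup>2)) \<longlongrightarrow> 0) at_top" by simp
  qed
  ultimately show ?thesis using True by (simp add: is_L2_fourier_def N_def)
qed (simp add: is_L2_fourier_def)

text \<open>By Plancherel the transforms of two truncations are as far apart as the truncations
  themselves. Completeness gives a limit along integer radii, and the bound by the tail
  \<open>tl R\<close>, obtained by letting the integer radius tend to infinity, extends the
  convergence to real radii.\<close>

lemma is_L2_fourier_exists:
  fixes f :: "'a::euclidean_space \<Rightarrow> complex"
  assumes f: "f \<in> L2"
  shows "\<exists>F. is_L2_fourier f F"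
proof -
  define T where "T = (\<lambda>R. (\<lambda>x. indicator (cball 0 R) x * f x))"
  have T: "T R \<in> L2" "integrable lborel (T R)" for R
    unfolding T_def using truncation_L2[OF f] by auto
  define tl where "tl R = L2_norm (\<lambda>x. f x - T R x)" for R
  have tl: "(tl \<longlongrightarrow> 0) at_top" unfolding tl_def T_def by (rule truncation_tendsto[OF f])
  have FT: "fourier_integral (T R) \<in> L2" for R by (intro fourier_integral_L2 T)
  have d: "L2_norm (\<lambda>\<xi>. fourier_integral (T R) \<xi> - fourier_integral (T R') \<xi>) \<le> tl R + tl R'" for R R'
    using L2_norm_triangle3[OF T(1) f T(1), of R R'] L2_norm_minus_commute[of "T R" f]
    by (simp add: L2_norm_fourier_integral_diff T tl_def)
  have "\<exists>N. \<forall>m\<ge>N. \<forall>n\<ge>N. L2_norm (\<lambda>\<xi>. fourier_integral (T (real m)) \<xi> - fourier_integral (T (real n)) \<xi>) \<le> e"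
    if "e > 0" for e
  proof -
    have "\<forall>\<^sub>F n in sequentially. tl (real n) < e/2"
      using order_tendstoD(2)[OF filterlim_compose[OF tl filterlim_real_sequentially], of "e/2"] that by simp
    then obtain N where "\<And>n. n \<ge> N \<Longrightarrow> tl (real n) < e/2" by (auto simp: eventually_sequentially)
    then have "tl (real m) + tl (real n) \<le> e" if "m \<ge> N" "n \<ge> N" for m n
      using that add_mono[of "tl (real m)" "e/2" "tl (real n)" "e/2"] by (simp add: less_imp_le)
    then show ?thesis using d order_trans by (intro exI[of _ N] allI impI) blast
  qed
  then obtain F where F: "F \<in> L2" "(\<lambda>n. L2_norm (\<lambda>\<xi>. fourier_integral (T (real n)) \<xi> - F \<xi>)) \<longlonglongrightarrow> 0"
    using L2_complete[of "\<lambda>n. fourier_integral (T (real n))"] FT by blast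
  have "((\<lambda>R. L2_norm (\<lambda>\<xi>. F \<xi> - fourier_integral (T R) \<xi>)) \<longlongrightarrow> 0) at_top"
  proof -
    have le: "L2_norm (\<lambda>\<xi>. F \<xi> - fourier_integral (T R) \<xi>) \<le> tl R" for R
    proof (rule tendsto_lowerbound)
      show "(\<lambda>n. L2_norm (\<lambda>\<xi>. fourier_integral (T (real n)) \<xi> - F \<xi>) + (tl (real n) + tl R)) \<longlonglongrightarrow> tl R"
        using tendsto_add[OF F(2) tendsto_add[OF filterlim_compose[OF tl filterlim_real_sequentially] tendsto_const[of "tl R"]]] by simp
      show "\<forall>\<^sub>F n in sequentially. L2_norm (\<lambda>\<xi>. F \<xi> - fourier_integral (T R) \<xi>) \<le> L2_norm (\<lambda>\<xi>. fourier_integral (T (real n)) \<xi> - F \<xi>) + (tl (real n) + tl R)"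
      proof (intro always_eventually allI)
        fix n
        show "L2_norm (\<lambda>\<xi>. F \<xi> - fourier_integral (T R) \<xi>) \<le> L2_norm (\<lambda>\<xi>. fourier_integral (T (real n)) \<xi> - F \<xi>) + (tl (real n) + tl R)"
          using L2_norm_triangle3[OF F(1) FT FT, of R "real n"] d[of "real n" R] L2_norm_minus_commute[of F "fourier_integral (T (real n))"]
          by linarith
      qed
    qed simp
    show ?thesis
      by (rule Lim_null_comparison[OF _ tl]) (simp add: le always_eventually)
  qed
  then show ?thesis using F(1) is_L2_fourier_iff[OF f] by (auto simp: T_def)
qed

lemma is_L2_fourier_L2_fourier: "f \<in> L2 \<Longrightarrow> is_L2_fourier f (L2_fourier f)"
  unfolding L2_fourier_alt using is_L2_fourier_exists by (rule someI_ex)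

lemma L2_fourier_L2[intro]: "f \<in> L2 \<Longrightarrow> L2_fourier f \<in> L2"
  using is_L2_fourier_L2_fourier by (auto simp: is_L2_fourier_def)

lemma L2_inner_eq_0_imp_AE:
  assumes "f \<in> L2" "L2_inner f f = 0"
  shows "AE x in lborel. f x = 0"
  using integral_nonneg_eq_0_iff_AE[OF L2_integrable_sq[OF assms(1)]] assms(2)
  by (simp add: L2_inner_self)

lemma L2_norm_eq_0_imp_AE:
  assumes "f \<in> L2" "L2_norm f = 0"
  shows "AE x in lborel. f x = 0"
  using L2_inner_eq_0_imp_AE[OF assms(1)] assms(2) by (simp add: L2_norm_def)

lemma is_L2_fourier_unique:
  assumes f: "f \<in> L2" and F: "is_L2_fourier f F" "is_L2_fourier f F'"
  shows "AE \<xi> in lborel. F \<xi> = F' \<xi>"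
proof -
  let ?T = "\<lambda>R. fourier_integral (\<lambda>x. indicator (cball 0 R) x * f x)"
  have L: "F \<in> L2" "F' \<in> L2" "\<And>R. ?T R \<in> L2"
    using F fourier_integral_L2[OF truncation_L2(2)[OF f] truncation_L2(1)[OF f]] by (auto simp: is_L2_fourier_def)
  have "L2_norm (\<lambda>\<xi>. F \<xi> - F' \<xi>) \<le> 0"
  proof (rule tendsto_lowerbound)
    show "((\<lambda>R. L2_norm (\<lambda>\<xi>. F \<xi> - ?T R \<xi>) + L2_norm (\<lambda>\<xi>. F' \<xi> - ?T R \<xi>)) \<longlongrightarrow> 0) at_top"
      using F unfolding is_L2_fourier_iff[OF f] by (intro tendsto_add_zero) auto
    show "\<forall>\<^sub>F R in at_top. L2_norm (\<lambda>\<xi>. F \<xi> - F' \<xi>) \<le> L2_norm (\<lambda>\<xi>. F \<xi> - ?T R \<xi>) + L2_norm (\<lambda>\<xi>. F' \<xi> - ?T R \<xi>)"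
    proof (intro always_eventually allI)
      fix R
      show "L2_norm (\<lambda>\<xi>. F \<xi> - F' \<xi>) \<le> L2_norm (\<lambda>\<xi>. F \<xi> - ?T R \<xi>) + L2_norm (\<lambda>\<xi>. F' \<xi> - ?T R \<xi>)"
        using L2_norm_triangle3[OF L(1) L(3) L(2), of R] L2_norm_minus_commute[of F' "?T R"] by simp
    qed
  qed simp
  then have "L2_norm (\<lambda>\<xi>. F \<xi> - F' \<xi>) = 0" by (simp add: order_antisym)
  then show ?thesis using L2_norm_eq_0_imp_AE[OF L2_diff[OF L(1,2)]] by simp
qed

section \<open>Linearity and the Parseval identity\<close>

lemma is_L2_fourier_add:
  assumes f: "f \<in> L2" "is_L2_fourier f F" and g: "g \<in> L2" "is_L2_fourier g G"
  shows "is_L2_fourier (\<lambda>x. f x + g x) (\<lambda>x. F x + G x)"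
proof -
  let ?T = "\<lambda>f R. fourier_integral (\<lambda>x. indicator (cball 0 R) x * f x)"
  have L: "F \<in> L2" "G \<in> L2" "\<And>R. ?T f R \<in> L2" "\<And>R. ?T g R \<in> L2"
    using f g fourier_integral_L2[OF truncation_L2(2)[OF f(1)] truncation_L2(1)[OF f(1)]]
      fourier_integral_L2[OF truncation_L2(2)[OF g(1)] truncation_L2(1)[OF g(1)]] by (auto simp: is_L2_fourier_def)
  have T: "?T (\<lambda>x. f x + g x) R \<xi> = ?T f R \<xi> + ?T g R \<xi>" for R \<xi>
    by (simp only: distrib_left fourier_integral_add[OF truncation_L2(2)[OF f(1)] truncation_L2(2)[OF g(1)]])
  have "((\<lambda>R. L2_norm (\<lambda>\<xi>. F \<xi> + G \<xi> - (?T f R \<xi> + ?T g R \<xi>))) \<longlongrightarrow> 0) at_top"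
  proof (rule Lim_null_comparison)
    show "((\<lambda>R. L2_norm (\<lambda>\<xi>. F \<xi> - ?T f R \<xi>) + L2_norm (\<lambda>\<xi>. G \<xi> - ?T g R \<xi>)) \<longlongrightarrow> 0) at_top"
      using f(2) g(2) unfolding is_L2_fourier_iff[OF f(1)] is_L2_fourier_iff[OF g(1)] by (intro tendsto_add_zero) auto
    show "\<forall>\<^sub>F R in at_top. norm (L2_norm (\<lambda>\<xi>. F \<xi> + G \<xi> - (?T f R \<xi> + ?T g R \<xi>))) \<le> L2_norm (\<lambda>\<xi>. F \<xi> - ?T f R \<xi>) + L2_norm (\<lambda>\<xi>. G \<xi> - ?T g R \<xi>)"
      using L2_norm_triangle[OF L2_diff[OF L(1,3)] L2_diff[OF L(2,4)]]
      by (intro always_eventually allI) (simp add: algebra_simps)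
  qed
  then show ?thesis unfolding is_L2_fourier_iff[OF L2_add[OF f(1) g(1)]] T using L by auto
qed

lemma is_L2_fourier_uminus:
  assumes f: "f \<in> L2" "is_L2_fourier f F"
  shows "is_L2_fourier (\<lambda>x. - f x) (\<lambda>x. - F x)"
proof -
  have T: "fourier_integral (\<lambda>x. indicator (cball 0 R) x * - f x) \<xi> = - fourier_integral (\<lambda>x. indicator (cball 0 R) x * f x) \<xi>" for R \<xi>
    by (simp add: fourier_integral_def)
  have "F \<in> L2" using f by (simp add: is_L2_fourier_def)
  moreover have "L2_norm (\<lambda>\<xi>. - F \<xi> - - fourier_integral (\<lambda>x. indicator (cball 0 R) x * f x) \<xi>) = L2_norm (\<lambda>\<xi>. F \<xi> - fourier_integral (\<lambda>x. indicator (cball 0 R) x * f x) \<xi>)" for R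
    using L2_norm_minus_commute[of F "fourier_integral (\<lambda>x. indicator (cball 0 R) x * f x)"] by simp
  ultimately show ?thesis using f unfolding is_L2_fourier_iff[OF L2_uminus[OF f(1)]] is_L2_fourier_iff[OF f(1)] T by auto
qed

lemma L2_fourier_add:
  assumes "f \<in> L2" "g \<in> L2"
  shows "AE \<xi> in lborel. L2_fourier (\<lambda>x. f x + g x) \<xi> = L2_fourier f \<xi> + L2_fourier g \<xi>"
  by (intro is_L2_fourier_unique[OF L2_add[OF assms]] is_L2_fourier_add is_L2_fourier_L2_fourier L2_add assms)

lemma L2_fourier_diff:
  assumes "f \<in> L2" "g \<in> L2"
  shows "AE \<xi> in lborel. L2_fourier (\<lambda>x. f x - g x) \<xi> = L2_fourier f \<xi> - L2_fourier g \<xi>"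
  using is_L2_fourier_unique[OF L2_add[OF assms(1) L2_uminus[OF assms(2)]] is_L2_fourier_L2_fourier
    is_L2_fourier_add[OF assms(1) is_L2_fourier_L2_fourier _ is_L2_fourier_uminus[OF assms(2) is_L2_fourier_L2_fourier]]]
    assms by (simp add: L2_diff L2_uminus)

lemma L2_inner_L2_fourier_self:
  assumes f: "f \<in> L2"
  shows "L2_inner (L2_fourier f) (L2_fourier f) = L2_inner f f"
proof -
  let ?t = "\<lambda>R x. indicator (cball 0 R) x * f x"
  have t: "?t R \<in> L2" "integrable lborel (?t R)" for R using truncation_L2[OF f] by auto
  have "((\<lambda>R. L2_inner (fourier_integral (?t R)) (fourier_integral (?t R))) \<longlongrightarrow> L2_inner (L2_fourier f) (L2_fourier f)) at_top"
    using is_L2_fourier_L2_fourier[OF f] unfolding is_L2_fourier_iff[OF f]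
    by (intro L2_inner_tendsto fourier_integral_L2 t) (simp_all add: L2_norm_minus_commute[of "fourier_integral _"])
  moreover have "((\<lambda>R. L2_inner (?t R) (?t R)) \<longlongrightarrow> L2_inner f f) at_top"
    using truncation_tendsto[OF f] by (intro L2_inner_tendsto t f) (simp_all add: L2_norm_minus_commute[of _ f])
  ultimately show ?thesis
    using tendsto_unique[OF trivial_limit_at_top_linorder] by (auto simp: L2_inner_fourier_integral t)
qed

text \<open>Polarisation of the norm identity. The transform is additive only almost everywhere,
  since each value of \<open>L2_fourier\<close> is a chosen representative.\<close>

theorem L2_fourier_Parseval:
  assumes f: "f \<in> L2" and g: "g \<in> L2"
  shows "L2_inner (L2_fourier f) (L2_fourier g) = L2_inner f g"
proof -
  have "L2_inner (\<lambda>x. L2_fourier f x + L2_fourier g x) (\<lambda>x. L2_fourier f x + L2_fourier g x) =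
      L2_inner (L2_fourier (\<lambda>x. f x + g x)) (L2_fourier (\<lambda>x. f x + g x))"
    by (intro L2_inner_cong_AE L2_measurable L2_add L2_fourier_L2 f g; use L2_fourier_add[OF f g] in \<open>auto elim: eventually_mono\<close>)
  moreover have "L2_inner (\<lambda>x. L2_fourier f x - L2_fourier g x) (\<lambda>x. L2_fourier f x - L2_fourier g x) =
      L2_inner (L2_fourier (\<lambda>x. f x - g x)) (L2_fourier (\<lambda>x. f x - g x))"
    by (intro L2_inner_cong_AE L2_measurable L2_diff L2_fourier_L2 f g; use L2_fourier_diff[OF f g] in \<open>auto elim: eventually_mono\<close>)
  ultimately have "4 * L2_inner (L2_fourier f) (L2_fourier g) = 4 * L2_inner f g"
    using f g by (simp add: L2_polarization L2_fourier_L2 L2_inner_L2_fourier_self L2_add L2_diff)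
  then show ?thesis by simp
qed

lemma L2_fourier_eq_fourier_integral:
  assumes f: "f \<in> L2" "integrable lborel f"
  shows "AE \<xi> in lborel. L2_fourier f \<xi> = fourier_integral f \<xi>"
proof (rule is_L2_fourier_unique[OF f(1) is_L2_fourier_L2_fourier[OF f(1)]])
  have "L2_norm (\<lambda>\<xi>. fourier_integral f \<xi> - fourier_integral (\<lambda>x. indicator (cball 0 R) x * f x) \<xi>) =
    L2_norm (\<lambda>x. f x - indicator (cball 0 R) x * f x)" for R
    by (intro L2_norm_fourier_integral_diff f truncation_L2)
  then show "is_L2_fourier f (fourier_integral f)"
    unfolding is_L2_fourier_iff[OF f(1)] using truncation_tendsto[OF f(1)] fourier_integral_L2[OF f(2,1)] by simp
qed

text \<open>The transforms agree everywhere, not just almost everywhere: the truncated Fourier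
  integrals coincide, so the choice operator is applied to the same predicate.\<close>

lemma L2_fourier_cong_AE:
  assumes [measurable]: "f \<in> borel_measurable borel" "g \<in> borel_measurable borel" and "AE x in lborel. f x = g x"
  shows "L2_fourier f = L2_fourier g"
proof -
  have "fourier_integral (\<lambda>x. indicator (cball 0 R) x * f x) = fourier_integral (\<lambda>x. indicator (cball 0 R) x * g x)" for R
    unfolding fourier_integral_def[abs_def]
  proof (intro ext arg_cong2[where f=times] refl integral_cong_AE)
    fix \<xi>
    show "(\<lambda>x. exp (- \<i> * complex_of_real (x \<bullet> \<xi>)) * (indicator (cball 0 R) x * f x)) \<in> borel_measurable lborel"
      "(\<lambda>x. exp (- \<i> * complex_of_real (x \<bullet> \<xi>)) * (indicator (cball 0 R) x * g x)) \<in> borel_measurable lborel"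
      by measurable
    show "AE x in lborel. exp (- \<i> * complex_of_real (x \<bullet> \<xi>)) * (indicator (cball 0 R) x * f x) =
        exp (- \<i> * complex_of_real (x \<bullet> \<xi>)) * (indicator (cball 0 R) x * g x)"
      using assms(3) by (auto elim: eventually_mono)
  qed
  then show ?thesis unfolding L2_fourier_def by simp
qed

lemma L2_reflect:
  assumes "f \<in> L2"
  shows "(\<lambda>x. f (- x)) \<in> L2"
proof (rule L2I)
  show "integrable lborel (\<lambda>x. (norm (f (- x)))\<^sup>2)"
    using lborel_integrable_affine[OF L2_integrable_sq[OF assms], of "-1" 0] by simp
qed (use assms in \<open>auto dest: L2_measurable\<close>)

lemma L2_inner_reflect:
  assumes [measurable]: "f \<in> borel_measurable borel" "g \<in> borel_measurable borel"
  shows "L2_inner (\<lambda>x. f (- x)) (\<lambda>x. g (- x)) = L2_inner f g"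
  unfolding L2_inner_def by (subst (2) lborel_integral_affine[of _ "-1" 0]) auto

section \<open>The fractional energy as an integral of differences\<close>

lemma norm_exp_i_minus_1_square: "(norm (exp (\<i> * complex_of_real t) - 1))\<^sup>2 = 2 - 2 * cos t"
proof -
  have "(norm (exp (\<i> * complex_of_real t) - 1))\<^sup>2 = (cos t - 1)\<^sup>2 + (sin t)\<^sup>2"
    by (simp add: cmod_power2 flip: cis_conv_exp)
  also have "\<dots> = ((sin t)\<^sup>2 + (cos t)\<^sup>2) + 1 - 2 * cos t"
    by (simp add: power2_eq_square algebra_simps)
  finally show ?thesis by simp
qed

lemma two_minus_two_cos_le: "2 - 2 * cos t \<le> t\<^sup>2" for t :: real
proof -
  have "2 - 2 * cos t = 4 * (sin (t/2))\<^sup>2"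
    using cos_double_sin[of "t/2"] by simp
  also have "\<dots> \<le> 4 * (t/2)\<^sup>2"
    using abs_sin_x_le_abs_x[of "t/2"] by (intro mult_left_mono) (auto simp: abs_le_square_iff[symmetric])
  finally show ?thesis by (simp add: power2_eq_square)
qed

text \<open>For \<open>\<bar>t\<bar> \<le> 1\<close> the quadratic bound is the stronger one because
  \<open>2 * s < 2\<close>; for larger \<open>\<bar>t\<bar>\<close> the trivial bound 4 is
  enough.\<close>

lemma two_minus_two_cos_le_powr:
  fixes t s :: real
  assumes "0 < s" "s < 1"
  shows "2 - 2 * cos t \<le> 4 * \<bar>t\<bar> powr (2 * s)"
proof (cases "\<bar>t\<bar> \<le> 1")
  case True
  have "2 - 2 * cos t \<le> \<bar>t\<bar>\<^sup>2" using two_minus_two_cos_le by simp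
  also have "\<bar>t\<bar>\<^sup>2 \<le> \<bar>t\<bar> powr (2 * s)"
  proof (cases "t = 0")
    case False
    then have "\<bar>t\<bar>\<^sup>2 = \<bar>t\<bar> powr 2" by simp
    also have "\<dots> \<le> \<bar>t\<bar> powr (2 * s)"
      using True assms False by (intro powr_mono') auto
    finally show ?thesis .
  qed simp
  finally show ?thesis by (smt (verit) powr_ge_zero)
next
  case False
  have "1 \<le> \<bar>t\<bar> powr (2 * s)" using False assms by (intro ge_one_powr_ge_zero) auto
  then show ?thesis using cos_ge_minus_one[of t] by linarith
qed

text \<open>The translations are parametrised as \<open>y = \<tau> w\<close> with \<open>\<tau> > 0\<close> and \<open>w\<close> Gaussian. Averaging
  \<open>\<bar>exp (i y \<bullet> \<xi>) - 1\<bar>\<^sup>2\<close> over \<open>w\<close> gives a function of \<open>\<tau> \<bar>\<xi>\<bar>\<close> only, and the weight in \<open>\<tau>\<close> then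
  produces \<open>\<bar>\<xi>\<bar>\<close> to the power \<open>2 s\<close>; the usual kernel would need polar coordinates instead.\<close>

definition gag_weight :: "real \<Rightarrow> real \<times> 'a::euclidean_space \<Rightarrow> real" where
  "gag_weight s p = (if fst p > 0 then fst p powr (- 1 - 2 * s) * exp (- (norm (snd p))\<^sup>2 / 2) else 0)"

definition gag_shift :: "real \<times> 'a::euclidean_space \<Rightarrow> 'a" where
  "gag_shift p = fst p *\<^sub>R snd p"

lemma gag_weight_nonneg[simp]: "0 \<le> gag_weight s p"
  by (simp add: gag_weight_def)

lemma gag_weight_measurable[measurable]: "gag_weight s \<in> borel_measurable borel"
proof -
  have "gag_weight s \<in> borel_measurable (borel \<Otimes>\<^sub>M borel)"
    unfolding gag_weight_def[abs_def] by measurable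
  then show ?thesis by (simp add: borel_prod)
qed

lemma gag_shift_measurable[measurable]: "gag_shift \<in> borel_measurable borel"
  unfolding gag_shift_def[abs_def]
  by (intro borel_measurable_continuous_onI continuous_intros)

lemma gaussian_two_minus_two_cos:
  fixes \<xi> :: "'a::euclidean_space"
  shows "(\<integral>\<^sup>+w. ennreal (exp (- (norm w)\<^sup>2 / 2) * (2 - 2 * cos (t * (w \<bullet> \<xi>)))) \<partial>lborel) =
     ennreal (2 * (2 * pi) powr (DIM('a) / 2) * (1 - exp (- (t * norm \<xi>)\<^sup>2 / 2)))"
proof -
  let ?P = "(2 * pi) powr (DIM('a) / 2)"
  note gi = gaussian_fourier_integrable[of "t *\<^sub>R \<xi>"]
  have Re_eq: "Re (exp (- \<i> * (w \<bullet> (t *\<^sub>R \<xi>))) * complex_of_real (exp (- (norm w)\<^sup>2 / 2))) = exp (- (norm w)\<^sup>2 / 2) * cos (t * (w \<bullet> \<xi>))" for w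
  proof -
    have "exp (- \<i> * complex_of_real (w \<bullet> (t *\<^sub>R \<xi>))) = cis (- (t * (w \<bullet> \<xi>)))"
      by (simp add: cis_conv_exp)
    then show ?thesis by simp
  qed
  have i: "integrable lborel (\<lambda>w. exp (- (norm w)\<^sup>2 / 2) * cos (t * (w \<bullet> \<xi>)))"
    using integrable_Re[OF gi] unfolding Re_eq .
  have c: "(LINT w|lborel. exp (- (norm w)\<^sup>2 / 2) * cos (t * (w \<bullet> \<xi>))) = ?P * exp (- (t * norm \<xi>)\<^sup>2 / 2)"
    using integral_Re[OF gi] unfolding Re_eq gaussian_fourier by (simp add: power_mult_distrib)
  have "(\<integral>\<^sup>+w. ennreal (exp (- (norm w)\<^sup>2 / 2) * (2 - 2 * cos (t * (w \<bullet> \<xi>)))) \<partial>lborel) =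
    ennreal (LINT w|lborel. exp (- (norm w)\<^sup>2 / 2) * (2 - 2 * cos (t * (w \<bullet> \<xi>))))"
  proof (rule nn_integral_eq_integral)
    show "integrable lborel (\<lambda>w. exp (- (norm w)\<^sup>2 / 2) * (2 - 2 * cos (t * (w \<bullet> \<xi>))))"
      using i gaussian_integrable[where 'a='a] by (simp add: algebra_simps)
  qed auto
  also have "(LINT w|lborel. exp (- (norm w)\<^sup>2 / 2) * (2 - 2 * cos (t * (w \<bullet> \<xi>)))) =
     (LINT (w::'a)|lborel. 2 * exp (- (norm w)\<^sup>2 / 2) - 2 * (exp (- (norm w)\<^sup>2 / 2) * cos (t * (w \<bullet> \<xi>))))"
    by (simp add: algebra_simps)
  also have "\<dots> = 2 * ?P - 2 * (?P * exp (- (t * norm \<xi>)\<^sup>2 / 2))"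
    by (subst Bochner_Integration.integral_diff)
      (intro integrable_mult_right i gaussian_integrable, intro integrable_mult_right i gaussian_integrable,
       simp only: integral_mult_right_zero c gaussian_integral)
  finally show ?thesis by (simp add: algebra_simps)
qed

text \<open>Near 0 the integrand is \<open>t powr (a - b - 1)\<close>, integrable as
  \<open>b < a\<close>; at infinity it is \<open>t powr (- 1 - b)\<close>, integrable as
  \<open>0 < b\<close>. The pairs that occur are \<open>b = 2 * s\<close>, \<open>a = 2\<close> for
  energies of Lipschitz fields and \<open>b = s\<close>, \<open>a = 1\<close> for the skew
  form.\<close>

lemma powr_min_integrable:
  fixes a b :: real
  assumes "0 < b" "b < a"
  shows "integrable lborel (\<lambda>t. indicator {0<..} t * (t powr (- 1 - b) * min 1 (t powr a)))"
proof -
  have 1: "(\<integral>\<^sup>+t. ennreal (indicator {0..1} t * t powr (a - b - 1)) \<partial>lborel) = ennreal (1 powr (a - b - 1 + 1) / (a - b - 1 + 1))"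
  proof (rule nn_integral_has_integral_lborel)
    have "((\<lambda>t. t powr (a - b - 1)) has_integral (1 powr (a - b - 1 + 1) / (a - b - 1 + 1))) {0..1}"
      using has_integral_powr_from_0[of "a - b - 1" 1] assms by simp
    then have "((\<lambda>t. if t \<in> {0..1} then t powr (a - b - 1) else 0) has_integral (1 powr (a - b - 1 + 1) / (a - b - 1 + 1))) UNIV"
      unfolding has_integral_restrict_UNIV .
    moreover have "(\<lambda>t. indicator {0..1} t * t powr (a - b - 1)) = (\<lambda>t. if t \<in> {0..1} then t powr (a - b - 1) else 0)"
      by (auto simp: indicator_def)
    ultimately show "((\<lambda>t. indicator {0..1} t * t powr (a - b - 1)) has_integral (1 powr (a - b - 1 + 1) / (a - b - 1 + 1))) UNIV"
      by simp
  qed auto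
  have 2: "(\<integral>\<^sup>+t. ennreal (indicator {1..} t * t powr (- 1 - b)) \<partial>lborel) = ennreal (- (1 powr (- 1 - b + 1)) / (- 1 - b + 1))"
  proof (rule nn_integral_has_integral_lborel)
    have "((\<lambda>t. t powr (- 1 - b)) has_integral (- (1 powr (- 1 - b + 1)) / (- 1 - b + 1))) {1..}"
      using has_integral_powr_to_inf[of "- 1 - b" 1] assms by simp
    then have "((\<lambda>t. if t \<in> {1..} then t powr (- 1 - b) else 0) has_integral (- (1 powr (- 1 - b + 1)) / (- 1 - b + 1))) UNIV"
      unfolding has_integral_restrict_UNIV .
    moreover have "(\<lambda>t. indicator {1..} t * t powr (- 1 - b)) = (\<lambda>t. if t \<in> {1..} then t powr (- 1 - b) else 0)"
      by (auto simp: indicator_def)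
    ultimately show "((\<lambda>t. indicator {1..} t * t powr (- 1 - b)) has_integral (- (1 powr (- 1 - b + 1)) / (- 1 - b + 1))) UNIV"
      by simp
  qed auto
  have le: "indicator {0<..} t * (t powr (- 1 - b) * min 1 (t powr a)) \<le>
    indicator {0..1} t * t powr (a - b - 1) + indicator {1..} t * t powr (- 1 - b)" for t :: real
  proof (cases "t > 0")
    case True
    have "t powr (- 1 - b) * t powr a = t powr (a - b - 1)"
      using True by (simp flip: powr_add add: algebra_simps)
    moreover have "t powr (- 1 - b) * min 1 (t powr a) \<le> t powr (- 1 - b) * t powr a" "t powr (- 1 - b) * min 1 (t powr a) \<le> t powr (- 1 - b) * 1"
      by (intro mult_left_mono; simp)+
    ultimately show ?thesis using True by (auto simp: indicator_def)
  qed (auto simp: indicator_def)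
  show ?thesis
  proof (rule integrableI_nonneg)
    have "(\<integral>\<^sup>+t. ennreal (indicator {0<..} t * (t powr (- 1 - b) * min 1 (t powr a))) \<partial>lborel) \<le>
      (\<integral>\<^sup>+t. ennreal (indicator {0..1} t * t powr (a - b - 1)) + ennreal (indicator {1..} t * t powr (- 1 - b)) \<partial>lborel)"
      using le by (intro nn_integral_mono) (simp flip: ennreal_plus add: ennreal_leI)
    also have "\<dots> < \<infinity>" by (subst nn_integral_add) (auto simp: 1 2 less_top)
    finally show "(\<integral>\<^sup>+t. ennreal (indicator {0<..} t * (t powr (- 1 - b) * min 1 (t powr a))) \<partial>lborel) < \<infinity>" .
  qed auto
qed

text \<open>Part of the Gaussian decay pays for the polynomial: lowering the exponent from 1/2 to
  1/8, that is, halving \<open>w\<close>, frees a factor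
  \<open>exp (3 * (norm w)\<^sup>2 / 8)\<close>, and ten times this factor dominates
  \<open>(1 + norm w)\<^sup>2\<close>.\<close>

lemma gaussian_weighted_integrable: "integrable lborel (\<lambda>w::'a::euclidean_space. exp (- (norm w)\<^sup>2 / 2) * (1 + norm w)\<^sup>2)"
proof (rule Bochner_Integration.integrable_bound)
  show "integrable lborel (\<lambda>w::'a. 10 * exp (- (norm ((1/2) *\<^sub>R w))\<^sup>2 / 2))"
    by (intro integrable_mult_right scaled_gaussian_integrable) simp
  show "AE w in lborel. norm (exp (- (norm (w::'a))\<^sup>2 / 2) * (1 + norm w)\<^sup>2) \<le> norm (10 * exp (- (norm ((1/2) *\<^sub>R w))\<^sup>2 / 2))"
  proof (rule AE_I2)
    fix w :: 'a
    let ?q = "(norm w)\<^sup>2"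
    have "(1 + norm w)\<^sup>2 \<le> 2 + 2 * ?q"
      using sum_squares_bound[of 1 "norm w"] by (simp add: power2_sum)
    also have "\<dots> \<le> 10 * (1 + 3 * ?q / 8)" 
    proof -
      have le: "2 + 2 * q \<le> 10 * (1 + 3 * q / 8)" if "0 \<le> q" for q :: real
        using that by (simp add: field_simps)
      show ?thesis by (rule le) simp
    qed
    also have "\<dots> \<le> 10 * exp (3 * ?q / 8)"
      by (intro mult_left_mono exp_ge_add_one_self) auto
    finally have "exp (- ?q / 2) * (1 + norm w)\<^sup>2 \<le> exp (- ?q / 2) * (10 * exp (3 * ?q / 8))"
      by (rule mult_left_mono) simp
    also have "\<dots> = 10 * exp (- ?q / 2 + 3 * ?q / 8)" by (simp only: exp_add mult_ac)
    also have "- ?q / 2 + 3 * ?q / 8 = - (norm ((1/2) *\<^sub>R w))\<^sup>2 / 2" by (simp add: power_divide)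
    finally show "norm (exp (- ?q / 2) * (1 + norm w)\<^sup>2) \<le> norm (10 * exp (- (norm ((1/2) *\<^sub>R w))\<^sup>2 / 2))" by simp
  qed
qed auto

lemma gag_weight_integrable:
  fixes a b :: real
  assumes "0 < b" "b < a"
  shows "integrable lborel (\<lambda>p::real \<times> 'a::euclidean_space. indicator {0<..} (fst p) * (fst p powr (- 1 - b) * min 1 (fst p powr a)) *
    (exp (- (norm (snd p))\<^sup>2 / 2) * (1 + norm (snd p))\<^sup>2))"
proof -
  let ?u = "\<lambda>t. indicator {0<..} t * (t powr (- 1 - b) * min 1 (t powr a))"
  let ?v = "\<lambda>w::'a. exp (- (norm w)\<^sup>2 / 2) * (1 + norm w)\<^sup>2"
  have u: "integrable lborel (\<lambda>t. complex_of_real (?u t))" and v: "integrable lborel (\<lambda>w. complex_of_real (?v w))"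
    by (intro integrable_of_real powr_min_integrable assms gaussian_weighted_integrable)+
  have "integrable (lborel \<Otimes>\<^sub>M lborel) (\<lambda>(t, w). complex_of_real (?u t) * complex_of_real (?v w) * 1)"
    using lborel_pair_integrable_mult[OF u v, of "\<lambda>_. 1"] by simp
  then have "integrable (lborel \<Otimes>\<^sub>M lborel) (\<lambda>p. complex_of_real (?u (fst p) * ?v (snd p)))"
    by (simp add: case_prod_beta')
  then show ?thesis unfolding complex_of_real_integrable_eq lborel_prod .
qed

text \<open>A translation multiplies the transform by a phase, and \<open>2 - 2 * cos\<close> is the
  squared distance of that phase from 1.\<close>

lemma L2_inner_shift_diff_self:
  fixes f :: "'a::euclidean_space \<Rightarrow> complex"
  assumes f: "f \<in> L2" "integrable lborel f"
  shows "ennreal (L2_inner (shift_diff y f) (shift_diff y f)) =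
    (\<integral>\<^sup>+\<xi>. ennreal ((2 - 2 * cos (y \<bullet> \<xi>)) * (norm (L2_fourier f \<xi>))\<^sup>2) \<partial>lborel)"
proof -
  have [measurable]: "f \<in> borel_measurable borel" using f(1) by (rule L2_measurable)
  have sh: "integrable lborel (\<lambda>x. f (x + y))" by (rule lborel_shift_integrable[OF f(2)])
  have sd: "integrable lborel (shift_diff y f)"
    unfolding shift_diff_def[abs_def] using sh f(2) by simp
  have shift: "fourier_integral (\<lambda>x. f (x + y)) \<xi> = exp (\<i> * complex_of_real (y \<bullet> \<xi>)) * fourier_integral f \<xi>" for \<xi>
  proof -
    have "(LINT x|lborel. exp (- \<i> * complex_of_real (x \<bullet> \<xi>)) * f x) = (LINT x|lborel. exp (- \<i> * complex_of_real ((x + y) \<bullet> \<xi>)) * f (x + y))"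
      by (rule lborel_shift_integral[symmetric]) measurable
    also have "\<dots> = (LINT x|lborel. exp (- \<i> * complex_of_real (y \<bullet> \<xi>)) * (exp (- \<i> * complex_of_real (x \<bullet> \<xi>)) * f (x + y)))"
    proof -
      have "exp (- \<i> * complex_of_real ((x + y) \<bullet> \<xi>)) = exp (- \<i> * complex_of_real (y \<bullet> \<xi>)) * exp (- \<i> * complex_of_real (x \<bullet> \<xi>))" for x
        unfolding exp_add[symmetric] by (simp add: inner_add_left algebra_simps)
      then show ?thesis by (simp only: mult.assoc)
    qed
    also have "\<dots> = exp (- \<i> * complex_of_real (y \<bullet> \<xi>)) * (LINT x|lborel. exp (- \<i> * complex_of_real (x \<bullet> \<xi>)) * f (x + y))"
      by (rule integral_mult_right_zero)
    finally have "fourier_integral f \<xi> = exp (- \<i> * complex_of_real (y \<bullet> \<xi>)) * fourier_integral (\<lambda>x. f (x + y)) \<xi>"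
      by (simp add: fourier_integral_def)
    then show ?thesis by (simp add: exp_minus field_simps)
  qed
  have eq: "fourier_integral (shift_diff y f) \<xi> = (exp (\<i> * complex_of_real (y \<bullet> \<xi>)) - 1) * fourier_integral f \<xi>" for \<xi>
    unfolding shift_diff_def[abs_def] by (simp add: fourier_integral_diff sh f shift algebra_simps)
  have "ennreal (L2_inner (shift_diff y f) (shift_diff y f)) = ennreal (L2_inner (fourier_integral (shift_diff y f)) (fourier_integral (shift_diff y f)))"
    by (simp add: L2_inner_fourier_integral sd L2_shift_diff f)
  also have "\<dots> = (\<integral>\<^sup>+\<xi>. ennreal ((norm (fourier_integral (shift_diff y f) \<xi>))\<^sup>2) \<partial>lborel)"
    by (rule nn_integral_L2_norm[symmetric]) (intro fourier_integral_L2 sd L2_shift_diff f)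
  also have "\<dots> = (\<integral>\<^sup>+\<xi>. ennreal ((2 - 2 * cos (y \<bullet> \<xi>)) * (norm (L2_fourier f \<xi>))\<^sup>2) \<partial>lborel)"
    by (intro nn_integral_cong_AE, use L2_fourier_eq_fourier_integral[OF f] in eventually_elim)
      (simp add: eq norm_mult power_mult_distrib norm_exp_i_minus_1_square)
  finally show ?thesis .
qed

text \<open>The ratio between the averaged symbol and \<open>norm \<xi> powr (2 * s)\<close>: the
  Gaussian average supplies the factor in front, and the integral is the radial one for a frequency
  of norm 1. It is kept in \<open>ennreal\<close> so that \<open>gag_symbol\<close> can be a plain
  application of Tonelli's theorem.\<close>

definition gag_const_nn :: "real \<Rightarrow> 'a::euclidean_space itself \<Rightarrow> ennreal" where
  "gag_const_nn s _ = ennreal (2 * (2 * pi) powr (DIM('a) / 2)) *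
     (\<integral>\<^sup>+t. ennreal (if t > 0 then t powr (- 1 - 2 * s) * (1 - exp (- t\<^sup>2 / 2)) else 0) \<partial>lborel)"

definition gag_const :: "real \<Rightarrow> 'a::euclidean_space itself \<Rightarrow> real" where
  "gag_const s T = enn2real (gag_const_nn s T)"

text \<open>The integral is finite because \<open>1 - exp (- t\<^sup>2 / 2)\<close> is at most
  \<open>min 1 (t\<^sup>2)\<close> and \<open>0 < 2 * s < 2\<close>. It is positive because its
  integrand is positive for positive \<open>t\<close>; positivity is what later permits division by
  the constant.\<close>

lemma gag_const:
  assumes "0 < s" "s < 1"
  shows "gag_const_nn s TYPE('a::euclidean_space) = ennreal (gag_const s TYPE('a))" and "gag_const s TYPE('a) > 0"
proof -
  let ?f = "\<lambda>t::real. if t > 0 then t powr (- 1 - 2 * s) * (1 - exp (- t\<^sup>2 / 2)) else 0"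
  have nn: "0 \<le> ?f t" for t by simp
  have [measurable]: "?f \<in> borel_measurable borel" by measurable
  have le: "?f t \<le> indicator {0<..} t * (t powr (- 1 - 2 * s) * min 1 (t powr 2))" for t
  proof (cases "t > 0")
    case True
    have "1 - exp (- t\<^sup>2 / 2) \<le> t\<^sup>2 / 2" using exp_ge_add_one_self[of "- t\<^sup>2 / 2"] by simp
    also have "\<dots> \<le> t\<^sup>2" by simp
    finally have "1 - exp (- t\<^sup>2 / 2) \<le> min 1 (t\<^sup>2)" by simp
    then show ?thesis using True by (simp add: mult_left_mono)
  qed simp
  have "(\<integral>\<^sup>+t. ennreal (?f t) \<partial>lborel) \<le> (\<integral>\<^sup>+t. ennreal (indicator {0<..} t * (t powr (- 1 - 2 * s) * min 1 (t powr 2))) \<partial>lborel)"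
    by (intro nn_integral_mono ennreal_leI le)
  also have "\<dots> < \<infinity>"
    using powr_min_integrable[of "2 * s" 2] assms by (subst nn_integral_eq_integral) auto
  finally have fin: "(\<integral>\<^sup>+t. ennreal (?f t) \<partial>lborel) < \<infinity>" .
  have pos: "(\<integral>\<^sup>+t. ennreal (?f t) \<partial>lborel) \<noteq> 0"
  proof
    assume "(\<integral>\<^sup>+t. ennreal (?f t) \<partial>lborel) = 0"
    then have "AE t in lborel. ennreal (?f t) = 0" by (subst (asm) nn_integral_0_iff_AE) auto
    then have "AE t in lborel. (t::real) \<notin> {0<..<1}"
    proof eventually_elim
      fix t :: real assume "ennreal (?f t) = 0"
      then have "?f t \<le> 0" using nn[of t] by (simp only: ennreal_eq_0_iff)
      moreover have "?f t > 0" if "t > 0"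
      proof -
        have "0 < t powr (- 1 - 2 * s) * (1 - exp (- t\<^sup>2 / 2))"
          using that by (intro mult_pos_pos) auto
        then show ?thesis using that by simp
      qed
      ultimately show "t \<notin> {0<..<1}" by (metis greaterThanLessThan_iff not_le)
    qed
    then have "{0<..<1::real} \<in> null_sets lborel" by (subst AE_iff_null_sets) auto
    then have "emeasure lborel {0<..<1::real} = 0" by (rule null_setsD1)
    then show False by simp
  qed
  have c: "gag_const_nn s TYPE('a) < \<infinity>" "gag_const_nn s TYPE('a) \<noteq> 0"
    using fin pos by (auto simp: gag_const_nn_def ennreal_mult_less_top)
  then show "gag_const_nn s TYPE('a) = ennreal (gag_const s TYPE('a))"
    by (simp add: gag_const_def)
  then show "gag_const s TYPE('a) > 0"
    using c by (metis ennreal_eq_0_iff not_le)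
qed

lemma gag_symbol:
  fixes \<xi> :: "'a::euclidean_space"
  assumes s: "0 < s" "s < 1"
  shows "(\<integral>\<^sup>+p. ennreal (gag_weight s p * (2 - 2 * cos (gag_shift p \<bullet> \<xi>))) \<partial>lborel) =
    gag_const_nn s TYPE('a) * ennreal (norm \<xi> powr (2 * s))"
proof -
  let ?f = "\<lambda>t::real. if t > 0 then t powr (- 1 - 2 * s) * (1 - exp (- t\<^sup>2 / 2)) else 0"
  let ?K = "2 * (2 * pi) powr (DIM('a) / 2)"
  define H where "H = (\<lambda>p::real \<times> 'a. ennreal (gag_weight s p * (2 - 2 * cos (gag_shift p \<bullet> \<xi>))))"
  have "H \<in> borel_measurable borel"
    unfolding H_def by measurable
  then have "H \<in> borel_measurable (lborel \<Otimes>\<^sub>M lborel)"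
    by (simp add: lborel_prod)
  from lborel.nn_integral_fst[OF this]
  have "(\<integral>\<^sup>+p. H p \<partial>lborel) = (\<integral>\<^sup>+t. (\<integral>\<^sup>+w. H (t, w) \<partial>lborel) \<partial>lborel)"
    by (simp add: lborel_prod)
  also have "\<dots> = (\<integral>\<^sup>+t. ennreal ?K * ennreal (if t > 0 then t powr (- 1 - 2 * s) * (1 - exp (- (t * norm \<xi>)\<^sup>2 / 2)) else 0) \<partial>lborel)"
  proof (rule nn_integral_cong)
    fix t :: real
    show "(\<integral>\<^sup>+w. H (t, w) \<partial>lborel) =
      ennreal ?K * ennreal (if t > 0 then t powr (- 1 - 2 * s) * (1 - exp (- (t * norm \<xi>)\<^sup>2 / 2)) else 0)"
    proof (cases "t > 0")
      case True
      have "(\<integral>\<^sup>+w. H (t, w) \<partial>lborel) =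
        (\<integral>\<^sup>+w. ennreal (t powr (- 1 - 2 * s)) * ennreal (exp (- (norm w)\<^sup>2 / 2) * (2 - 2 * cos (t * (w \<bullet> \<xi>)))) \<partial>lborel)"
        using True by (intro nn_integral_cong) (simp add: H_def gag_weight_def gag_shift_def mult.assoc flip: ennreal_mult')
      also have "\<dots> = ennreal (t powr (- 1 - 2 * s)) * ennreal (?K * (1 - exp (- (t * norm \<xi>)\<^sup>2 / 2)))"
        by (subst nn_integral_cmult, measurable, simp only: gaussian_two_minus_two_cos)
      also have "\<dots> = ennreal ?K * ennreal (if t > 0 then t powr (- 1 - 2 * s) * (1 - exp (- (t * norm \<xi>)\<^sup>2 / 2)) else 0)"
        using True by (simp add: mult_ac flip: ennreal_mult')
      finally show ?thesis .
    qed (simp add: H_def gag_weight_def)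
  qed
  also have "\<dots> = ennreal ?K * (\<integral>\<^sup>+t. ennreal (if t > 0 then t powr (- 1 - 2 * s) * (1 - exp (- (t * norm \<xi>)\<^sup>2 / 2)) else 0) \<partial>lborel)"
    by (rule nn_integral_cmult) measurable
  also have "(\<integral>\<^sup>+t. ennreal (if t > 0 then t powr (- 1 - 2 * s) * (1 - exp (- (t * norm \<xi>)\<^sup>2 / 2)) else 0) \<partial>lborel) =
    (\<integral>\<^sup>+t. ennreal (?f t) \<partial>lborel) * ennreal (norm \<xi> powr (2 * s))"
  proof (cases "\<xi> = 0")
    case True
    then show ?thesis by (simp cong: if_cong)
  next
    case False
    define r where "r = norm \<xi>"
    have r: "r > 0" using False by (simp add: r_def)
    \<comment> \<open>Rescaling by \<open>r\<close>: the length element and the homogeneous weight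
      together contribute \<open>r * r powr (- 1 - 2 * s)\<close>, the reciprocal of
      \<open>r powr (2 * s)\<close>.\<close>
    have "(\<integral>\<^sup>+t. ennreal (?f t) \<partial>lborel) = ennreal r * (\<integral>\<^sup>+t. ennreal (?f (0 + r *\<^sub>R t)) \<partial>lborel)"
      using r lborel_nn_integral_affine[of "\<lambda>t. ennreal (?f t)" r 0] by simp
    also have "(\<lambda>t. ennreal (?f (0 + r *\<^sub>R t))) = (\<lambda>t. ennreal (r powr (- 1 - 2 * s)) * ennreal (if t > 0 then t powr (- 1 - 2 * s) * (1 - exp (- (t * r)\<^sup>2 / 2)) else 0))"
      using r by (auto simp: zero_less_mult_iff powr_mult mult_ac fun_eq_iff simp flip: ennreal_mult')
    also have "ennreal r * (\<integral>\<^sup>+t. ennreal (r powr (- 1 - 2 * s)) * ennreal (if t > 0 then t powr (- 1 - 2 * s) * (1 - exp (- (t * r)\<^sup>2 / 2)) else 0) \<partial>lborel) =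
      ennreal r * (ennreal (r powr (- 1 - 2 * s)) * (\<integral>\<^sup>+t. ennreal (if t > 0 then t powr (- 1 - 2 * s) * (1 - exp (- (t * r)\<^sup>2 / 2)) else 0) \<partial>lborel))"
      by (subst nn_integral_cmult) auto
    also have "\<dots> = ennreal (r * r powr (- 1 - 2 * s)) * (\<integral>\<^sup>+t. ennreal (if t > 0 then t powr (- 1 - 2 * s) * (1 - exp (- (t * r)\<^sup>2 / 2)) else 0) \<partial>lborel)"
      using r by (simp add: ennreal_mult' mult.assoc)
    finally have "(\<integral>\<^sup>+t. ennreal (?f t) \<partial>lborel) * ennreal (r powr (2 * s)) =
        ennreal (r powr (2 * s)) * ennreal (r * r powr (- 1 - 2 * s)) * (\<integral>\<^sup>+t. ennreal (if t > 0 then t powr (- 1 - 2 * s) * (1 - exp (- (t * r)\<^sup>2 / 2)) else 0) \<partial>lborel)"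
      by (simp add: mult_ac)
    also have "ennreal (r powr (2 * s)) * ennreal (r * r powr (- 1 - 2 * s)) = ennreal (r powr (2 * s) * (r powr 1 * r powr (- 1 - 2 * s)))"
      using r by (simp flip: ennreal_mult')
    also have "r powr (2 * s) * (r powr 1 * r powr (- 1 - 2 * s)) = 1"
      unfolding powr_add[symmetric] using r by simp
    finally show ?thesis unfolding r_def by simp
  qed
  finally show ?thesis by (simp add: gag_const_nn_def mult_ac H_def)
qed

text \<open>Tonelli's theorem with \<open>gag_symbol\<close>. Both sides may be infinite, so the
  identity also decides whether the energy is finite.\<close>

lemma gag_energy_scalar:
  fixes f :: "'a::euclidean_space \<Rightarrow> complex"
  assumes s: "0 < s" "s < 1" and f: "f \<in> L2" "integrable lborel f"
  shows "(\<integral>\<^sup>+p. ennreal (gag_weight s p * L2_inner (shift_diff (gag_shift p) f) (shift_diff (gag_shift p) f)) \<partial>lborel) =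
    ennreal (gag_const s TYPE('a)) * (\<integral>\<^sup>+\<xi>. ennreal (norm \<xi> powr (2 * s) * (norm (L2_fourier f \<xi>))\<^sup>2) \<partial>lborel)"
proof -
  define F where "F = L2_fourier f"
  have [measurable]: "F \<in> borel_measurable borel" unfolding F_def using L2_fourier_L2[OF f(1)] by (rule L2_measurable)
  have gm: "(\<lambda>(p::real \<times> 'a, \<xi>). ennreal (gag_weight s p * ((2 - 2 * cos (gag_shift p \<bullet> \<xi>)) * (norm (F \<xi>))\<^sup>2))) \<in> borel_measurable (lborel \<Otimes>\<^sub>M lborel)"
    by measurable
  have "(\<integral>\<^sup>+p. ennreal (gag_weight s p * L2_inner (shift_diff (gag_shift p) f) (shift_diff (gag_shift p) f)) \<partial>lborel) =
     (\<integral>\<^sup>+p. (\<integral>\<^sup>+\<xi>. ennreal (gag_weight s p * ((2 - 2 * cos (gag_shift p \<bullet> \<xi>)) * (norm (F \<xi>))\<^sup>2)) \<partial>lborel) \<partial>(lborel :: (real \<times> 'a) measure))"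
    by (intro nn_integral_cong)
      (simp add: ennreal_mult' L2_inner_shift_diff_self[OF f] nn_integral_cmult F_def[symmetric])
  also have "\<dots> = (\<integral>\<^sup>+\<xi>. (\<integral>\<^sup>+p. ennreal (gag_weight s p * ((2 - 2 * cos (gag_shift p \<bullet> \<xi>)) * (norm (F \<xi>))\<^sup>2)) \<partial>(lborel :: (real \<times> 'a) measure)) \<partial>lborel)"
    by (rule lborel_pair.Fubini'[OF gm, symmetric])
  also have "\<dots> = (\<integral>\<^sup>+\<xi>. ennreal ((norm (F \<xi>))\<^sup>2) * (gag_const_nn s TYPE('a) * ennreal (norm \<xi> powr (2 * s))) \<partial>lborel)"
  proof (rule nn_integral_cong)
    fix \<xi> :: 'a
    have "(\<integral>\<^sup>+p. ennreal (gag_weight s p * ((2 - 2 * cos (gag_shift p \<bullet> \<xi>)) * (norm (F \<xi>))\<^sup>2)) \<partial>(lborel :: (real \<times> 'a) measure)) =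
      (\<integral>\<^sup>+p. ennreal ((norm (F \<xi>))\<^sup>2) * ennreal (gag_weight s p * (2 - 2 * cos (gag_shift p \<bullet> \<xi>))) \<partial>(lborel :: (real \<times> 'a) measure))"
      by (intro nn_integral_cong) (simp add: mult_ac flip: ennreal_mult')
    also have "\<dots> = ennreal ((norm (F \<xi>))\<^sup>2) * (gag_const_nn s TYPE('a) * ennreal (norm \<xi> powr (2 * s)))"
      by (subst nn_integral_cmult) (auto simp: gag_symbol[OF s])
    finally show "(\<integral>\<^sup>+p. ennreal (gag_weight s p * ((2 - 2 * cos (gag_shift p \<bullet> \<xi>)) * (norm (F \<xi>))\<^sup>2)) \<partial>(lborel :: (real \<times> 'a) measure)) =
      ennreal ((norm (F \<xi>))\<^sup>2) * (gag_const_nn s TYPE('a) * ennreal (norm \<xi> powr (2 * s)))" .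
  qed
  also have "\<dots> = (\<integral>\<^sup>+\<xi>. gag_const_nn s TYPE('a) * ennreal (norm \<xi> powr (2 * s) * (norm (F \<xi>))\<^sup>2) \<partial>lborel)"
    by (intro nn_integral_cong) (simp add: ennreal_mult' mult_ac)
  also have "\<dots> = gag_const_nn s TYPE('a) * (\<integral>\<^sup>+\<xi>. ennreal (norm \<xi> powr (2 * s) * (norm (F \<xi>))\<^sup>2) \<partial>lborel)"
    by (rule nn_integral_cmult) measurable
  finally show ?thesis using gag_const[OF s, where 'a='a] by (simp add: F_def)
qed

section \<open>The fractional form of vector fields\<close>

definition fcomp :: "('a::euclidean_space \<Rightarrow> real ^ 'n) \<Rightarrow> 'n \<Rightarrow> 'a \<Rightarrow> complex" where
  "fcomp f i x = complex_of_real (f x $ i)"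

lemma borel_measurable_vec_nth:
  assumes [measurable]: "f \<in> borel_measurable M"
  shows "(\<lambda>x. f x $ i :: 'b::euclidean_space) \<in> borel_measurable M"
  by (rule borel_measurable_continuous_on[OF _ assms]) (intro continuous_intros)

lemma fcomp_measurable[measurable]:
  assumes "f \<in> borel_measurable borel"
  shows "fcomp f i \<in> borel_measurable borel"
  unfolding fcomp_def[abs_def] using borel_measurable_vec_nth[OF assms] by simp

lemma norm_fcomp_le: "norm (fcomp f i x) \<le> norm (f x)"
  by (simp add: fcomp_def component_le_norm_cart)

lemma fcomp_L2[intro]: "f \<in> L2 \<Longrightarrow> fcomp f i \<in> L2"
  by (rule L2_dominated[where c=1 and g=f]) (auto simp: norm_fcomp_le intro!: fcomp_measurable dest: L2_measurable)

lemma fcomp_integrable[intro]: 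
  assumes "integrable lborel f"
  shows "integrable lborel (fcomp f i)"
proof -
  have "f \<in> borel_measurable borel" using assms by auto
  then show ?thesis
    using assms by (intro Bochner_Integration.integrable_bound[OF assms]) (auto simp: norm_fcomp_le)
qed

lemma fcomp_shift_diff: "fcomp (shift_diff y f) i = shift_diff y (fcomp f i)"
  by (simp add: fcomp_def shift_diff_def fun_eq_iff)

lemma fcomp_add: "fcomp (\<lambda>x. f x + g x) i = (\<lambda>x. fcomp f i x + fcomp g i x)"
  and fcomp_diff: "fcomp (\<lambda>x. f x - g x) i = (\<lambda>x. fcomp f i x - fcomp g i x)"
  by (simp_all add: fcomp_def fun_eq_iff)

lemma L2_inner_fcomp:
  assumes "f \<in> L2" "g \<in> L2"
  shows "L2_inner f g = (\<Sum>i\<in>UNIV. L2_inner (fcomp f i) (fcomp g i))"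
proof -
  have "(\<Sum>i\<in>UNIV. L2_inner (fcomp f i) (fcomp g i)) = (LINT x|lborel. (\<Sum>i\<in>UNIV. fcomp f i x \<bullet> fcomp g i x))"
    unfolding L2_inner_def by (rule Bochner_Integration.integral_sum[symmetric]) (intro L2_inner_integrable fcomp_L2 assms)
  also have "\<dots> = L2_inner f g"
    unfolding L2_inner_def by (simp add: inner_vec_def fcomp_def inner_complex_def)
  finally show ?thesis ..
qed

text \<open>Integrability is part of the space so that \<open>L2_fourier\<close> is given almost
  everywhere by the Fourier integral and \<open>L2_inner_shift_diff_self\<close> applies. The fields
  of the proof vanish outside a ball up to null sets, hence satisfy it.\<close>

definition frac_space :: "real \<Rightarrow> ('a::euclidean_space \<Rightarrow> real ^ 'n) set" where
  "frac_space s = {f. f \<in> L2 \<and> integrable lborel f \<and>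
     (\<forall>i. integrable lborel (\<lambda>\<xi>. norm \<xi> powr (2 * s) * (norm (L2_fourier (fcomp f i) \<xi>))\<^sup>2))}"

text \<open>The Fourier side of \<open>frac_laplacian (s / 2)\<close>, before the outer inverse
  transform.\<close>

definition frac_symbol :: "real \<Rightarrow> ('a::euclidean_space \<Rightarrow> real ^ 'n) \<Rightarrow> 'n \<Rightarrow> 'a \<Rightarrow> complex" where
  "frac_symbol s f i \<xi> = complex_of_real (norm \<xi> powr s) * L2_fourier (fcomp f i) \<xi>"

lemma norm_frac_symbol_square: "(norm (frac_symbol s f i \<xi>))\<^sup>2 = norm \<xi> powr (2 * s) * (norm (L2_fourier (fcomp f i) \<xi>))\<^sup>2"
  by (simp add: frac_symbol_def norm_mult power_mult_distrib power2_eq_square[of "_ powr _"] flip: powr_add)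

lemma frac_symbol_measurable[measurable]:
  assumes "f \<in> L2"
  shows "frac_symbol s f i \<in> borel_measurable borel"
proof -
  have [measurable]: "L2_fourier (fcomp f i) \<in> borel_measurable borel"
    by (intro L2_measurable L2_fourier_L2 fcomp_L2 assms)
  show ?thesis unfolding frac_symbol_def[abs_def] by measurable
qed

lemma frac_spaceD:
  assumes "f \<in> frac_space s"
  shows "f \<in> L2" "integrable lborel f" "frac_symbol s f i \<in> L2"
proof -
  show f: "f \<in> L2" "integrable lborel f" using assms by (auto simp: frac_space_def)
  show "frac_symbol s f i \<in> L2"
    using assms by (intro L2I frac_symbol_measurable f) (auto simp: frac_space_def norm_frac_symbol_square)
qed

lemma frac_laplacian_nth: "frac_laplacian (s / 2) f x $ i = L2_fourier (frac_symbol s f i) (- x)"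
  by (simp add: frac_laplacian_def L2_fourier_inv_def frac_symbol_def[abs_def] fcomp_def[abs_def])

lemma frac_laplacian_component_L2:
  assumes "f \<in> frac_space s"
  shows "(\<lambda>x. frac_laplacian (s / 2) f x $ i) \<in> L2"
  unfolding frac_laplacian_nth by (intro L2_reflect L2_fourier_L2 frac_spaceD assms)

lemma borel_measurable_vec_lambda:
  fixes f :: "'i::finite \<Rightarrow> 'a \<Rightarrow> 'b::euclidean_space"
  assumes [measurable]: "\<And>i. f i \<in> borel_measurable M"
  shows "(\<lambda>x. \<chi> i. f i x) \<in> borel_measurable M"
proof (subst borel_measurable_euclidean_space, intro ballI)
  fix b :: "'b ^ 'i" assume "b \<in> Basis"
  then obtain i c where b: "b = axis i c" by (auto simp: Basis_vec_def)
  show "(\<lambda>x. (\<chi> i. f i x) \<bullet> b) \<in> borel_measurable M"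
    unfolding b by (simp add: inner_axis)
qed

lemma L2_vec:
  fixes f :: "'a::euclidean_space \<Rightarrow> 'b::euclidean_space ^ 'n"
  assumes f: "\<And>i. (\<lambda>x. f x $ i) \<in> L2"
  shows "f \<in> L2"
proof (rule L2I)
  have "f = (\<lambda>x. \<chi> i. f x $ i)" by simp
  moreover have "(\<lambda>x. \<chi> i. f x $ i) \<in> borel_measurable borel"
    by (intro borel_measurable_vec_lambda L2_measurable f)
  ultimately show "f \<in> borel_measurable borel" by simp
  have "(norm (f x))\<^sup>2 = (\<Sum>i\<in>UNIV. (norm (f x $ i))\<^sup>2)" for x
    by (simp add: power2_norm_eq_inner inner_vec_def)
  then show "integrable lborel (\<lambda>x. (norm (f x))\<^sup>2)"
    using L2_integrable_sq[OF f] by simp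
qed

lemma frac_laplacian_L2:
  assumes "f \<in> frac_space s"
  shows "frac_laplacian (s / 2) f \<in> L2"
  by (rule L2_vec) (rule frac_laplacian_component_L2[OF assms])

text \<open>The reflection in \<open>L2_fourier_inv\<close> preserves inner products and Parseval
  removes the outer transform. Thus the form is evaluated on the Fourier side without Fourier
  inversion.\<close>

lemma L2_inner_frac_laplacian:
  assumes "f \<in> frac_space s" "g \<in> frac_space s"
  shows "L2_inner (frac_laplacian (s / 2) f) (frac_laplacian (s / 2) g) =
    (\<Sum>i\<in>UNIV. L2_inner (frac_symbol s f i) (frac_symbol s g i))"
proof -
  have "L2_inner (frac_laplacian (s / 2) f) (frac_laplacian (s / 2) g) =
    (LINT x|lborel. (\<Sum>i\<in>UNIV. frac_laplacian (s / 2) f x $ i \<bullet> frac_laplacian (s / 2) g x $ i))"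
    by (simp add: L2_inner_def inner_vec_def)
  also have "\<dots> = (\<Sum>i\<in>UNIV. L2_inner (\<lambda>x. frac_laplacian (s / 2) f x $ i) (\<lambda>x. frac_laplacian (s / 2) g x $ i))"
    unfolding L2_inner_def
    by (rule Bochner_Integration.integral_sum) (intro L2_inner_integrable frac_laplacian_component_L2 assms)
  also have "\<dots> = (\<Sum>i\<in>UNIV. L2_inner (frac_symbol s f i) (frac_symbol s g i))"
  proof (rule sum.cong[OF refl])
    fix i
    note m = frac_spaceD(3)[OF assms(1), of i] frac_spaceD(3)[OF assms(2), of i]
    show "L2_inner (\<lambda>x. frac_laplacian (s / 2) f x $ i) (\<lambda>x. frac_laplacian (s / 2) g x $ i) = L2_inner (frac_symbol s f i) (frac_symbol s g i)"
      unfolding frac_laplacian_nth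
      using m by (subst L2_inner_reflect) (auto simp: L2_fourier_Parseval intro!: L2_measurable)
  qed
  finally show ?thesis .
qed

lemma L2_inner_measurable:
  fixes F :: "'b::euclidean_space \<Rightarrow> 'a::euclidean_space \<Rightarrow> 'c::euclidean_space"
  assumes [measurable]: "(\<lambda>(p, x). F p x) \<in> borel_measurable (lborel \<Otimes>\<^sub>M lborel)" "(\<lambda>(p, x). G p x) \<in> borel_measurable (lborel \<Otimes>\<^sub>M lborel)"
  shows "(\<lambda>p. L2_inner (F p) (G p)) \<in> borel_measurable borel"
  unfolding L2_inner_def by measurable

lemma gag_integrand_measurable[measurable]:
  fixes f g :: "'a::euclidean_space \<Rightarrow> 'b::euclidean_space"
  assumes [measurable]: "f \<in> borel_measurable borel" "g \<in> borel_measurable borel"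
  shows "(\<lambda>p. L2_inner (shift_diff (gag_shift p) f) (shift_diff (gag_shift p) g)) \<in> borel_measurable borel"
  by (rule L2_inner_measurable) (unfold shift_diff_def, measurable)

lemma gag_energy:
  fixes f :: "'a::euclidean_space \<Rightarrow> real ^ 'n"
  assumes s: "0 < s" "s < 1" and f: "f \<in> L2" "integrable lborel f"
  shows "(\<integral>\<^sup>+p. ennreal (gag_weight s p * L2_inner (shift_diff (gag_shift p) f) (shift_diff (gag_shift p) f)) \<partial>lborel) =
    ennreal (gag_const s TYPE('a)) * (\<Sum>i\<in>UNIV. \<integral>\<^sup>+\<xi>. ennreal (norm \<xi> powr (2 * s) * (norm (L2_fourier (fcomp f i) \<xi>))\<^sup>2) \<partial>lborel)"
proof -
  have [measurable]: "fcomp f i \<in> borel_measurable borel" for i using L2_measurable[OF fcomp_L2[OF f(1)]] .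
  have "(\<integral>\<^sup>+p. ennreal (gag_weight s p * L2_inner (shift_diff (gag_shift p) f) (shift_diff (gag_shift p) f)) \<partial>lborel) =
    (\<integral>\<^sup>+p. (\<Sum>i\<in>UNIV. ennreal (gag_weight s p * L2_inner (shift_diff (gag_shift p) (fcomp f i)) (shift_diff (gag_shift p) (fcomp f i)))) \<partial>lborel)"
    by (intro nn_integral_cong)
      (simp add: L2_inner_fcomp[OF L2_shift_diff[OF f(1)] L2_shift_diff[OF f(1)]] fcomp_shift_diff sum_distrib_left sum_ennreal)
  also have "\<dots> = (\<Sum>i\<in>UNIV. \<integral>\<^sup>+p. ennreal (gag_weight s p * L2_inner (shift_diff (gag_shift p) (fcomp f i)) (shift_diff (gag_shift p) (fcomp f i))) \<partial>lborel)"
    by (rule nn_integral_sum) measurable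
  also have "\<dots> = (\<Sum>i\<in>UNIV. ennreal (gag_const s TYPE('a)) * (\<integral>\<^sup>+\<xi>. ennreal (norm \<xi> powr (2 * s) * (norm (L2_fourier (fcomp f i) \<xi>))\<^sup>2) \<partial>lborel))"
    by (intro sum.cong refl gag_energy_scalar s fcomp_L2 fcomp_integrable f)
  finally show ?thesis by (simp add: sum_distrib_left)
qed

text \<open>Finite energy becomes a condition on translations. This is the form in which products
  and Lipschitz fields, whose Fourier transforms are out of reach, can be tested.\<close>

lemma frac_space_iff:
  fixes f :: "'a::euclidean_space \<Rightarrow> real ^ 'n"
  assumes s: "0 < s" "s < 1" and f: "f \<in> L2" "integrable lborel f"
  shows "f \<in> frac_space s \<longleftrightarrow>
    (\<integral>\<^sup>+p. ennreal (gag_weight s p * L2_inner (shift_diff (gag_shift p) f) (shift_diff (gag_shift p) f)) \<partial>lborel) < \<infinity>"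
proof -
  have [measurable]: "L2_fourier (fcomp f i) \<in> borel_measurable borel" for i
    by (intro L2_measurable L2_fourier_L2 fcomp_L2 f)
  have "integrable lborel (\<lambda>\<xi>. norm \<xi> powr (2 * s) * (norm (L2_fourier (fcomp f i) \<xi>))\<^sup>2) \<longleftrightarrow>
    (\<integral>\<^sup>+\<xi>. ennreal (norm \<xi> powr (2 * s) * (norm (L2_fourier (fcomp f i) \<xi>))\<^sup>2) \<partial>lborel) < \<infinity>" for i
    by (simp add: integrable_iff_bounded abs_mult)
  moreover have "ennreal (gag_const s TYPE('a)) * X < \<infinity> \<longleftrightarrow> X < \<infinity>" for X
    using gag_const(2)[OF s, where 'a='a] by (auto simp: ennreal_mult_less_top)
  ultimately show ?thesis
    using f by (simp add: frac_space_def gag_energy[OF s f] less_top)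
qed

lemma
  fixes f :: "'a::euclidean_space \<Rightarrow> real ^ 'n"
  assumes s: "0 < s" "s < 1" and f: "f \<in> frac_space s"
  shows gag_self_integrable: "integrable lborel (\<lambda>p. gag_weight s p * L2_inner (shift_diff (gag_shift p) f) (shift_diff (gag_shift p) f))" (is ?I)
    and gag_self: "(LINT p|lborel. gag_weight s p * L2_inner (shift_diff (gag_shift p) f) (shift_diff (gag_shift p) f)) =
      gag_const s TYPE('a) * L2_inner (frac_laplacian (s / 2) f) (frac_laplacian (s / 2) f)"
proof -
  note fD = frac_spaceD[OF f]
  have [measurable]: "f \<in> borel_measurable borel" using fD(1) by (rule L2_measurable)
  show I: ?I
    using frac_space_iff[OF s fD(1,2)] f by (intro integrableI_nonneg) auto
  have "ennreal (LINT p|lborel. gag_weight s p * L2_inner (shift_diff (gag_shift p) f) (shift_diff (gag_shift p) f)) =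
     (\<integral>\<^sup>+p. ennreal (gag_weight s p * L2_inner (shift_diff (gag_shift p) f) (shift_diff (gag_shift p) f)) \<partial>lborel)"
    using I by (intro nn_integral_eq_integral[symmetric]) auto
  also have "\<dots> = ennreal (gag_const s TYPE('a)) * (\<Sum>i\<in>UNIV. ennreal (L2_inner (frac_symbol s f i) (frac_symbol s f i)))"
    unfolding gag_energy[OF s fD(1,2)] by (simp add: nn_integral_L2_norm[OF fD(3), symmetric] norm_frac_symbol_square)
  also have "\<dots> = ennreal (gag_const s TYPE('a) * L2_inner (frac_laplacian (s / 2) f) (frac_laplacian (s / 2) f))"
    using gag_const(2)[OF s, where 'a='a] by (simp add: L2_inner_frac_laplacian[OF f f] ennreal_mult' sum_ennreal)
  finally show "(LINT p|lborel. gag_weight s p * L2_inner (shift_diff (gag_shift p) f) (shift_diff (gag_shift p) f)) =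
      gag_const s TYPE('a) * L2_inner (frac_laplacian (s / 2) f) (frac_laplacian (s / 2) f)"
    using gag_const(2)[OF s, where 'a='a] by (subst (asm) ennreal_inj) (auto intro!: Bochner_Integration.integral_nonneg)
qed

lemma frac_symbol_add:
  assumes "f \<in> L2" "g \<in> L2"
  shows "AE \<xi> in lborel. frac_symbol s (\<lambda>x. f x + g x) i \<xi> = frac_symbol s f i \<xi> + frac_symbol s g i \<xi>"
  using L2_fourier_add[OF fcomp_L2[OF assms(1)] fcomp_L2[OF assms(2)], of i i]
  by eventually_elim (simp add: frac_symbol_def fcomp_add distrib_left)

lemma frac_symbol_diff:
  assumes "f \<in> L2" "g \<in> L2"
  shows "AE \<xi> in lborel. frac_symbol s (\<lambda>x. f x - g x) i \<xi> = frac_symbol s f i \<xi> - frac_symbol s g i \<xi>"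
  using L2_fourier_diff[OF fcomp_L2[OF assms(1)] fcomp_L2[OF assms(2)], of i i]
  by eventually_elim (simp add: frac_symbol_def fcomp_diff right_diff_distrib)

lemma frac_spaceI:
  assumes "f \<in> L2" "integrable lborel f" "\<And>i. frac_symbol s f i \<in> L2"
  shows "f \<in> frac_space s"
  using assms(1,2) L2_integrable_sq[OF assms(3)] by (simp add: frac_space_def norm_frac_symbol_square)

lemma frac_space_add:
  assumes f: "f \<in> frac_space s" and g: "g \<in> frac_space s"
  shows "(\<lambda>x. f x + g x) \<in> frac_space s"
proof (rule frac_spaceI)
  note D = frac_spaceD[OF f] frac_spaceD[OF g]
  show "frac_symbol s (\<lambda>x. f x + g x) i \<in> L2" for i
    by (rule L2_dominated[OF L2_add[OF D(3)[of i] D(6)[of i]], where c=1])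
      (use frac_symbol_add[OF D(1,4), of s i] D in \<open>auto elim!: eventually_mono intro!: frac_symbol_measurable\<close>)
qed (use frac_spaceD[OF f] frac_spaceD[OF g] in auto)

lemma frac_space_diff:
  assumes f: "f \<in> frac_space s" and g: "g \<in> frac_space s"
  shows "(\<lambda>x. f x - g x) \<in> frac_space s"
proof (rule frac_spaceI)
  note D = frac_spaceD[OF f] frac_spaceD[OF g]
  show "frac_symbol s (\<lambda>x. f x - g x) i \<in> L2" for i
    by (rule L2_dominated[OF L2_diff[OF D(3)[of i] D(6)[of i]], where c=1])
      (use frac_symbol_diff[OF D(1,4), of s i] D in \<open>auto elim!: eventually_mono intro!: frac_symbol_measurable\<close>)
qed (use frac_spaceD[OF f] frac_spaceD[OF g] in auto)

definition frac_form :: "real \<Rightarrow> ('a::euclidean_space \<Rightarrow> real ^ 'n) \<Rightarrow> ('a \<Rightarrow> real ^ 'n) \<Rightarrow> real" where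
  "frac_form s f g = L2_inner (frac_laplacian (s / 2) f) (frac_laplacian (s / 2) g)"

lemma
  assumes f: "f \<in> frac_space s" "f' \<in> frac_space s" and g: "g \<in> frac_space s"
  shows frac_form_add_left: "frac_form s (\<lambda>x. f x + f' x) g = frac_form s f g + frac_form s f' g"
    and frac_form_diff_left: "frac_form s (\<lambda>x. f x - f' x) g = frac_form s f g - frac_form s f' g"
proof -
  note D = frac_spaceD[OF f(1)] frac_spaceD[OF f(2)] frac_spaceD[OF g]
  have "L2_inner (frac_symbol s (\<lambda>x. f x + f' x) i) (frac_symbol s g i) = L2_inner (\<lambda>\<xi>. frac_symbol s f i \<xi> + frac_symbol s f' i \<xi>) (frac_symbol s g i)" for i
    by (intro L2_inner_cong_AE frac_symbol_add) (use D in \<open>auto intro!: frac_symbol_measurable borel_measurable_add\<close>)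
  then show "frac_form s (\<lambda>x. f x + f' x) g = frac_form s f g + frac_form s f' g"
    using D by (simp add: frac_form_def L2_inner_frac_laplacian f g frac_space_add L2_inner_add_left sum.distrib)
  have "L2_inner (frac_symbol s (\<lambda>x. f x - f' x) i) (frac_symbol s g i) = L2_inner (\<lambda>\<xi>. frac_symbol s f i \<xi> - frac_symbol s f' i \<xi>) (frac_symbol s g i)" for i
    by (intro L2_inner_cong_AE frac_symbol_diff) (use D in \<open>auto intro!: frac_symbol_measurable borel_measurable_diff\<close>)
  then show "frac_form s (\<lambda>x. f x - f' x) g = frac_form s f g - frac_form s f' g"
    using D by (simp add: frac_form_def L2_inner_frac_laplacian f g frac_space_diff L2_inner_diff_left sum_subtractf)
qed

lemma frac_form_commute: "frac_form s f g = frac_form s g f"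
  by (simp add: frac_form_def L2_inner_commute)

lemma frac_form_self_nonneg[simp]: "0 \<le> frac_form s f f"
  by (simp add: frac_form_def)

lemma frac_form_Cauchy_Schwarz:
  assumes "f \<in> frac_space s" "g \<in> frac_space s"
  shows "\<bar>frac_form s f g\<bar> \<le> sqrt (frac_form s f f) * sqrt (frac_form s g g)"
  using L2_Cauchy_Schwarz[OF frac_laplacian_L2[OF assms(1)] frac_laplacian_L2[OF assms(2)]]
  by (simp add: frac_form_def L2_norm_def)

lemma frac_form_add_right: 
  assumes "f \<in> frac_space s" "f' \<in> frac_space s" "g \<in> frac_space s"
  shows "frac_form s g (\<lambda>x. f x + f' x) = frac_form s g f + frac_form s g f'"
  using frac_form_add_left[OF assms] by (simp add: frac_form_commute)

lemma frac_form_diff_right: 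
  assumes "f \<in> frac_space s" "f' \<in> frac_space s" "g \<in> frac_space s"
  shows "frac_form s g (\<lambda>x. f x - f' x) = frac_form s g f - frac_form s g f'"
  using frac_form_diff_left[OF assms] by (simp add: frac_form_commute)

lemma shift_diff_add: "shift_diff y (\<lambda>x. f x + g x) = (\<lambda>x. shift_diff y f x + shift_diff y g x)"
  and shift_diff_diff: "shift_diff y (\<lambda>x. f x - g x) = (\<lambda>x. shift_diff y f x - shift_diff y g x)"
  by (simp_all add: shift_diff_def fun_eq_iff)

text \<open>Polarisation, in the integrand on one side and in \<open>frac_form\<close> on the
  other.\<close>

theorem gagliardo:
  fixes f g :: "'a::euclidean_space \<Rightarrow> real ^ 'n"
  assumes s: "0 < s" "s < 1" and f: "f \<in> frac_space s" and g: "g \<in> frac_space s"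
  shows gag_integrable: "integrable lborel (\<lambda>p. gag_weight s p * L2_inner (shift_diff (gag_shift p) f) (shift_diff (gag_shift p) g))" (is ?I)
    and gag_form: "(LINT p|lborel. gag_weight s p * L2_inner (shift_diff (gag_shift p) f) (shift_diff (gag_shift p) g)) =
      gag_const s TYPE('a) * frac_form s f g"
proof -
  note D = frac_spaceD[OF f] frac_spaceD[OF g]
  let ?E = "\<lambda>f p. gag_weight s p * L2_inner (shift_diff (gag_shift p) f) (shift_diff (gag_shift p) f)"
  note add = frac_space_add[OF f g] and diff = frac_space_diff[OF f g]
  have eq: "gag_weight s p * L2_inner (shift_diff (gag_shift p) f) (shift_diff (gag_shift p) g) =
    (1/4) * (?E (\<lambda>x. f x + g x) p - ?E (\<lambda>x. f x - g x) p)" for p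
    using L2_polarization[OF L2_shift_diff[OF D(1)] L2_shift_diff[OF D(4)], of "gag_shift p" "gag_shift p"]
    by (simp add: shift_diff_add shift_diff_diff flip: right_diff_distrib)
  note i = gag_self_integrable[OF s add] gag_self_integrable[OF s diff]
  show ?I unfolding eq using i by (intro integrable_mult_right Bochner_Integration.integrable_diff)
  have "(LINT p|lborel. gag_weight s p * L2_inner (shift_diff (gag_shift p) f) (shift_diff (gag_shift p) g)) =
    (1/4) * ((LINT p|lborel. ?E (\<lambda>x. f x + g x) p) - (LINT p|lborel. ?E (\<lambda>x. f x - g x) p))"
    unfolding eq integral_mult_right_zero using i by (simp only: Bochner_Integration.integral_diff)
  also have "\<dots> = (1/4) * gag_const s TYPE('a) * (frac_form s (\<lambda>x. f x + g x) (\<lambda>x. f x + g x) - frac_form s (\<lambda>x. f x - g x) (\<lambda>x. f x - g x))"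
    unfolding gag_self[OF s add] gag_self[OF s diff] frac_form_def by (simp add: algebra_simps)
  also have "frac_form s (\<lambda>x. f x + g x) (\<lambda>x. f x + g x) - frac_form s (\<lambda>x. f x - g x) (\<lambda>x. f x - g x) = 4 * frac_form s f g"
    using frac_form_commute[of s g f]
    by (simp add: frac_form_add_left frac_form_add_right frac_form_diff_left frac_form_diff_right f g add diff)
  finally show "(LINT p|lborel. gag_weight s p * L2_inner (shift_diff (gag_shift p) f) (shift_diff (gag_shift p) g)) =
      gag_const s TYPE('a) * frac_form s f g" by simp
qed

text \<open>A translation by \<open>y\<close> costs \<open>norm y powr s\<close> in
  \<open>L\<^sup>2\<close>, as \<open>two_minus_two_cos_le_powr\<close> shows on the Fourier side.
  The rate is used twice: for the majorant of the skew form and for the unit length defect.\<close>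

lemma shift_diff_frac_bound:
  fixes f :: "'a::euclidean_space \<Rightarrow> real ^ 'n"
  assumes s: "0 < s" "s < 1" and f: "f \<in> frac_space s"
  shows "L2_inner (shift_diff y f) (shift_diff y f) \<le> 4 * norm y powr (2 * s) * frac_form s f f"
proof -
  note D = frac_spaceD[OF f]
  have "L2_inner (shift_diff y (fcomp f i)) (shift_diff y (fcomp f i)) \<le> 4 * norm y powr (2 * s) * L2_inner (frac_symbol s f i) (frac_symbol s f i)" for i
  proof -
    have [measurable]: "frac_symbol s f i \<in> borel_measurable borel" by (rule frac_symbol_measurable[OF D(1)])
    have "ennreal (L2_inner (shift_diff y (fcomp f i)) (shift_diff y (fcomp f i))) =
       (\<integral>\<^sup>+\<xi>. ennreal ((2 - 2 * cos (y \<bullet> \<xi>)) * (norm (L2_fourier (fcomp f i) \<xi>))\<^sup>2) \<partial>lborel)"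
      by (rule L2_inner_shift_diff_self) (use D in auto)
    also have "\<dots> \<le> (\<integral>\<^sup>+\<xi>. ennreal (4 * norm y powr (2 * s)) * ennreal ((norm (frac_symbol s f i \<xi>))\<^sup>2) \<partial>lborel)"
    proof (rule nn_integral_mono)
      fix \<xi> :: 'a
      have "2 - 2 * cos (y \<bullet> \<xi>) \<le> 4 * \<bar>y \<bullet> \<xi>\<bar> powr (2 * s)"
        by (rule two_minus_two_cos_le_powr[OF s])
      also have "\<dots> \<le> 4 * (norm y * norm \<xi>) powr (2 * s)"
        using s by (intro mult_left_mono powr_mono2 Cauchy_Schwarz_ineq2) auto
      finally have "(2 - 2 * cos (y \<bullet> \<xi>)) * (norm (L2_fourier (fcomp f i) \<xi>))\<^sup>2 \<le> (4 * (norm y * norm \<xi>) powr (2 * s)) * (norm (L2_fourier (fcomp f i) \<xi>))\<^sup>2"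
        by (rule mult_right_mono) simp
      also have "\<dots> = (4 * norm y powr (2 * s)) * (norm (frac_symbol s f i \<xi>))\<^sup>2"
        by (simp add: norm_frac_symbol_square powr_mult)
      finally show "ennreal ((2 - 2 * cos (y \<bullet> \<xi>)) * (norm (L2_fourier (fcomp f i) \<xi>))\<^sup>2) \<le> ennreal (4 * norm y powr (2 * s)) * ennreal ((norm (frac_symbol s f i \<xi>))\<^sup>2)"
        by (simp add: ennreal_leI flip: ennreal_mult')
    qed
    also have "\<dots> = ennreal (4 * norm y powr (2 * s)) * ennreal (L2_inner (frac_symbol s f i) (frac_symbol s f i))"
      by (subst nn_integral_cmult) (auto simp: nn_integral_L2_norm[OF D(3)])
    also have "\<dots> = ennreal (4 * norm y powr (2 * s) * L2_inner (frac_symbol s f i) (frac_symbol s f i))"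
      by (simp flip: ennreal_mult')
    finally show ?thesis by (subst (asm) ennreal_le_iff) auto
  qed
  then have "(\<Sum>i\<in>UNIV. L2_inner (shift_diff y (fcomp f i)) (shift_diff y (fcomp f i))) \<le> (\<Sum>i\<in>UNIV. 4 * norm y powr (2 * s) * L2_inner (frac_symbol s f i) (frac_symbol s f i))"
    by (rule sum_mono)
  then show ?thesis
    by (simp add: L2_inner_fcomp L2_shift_diff D fcomp_shift_diff frac_form_def L2_inner_frac_laplacian[OF f f] sum_distrib_left)
qed

section \<open>Lipschitz fields\<close>

lemma bounded_support_L2:
  fixes g :: "'a::euclidean_space \<Rightarrow> 'b::euclidean_space"
  assumes [measurable]: "g \<in> borel_measurable borel"
    and B: "\<And>x. norm (g x) \<le> B" and S: "\<And>x. norm x > R \<Longrightarrow> g x = 0"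
  shows "g \<in> L2" "integrable lborel g"
proof -
  have "integrable lborel (indicator (cball 0 R) :: 'a \<Rightarrow> real)"
    using emeasure_lborel_cball_finite[of "0::'a" R] by simp
  then have i: "integrable lborel (\<lambda>x::'a. c * indicator (cball 0 R) x :: real)" for c :: real
    by (intro integrable_mult_right)
  have B0: "0 \<le> B" using B[of 0] norm_ge_zero order_trans by blast
  show "integrable lborel g"
    by (rule Bochner_Integration.integrable_bound[OF i[of B]]) (use B B0 S in \<open>auto intro!: AE_I2 simp: indicator_def\<close>)
  show "g \<in> L2"
  proof (rule L2I)
    show "integrable lborel (\<lambda>x. (norm (g x))\<^sup>2)"
      by (rule Bochner_Integration.integrable_bound[OF i[of "B\<^sup>2"]]) (use B S in \<open>auto intro!: AE_I2 power_mono simp: indicator_def\<close>)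
  qed measurable
qed

text \<open>The difference vanishes unless \<open>x\<close> or \<open>x + y\<close> lies in the
  ball, which accounts for twice its measure; the minimum joins the bound by size to the bound by
  slope.\<close>

lemma shift_diff_lipschitz_bound:
  fixes g :: "'a::euclidean_space \<Rightarrow> 'b::euclidean_space"
  assumes L: "L-lipschitz_on UNIV g" and B: "\<And>x. norm (g x) \<le> B" and S: "\<And>x. norm x > R \<Longrightarrow> g x = 0"
  shows "L2_inner (shift_diff y g) (shift_diff y g) \<le> 2 * measure lborel (cball (0::'a) R) * (min (2 * B) (L * norm y))\<^sup>2"
proof -
  have g[measurable]: "g \<in> borel_measurable borel"
    by (intro borel_measurable_continuous_onI lipschitz_on_continuous_on[OF L])
  define c where "c = min (2 * B) (L * norm y)"
  define I where "I = (indicator (cball 0 R) :: 'a \<Rightarrow> real)"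
  have iI: "integrable lborel I"
    unfolding I_def using emeasure_lborel_cball_finite[of "0::'a" R] by simp
  have le: "(norm (shift_diff y g x))\<^sup>2 \<le> c\<^sup>2 * (I x + I (x + y))" for x
  proof (cases "norm x > R \<and> norm (x + y) > R")
    case False
    have "norm (shift_diff y g x) \<le> norm (g (x + y)) + norm (g x)"
      unfolding shift_diff_def by (rule norm_triangle_ineq4)
    then have "norm (shift_diff y g x) \<le> 2 * B" using B[of x] B[of "x + y"] by linarith
    moreover have "norm (shift_diff y g x) \<le> L * norm y"
      using lipschitz_onD[OF L, of "x + y" x] by (simp add: shift_diff_def dist_norm)
    ultimately have "norm (shift_diff y g x) \<le> c" by (simp add: c_def)
    then have "(norm (shift_diff y g x))\<^sup>2 \<le> c\<^sup>2 * 1" by (simp add: power_mono)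
    also have "\<dots> \<le> c\<^sup>2 * (I x + I (x + y))"
      using False by (intro mult_left_mono) (auto simp: I_def indicator_def)
    finally show ?thesis .
  qed (simp add: shift_diff_def S I_def)
  have "L2_inner (shift_diff y g) (shift_diff y g) \<le> (LINT x|lborel. c\<^sup>2 * (I x + I (x + y)))"
    unfolding L2_inner_self
    by (rule integral_mono) (use le iI lborel_shift_integrable[OF iI, of y] in
      \<open>auto intro!: L2_integrable_sq L2_shift_diff bounded_support_L2[OF g B S]\<close>)
  also have "\<dots> = c\<^sup>2 * (2 * measure lborel (cball (0::'a) R))"
    using iI lborel_shift_integrable[OF iI, of y] lborel_shift_integral[of I y] by (simp add: I_def)
  finally show ?thesis by (simp add: c_def mult_ac)
qed

text \<open>The common majorant of dominated convergence in the variables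
  \<open>(\<tau>, w)\<close>. The power of \<open>1 + norm (snd p)\<close> absorbs the factors
  \<open>norm w\<close> that come out of \<open>norm (gag_shift p)\<close>.\<close>

definition gag_dominant :: "real \<Rightarrow> real \<Rightarrow> real \<times> 'a::euclidean_space \<Rightarrow> real" where
  "gag_dominant b a p = indicator {0<..} (fst p) * (fst p powr (- 1 - b) * min 1 (fst p powr a)) *
    (exp (- (norm (snd p))\<^sup>2 / 2) * (1 + norm (snd p))\<^sup>2)"

lemma gag_dominant_nonneg[simp]: "0 \<le> gag_dominant b a p"
  by (simp add: gag_dominant_def)

lemma gag_dominant_integrable: "0 < b \<Longrightarrow> b < a \<Longrightarrow> integrable lborel (gag_dominant b a :: real \<times> 'a::euclidean_space \<Rightarrow> real)"
  unfolding gag_dominant_def[abs_def] by (rule gag_weight_integrable)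

text \<open>The slope branch of the minimum serves for \<open>fst p \<le> 1\<close>, the constant
  branch beyond; \<open>1 + norm (snd p)\<close> is at least \<open>norm (snd p)\<close> and at
  least 1, so it covers both.\<close>

lemma min_gag_shift_le:
  assumes "B \<ge> 0" "L \<ge> 0" "fst p > 0"
  shows "min B (L * norm (gag_shift p)) \<le> (B + L) * min 1 (fst p) * (1 + norm (snd p))"
proof (cases "fst p \<le> 1")
  case True
  have "L * norm (gag_shift p) = L * fst p * norm (snd p)" using assms(3) by (simp add: gag_shift_def)
  also have "\<dots> \<le> (B + L) * fst p * (1 + norm (snd p))"
    using assms by (intro mult_mono) auto
  finally show ?thesis using True by simp
next
  case False
  have "B * 1 \<le> (B + L) * (1 + norm (snd p))" using assms by (intro mult_mono) auto
  then show ?thesis using False by simp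
qed

lemma gag_weight_min_bound:
  fixes p :: "real \<times> 'a::euclidean_space"
  assumes "B \<ge> 0" "L \<ge> 0"
  shows "gag_weight s p * (min B (L * norm (gag_shift p)))\<^sup>2 \<le> (B + L)\<^sup>2 * gag_dominant (2 * s) 2 p"
proof (cases "fst p > 0")
  case True
  define t w where "t = fst p" and "w = snd p"
  have t: "t > 0" using True by (simp add: t_def)
  have "min B (L * norm (gag_shift p)) \<le> (B + L) * min 1 t * (1 + norm w)"
    unfolding t_def w_def by (rule min_gag_shift_le[OF assms(1,2) True])
  then have "(min B (L * norm (gag_shift p)))\<^sup>2 \<le> ((B + L) * min 1 t * (1 + norm w))\<^sup>2"
    using assms by (intro power_mono) auto
  also have "\<dots> = (B + L)\<^sup>2 * (min 1 (t powr 2) * (1 + norm w)\<^sup>2)"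
  proof -
    have "(min 1 t)\<^sup>2 = min 1 (t powr 2)"
    proof (cases "t \<le> 1")
      case True
      then show ?thesis using t power_le_one[of t 2] by simp
    next
      case False
      then show ?thesis using t one_le_power[of t 2] by simp
    qed
    then show ?thesis by (simp add: power_mult_distrib)
  qed
  finally have "gag_weight s p * (min B (L * norm (gag_shift p)))\<^sup>2 \<le> gag_weight s p * ((B + L)\<^sup>2 * (min 1 (t powr 2) * (1 + norm w)\<^sup>2))"
    by (rule mult_left_mono) simp
  also have "\<dots> = (B + L)\<^sup>2 * gag_dominant (2 * s) 2 p"
    using True by (simp add: gag_weight_def gag_dominant_def t_def w_def mult_ac)
  finally show ?thesis .
qed (simp add: gag_weight_def gag_dominant_def)

text \<open>Squared differences of a Lipschitz field are of order \<open>\<tau>\<^sup>2\<close> for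
  small \<tau>, which the weight tolerates because \<open>s < 1\<close>; for large \<tau>
  boundedness is enough because \<open>0 < s\<close>.\<close>

lemma lipschitz_frac_space:
  fixes g :: "'a::euclidean_space \<Rightarrow> real ^ 'n"
  assumes s: "0 < s" "s < 1"
    and L: "L-lipschitz_on UNIV g" and B: "\<And>x. norm (g x) \<le> B" and S: "\<And>x. norm x > R \<Longrightarrow> g x = 0"
  shows "g \<in> frac_space s"
proof -
  have g[measurable]: "g \<in> borel_measurable borel"
    by (intro borel_measurable_continuous_onI lipschitz_on_continuous_on[OF L])
  have B0: "0 \<le> B" using B[of 0] norm_ge_zero order_trans by blast
  have L0: "0 \<le> L" using lipschitz_on_nonneg[OF L] .
  let ?V = "2 * measure lborel (cball (0::'a) R)"
  have le: "gag_weight s p * L2_inner (shift_diff (gag_shift p) g) (shift_diff (gag_shift p) g) \<le> ?V * (2 * B + L)\<^sup>2 * gag_dominant (2 * s) 2 p" for p :: "real \<times> 'a"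
  proof -
    have "gag_weight s p * L2_inner (shift_diff (gag_shift p) g) (shift_diff (gag_shift p) g) \<le> gag_weight s p * (?V * (min (2 * B) (L * norm (gag_shift p)))\<^sup>2)"
      by (intro mult_left_mono shift_diff_lipschitz_bound[OF L B S]) auto
    also have "\<dots> = ?V * (gag_weight s p * (min (2 * B) (L * norm (gag_shift p)))\<^sup>2)" by (simp add: mult_ac)
    also have "\<dots> \<le> ?V * ((2 * B + L)\<^sup>2 * gag_dominant (2 * s) 2 p)"
      using B0 L0 by (intro mult_left_mono gag_weight_min_bound) auto
    finally show ?thesis by (simp add: mult_ac)
  qed
  have "(\<integral>\<^sup>+p. ennreal (gag_weight s p * L2_inner (shift_diff (gag_shift p) g) (shift_diff (gag_shift p) g)) \<partial>lborel) \<le>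
    (\<integral>\<^sup>+p. ennreal (?V * (2 * B + L)\<^sup>2 * gag_dominant (2 * s) 2 p) \<partial>(lborel :: (real \<times> 'a) measure))"
    by (intro nn_integral_mono ennreal_leI le)
  also have "\<dots> < \<infinity>"
    using gag_dominant_integrable[of "2 * s" 2, where 'a='a] s
    by (subst nn_integral_eq_integral) (auto intro!: integrable_mult_right AE_I2 mult_nonneg_nonneg)
  finally show ?thesis
    by (subst frac_space_iff[OF s bounded_support_L2[OF g B S]])
qed

lemma frac_form_lipschitz_tendsto_0:
  fixes g :: "nat \<Rightarrow> 'a::euclidean_space \<Rightarrow> real ^ 'n"
  assumes s: "0 < s" "s < 1"
    and L: "\<And>k. L-lipschitz_on UNIV (g k)" and B: "\<And>k x. norm (g k x) \<le> B k" and S: "\<And>k x. norm x > R \<Longrightarrow> g k x = 0"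
    and B0: "B \<longlonglongrightarrow> 0"
  shows "(\<lambda>k. frac_form s (g k) (g k)) \<longlonglongrightarrow> 0"
proof -
  have Bp: "0 \<le> B k" for k using B[of k 0] norm_ge_zero order_trans by blast
  have L0: "0 \<le> L" using lipschitz_on_nonneg[OF L] .
  let ?V = "2 * measure lborel (cball (0::'a) R)"
  let ?m = "\<lambda>k (p::real \<times> 'a). gag_weight s p * (?V * (min (2 * B k) (L * norm (gag_shift p)))\<^sup>2)"
  obtain M where M: "\<And>k. B k \<le> M" "M > 0"
  proof -
    from convergent_imp_Bseq[OF convergentI[OF B0]] obtain M where "M > 0" "\<And>k. norm (B k) \<le> M"
      by (auto simp: Bseq_def)
    then show thesis using that Bp by (metis abs_of_nonneg real_norm_def)
  qed
  have bd: "?m k p \<le> ?V * ((2 * M + L)\<^sup>2 * gag_dominant (2 * s) 2 p)" for k p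
  proof -
    have "?m k p \<le> gag_weight s p * (?V * (min (2 * M) (L * norm (gag_shift p)))\<^sup>2)"
    proof (intro mult_left_mono power_mono)
      show "min (2 * B k) (L * norm (gag_shift p)) \<le> min (2 * M) (L * norm (gag_shift p))"
        using M(1)[of k] by (intro min.mono) auto
    qed (use Bp[of k] L0 in auto)
    also have "\<dots> = ?V * (gag_weight s p * (min (2 * M) (L * norm (gag_shift p)))\<^sup>2)" by (simp add: mult_ac)
    also have "\<dots> \<le> ?V * ((2 * M + L)\<^sup>2 * gag_dominant (2 * s) 2 p)"
      using M L0 by (intro mult_left_mono gag_weight_min_bound) auto
    finally show ?thesis .
  qed
  have id: "integrable lborel (\<lambda>p::real \<times> 'a. ?V * ((2 * M + L)\<^sup>2 * gag_dominant (2 * s) 2 p))"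
    using gag_dominant_integrable[of "2 * s" 2, where 'a='a] s by (intro integrable_mult_right) auto
  have m0: "0 \<le> ?m k p" for k p by simp
  have mm: "(\<lambda>p. ?m k p) \<in> borel_measurable lborel" for k by measurable
  have im: "integrable lborel (?m k)" for k
  proof (rule Bochner_Integration.integrable_bound[OF id mm], intro AE_I2)
    fix p :: "real \<times> 'a"
    show "norm (?m k p) \<le> norm (?V * ((2 * M + L)\<^sup>2 * gag_dominant (2 * s) 2 p))"
      using order_trans[OF bd[of p k] abs_ge_self] m0[of p k] by (simp only: real_norm_def abs_of_nonneg)
  qed
  have lim: "(\<lambda>k. LINT p|lborel. ?m k p) \<longlonglongrightarrow> (LINT p|(lborel :: (real \<times> 'a) measure). 0)"
  proof (rule integral_dominated_convergence[OF _ mm id])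
    show "AE p in lborel. (\<lambda>k. ?m k p) \<longlonglongrightarrow> 0"
    proof (rule AE_I2)
      fix p :: "real \<times> 'a"
      have "(\<lambda>k. (?m k p)) \<longlonglongrightarrow> gag_weight s p * (?V * (min (2 * 0) (L * norm (gag_shift p)))\<^sup>2)"
        by (intro tendsto_intros B0)
      then show "(\<lambda>k. ?m k p) \<longlonglongrightarrow> 0" using L0 by simp
    qed
    show "AE p in lborel. norm (?m k p) \<le> ?V * ((2 * M + L)\<^sup>2 * gag_dominant (2 * s) 2 p)" for k
      using bd m0 by (intro AE_I2) (simp only: real_norm_def abs_of_nonneg)
  qed simp
  have gf: "g k \<in> frac_space s" for k by (rule lipschitz_frac_space[OF s L B S])
  have c: "gag_const s TYPE('a) > 0" by (rule gag_const(2)[OF s])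
  have "(\<lambda>k. gag_const s TYPE('a) * frac_form s (g k) (g k)) \<longlonglongrightarrow> 0"
  proof (rule Lim_null_comparison)
    show "(\<lambda>k. LINT p|lborel. ?m k p) \<longlonglongrightarrow> 0" using lim by simp
    show "\<forall>\<^sub>F k in sequentially. norm (gag_const s TYPE('a) * frac_form s (g k) (g k)) \<le> (LINT p|lborel. ?m k p)"
    proof (intro always_eventually allI)
      fix k
      have "gag_const s TYPE('a) * frac_form s (g k) (g k) = (LINT p|lborel. gag_weight s p * L2_inner (shift_diff (gag_shift p) (g k)) (shift_diff (gag_shift p) (g k)))"
        by (rule gag_form[OF s gf gf, symmetric])
      also have "\<dots> \<le> (LINT p|lborel. ?m k p)"
        by (intro integral_mono gag_integrable[OF s gf gf] im mult_left_mono shift_diff_lipschitz_bound[OF L B S]) auto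
      finally show "norm (gag_const s TYPE('a) * frac_form s (g k) (g k)) \<le> (LINT p|lborel. ?m k p)"
        using c by simp
    qed
  qed
  then have "(\<lambda>k. (1 / gag_const s TYPE('a)) * (gag_const s TYPE('a) * frac_form s (g k) (g k))) \<longlonglongrightarrow> (1 / gag_const s TYPE('a)) * 0"
    by (intro tendsto_intros)
  then show ?thesis using c by simp
qed

text \<open>Bounded energy and \<open>L\<^sup>2\<close> convergence to zero imply weak convergence
  to zero in the energy space. On low frequencies the unbounded multiplier is moved from
  \<open>g k\<close> to \<open>u\<close>; the high-frequency tail of \<open>u\<close> is small and
  meets the energy bound.\<close>

lemma frac_form_weak_limit_0:
  fixes u :: "'a::euclidean_space \<Rightarrow> real ^ 'n"
  assumes s: "0 < s"
    and u: "u \<in> frac_space s" and g: "\<And>k. g k \<in> frac_space s"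
    and K: "\<And>k. frac_form s (g k) (g k) \<le> K" and lim: "(\<lambda>k. L2_norm (g k)) \<longlonglongrightarrow> 0"
  shows "(\<lambda>k. frac_form s u (g k)) \<longlonglongrightarrow> 0"
proof -
  note u' = frac_spaceD[OF u] and g' = frac_spaceD[OF g]
  have K0: "0 \<le> K" using K[of 0] frac_form_self_nonneg order_trans by blast
  have "(\<lambda>k. L2_inner (frac_symbol s u i) (frac_symbol s (g k) i)) \<longlonglongrightarrow> 0" for i
  proof (rule LIMSEQ_I)
    fix e :: real assume e: "e > 0"
    let ?U = "frac_symbol s u i"
    let ?T = "\<lambda>R \<xi>. indicator (cball 0 R) \<xi> * ?U \<xi>"
    \<comment> \<open>The \<open>+ 1\<close> makes the threshold meaningful also for
      \<open>K = 0\<close>.\<close>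
    have "\<forall>\<^sub>F R in at_top. L2_norm (\<lambda>\<xi>. ?U \<xi> - ?T R \<xi>) < e / (2 * (sqrt K + 1))"
      using order_tendstoD(2)[OF truncation_tendsto[OF u'(3)]] e K0 by (simp add: add_nonneg_pos)
    then obtain R where R: "L2_norm (\<lambda>\<xi>. ?U \<xi> - ?T R \<xi>) < e / (2 * (sqrt K + 1))" "R \<ge> 1"
      using eventually_happens'[OF trivial_limit_at_top_linorder eventually_conj[OF _ eventually_ge_at_top[of 1]]] by auto
    have T: "?T R \<in> L2" by (rule truncation_L2[OF u'(3)])
    \<comment> \<open>On the ball the multiplier is at most \<open>R powr s\<close>, so it may be
      shifted to \<open>u\<close> and leaves only the plain \<open>L\<^sup>2\<close> norm of
      \<open>g k\<close> on the other side.\<close>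
    let ?W = "\<lambda>\<xi>. complex_of_real (norm \<xi> powr s) * ?T R \<xi>"
    have [measurable]: "?U \<in> borel_measurable borel" "\<And>k. frac_symbol s (g k) i \<in> borel_measurable borel"
      using u'(3) g'(3) by (auto dest: L2_measurable)
    have W: "?W \<in> L2"
    proof (rule L2_dominated[OF T, where c="R powr s"])
      show "?W \<in> borel_measurable borel" by measurable
      show "AE \<xi> in lborel. norm (?W \<xi>) \<le> R powr s * norm (?T R \<xi>)"
        using s by (intro AE_I2) (auto simp: norm_mult indicator_def intro!: mult_right_mono powr_mono2)
    qed
    have gk: "L2_norm (frac_symbol s (g k) i) \<le> sqrt K" for k
    proof -
      have "L2_inner (frac_symbol s (g k) i) (frac_symbol s (g k) i) \<le> (\<Sum>i\<in>UNIV. L2_inner (frac_symbol s (g k) i) (frac_symbol s (g k) i))"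
        by (rule member_le_sum) auto
      also have "\<dots> \<le> K" using K[of k] by (simp add: frac_form_def L2_inner_frac_laplacian g)
      finally show ?thesis by (simp add: L2_norm_def)
    qed
    have gF: "L2_fourier (fcomp (g k) i) \<in> L2" for k by (intro L2_fourier_L2 fcomp_L2 g')
    have gn: "L2_norm (L2_fourier (fcomp (g k) i)) \<le> L2_norm (g k)" for k
    proof -
      have "L2_inner (fcomp (g k) i) (fcomp (g k) i) \<le> L2_inner (g k) (g k)"
        unfolding L2_inner_fcomp[OF g'(1) g'(1)] by (rule member_le_sum) auto
      then show ?thesis by (simp add: L2_norm_def L2_fourier_Parseval fcomp_L2 g')
    qed
    have "\<forall>\<^sub>F k in sequentially. L2_norm ?W * L2_norm (g k) < e / 2"
      using order_tendstoD(2)[OF tendsto_mult_left[OF lim, of "L2_norm ?W"], of "e/2"] e by simp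
    then obtain N where N: "\<And>k. k \<ge> N \<Longrightarrow> L2_norm ?W * L2_norm (g k) < e / 2"
      by (auto simp: eventually_sequentially)
    have "norm (L2_inner ?U (frac_symbol s (g k) i) - 0) < e" if "k \<ge> N" for k
    proof -
      have "L2_inner ?U (frac_symbol s (g k) i) = L2_inner (\<lambda>\<xi>. ?U \<xi> - ?T R \<xi>) (frac_symbol s (g k) i) + L2_inner (?T R) (frac_symbol s (g k) i)"
        by (simp add: L2_inner_diff_left u' g' T)
      also have "L2_inner (?T R) (frac_symbol s (g k) i) = L2_inner ?W (L2_fourier (fcomp (g k) i))"
        unfolding L2_inner_def frac_symbol_def by (intro Bochner_Integration.integral_cong refl) (simp add: inner_complex_def algebra_simps)
      finally have "\<bar>L2_inner ?U (frac_symbol s (g k) i)\<bar> \<le> \<bar>L2_inner (\<lambda>\<xi>. ?U \<xi> - ?T R \<xi>) (frac_symbol s (g k) i)\<bar> + \<bar>L2_inner ?W (L2_fourier (fcomp (g k) i))\<bar>"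
        by simp
      also have "\<bar>L2_inner (\<lambda>\<xi>. ?U \<xi> - ?T R \<xi>) (frac_symbol s (g k) i)\<bar> \<le> L2_norm (\<lambda>\<xi>. ?U \<xi> - ?T R \<xi>) * L2_norm (frac_symbol s (g k) i)"
        by (intro L2_Cauchy_Schwarz L2_diff u' g' T)
      also have "\<dots> \<le> (e / (2 * (sqrt K + 1))) * sqrt K"
        using R gk[of k] e K0 by (intro mult_mono) auto
      also have "\<dots> \<le> e / 2"
      proof -
        have "(e / (2 * (sqrt K + 1))) * sqrt K = (e / 2) * (sqrt K / (sqrt K + 1))" by simp
        also have "\<dots> \<le> (e / 2) * 1"
          using e K0 by (intro mult_left_mono) (auto simp: divide_le_eq add_nonneg_pos)
        finally show ?thesis by simp
      qed
      also have "\<bar>L2_inner ?W (L2_fourier (fcomp (g k) i))\<bar> \<le> L2_norm ?W * L2_norm (L2_fourier (fcomp (g k) i))"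
        by (intro L2_Cauchy_Schwarz W gF)
      also have "\<dots> \<le> L2_norm ?W * L2_norm (g k)"
        by (intro mult_left_mono gn) simp
      also have "\<dots> < e / 2" using N[OF that] .
      finally show ?thesis by simp
    qed
    then show "\<exists>no. \<forall>k\<ge>no. norm (L2_inner ?U (frac_symbol s (g k) i) - 0) < e" by blast
  qed
  then have "(\<lambda>k. \<Sum>i\<in>UNIV. L2_inner (frac_symbol s u i) (frac_symbol s (g k) i)) \<longlonglongrightarrow> (\<Sum>i\<in>(UNIV :: 'n set). 0)"
    by (intro tendsto_sum)
  then show ?thesis by (simp add: frac_form_def L2_inner_frac_laplacian u g)
qed

section \<open>Compactness\<close>

lemma weakly_converges_L2D:
  assumes "weakly_converges_L2 w u"
  shows "w n \<in> L2" "u \<in> L2" "\<phi> \<in> L2 \<Longrightarrow> (\<lambda>n. L2_inner (w n) \<phi>) \<longlonglongrightarrow> L2_inner u \<phi>"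
  using assms by (auto simp: weakly_converges_L2_def)

text \<open>Testing with \<open>u\<close> cut off to \<open>S\<close> shows that \<open>u\<close>
  has zero norm on \<open>S\<close>.\<close>

lemma weak_limit_support:
  fixes w :: "nat \<Rightarrow> 'a::euclidean_space \<Rightarrow> 'b::euclidean_space"
  assumes weak: "weakly_converges_L2 w u" and S[measurable]: "S \<in> sets borel" and z: "\<And>k x. x \<in> S \<Longrightarrow> w k x = 0"
  shows "AE x in lborel. x \<in> S \<longrightarrow> u x = 0"
proof -
  note W = weakly_converges_L2D[OF weak]
  have [measurable]: "u \<in> borel_measurable borel" using W(2) by (rule L2_measurable)
  let ?\<phi> = "\<lambda>x. indicator S x *\<^sub>R u x"
  have phi: "?\<phi> \<in> L2" by (rule L2_dominated[OF W(2), where c=1]) (auto simp: indicator_def)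
  have "L2_inner (w k) ?\<phi> = (LINT x|(lborel :: 'a measure). 0)" for k
    unfolding L2_inner_def by (intro Bochner_Integration.integral_cong refl) (auto simp: indicator_def z)
  then have "L2_inner u ?\<phi> = 0" using LIMSEQ_unique[OF W(3)[OF phi]] by simp
  moreover have "L2_inner ?\<phi> ?\<phi> = L2_inner u ?\<phi>"
    unfolding L2_inner_def by (intro Bochner_Integration.integral_cong refl) (auto simp: indicator_def)
  ultimately have "AE x in lborel. ?\<phi> x = 0" using L2_inner_eq_0_imp_AE[OF phi] by simp
  then show ?thesis by eventually_elim (auto simp: indicator_def)
qed

text \<open>Since all supports lie in one ball, the plane wave may be truncated to that ball; its
  cosine and sine parts are then admissible test functions, and pairing with them gives the Fourier
  integral.\<close>

lemma weak_fourier_tendsto: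
  fixes w :: "nat \<Rightarrow> 'a::euclidean_space \<Rightarrow> real ^ 'n"
  assumes weak: "weakly_converges_L2 w u" and S: "\<And>k x. norm x > R \<Longrightarrow> w k x = 0"
  shows "(\<lambda>k. fourier_integral (fcomp (w k) i) \<xi>) \<longlonglongrightarrow> fourier_integral (fcomp u i) \<xi>"
proof -
  note W = weakly_converges_L2D[OF weak]
  have Su: "AE x in lborel. norm x > R \<longrightarrow> u x = 0"
    using weak_limit_support[OF weak, of "{x. norm x > R}"] S by simp
  define \<phi> where "\<phi> = (\<lambda>h x::'a. (indicator (cball 0 R) x * h (x \<bullet> \<xi>)) *\<^sub>R (axis i 1 :: real ^ 'n))"
  have phi: "\<phi> h \<in> L2" if h[measurable]: "h \<in> borel_measurable borel" and "\<And>t. \<bar>h t\<bar> \<le> 1" for h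
  proof (rule bounded_support_L2(1))
    show "\<phi> h \<in> borel_measurable borel" unfolding \<phi>_def by measurable
    show "norm (\<phi> h x) \<le> 1" for x using that(2) by (simp add: \<phi>_def norm_axis_1 indicator_def)
    show "\<phi> h x = 0" if "norm x > R" for x using that by (simp add: \<phi>_def)
  qed
  have key: "fourier_integral (fcomp f i) \<xi> = complex_of_real ((2 * pi) powr (- real DIM('a) / 2)) * Complex (L2_inner f (\<phi> cos)) (- L2_inner f (\<phi> sin))"
    if f: "f \<in> L2" and Sf: "AE x in lborel. norm x > R \<longrightarrow> f x = 0" for f
  proof -
    have [measurable]: "f \<in> borel_measurable borel" using f by (rule L2_measurable)
    have [measurable]: "\<phi> cos \<in> borel_measurable borel" "\<phi> sin \<in> borel_measurable borel"
      using L2_measurable[OF phi[of cos]] L2_measurable[OF phi[of sin]] by auto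
    have i: "integrable lborel (\<lambda>x. exp (- \<i> * complex_of_real (x \<bullet> \<xi>)) * fcomp f i x)"
      by (intro fourier_integrand_integrable fcomp_integrable L2_bounded_support_integrable[OF f Sf])
    have e: "exp (- (\<i> * complex_of_real t)) = Complex (cos t) (- sin t)" for t
      by (simp add: complex_eq_iff Re_exp Im_exp)
    have "Re (LINT x|lborel. exp (- \<i> * complex_of_real (x \<bullet> \<xi>)) * fcomp f i x) = (LINT x|lborel. Re (exp (- \<i> * complex_of_real (x \<bullet> \<xi>)) * fcomp f i x))"
      by (rule integral_Re[OF i, symmetric])
    also have "\<dots> = L2_inner f (\<phi> cos)"
      unfolding L2_inner_def
    proof (rule integral_cong_AE)
      show "AE x in lborel. Re (exp (- \<i> * complex_of_real (x \<bullet> \<xi>)) * fcomp f i x) = f x \<bullet> \<phi> cos x"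
        using Sf by eventually_elim (auto simp: e fcomp_def \<phi>_def indicator_def inner_axis)
    qed measurable
    finally have re: "Re (LINT x|lborel. exp (- \<i> * complex_of_real (x \<bullet> \<xi>)) * fcomp f i x) = L2_inner f (\<phi> cos)" .
    have "Im (LINT x|lborel. exp (- \<i> * complex_of_real (x \<bullet> \<xi>)) * fcomp f i x) = (LINT x|lborel. Im (exp (- \<i> * complex_of_real (x \<bullet> \<xi>)) * fcomp f i x))"
      by (rule integral_Im[OF i, symmetric])
    also have "\<dots> = (LINT x|lborel. - (f x \<bullet> \<phi> sin x))"
    proof (rule integral_cong_AE)
      show "AE x in lborel. Im (exp (- \<i> * complex_of_real (x \<bullet> \<xi>)) * fcomp f i x) = - (f x \<bullet> \<phi> sin x)"
        using Sf by eventually_elim (auto simp: e fcomp_def \<phi>_def indicator_def inner_axis)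
    qed measurable
    also have "\<dots> = - L2_inner f (\<phi> sin)" by (simp add: L2_inner_def)
    finally show ?thesis unfolding fourier_integral_def using re by (simp add: complex_eq_iff)
  qed
  have "(\<lambda>k. complex_of_real ((2 * pi) powr (- real DIM('a) / 2)) * Complex (L2_inner (w k) (\<phi> cos)) (- L2_inner (w k) (\<phi> sin)))
    \<longlonglongrightarrow> complex_of_real ((2 * pi) powr (- real DIM('a) / 2)) * Complex (L2_inner u (\<phi> cos)) (- L2_inner u (\<phi> sin))"
    by (intro tendsto_intros tendsto_Complex W(3) phi) auto
  moreover have "AE x in lborel. norm x > R \<longrightarrow> w k x = 0" for k using S by auto
  ultimately show ?thesis using key[OF W(1)] key[OF W(2) Su] by simp
qed

lemma integrable_indicator_cball: "integrable lborel (\<lambda>x::'a::euclidean_space. indicator (cball a R) x * c :: real)"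
  using emeasure_lborel_cball_finite[of a R] by (intro integrable_mult_left) simp

text \<open>Weak convergence with uniformly bounded supports is pointwise convergence of the Fourier
  transforms; the bound on the fractional energy controls the high frequencies.\<close>

theorem weak_limit_frac_space:
  fixes w :: "nat \<Rightarrow> 'a::euclidean_space \<Rightarrow> real ^ 'n"
  assumes s: "0 < s" "s < 1" and weak: "weakly_converges_L2 w u"
    and w: "\<And>k. w k \<in> frac_space s" and K: "\<And>k. frac_form s (w k) (w k) \<le> K"
    and S: "\<And>k x. norm x > R \<Longrightarrow> w k x = 0" and B: "\<And>k x. norm (w k x) \<le> B"
  shows "u \<in> frac_space s" and "(\<lambda>k. L2_norm (\<lambda>x. w k x - u x)) \<longlonglongrightarrow> 0"
proof -
  note W = weakly_converges_L2D[OF weak]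
  note w' = frac_spaceD[OF w]
  have [measurable]: "u \<in> borel_measurable borel" "\<And>k. w k \<in> borel_measurable borel"
    using W by (auto dest: L2_measurable)
  have Su: "AE x in lborel. norm x > R \<longrightarrow> u x = 0"
    using weak_limit_support[OF weak, of "{x. norm x > R}"] S by simp
  have ui: "integrable lborel u" by (rule L2_bounded_support_integrable[OF W(2) Su])
  have four: "AE \<xi> in lborel. L2_fourier (fcomp (w k) i) \<xi> = fourier_integral (fcomp (w k) i) \<xi>" for k i
    by (intro L2_fourier_eq_fourier_integral fcomp_L2 fcomp_integrable w')
  have four_u: "AE \<xi> in lborel. L2_fourier (fcomp u i) \<xi> = fourier_integral (fcomp u i) \<xi>" for i
    by (intro L2_fourier_eq_fourier_integral fcomp_L2 fcomp_integrable W ui)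
  have lim: "AE \<xi> in lborel. (\<lambda>k. frac_symbol s (w k) i \<xi>) \<longlonglongrightarrow> frac_symbol s u i \<xi>" for i
  proof -
    have "AE \<xi> in lborel. \<forall>k. L2_fourier (fcomp (w k) i) \<xi> = fourier_integral (fcomp (w k) i) \<xi>"
      using four by (simp add: AE_all_countable)
    then show ?thesis using four_u[of i]
    proof eventually_elim
      case (elim \<xi>)
      then show ?case unfolding frac_symbol_def
        using weak_fourier_tendsto[OF weak S, of R i \<xi>] by (auto intro!: tendsto_intros)
    qed
  qed
  have sym_le: "L2_inner (frac_symbol s f i) (frac_symbol s f i) \<le> frac_form s f f" if "f \<in> frac_space s" for f :: "'a \<Rightarrow> real ^ 'n" and i
    unfolding frac_form_def L2_inner_frac_laplacian[OF that that] by (rule member_le_sum) auto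
  show u: "u \<in> frac_space s"
  proof (rule frac_spaceI[OF W(2) ui])
    fix i
    have [measurable]: "frac_symbol s u i \<in> borel_measurable borel" "\<And>k. frac_symbol s (w k) i \<in> borel_measurable borel"
      by (intro frac_symbol_measurable W)+
    \<comment> \<open>Fatou's lemma on the Fourier side: pointwise convergence of the symbols gives
      lower semicontinuity of the energy.\<close>
    have "(\<integral>\<^sup>+ x. ennreal ((norm (frac_symbol s u i x))\<^sup>2) \<partial>lborel) = (\<integral>\<^sup>+ x. liminf (\<lambda>k. ennreal ((norm (frac_symbol s (w k) i x))\<^sup>2)) \<partial>lborel)"
    proof (rule nn_integral_cong_AE, use lim[of i] in eventually_elim)
      fix x assume "(\<lambda>k. frac_symbol s (w k) i x) \<longlonglongrightarrow> frac_symbol s u i x"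
      then have "(\<lambda>k. ennreal ((norm (frac_symbol s (w k) i x))\<^sup>2)) \<longlonglongrightarrow> ennreal ((norm (frac_symbol s u i x))\<^sup>2)"
        by (intro tendsto_intros)
      then show "ennreal ((norm (frac_symbol s u i x))\<^sup>2) = liminf (\<lambda>k. ennreal ((norm (frac_symbol s (w k) i x))\<^sup>2))"
        by (rule lim_imp_Liminf[OF sequentially_bot, symmetric])
    qed
    also have "\<dots> \<le> liminf (\<lambda>k. \<integral>\<^sup>+ x. ennreal ((norm (frac_symbol s (w k) i x))\<^sup>2) \<partial>lborel)"
      by (rule nn_integral_liminf) measurable
    also have "\<dots> \<le> limsup (\<lambda>k. \<integral>\<^sup>+ x. ennreal ((norm (frac_symbol s (w k) i x))\<^sup>2) \<partial>lborel)"
      by (rule Liminf_le_Limsup) simp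
    also have "\<dots> \<le> ennreal K"
    proof (rule Limsup_bounded, intro always_eventually allI)
      fix k
      show "(\<integral>\<^sup>+ x. ennreal ((norm (frac_symbol s (w k) i x))\<^sup>2) \<partial>lborel) \<le> ennreal K"
        using order_trans[OF sym_le[OF w] K] by (simp add: nn_integral_L2_norm w' ennreal_leI)
    qed
    finally have fin: "(\<integral>\<^sup>+ x. ennreal ((norm (frac_symbol s u i x))\<^sup>2) \<partial>lborel) \<le> ennreal K" .
    show "frac_symbol s u i \<in> L2"
      by (rule L2I_nn_integral) (use fin in \<open>auto intro: order.strict_trans1\<close>)
  qed
  define d where "d = (\<lambda>k x. w k x - u x)"
  have d: "d k \<in> frac_space s" for k unfolding d_def by (rule frac_space_diff[OF w u])
  note d' = frac_spaceD[OF d]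
  have [measurable]: "\<And>k. d k \<in> borel_measurable borel" using d'(1) by (auto dest: L2_measurable)
  \<comment> \<open>A bound for the energy of \<open>w k - u\<close>, from expanding the square and
    Cauchy-Schwarz.\<close>
  define E where "E = (sqrt K + sqrt (frac_form s u u))\<^sup>2"
  have K0: "0 \<le> K" using K[of 0] frac_form_self_nonneg order_trans by blast
  have E: "frac_form s (d k) (d k) \<le> E" for k
  proof -
    have "frac_form s (d k) (d k) = frac_form s (w k) (w k) - 2 * frac_form s (w k) u + frac_form s u u"
      using frac_form_commute[of s u "w k"]
      by (simp add: d_def frac_form_diff_left frac_form_diff_right w u frac_space_diff)
    also have "\<dots> \<le> K + 2 * (sqrt K * sqrt (frac_form s u u)) + frac_form s u u"
    proof -
      have "\<bar>frac_form s (w k) u\<bar> \<le> sqrt (frac_form s (w k) (w k)) * sqrt (frac_form s u u)"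
        by (rule frac_form_Cauchy_Schwarz[OF w u])
      also have "\<dots> \<le> sqrt K * sqrt (frac_form s u u)"
        by (intro mult_right_mono) (simp_all add: K)
      finally show ?thesis using K[of k] by linarith
    qed
    also have "\<dots> = E" using K0 by (simp add: E_def power2_sum)
    finally show ?thesis .
  qed
  have comp: "(\<lambda>k. L2_inner (fcomp (d k) i) (fcomp (d k) i)) \<longlonglongrightarrow> 0" for i
  proof (rule LIMSEQ_I)
    fix e :: real assume e: "e > 0"
    define F where "F = (\<lambda>k. fourier_integral (fcomp (d k) i))"
    have Fd: "AE \<xi> in lborel. L2_fourier (fcomp (d k) i) \<xi> = F k \<xi>" for k
      unfolding F_def by (intro L2_fourier_eq_fourier_integral fcomp_L2 fcomp_integrable d')
    have F2: "F k \<in> L2" for k unfolding F_def by (intro fourier_integral_L2 fcomp_L2 fcomp_integrable d')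
    then have [measurable]: "F k \<in> borel_measurable borel" for k by (rule L2_measurable)
    have Flim: "(\<lambda>k. F k \<xi>) \<longlonglongrightarrow> 0" for \<xi>
    proof -
      have "F k \<xi> = fourier_integral (fcomp (w k) i) \<xi> - fourier_integral (fcomp u i) \<xi>" for k
        unfolding F_def d_def fcomp_diff by (intro fourier_integral_diff fcomp_integrable w' ui)
      then show ?thesis using weak_fourier_tendsto[OF weak S, of R i \<xi>] by (simp add: LIM_zero)
    qed
    \<comment> \<open>The bound \<open>B\<close> and the common ball control the integrals of
      \<open>norm (w k x)\<close>, hence the transforms uniformly in \<open>k\<close> and \<xi>. On
      a ball of frequencies this is the majorant for the pointwise convergence
      \<open>Flim\<close>.\<close>
    define M where "M = (2 * pi) powr (- real DIM('a) / 2) * (B * measure lborel (cball (0::'a) R) + (LINT x|lborel. norm (u x)))"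
    have FM: "norm (F k \<xi>) \<le> M" for k \<xi>
    proof -
      have "norm (F k \<xi>) \<le> (2 * pi) powr (- real DIM('a) / 2) * (LINT x|lborel. norm (fcomp (d k) i x))"
        unfolding F_def by (rule fourier_integral_bound)
      also have "(LINT x|lborel. norm (fcomp (d k) i x)) \<le> (LINT x|lborel. indicator (cball 0 R) x * B + norm (u x))"
      proof (rule integral_mono)
        show "norm (fcomp (d k) i x) \<le> indicator (cball 0 R) x * B + norm (u x)" for x
        proof -
          have "norm (fcomp (d k) i x) \<le> norm (w k x) + norm (u x)"
            using norm_fcomp_le[of "d k" i x] norm_triangle_ineq4[of "w k x" "u x"] by (simp add: d_def)
          moreover have "norm (w k x) \<le> indicator (cball 0 R) x * B"
            using B[of k x] S[of x k] by (auto simp: indicator_def)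
          ultimately show ?thesis by simp
        qed
        show "integrable lborel (\<lambda>x. norm (fcomp (d k) i x))" by (intro integrable_norm fcomp_integrable d')
        show "integrable lborel (\<lambda>x. indicator (cball 0 R) x * B + norm (u x))"
          by (intro Bochner_Integration.integrable_add integrable_indicator_cball integrable_norm ui)
      qed
      also have "\<dots> = B * measure lborel (cball (0::'a) R) + (LINT x|lborel. norm (u x))"
        using integrable_indicator_cball[of "0::'a" R B] integrable_norm[OF ui] by simp
      finally show ?thesis by (simp add: M_def mult_left_mono)
    qed
    \<comment> \<open>Frequencies beyond \<rho> contribute at most
      \<open>\<rho> powr (- 2 * s)\<close> times the energy; the rest lives on a ball of finite
      measure.\<close>
    obtain \<rho> where r: "\<rho> > 0" "E * \<rho> powr (- 2 * s) < e / 2"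
    proof -
      have "((\<lambda>\<rho>. E * \<rho> powr (- 2 * s)) \<longlongrightarrow> E * 0) at_top"
        using s by (intro tendsto_intros tendsto_neg_powr filterlim_ident) auto
      then have "\<forall>\<^sub>F \<rho> in at_top. E * \<rho> powr (- 2 * s) < e / 2"
        using e by (intro order_tendstoD(2)) auto
      then show thesis
        using that eventually_happens'[OF trivial_limit_at_top_linorder eventually_conj[OF _ eventually_gt_at_top[of 0]]] by auto
    qed
    have low: "(\<lambda>k. LINT \<xi>|lborel. indicator (cball 0 \<rho>) \<xi> * (norm (F k \<xi>))\<^sup>2) \<longlonglongrightarrow> (LINT \<xi>|(lborel :: 'a measure). 0)"
    proof (rule integral_dominated_convergence[OF _ _ integrable_indicator_cball[of 0 \<rho> "M\<^sup>2"]])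
      show "AE \<xi> in lborel. (\<lambda>k. indicator (cball 0 \<rho>) \<xi> * (norm (F k \<xi>))\<^sup>2) \<longlonglongrightarrow> 0"
      proof (rule AE_I2)
        fix \<xi>
        have "(\<lambda>k. indicator (cball 0 \<rho>) \<xi> * (norm (F k \<xi>))\<^sup>2) \<longlonglongrightarrow> indicator (cball 0 \<rho>) \<xi> * (norm (0::complex))\<^sup>2"
          by (intro tendsto_intros Flim)
        then show "(\<lambda>k. indicator (cball 0 \<rho>) \<xi> * (norm (F k \<xi>))\<^sup>2) \<longlonglongrightarrow> 0" by simp
      qed
      show "AE \<xi> in lborel. norm (indicator (cball 0 \<rho>) \<xi> * (norm (F k \<xi>))\<^sup>2) \<le> indicator (cball 0 \<rho>) \<xi> * M\<^sup>2" for k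
        using FM by (auto intro!: AE_I2 power_mono simp: indicator_def)
    qed measurable
    then obtain N where N: "\<And>k. k \<ge> N \<Longrightarrow> norm ((LINT \<xi>|lborel. indicator (cball 0 \<rho>) \<xi> * (norm (F k \<xi>))\<^sup>2) - 0) < e / 2"
      using LIMSEQ_D[OF low, of "e/2"] e by auto
    have "norm (L2_inner (fcomp (d k) i) (fcomp (d k) i) - 0) < e" if "k \<ge> N" for k
    proof -
      have i1: "integrable lborel (\<lambda>\<xi>. indicator (cball 0 \<rho>) \<xi> * (norm (F k \<xi>))\<^sup>2)"
        by (rule Bochner_Integration.integrable_bound[OF L2_integrable_sq[OF F2]]) (auto simp: indicator_def)
      have i2: "integrable lborel (\<lambda>\<xi>. (norm (frac_symbol s (d k) i \<xi>))\<^sup>2)"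
        by (rule L2_integrable_sq[OF d'(3)])
      have "L2_inner (fcomp (d k) i) (fcomp (d k) i) = L2_inner (F k) (F k)"
        unfolding F_def by (intro L2_inner_fourier_integral[symmetric] fcomp_L2 fcomp_integrable d')
      also have "\<dots> \<le> (LINT \<xi>|lborel. indicator (cball 0 \<rho>) \<xi> * (norm (F k \<xi>))\<^sup>2 + \<rho> powr (- 2 * s) * (norm (frac_symbol s (d k) i \<xi>))\<^sup>2)"
        unfolding L2_inner_self
      proof (rule integral_mono_AE)
        show "AE \<xi> in lborel. (norm (F k \<xi>))\<^sup>2 \<le> indicator (cball 0 \<rho>) \<xi> * (norm (F k \<xi>))\<^sup>2 + \<rho> powr (- 2 * s) * (norm (frac_symbol s (d k) i \<xi>))\<^sup>2"
          using Fd[of k]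
        proof eventually_elim
          case (elim \<xi>)
          show ?case
          proof (cases "norm \<xi> \<le> \<rho>")
            case False
            have "\<rho> powr (2 * s) \<le> norm \<xi> powr (2 * s)" using False r s by (intro powr_mono2) auto
            then have "\<rho> powr (- 2 * s) * \<rho> powr (2 * s) \<le> \<rho> powr (- 2 * s) * norm \<xi> powr (2 * s)"
              by (rule mult_left_mono) simp
            then have "1 \<le> \<rho> powr (- 2 * s) * norm \<xi> powr (2 * s)" using r by (simp flip: powr_add)
            then have "1 * (norm (F k \<xi>))\<^sup>2 \<le> (\<rho> powr (- 2 * s) * norm \<xi> powr (2 * s)) * (norm (F k \<xi>))\<^sup>2"
              by (rule mult_right_mono) simp
            then show ?thesis using False elim by (simp add: norm_frac_symbol_square mult_ac)
          qed simp
        qed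
        show "integrable lborel (\<lambda>\<xi>. indicator (cball 0 \<rho>) \<xi> * (norm (F k \<xi>))\<^sup>2 + \<rho> powr (- 2 * s) * (norm (frac_symbol s (d k) i \<xi>))\<^sup>2)"
          by (intro Bochner_Integration.integrable_add i1 integrable_mult_right i2)
      qed (rule L2_integrable_sq[OF F2])
      also have "\<dots> = (LINT \<xi>|lborel. indicator (cball 0 \<rho>) \<xi> * (norm (F k \<xi>))\<^sup>2) + \<rho> powr (- 2 * s) * L2_inner (frac_symbol s (d k) i) (frac_symbol s (d k) i)"
        unfolding L2_inner_self using i1 i2 by simp
      also have "\<dots> < e / 2 + e / 2"
      proof (rule add_strict_mono)
        show "(LINT \<xi>|lborel. indicator (cball 0 \<rho>) \<xi> * (norm (F k \<xi>))\<^sup>2) < e / 2" using N[OF that] by simp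
        have "\<rho> powr (- 2 * s) * L2_inner (frac_symbol s (d k) i) (frac_symbol s (d k) i) \<le> \<rho> powr (- 2 * s) * E"
          using order_trans[OF sym_le[OF d] E] by (intro mult_left_mono) auto
        also have "\<dots> < e / 2" using r(2) by (simp add: mult.commute)
        finally show "\<rho> powr (- 2 * s) * L2_inner (frac_symbol s (d k) i) (frac_symbol s (d k) i) < e / 2" .
      qed
      finally show ?thesis by simp
    qed
    then show "\<exists>no. \<forall>k\<ge>no. norm (L2_inner (fcomp (d k) i) (fcomp (d k) i) - 0) < e" by blast
  qed
  have "(\<lambda>k. L2_inner (d k) (d k)) \<longlonglongrightarrow> (\<Sum>i\<in>(UNIV :: 'n set). 0)"
    unfolding L2_inner_fcomp[OF d'(1) d'(1)] by (intro tendsto_sum comp)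
  then have "(\<lambda>k. sqrt (L2_inner (d k) (d k))) \<longlonglongrightarrow> sqrt 0" by (intro tendsto_real_sqrt) simp
  then show "(\<lambda>k. L2_norm (\<lambda>x. w k x - u x)) \<longlonglongrightarrow> 0" by (simp add: L2_norm_def d_def)
qed

section \<open>Skew test fields\<close>

text \<open>Three comparison fields because the expressions to be controlled, \<open>wedge\<close>
  and \<open>(w j x \<bullet> u x) *\<^sub>R v x\<close>, are trilinear; the 3 comes from squaring a
  sum of three terms.\<close>

lemma frac_space_dominated:
  fixes h :: "'a::euclidean_space \<Rightarrow> real ^ 'n"
  assumes s: "0 < s" "s < 1" and h: "h \<in> L2" "integrable lborel h"
    and f: "f1 \<in> frac_space s" "f2 \<in> frac_space s" "f3 \<in> frac_space s" and A: "0 \<le> A"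
    and le: "\<And>x y. norm (shift_diff y h x) \<le> A * (norm (shift_diff y f1 x) + norm (shift_diff y f2 x) + norm (shift_diff y f3 x))"
  shows "h \<in> frac_space s" "frac_form s h h \<le> 3 * A\<^sup>2 * (frac_form s f1 f1 + frac_form s f2 f2 + frac_form s f3 f3)"
proof -
  let ?E = "\<lambda>f p. gag_weight s p * L2_inner (shift_diff (gag_shift p) f) (shift_diff (gag_shift p) f)"
  have [measurable]: "h \<in> borel_measurable borel" using h(1) by (rule L2_measurable)
  note D = frac_spaceD(1)[OF f(1)] frac_spaceD(1)[OF f(2)] frac_spaceD(1)[OF f(3)]
  note S = D[THEN L2_shift_diff]
  have le2: "L2_inner (shift_diff y h) (shift_diff y h) \<le> 3 * A\<^sup>2 * (L2_inner (shift_diff y f1) (shift_diff y f1) + L2_inner (shift_diff y f2) (shift_diff y f2) + L2_inner (shift_diff y f3) (shift_diff y f3))" for y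
  proof -
    have i: "integrable lborel (\<lambda>x. (norm (shift_diff y f1 x))\<^sup>2)" "integrable lborel (\<lambda>x. (norm (shift_diff y f2 x))\<^sup>2)"
      "integrable lborel (\<lambda>x. (norm (shift_diff y f3 x))\<^sup>2)" by (intro L2_integrable_sq S)+
    have "L2_inner (shift_diff y h) (shift_diff y h) \<le> (LINT x|lborel. 3 * A\<^sup>2 * ((norm (shift_diff y f1 x))\<^sup>2 + (norm (shift_diff y f2 x))\<^sup>2 + (norm (shift_diff y f3 x))\<^sup>2))"
      unfolding L2_inner_self
    proof (rule integral_mono)
      show "integrable lborel (\<lambda>x. (norm (shift_diff y h x))\<^sup>2)" by (intro L2_integrable_sq L2_shift_diff h)
      show "integrable lborel (\<lambda>x. 3 * A\<^sup>2 * ((norm (shift_diff y f1 x))\<^sup>2 + (norm (shift_diff y f2 x))\<^sup>2 + (norm (shift_diff y f3 x))\<^sup>2))"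
        by (intro integrable_mult_right Bochner_Integration.integrable_add i)
      fix x
      let ?a = "norm (shift_diff y f1 x)" and ?b = "norm (shift_diff y f2 x)" and ?c = "norm (shift_diff y f3 x)"
      have "(norm (shift_diff y h x))\<^sup>2 \<le> (A * (?a + ?b + ?c))\<^sup>2"
        using le[of y x] by (intro power_mono) auto
      also have "\<dots> = A\<^sup>2 * (?a + ?b + ?c)\<^sup>2" by (rule power_mult_distrib)
      also have "\<dots> \<le> A\<^sup>2 * (3 * (?a\<^sup>2 + ?b\<^sup>2 + ?c\<^sup>2))"
      proof (rule mult_left_mono)
        have "0 \<le> (?a - ?b)\<^sup>2 + (?b - ?c)\<^sup>2 + (?a - ?c)\<^sup>2" by simp
        then show "(?a + ?b + ?c)\<^sup>2 \<le> 3 * (?a\<^sup>2 + ?b\<^sup>2 + ?c\<^sup>2)"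
          by (simp add: power2_eq_square algebra_simps)
      qed simp
      finally show "(norm (shift_diff y h x))\<^sup>2 \<le> 3 * A\<^sup>2 * (?a\<^sup>2 + ?b\<^sup>2 + ?c\<^sup>2)" by (simp only: mult_ac)
    qed
    also have "\<dots> = 3 * A\<^sup>2 * (L2_inner (shift_diff y f1) (shift_diff y f1) + L2_inner (shift_diff y f2) (shift_diff y f2) + L2_inner (shift_diff y f3) (shift_diff y f3))"
      unfolding L2_inner_self using i by simp
    finally show ?thesis .
  qed
  have leE: "?E h p \<le> 3 * A\<^sup>2 * (?E f1 p + ?E f2 p + ?E f3 p)" for p
    using mult_left_mono[OF le2 gag_weight_nonneg] by (simp add: algebra_simps)
  have iE: "integrable lborel (\<lambda>p. 3 * A\<^sup>2 * (?E f1 p + ?E f2 p + ?E f3 p))"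
    by (intro integrable_mult_right Bochner_Integration.integrable_add gag_self_integrable s f)
  have "(\<integral>\<^sup>+p. ennreal (?E h p) \<partial>lborel) \<le> (\<integral>\<^sup>+p. ennreal (3 * A\<^sup>2 * (?E f1 p + ?E f2 p + ?E f3 p)) \<partial>lborel)"
    by (intro nn_integral_mono ennreal_leI leE)
  also have "\<dots> < \<infinity>"
    by (subst nn_integral_eq_integral[OF iE]) auto
  finally show hf: "h \<in> frac_space s" by (subst frac_space_iff[OF s h])
  have "gag_const s TYPE('a) * frac_form s h h = (LINT p|lborel. ?E h p)"
    by (rule gag_form[OF s hf hf, symmetric])
  also have "\<dots> \<le> (LINT p|lborel. 3 * A\<^sup>2 * (?E f1 p + ?E f2 p + ?E f3 p))"
    by (intro integral_mono gag_self_integrable s hf iE leE)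
  also have "\<dots> = 3 * A\<^sup>2 * ((LINT p|lborel. ?E f1 p) + (LINT p|lborel. ?E f2 p) + (LINT p|lborel. ?E f3 p))"
    using gag_self_integrable[OF s f(1)] gag_self_integrable[OF s f(2)] gag_self_integrable[OF s f(3)] by simp
  also have "\<dots> = gag_const s TYPE('a) * (3 * A\<^sup>2 * (frac_form s f1 f1 + frac_form s f2 f2 + frac_form s f3 f3))"
    by (simp add: gag_form[OF s] f algebra_simps)
  finally show "frac_form s h h \<le> 3 * A\<^sup>2 * (frac_form s f1 f1 + frac_form s f2 f2 + frac_form s f3 f3)"
    using gag_const(2)[OF s, where 'a='a] by simp
qed

text \<open>The skew-symmetric matrix a b^T - b a^T applied to \<open>z\<close>, that is, an
  infinitesimal rotation, which is tangent at \<open>z\<close> to the sphere through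
  \<open>z\<close>.\<close>

definition wedge :: "'b::real_inner \<Rightarrow> 'b \<Rightarrow> 'b \<Rightarrow> 'b" where
  "wedge a b z = (b \<bullet> z) *\<^sub>R a - (a \<bullet> z) *\<^sub>R b"

lemma inner_wedge_self[simp]: "z \<bullet> wedge a b z = 0"
  by (simp add: wedge_def inner_diff_right inner_commute)

lemma wedge_zero[simp]: "wedge 0 b z = 0" "wedge a 0 z = 0" "wedge a b 0 = 0"
  by (simp_all add: wedge_def)

lemma wedge_diff:
  "wedge (a - a') b z = wedge a b z - wedge a' b z"
  "wedge a (b - b') z = wedge a b z - wedge a b' z"
  "wedge a b (z - z') = wedge a b z - wedge a b z'"
  by (simp_all add: wedge_def inner_diff_left inner_diff_right algebra_simps)

lemma norm_wedge_le: "norm (wedge a b z) \<le> 2 * norm a * norm b * norm z"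
proof -
  have "norm (wedge a b z) \<le> \<bar>b \<bullet> z\<bar> * norm a + \<bar>a \<bullet> z\<bar> * norm b"
    unfolding wedge_def using norm_triangle_ineq4[of "(b \<bullet> z) *\<^sub>R a" "(a \<bullet> z) *\<^sub>R b"] by simp
  also have "\<dots> \<le> (norm b * norm z) * norm a + (norm a * norm z) * norm b"
    by (intro add_mono mult_right_mono Cauchy_Schwarz_ineq2) auto
  finally show ?thesis by (simp add: mult_ac)
qed

lemma wedge_measurable[measurable]:
  fixes f g h :: "'a \<Rightarrow> 'b::euclidean_space"
  assumes [measurable]: "f \<in> borel_measurable M" "g \<in> borel_measurable M" "h \<in> borel_measurable M"
  shows "(\<lambda>x. wedge (f x) (g x) (h x)) \<in> borel_measurable M"
  unfolding wedge_def by measurable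

text \<open>Telescoping in the three arguments. The last one has its own bound \<open>B'\<close>,
  later instantiated by pointwise quantities such as \<open>norm (w k x)\<close> or
  \<open>norm (u x - u y)\<close>.\<close>

lemma norm_wedge_diff_le:
  assumes "norm a \<le> B" "norm b' \<le> B" "norm b \<le> B" "norm z' \<le> B'" "norm a' \<le> B" "norm z \<le> B'"
  shows "norm (wedge a' b' z' - wedge a b z) \<le> 2 * B * B' * norm (a' - a) + 2 * B * B' * norm (b' - b) + 2 * B * B * norm (z' - z)"
proof -
  have B: "0 \<le> B" "0 \<le> B'" using assms norm_ge_zero order_trans by blast+
  have "wedge a' b' z' - wedge a b z = wedge (a' - a) b' z' + wedge a (b' - b) z' + wedge a b (z' - z)"
    by (simp add: wedge_diff)
  then have "norm (wedge a' b' z' - wedge a b z) \<le> norm (wedge (a' - a) b' z') + norm (wedge a (b' - b) z') + norm (wedge a b (z' - z))"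
    by (metis norm_triangle_mono norm_triangle_ineq order_refl)
  also have "\<dots> \<le> 2 * norm (a' - a) * B * B' + 2 * B * norm (b' - b) * B' + 2 * B * B * norm (z' - z)"
    using assms B by (intro add_mono order_trans[OF norm_wedge_le] mult_mono) auto
  finally show ?thesis by (simp add: mult_ac)
qed

lemma wedge_frac_space:
  fixes v p z :: "'a::euclidean_space \<Rightarrow> real ^ 'n"
  assumes s: "0 < s" "s < 1" and f: "v \<in> frac_space s" "p \<in> frac_space s" "z \<in> frac_space s"
    and B: "\<And>x. norm (v x) \<le> B" "\<And>x. norm (p x) \<le> B" "\<And>x. norm (z x) \<le> B"
    and S: "\<And>x. norm x > R \<Longrightarrow> v x = 0"
  shows "(\<lambda>x. wedge (v x) (p x) (z x)) \<in> frac_space s"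
proof -
  have B0: "0 \<le> B" using B(1)[of 0] norm_ge_zero order_trans by blast
  have [measurable]: "v \<in> borel_measurable borel" "p \<in> borel_measurable borel" "z \<in> borel_measurable borel"
    using f by (auto dest: frac_spaceD(1) L2_measurable)
  have bd: "norm (wedge (v x) (p x) (z x)) \<le> 2 * B * B * B" for x
    by (rule order_trans[OF norm_wedge_le]) (use B[of x] B0 in \<open>auto intro!: mult_mono\<close>)
  have m: "(\<lambda>x. wedge (v x) (p x) (z x)) \<in> borel_measurable borel" by measurable
  have b: "(\<lambda>x. wedge (v x) (p x) (z x)) \<in> L2" "integrable lborel (\<lambda>x. wedge (v x) (p x) (z x))"
    using bounded_support_L2[OF m bd, of R] S by auto
  show ?thesis
  proof (rule frac_space_dominated(1)[OF s b f, of "2 * B * B"])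
    fix x y
    show "norm (shift_diff y (\<lambda>x. wedge (v x) (p x) (z x)) x) \<le> 2 * B * B * (norm (shift_diff y v x) + norm (shift_diff y p x) + norm (shift_diff y z x))"
      unfolding shift_diff_def
      using norm_wedge_diff_le[of "v x" B "p (x + y)" "p x" "z (x + y)" B "v (x + y)" "z x"] B
      by (simp add: algebra_simps)
  qed (use B0 in auto)
qed

text \<open>The two factors of the skew form, one of Lipschitz type and one of order
  \<open>\<tau> powr s\<close>, reduce the weight to
  \<open>\<tau> powr (- 1 - s) * min 1 \<tau>\<close>, which is integrable exactly as needed for
  \<open>0 < s < 1\<close>.\<close>

lemma gag_weight_powr_min_bound:
  fixes p :: "real \<times> 'a::euclidean_space"
  assumes "B \<ge> 0" "L \<ge> 0" and s: "0 < s" "s < 1"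
  shows "gag_weight s p * (min B (L * norm (gag_shift p)) * norm (gag_shift p) powr s) \<le> (B + L) * gag_dominant s 1 p"
proof (cases "fst p > 0")
  case True
  define t w where "t = fst p" and "w = snd p"
  have t: "t > 0" using True by (simp add: t_def)
  have "min B (L * norm (gag_shift p)) \<le> (B + L) * min 1 t * (1 + norm w)"
    unfolding t_def w_def by (rule min_gag_shift_le[OF assms(1,2) True])
  moreover have "norm (gag_shift p) powr s \<le> t powr s * (1 + norm w)"
  proof -
    have "norm w powr s \<le> (1 + norm w) powr s" using s by (intro powr_mono2) auto
    also have "\<dots> \<le> (1 + norm w) powr 1" using s by (intro powr_mono) auto
    also have "\<dots> = 1 + norm w" by simp
    finally have "t powr s * norm w powr s \<le> t powr s * (1 + norm w)" by (rule mult_left_mono) simp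
    moreover have "norm (gag_shift p) powr s = t powr s * norm w powr s"
      using t by (simp add: gag_shift_def t_def w_def powr_mult)
    ultimately show ?thesis by simp
  qed
  ultimately have "min B (L * norm (gag_shift p)) * norm (gag_shift p) powr s \<le> ((B + L) * min 1 t * (1 + norm w)) * (t powr s * (1 + norm w))"
    using assms t by (intro mult_mono) auto
  then have "gag_weight s p * (min B (L * norm (gag_shift p)) * norm (gag_shift p) powr s) \<le>
      gag_weight s p * (((B + L) * min 1 t * (1 + norm w)) * (t powr s * (1 + norm w)))"
    by (rule mult_left_mono) simp
  also have "\<dots> = (B + L) * ((t powr (- 1 - 2 * s) * t powr s) * min 1 t) * (exp (- (norm w)\<^sup>2 / 2) * (1 + norm w)\<^sup>2)"
    using True by (simp add: gag_weight_def t_def w_def power2_eq_square mult_ac)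
  also have "t powr (- 1 - 2 * s) * t powr s = t powr (- 1 - s)"
    by (simp flip: powr_add add: algebra_simps)
  also have "(B + L) * (t powr (- 1 - s) * min 1 t) * (exp (- (norm w)\<^sup>2 / 2) * (1 + norm w)\<^sup>2) = (B + L) * gag_dominant s 1 p"
    using t by (simp add: gag_dominant_def t_def w_def mult_ac)
  finally show ?thesis .
qed (simp add: gag_weight_def gag_dominant_def)

text \<open>Since \<^const>\<open>wedge\<close> is skew in its last argument, the difference quotient of \<open>w\<close> never meets itself
  in the integrand below: one factor falls on the Lipschitz fields \<open>v, p\<close>, which leaves an
  integrable majorant and reduces weak convergence to strong \<open>L\<^sup>2\<close> convergence.\<close>

lemma wedge_form_tendsto:
  fixes w :: "nat \<Rightarrow> 'a::euclidean_space \<Rightarrow> real ^ 'n"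
  assumes s: "0 < s" "s < 1"
    and w: "\<And>k. w k \<in> frac_space s" and K: "\<And>k. frac_form s (w k) (w k) \<le> K" and u: "u \<in> frac_space s"
    and lim: "(\<lambda>k. L2_norm (\<lambda>x. w k x - u x)) \<longlonglongrightarrow> 0"
    and v: "L-lipschitz_on UNIV v" "\<And>x. norm (v x) \<le> B" and p: "L-lipschitz_on UNIV p" "\<And>x. norm (p x) \<le> B"
    and \<Phi>w: "\<And>k. (\<lambda>x. wedge (v x) (p x) (w k x)) \<in> frac_space s" and \<Phi>u: "(\<lambda>x. wedge (v x) (p x) (u x)) \<in> frac_space s"
  shows "(\<lambda>k. frac_form s (w k) (\<lambda>x. wedge (v x) (p x) (w k x))) \<longlonglongrightarrow> frac_form s u (\<lambda>x. wedge (v x) (p x) (u x))"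
proof -
  let ?\<Phi> = "\<lambda>f x. wedge (v x) (p x) (f x)"
  note w' = frac_spaceD(1)[OF w] and u' = frac_spaceD(1)[OF u] and \<Phi>w' = frac_spaceD(1)[OF \<Phi>w] and \<Phi>u' = frac_spaceD(1)[OF \<Phi>u]
  have B0: "0 \<le> B" using v(2)[of 0] norm_ge_zero order_trans by blast
  have L0: "0 \<le> L" using lipschitz_on_nonneg[OF v(1)] .
  have K0: "0 \<le> K" using K[of 0] frac_form_self_nonneg order_trans by blast
  have [measurable]: "v \<in> borel_measurable borel" "p \<in> borel_measurable borel"
    using lipschitz_on_continuous_on[OF v(1)] lipschitz_on_continuous_on[OF p(1)]
    by (auto intro: borel_measurable_continuous_onI)
  have [measurable]: "w k \<in> borel_measurable borel" for k using w' by (rule L2_measurable)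
  have [measurable]: "u \<in> borel_measurable borel" using u' by (rule L2_measurable)
  obtain M where M: "\<And>k. L2_norm (w k) \<le> M" "M > 0"
  proof -
    from convergent_imp_Bseq[OF convergentI[OF lim]] obtain b where b: "b > 0" "\<And>k. norm (L2_norm (\<lambda>x. w k x - u x)) \<le> b"
      by (auto simp: Bseq_def)
    have "L2_norm (w k) \<le> b + L2_norm u" for k
      using L2_norm_triangle[OF L2_diff[OF w' u'] u', of k] b(2)[of k] by simp
    then show thesis using that[of "b + L2_norm u"] b(1) by (simp add: add_pos_nonneg)
  qed
  define c where "c y = min (2 * B) (L * norm y)" for y :: 'a
  have c0: "0 \<le> c y" for y using B0 L0 by (simp add: c_def)
  have cv: "norm (v (x + y) - v x) \<le> c y" for x y
    using lipschitz_onD[OF v(1), of "x + y" x] norm_triangle_ineq4[of "v (x + y)" "v x"] v(2)[of x] v(2)[of "x + y"]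
    by (simp add: c_def dist_norm)
  have cp: "norm (p (x + y) - p x) \<le> c y" for x y
    using lipschitz_onD[OF p(1), of "x + y" x] norm_triangle_ineq4[of "p (x + y)" "p x"] p(2)[of x] p(2)[of "x + y"]
    by (simp add: c_def dist_norm)
  have G: "\<bar>L2_inner (shift_diff y (w k)) (shift_diff y (?\<Phi> (w k)))\<bar> \<le> 8 * B * M * sqrt K * (c y * norm y powr s)" for y k
  proof -
    \<comment> \<open>The difference of the coefficients alone, acting on the unshifted value of
      \<open>w k\<close>. It is bounded by \<open>c y\<close> without any difference of
      \<open>w k\<close>.\<close>
    let ?r = "\<lambda>x. wedge (v (x + y)) (p (x + y)) (w k x) - wedge (v x) (p x) (w k x)"
    have nr: "norm (?r x) \<le> (4 * B * c y) * norm (w k x)" for x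
    proof -
      have "norm (?r x) \<le> 2 * B * norm (w k x) * norm (v (x + y) - v x) + 2 * B * norm (w k x) * norm (p (x + y) - p x) + 2 * B * B * norm (w k x - w k x)"
        by (rule norm_wedge_diff_le) (use v p in auto)
      also have "\<dots> \<le> 2 * B * norm (w k x) * c y + 2 * B * norm (w k x) * c y + 2 * B * B * norm (w k x - w k x)"
        using B0 by (intro add_mono mult_left_mono cv cp) auto
      finally show ?thesis by (simp add: algebra_simps)
    qed
    have r: "?r \<in> L2"
      by (rule L2_dominated[OF w'[of k], where c="4 * B * c y"]) (use nr in auto)
    \<comment> \<open>The remaining part of the difference is a skew map applied to
      \<open>shift_diff y (w k) x\<close> itself, hence orthogonal to it. This is the cancellation
      of the critical term.\<close>
    have "shift_diff y (w k) x \<bullet> shift_diff y (?\<Phi> (w k)) x = shift_diff y (w k) x \<bullet> ?r x" for x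
    proof -
      have "shift_diff y (?\<Phi> (w k)) x = wedge (v (x + y)) (p (x + y)) (shift_diff y (w k) x) + ?r x"
        by (simp add: shift_diff_def wedge_diff)
      then show ?thesis by (simp add: inner_add_right)
    qed
    then have "L2_inner (shift_diff y (w k)) (shift_diff y (?\<Phi> (w k))) = L2_inner (shift_diff y (w k)) ?r"
      by (simp add: L2_inner_def)
    then have "\<bar>L2_inner (shift_diff y (w k)) (shift_diff y (?\<Phi> (w k)))\<bar> \<le> L2_norm (shift_diff y (w k)) * L2_norm ?r"
      using L2_Cauchy_Schwarz[OF L2_shift_diff[OF w'] r] by simp
    also have "\<dots> \<le> (2 * norm y powr s * sqrt K) * (4 * B * c y * M)"
    proof (rule mult_mono)
      have "L2_inner (shift_diff y (w k)) (shift_diff y (w k)) \<le> 4 * norm y powr (2 * s) * K"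
        by (rule order_trans[OF shift_diff_frac_bound[OF s w]]) (intro mult_left_mono K, simp)
      also have "\<dots> = (2 * norm y powr s * sqrt K)\<^sup>2"
        using K0 by (simp add: power_mult_distrib power2_eq_square[of "_ powr _"] flip: powr_add)
      finally have "L2_norm (shift_diff y (w k)) \<le> sqrt ((2 * norm y powr s * sqrt K)\<^sup>2)"
        unfolding L2_norm_def by (rule real_sqrt_le_mono)
      then show "L2_norm (shift_diff y (w k)) \<le> 2 * norm y powr s * sqrt K" using K0 by simp
      have "L2_inner ?r ?r \<le> L2_inner (\<lambda>x. (4 * B * c y) *\<^sub>R w k x) (\<lambda>x. (4 * B * c y) *\<^sub>R w k x)"
        using nr B0 c0[of y] by (intro L2_inner_mono L2_scaleR w') (auto intro!: AE_I2 simp: abs_mult)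
      also have "\<dots> = (4 * B * c y * L2_norm (w k))\<^sup>2"
        by (simp add: L2_inner_scaleR_left L2_inner_scaleR_right power_mult_distrib L2_norm_square power2_eq_square[of B] power2_eq_square[of "c y"])
      finally have "L2_norm ?r \<le> sqrt ((4 * B * c y * L2_norm (w k))\<^sup>2)"
        unfolding L2_norm_def by (rule real_sqrt_le_mono)
      also have "\<dots> = 4 * B * c y * L2_norm (w k)" using B0 c0[of y] by simp
      also have "\<dots> \<le> 4 * B * c y * M" using B0 c0[of y] by (intro mult_left_mono M) auto
      finally show "L2_norm ?r \<le> 4 * B * c y * M" .
    qed (use K0 in auto)
    finally show ?thesis by (simp add: mult_ac)
  qed
  have "(\<lambda>k. LINT q|lborel. gag_weight s q * L2_inner (shift_diff (gag_shift q) (w k)) (shift_diff (gag_shift q) (?\<Phi> (w k)))) \<longlonglongrightarrow>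
    (LINT q|lborel. gag_weight s q * L2_inner (shift_diff (gag_shift q) u) (shift_diff (gag_shift q) (?\<Phi> u)))"
  proof (rule integral_dominated_convergence)
    show "integrable lborel (\<lambda>q::real \<times> 'a. (8 * B * M * sqrt K) * ((2 * B + L) * gag_dominant s 1 q))"
      using s by (intro integrable_mult_right gag_dominant_integrable) auto
    show "AE q in lborel. norm (gag_weight s q * L2_inner (shift_diff (gag_shift q) (w k)) (shift_diff (gag_shift q) (?\<Phi> (w k)))) \<le>
      (8 * B * M * sqrt K) * ((2 * B + L) * gag_dominant s 1 q)" for k
    proof (rule AE_I2)
      fix q :: "real \<times> 'a"
      have "norm (gag_weight s q * L2_inner (shift_diff (gag_shift q) (w k)) (shift_diff (gag_shift q) (?\<Phi> (w k)))) \<le>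
        gag_weight s q * (8 * B * M * sqrt K * (c (gag_shift q) * norm (gag_shift q) powr s))"
        using G[of "gag_shift q" k] by (simp add: abs_mult mult_left_mono)
      also have "\<dots> = (8 * B * M * sqrt K) * (gag_weight s q * (c (gag_shift q) * norm (gag_shift q) powr s))"
        by (simp add: mult_ac)
      also have "\<dots> \<le> (8 * B * M * sqrt K) * ((2 * B + L) * gag_dominant s 1 q)"
        unfolding c_def using B0 L0 M K0 s by (intro mult_left_mono gag_weight_powr_min_bound) auto
      finally show "norm (gag_weight s q * L2_inner (shift_diff (gag_shift q) (w k)) (shift_diff (gag_shift q) (?\<Phi> (w k)))) \<le>
        (8 * B * M * sqrt K) * ((2 * B + L) * gag_dominant s 1 q)" .
    qed
    \<comment> \<open>For a fixed translation only \<open>L\<^sup>2\<close> norms occur: differences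
      at most double them, and the skew map is bounded by \<open>2 * B * B\<close>.\<close>
    show "AE q in lborel. (\<lambda>k. gag_weight s q * L2_inner (shift_diff (gag_shift q) (w k)) (shift_diff (gag_shift q) (?\<Phi> (w k)))) \<longlonglongrightarrow>
      gag_weight s q * L2_inner (shift_diff (gag_shift q) u) (shift_diff (gag_shift q) (?\<Phi> u))"
    proof (intro AE_I2 tendsto_mult tendsto_const L2_inner_tendsto L2_shift_diff w' u' \<Phi>w' \<Phi>u')
      fix q :: "real \<times> 'a"
      let ?y = "gag_shift q"
      have d: "L2_norm (\<lambda>x. shift_diff ?y f x - shift_diff ?y g x) \<le> 2 * L2_norm (\<lambda>x. f x - g x)"
        if "f \<in> L2" "g \<in> L2" for f g :: "'a \<Rightarrow> real ^ 'n"
        using L2_norm_shift_diff_le[OF L2_diff[OF that], of ?y] by (simp add: shift_diff_diff)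
      have l2: "(\<lambda>k. 2 * L2_norm (\<lambda>x. w k x - u x)) \<longlonglongrightarrow> 0" using tendsto_mult_left[OF lim, of 2] by simp
      show "(\<lambda>k. L2_norm (\<lambda>x. shift_diff ?y (w k) x - shift_diff ?y u x)) \<longlonglongrightarrow> 0"
        by (rule Lim_null_comparison[OF _ l2]) (use d[OF w' u'] in auto)
      have n: "L2_norm (\<lambda>x. ?\<Phi> (w k) x - ?\<Phi> u x) \<le> 2 * B * B * L2_norm (\<lambda>x. w k x - u x)" for k
      proof -
        have "L2_inner (\<lambda>x. ?\<Phi> (w k) x - ?\<Phi> u x) (\<lambda>x. ?\<Phi> (w k) x - ?\<Phi> u x) \<le>
          L2_inner (\<lambda>x. (2 * B * B) *\<^sub>R (w k x - u x)) (\<lambda>x. (2 * B * B) *\<^sub>R (w k x - u x))"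
        proof (intro L2_inner_mono L2_scaleR L2_diff w' u' AE_I2)
          fix x
          have "norm (wedge (v x) (p x) (w k x - u x)) \<le> 2 * norm (v x) * norm (p x) * norm (w k x - u x)"
            by (rule norm_wedge_le)
          also have "\<dots> \<le> 2 * B * B * norm (w k x - u x)"
            using v(2) p(2) B0 by (intro mult_mono) auto
          finally show "norm (?\<Phi> (w k) x - ?\<Phi> u x) \<le> norm ((2 * B * B) *\<^sub>R (w k x - u x))"
            using B0 by (simp add: wedge_diff abs_mult)
        qed measurable
        also have "\<dots> = (2 * B * B * L2_norm (\<lambda>x. w k x - u x))\<^sup>2"
          by (simp only: L2_inner_scaleR_left L2_inner_scaleR_right power_mult_distrib L2_norm_square) (simp add: power2_eq_square)
        finally have "L2_norm (\<lambda>x. ?\<Phi> (w k) x - ?\<Phi> u x) \<le> sqrt ((2 * B * B * L2_norm (\<lambda>x. w k x - u x))\<^sup>2)"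
          unfolding L2_norm_def[of "\<lambda>x. ?\<Phi> (w k) x - ?\<Phi> u x"] by (rule real_sqrt_le_mono)
        then show ?thesis using B0 by simp
      qed
      have l3: "(\<lambda>k. 2 * (2 * B * B * L2_norm (\<lambda>x. w k x - u x))) \<longlonglongrightarrow> 0"
        using tendsto_mult_left[OF lim, of "2 * (2 * B * B)"] by (simp add: mult.assoc)
      show "(\<lambda>k. L2_norm (\<lambda>x. shift_diff ?y (?\<Phi> (w k)) x - shift_diff ?y (?\<Phi> u) x)) \<longlonglongrightarrow> 0"
      proof (rule Lim_null_comparison[OF _ l3], intro always_eventually allI)
        fix k
        show "norm (L2_norm (\<lambda>x. shift_diff ?y (?\<Phi> (w k)) x - shift_diff ?y (?\<Phi> u) x)) \<le> 2 * (2 * B * B * L2_norm (\<lambda>x. w k x - u x))"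
          using d[OF \<Phi>w'[of k] \<Phi>u'] n[of k] by simp
      qed
    qed
  qed measurable
  then have "(\<lambda>k. gag_const s TYPE('a) * frac_form s (w k) (?\<Phi> (w k))) \<longlonglongrightarrow> gag_const s TYPE('a) * frac_form s u (?\<Phi> u)"
    unfolding gag_form[OF s w \<Phi>w] gag_form[OF s u \<Phi>u] .
  then have "(\<lambda>k. (1 / gag_const s TYPE('a)) * (gag_const s TYPE('a) * frac_form s (w k) (?\<Phi> (w k)))) \<longlonglongrightarrow>
    (1 / gag_const s TYPE('a)) * (gag_const s TYPE('a) * frac_form s u (?\<Phi> u))"
    by (rule tendsto_mult_left)
  moreover have "(1 / gag_const s TYPE('a)) * (gag_const s TYPE('a) * X) = X" for X
    using gag_const(2)[OF s, where 'a='a] by simp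
  ultimately show ?thesis by (simp only:)
qed

section \<open>Piecewise affine functions on triangulations\<close>

lemma affine_map_on_subset: "affine_map_on K f \<Longrightarrow> F \<subseteq> K \<Longrightarrow> affine_map_on F f"
  unfolding affine_map_on_def by blast

lemma affine_map_on_diff:
  assumes "affine_map_on K f" "affine_map_on K g"
  shows "affine_map_on K (\<lambda>x. f x - g x)"
proof -
  from assms obtain A b A' b' where "linear A" "linear A'" and e: "\<And>x. x \<in> K \<Longrightarrow> f x = A x + b" "\<And>x. x \<in> K \<Longrightarrow> g x = A' x + b'"
    unfolding affine_map_on_def by blast
  then have "linear (\<lambda>x. A x - A' x)" by (intro linear_compose_sub)
  moreover have "\<forall>x\<in>K. f x - g x = (A x - A' x) + (b - b')" using e by (simp add: algebra_simps)
  ultimately show ?thesis unfolding affine_map_on_def by (intro exI[of _ "\<lambda>x. A x - A' x"] exI[of _ "b - b'"]) simp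
qed

lemma affine_map_on_add:
  assumes "affine_map_on K f" "affine_map_on K g"
  shows "affine_map_on K (\<lambda>x. f x + g x)"
proof -
  from assms obtain A b A' b' where "linear A" "linear A'" and e: "\<And>x. x \<in> K \<Longrightarrow> f x = A x + b" "\<And>x. x \<in> K \<Longrightarrow> g x = A' x + b'"
    unfolding affine_map_on_def by blast
  then have "linear (\<lambda>x. A x + A' x)" by (intro linear_compose_add)
  moreover have "\<forall>x\<in>K. f x + g x = (A x + A' x) + (b + b')" using e by (simp add: algebra_simps)
  ultimately show ?thesis unfolding affine_map_on_def by (intro exI[of _ "\<lambda>x. A x + A' x"] exI[of _ "b + b'"]) simp
qed

lemma affine_map_on_linear_comp:
  assumes "affine_map_on K f" "linear M"
  shows "affine_map_on K (\<lambda>x. M (f x))"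
proof -
  from assms obtain A b where A: "linear A" and e: "\<And>x. x \<in> K \<Longrightarrow> f x = A x + b"
    unfolding affine_map_on_def by blast
  have "linear (\<lambda>x. M (A x))" using linear_compose[OF A assms(2)] by (simp add: o_def)
  moreover have "\<forall>x\<in>K. M (f x) = M (A x) + M b" using e linear_add[OF assms(2)] by simp
  ultimately show ?thesis unfolding affine_map_on_def by (intro exI[of _ "\<lambda>x. M (A x)"] exI[of _ "M b"]) simp
qed

text \<open>The affine preimage of a convex set is convex, so by Krein-Milman it contains
  \<open>F\<close> once it contains the extreme points. A singleton \<open>D\<close> gives
  uniqueness from nodal values, a ball gives the maximum principle.\<close>

lemma affine_map_on_in_convex:
  fixes F :: "'a::euclidean_space set"
  assumes F: "compact F" "convex F" and w: "affine_map_on F w" and D: "convex D"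
    and z: "\<And>z. z extreme_point_of F \<Longrightarrow> w z \<in> D" and x: "x \<in> F"
  shows "w x \<in> D"
proof -
  from w obtain A b where A: "linear A" and e: "\<And>x. x \<in> F \<Longrightarrow> w x = A x + b"
    unfolding affine_map_on_def by blast
  have "convex (A -` ((\<lambda>y. - b + y) ` D))"
    by (intro convex_linear_vimage A convex_translation D)
  also have "A -` ((\<lambda>y. - b + y) ` D) = {x. A x + b \<in> D}"
  proof -
    have "A x \<in> (\<lambda>y. - b + y) ` D \<longleftrightarrow> A x + b \<in> D" for x
      by (auto simp: image_iff algebra_simps intro!: bexI[of _ "A x + b"])
    then show ?thesis by auto
  qed
  finally have c: "convex {x. A x + b \<in> D}" .
  have "F = convex hull {x. x extreme_point_of F}" by (rule Krein_Milman_Minkowski[OF F])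
  also have "\<dots> \<subseteq> {x. A x + b \<in> D}"
  proof (rule hull_minimal)
    show "{x. x extreme_point_of F} \<subseteq> {x. A x + b \<in> D}"
    proof safe
      fix z assume "z extreme_point_of F"
      then show "A z + b \<in> D" using z[of z] e[of z] by (auto simp: extreme_point_of_def)
    qed
  qed (rule c)
  finally show ?thesis using x e by auto
qed

lemma affine_map_on_unique:
  fixes F :: "'a::euclidean_space set"
  assumes F: "compact F" "convex F" and w: "affine_map_on F w" "affine_map_on F w'"
    and z: "\<And>z. z extreme_point_of F \<Longrightarrow> w z = w' z" and x: "x \<in> F"
  shows "w x = w' x"
  using affine_map_on_in_convex[OF F affine_map_on_diff[OF w] convex_singleton[of 0] _ x] z by simp

lemma affine_map_on_norm_bound:
  fixes F :: "'a::euclidean_space set"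
  assumes F: "compact F" "convex F" and w: "affine_map_on F w"
    and z: "\<And>z. z extreme_point_of F \<Longrightarrow> norm (w z - c) \<le> M" and x: "x \<in> F"
  shows "norm (w x - c) \<le> M"
proof -
  have "w x \<in> cball c M"
    by (rule affine_map_on_in_convex[OF F w convex_cball _ x]) (use z in \<open>simp add: dist_norm norm_minus_commute\<close>)
  then show ?thesis by (simp add: dist_norm norm_minus_commute)
qed

text \<open>The inverse estimate: the linear part is measured along a diameter of an inscribed
  ball.\<close>

lemma affine_map_on_lipschitz_ball:
  fixes K :: "'a::euclidean_space set" and w :: "'a \<Rightarrow> 'b::euclidean_space"
  assumes w: "affine_map_on K w" and b: "cball z r \<subseteq> K" "r > 0"
    and M: "\<And>x. x \<in> K \<Longrightarrow> norm (w x) \<le> M" and xy: "x \<in> K" "y \<in> K"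
  shows "norm (w x - w y) \<le> M / r * norm (x - y)"
proof -
  from w obtain A c where A: "linear A" and e: "\<And>x. x \<in> K \<Longrightarrow> w x = A x + c"
    unfolding affine_map_on_def by blast
  have bd: "norm (A v) \<le> M / r * norm v" for v
  proof (cases "v = 0")
    case False
    \<comment> \<open>A vector in direction \<open>v\<close> of length exactly \<open>r\<close>, so
      that both \<open>z + h\<close> and \<open>z - h\<close> lie in the ball; the symmetric
      difference yields the constant \<open>M / r\<close> rather than twice that.\<close>
    define h where "h = (r / norm v) *\<^sub>R v"
    have h: "norm h = r" using False b by (simp add: h_def)
    then have m: "z + h \<in> K" "z - h \<in> K" using b(1) by (auto simp: dist_norm intro!: subsetD[OF b(1)])
    have "A (z + h) - A (z - h) = 2 *\<^sub>R A h"
      by (simp add: linear_add[OF A] linear_diff[OF A] scaleR_2)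
    then have "w (z + h) - w (z - h) = 2 *\<^sub>R A h" using e m by simp
    then have "2 * norm (A h) = norm (w (z + h) - w (z - h))" by simp
    also have "\<dots> \<le> norm (w (z + h)) + norm (w (z - h))" by (rule norm_triangle_ineq4)
    also have "\<dots> \<le> 2 * M" using M[OF m(1)] M[OF m(2)] by simp
    finally have "norm (A h) \<le> M" by simp
    moreover have "norm (A h) = (r / norm v) * norm (A v)"
      using b by (simp add: h_def linear_cmul[OF A])
    ultimately show ?thesis using False b by (simp add: field_simps)
  qed (simp add: linear_0[OF A])
  have "w x - w y = A (x - y)" using xy e by (simp add: linear_diff[OF A])
  then show ?thesis using bd by simp
qed

lemma affine_map_on_lipschitz:
  fixes w :: "'a::euclidean_space \<Rightarrow> 'b::euclidean_space"
  assumes "affine_map_on K w"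
  obtains L where "L-lipschitz_on K w"
proof -
  from assms obtain A b where A: "linear A" and e: "\<And>x. x \<in> K \<Longrightarrow> w x = A x + b"
    unfolding affine_map_on_def by blast
  obtain B where B: "B > 0" "\<And>x. norm (A x) \<le> B * norm x" using linear_bounded_pos[OF A] by blast
  have "B-lipschitz_on K w"
  proof (rule lipschitz_onI)
    fix x y assume "x \<in> K" "y \<in> K"
    then show "dist (w x) (w y) \<le> B * dist x y"
      using B(2)[of "x - y"] e by (simp add: dist_norm linear_diff[OF A])
  qed (use B in simp)
  then show thesis by (rule that)
qed

text \<open>A segment between two points meets the pieces in finitely many closed parameter sets,
  along which the estimates add up. Elements can thus be glued with the complement of the domain
  without worsening the constant.\<close>

lemma lipschitz_on_finite_closed_cover:
  fixes f :: "'a::euclidean_space \<Rightarrow> 'b::euclidean_space"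
  assumes C: "finite \<C>" "\<And>S. S \<in> \<C> \<Longrightarrow> closed S" "\<Union>\<C> = UNIV"
    and L: "\<And>S. S \<in> \<C> \<Longrightarrow> L-lipschitz_on S f" and L0: "0 \<le> L"
  shows "L-lipschitz_on UNIV f"
proof (rule lipschitz_onI[OF _ L0])
  fix x y :: 'a
  let ?g = "\<lambda>t::real. x + t *\<^sub>R (y - x)"
  have "(L * norm (y - x))-lipschitz_on {0..1} (f \<circ> ?g)"
  proof (rule lipschitz_on_closed_Union[where I=\<C> and U="\<lambda>S. ?g -` S"])
    fix S assume S: "S \<in> \<C>"
    show "closed (?g -` S)"
      by (intro closed_vimage C S continuous_intros)
    show "(L * norm (y - x))-lipschitz_on (?g -` S) (f \<circ> ?g)"
    proof (rule lipschitz_onI)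
      fix t u assume "t \<in> ?g -` S" "u \<in> ?g -` S"
      then have "dist (f (?g t)) (f (?g u)) \<le> L * dist (?g t) (?g u)"
        by (intro lipschitz_onD[OF L[OF S]]) auto
      also have "dist (?g t) (?g u) = norm (y - x) * dist t u"
        by (simp add: dist_norm scaleR_diff_left[symmetric] mult.commute)
      finally show "dist ((f \<circ> ?g) t) ((f \<circ> ?g) u) \<le> L * norm (y - x) * dist t u" by (simp add: mult_ac)
    qed (use L0 in auto)
  next
    show "{0..1} \<subseteq> (\<Union>S\<in>\<C>. ?g -` S)"
    proof
      fix t :: real
      have "?g t \<in> \<Union>\<C>" using C(3) by simp
      then show "t \<in> (\<Union>S\<in>\<C>. ?g -` S)" by blast
    qed
  qed (use C(1) L0 in auto)
  then have "dist ((f \<circ> ?g) 0) ((f \<circ> ?g) 1) \<le> (L * norm (y - x)) * dist (0::real) 1"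
    by (rule lipschitz_onD) auto
  then show "dist (f x) (f y) \<le> L * dist x y" by (simp add: dist_norm norm_minus_commute)
qed

text \<open>The differences of the vertices to one of them are linearly independent, so values at
  the vertices prescribe a linear map; extreme points of the simplex are among the vertices.\<close>

lemma simplex_affine_extension:
  fixes K :: "'a::euclidean_space set" and f :: "'a \<Rightarrow> 'b::euclidean_space"
  assumes "n simplex K"
  shows "\<exists>A b. linear A \<and> (\<forall>z. z extreme_point_of K \<longrightarrow> A z + b = f z)"
proof -
  from assms obtain C where C: "\<not> affine_dependent C" "K = convex hull C"
    unfolding simplex_def by blast
  have ext: "z extreme_point_of K \<Longrightarrow> z \<in> C" for z
    using C(2) extreme_point_of_convex_hull by blast
  show ?thesis
  proof (cases "C = {}")
    case True
    then have "\<not> z extreme_point_of K" for z using ext by blast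
    then show ?thesis by (intro exI[of _ "\<lambda>_. 0"] exI[of _ 0]) (simp add: linear_zero)
  next
    case False
    then obtain a where a: "a \<in> C" by blast
    have ind: "independent ((\<lambda>x. - a + x) ` (C - {a}))"
      using affine_dependent_iff_dependent2[OF a] C(1) by blast
    obtain g where g: "linear g" "\<And>x. x \<in> (\<lambda>x. - a + x) ` (C - {a}) \<Longrightarrow> g x = f (a + x) - f a"
      using linear_independent_extend[OF ind, of "\<lambda>x. f (a + x) - f a"] by blast
    have "g z + (f a - g a) = f z" if "z \<in> C" for z
    proof (cases "z = a")
      case False
      then have "g (- a + z) = f z - f a" using g(2)[of "- a + z"] that by simp
      moreover have "g (- a + z) = g z - g a" using linear_diff[OF g(1), of z a] by (simp add: add.commute)
      ultimately have "f z - f a = g z - g a" by simp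
      then have "f z = (g z - g a) + f a" by (metis diff_add_cancel)
      then show ?thesis by simp
    qed simp
    then show ?thesis using g(1) ext by blast
  qed
qed

lemma triangulationD:
  assumes "triangulation \<T>"
  shows "finite \<T>" "K \<in> \<T> \<Longrightarrow> compact K" "K \<in> \<T> \<Longrightarrow> convex K" "K \<in> \<T> \<Longrightarrow> \<exists>n. n simplex K"
    "K \<in> \<T> \<Longrightarrow> K' \<in> \<T> \<Longrightarrow> (K \<inter> K') face_of K"
  using assms by (auto simp: triangulation_def intro: compact_simplex convex_simplex)

section \<open>Piecewise affine spaces and nodal interpolation\<close>

lemma S1_affine: "w \<in> S1 \<T> \<Longrightarrow> K \<in> \<T> \<Longrightarrow> affine_map_on K w"
  by (simp add: S1_def)

lemma nodes_extreme: "K \<in> \<T> \<Longrightarrow> z extreme_point_of K \<Longrightarrow> z \<in> nodes \<T>"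
  by (auto simp: nodes_def)

lemma S1_unique:
  assumes T: "triangulation \<T>" and w: "w \<in> S1 \<T>" "w' \<in> S1 \<T>" and z: "\<And>z. z \<in> nodes \<T> \<Longrightarrow> w z = w' z"
  shows "w = w'"
proof
  fix x
  show "w x = w' x"
  proof (cases "x \<in> \<Union>\<T>")
    case True
    then obtain K where "K \<in> \<T>" "x \<in> K" by blast
    then show ?thesis
      using affine_map_on_unique[of K w w' x] triangulationD[OF T] S1_affine w z nodes_extreme by metis
  qed (use w in \<open>simp add: S1_def\<close>)
qed

text \<open>Affine interpolants are chosen element by element. They are compatible because the
  intersection of two elements is a face of both: its extreme points are vertices of both, where the
  interpolants have the same values.\<close>

lemma S1_exists:
  fixes f :: "'a::euclidean_space \<Rightarrow> 'b::euclidean_space"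
  assumes T: "triangulation \<T>"
  shows "\<exists>w. w \<in> S1 \<T> \<and> (\<forall>z\<in>nodes \<T>. w z = f z)"
proof -
  note D = triangulationD[OF T]
  have "\<forall>K\<in>\<T>. \<exists>g. affine_map_on K g \<and> (\<forall>z. z extreme_point_of K \<longrightarrow> g z = f z)"
  proof
    fix K assume "K \<in> \<T>"
    then obtain A b where "linear A" "\<forall>z. z extreme_point_of K \<longrightarrow> A z + b = f z"
      using D(4) simplex_affine_extension by metis
    then show "\<exists>g. affine_map_on K g \<and> (\<forall>z. z extreme_point_of K \<longrightarrow> g z = f z)"
      unfolding affine_map_on_def by (intro exI[of _ "\<lambda>x. A x + b"]) auto
  qed
  then obtain g where g: "\<And>K. K \<in> \<T> \<Longrightarrow> affine_map_on K (g K)" "\<And>K z. K \<in> \<T> \<Longrightarrow> z extreme_point_of K \<Longrightarrow> g K z = f z"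
    by metis
  have comp: "g K x = g K' x" if K: "K \<in> \<T>" "K' \<in> \<T>" and x: "x \<in> K" "x \<in> K'" for K K' x
  proof (rule affine_map_on_unique[of "K \<inter> K'"])
    show "compact (K \<inter> K')" using D(2) K by (simp add: compact_Int)
    show "convex (K \<inter> K')" using D(3) K by (simp add: convex_Int)
    show "affine_map_on (K \<inter> K') (g K)" "affine_map_on (K \<inter> K') (g K')"
      using g(1) K affine_map_on_subset by (metis Int_lower1, metis Int_lower2)
    fix z assume z: "z extreme_point_of K \<inter> K'"
    have "z extreme_point_of K"
      using extreme_point_of_face[OF D(5)[OF K]] z by blast
    moreover have "z extreme_point_of K'"
      using extreme_point_of_face[OF D(5)[OF K(2,1)]] z by (simp add: Int_commute)
    ultimately show "g K z = g K' z" using g(2) K by simp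
  qed (use x in simp)
  define w where "w x = (if x \<in> \<Union>\<T> then g (SOME K. K \<in> \<T> \<and> x \<in> K) x else 0)" for x
  have w: "w x = g K x" if "K \<in> \<T>" "x \<in> K" for K x
  proof -
    have "(SOME K. K \<in> \<T> \<and> x \<in> K) \<in> \<T> \<and> x \<in> (SOME K. K \<in> \<T> \<and> x \<in> K)"
      by (rule someI[of _ K]) (use that in simp)
    moreover have "w x = g (SOME K. K \<in> \<T> \<and> x \<in> K) x"
      unfolding w_def using that by (intro if_P) blast
    ultimately show ?thesis using comp[OF _ that(1) _ that(2)] by metis
  qed
  have aff: "affine_map_on K w" if "K \<in> \<T>" for K
    using g(1)[OF that] unfolding affine_map_on_def by (simp add: w[OF that] cong: ball_cong)
  have "continuous_on (\<Union>\<T>) w"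
  proof -
    have "continuous_on (\<Union>K\<in>\<T>. K) w"
    proof (rule continuous_on_closed_Union)
      fix K assume K: "K \<in> \<T>"
      show "continuous_on K w"
        using affine_map_on_lipschitz[OF aff[OF K]] lipschitz_on_continuous_on by metis
      show "closed K" using D(2)[OF K] by (rule compact_imp_closed)
    qed (rule D(1))
    then show ?thesis by simp
  qed
  then have "w \<in> S1 \<T>" using aff by (auto simp: S1_def w_def)
  moreover have "w z = f z" if "z \<in> nodes \<T>" for z
  proof -
    from that obtain K where "K \<in> \<T>" "z extreme_point_of K" by (auto simp: nodes_def)
    then show ?thesis using w[of K z] g(2) by (simp add: extreme_point_of_def)
  qed
  ultimately show ?thesis by blast
qed

lemma nodal_interpolant:
  assumes "triangulation \<T>"
  shows nodal_interpolant_S1: "nodal_interpolant \<T> f \<in> S1 \<T>"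
    and nodal_interpolant_nodes: "z \<in> nodes \<T> \<Longrightarrow> nodal_interpolant \<T> f z = f z"
proof -
  have "\<exists>!w. w \<in> S1 \<T> \<and> (\<forall>z\<in>nodes \<T>. w z = f z)"
    using S1_exists[OF assms, of f] S1_unique[OF assms] by (metis (no_types, lifting))
  from theI'[OF this] show "nodal_interpolant \<T> f \<in> S1 \<T>" "z \<in> nodes \<T> \<Longrightarrow> nodal_interpolant \<T> f z = f z"
    unfolding nodal_interpolant_def by auto
qed

lemma S1_norm_bound:
  assumes T: "triangulation \<T>" and w: "w \<in> S1 \<T>" and K: "K \<in> \<T>"
    and z: "\<And>z. z extreme_point_of K \<Longrightarrow> norm (w z - c) \<le> M" and x: "x \<in> K"
  shows "norm (w x - c) \<le> M"
  by (rule affine_map_on_norm_bound[OF triangulationD(2)[OF T K] triangulationD(3)[OF T K] S1_affine[OF w K] z x])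

lemma mesh_size_dist:
  assumes T: "triangulation \<T>" and K: "K \<in> \<T>" and "x \<in> K" "y \<in> K"
  shows "norm (x - y) \<le> mesh_size \<T>"
proof -
  have "dist x y \<le> diameter K"
    by (intro diameter_bounded_bound compact_imp_bounded triangulationD(2)[OF T K] assms)
  also have "\<dots> \<le> mesh_size \<T>"
    unfolding mesh_size_def using triangulationD(1)[OF T] K by (intro Max_ge) auto
  finally show ?thesis by (simp add: dist_norm)
qed

text \<open>When the mesh is finer than the distance from the support of \<open>f\<close> to the complement of \<open>\<Omega>\<close>,
  elements that reach outside \<open>\<Omega>\<close> carry only zero nodal values.\<close>

lemma nodal_interpolant_vanishes:
  assumes T: "triangulation \<T>" and \<delta>: "\<And>z x. f z \<noteq> 0 \<Longrightarrow> norm (z - x) < \<delta> \<Longrightarrow> x \<in> \<Omega>" and m: "mesh_size \<T> < \<delta>"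
    and x: "x \<notin> \<Omega>"
  shows "nodal_interpolant \<T> f x = 0"
proof (cases "x \<in> \<Union>\<T>")
  case True
  then obtain K where K: "K \<in> \<T>" "x \<in> K" by blast
  have "norm (nodal_interpolant \<T> f x - 0) \<le> 0"
  proof (rule S1_norm_bound[OF T nodal_interpolant_S1[OF T] K(1) _ K(2)])
    fix z assume z: "z extreme_point_of K"
    then have "z \<in> K" by (simp add: extreme_point_of_def)
    then have "norm (z - x) < \<delta>" using mesh_size_dist[OF T K(1), of z x] K m by simp
    then have "f z = 0" using \<delta> x by blast
    then show "norm (nodal_interpolant \<T> f z - 0) \<le> 0"
      by (simp add: nodal_interpolant_nodes[OF T nodes_extreme[OF K(1) z]])
  qed
  then show ?thesis by simp
qed (use nodal_interpolant_S1[OF T, of f] in \<open>simp add: S1_def\<close>)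

text \<open>The maximum principle applied after subtracting the constant \<open>f x\<close>: at the
  vertices the distance from \<open>f x\<close> is bounded by slope times mesh size.\<close>

lemma nodal_interpolant_error:
  assumes T: "triangulation \<T>" and L: "L-lipschitz_on UNIV f" and x: "x \<in> \<Union>\<T>"
  shows "norm (nodal_interpolant \<T> f x - f x) \<le> L * mesh_size \<T>"
proof -
  obtain K where K: "K \<in> \<T>" "x \<in> K" using x by blast
  show ?thesis
  proof (rule S1_norm_bound[OF T nodal_interpolant_S1[OF T] K(1) _ K(2)])
    fix z assume z: "z extreme_point_of K"
    then have "z \<in> K" by (simp add: extreme_point_of_def)
    have "norm (f z - f x) \<le> L * norm (z - x)" using lipschitz_onD[OF L, of z x] by (simp add: dist_norm)
    also have "\<dots> \<le> L * mesh_size \<T>"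
      using mesh_size_dist[OF T K(1) \<open>z \<in> K\<close> K(2)] lipschitz_on_nonneg[OF L] by (intro mult_left_mono)
    finally show "norm (nodal_interpolant \<T> f z - f x) \<le> L * mesh_size \<T>"
      by (simp add: nodal_interpolant_nodes[OF T nodes_extreme[OF K(1) z]])
  qed
qed

section \<open>Interpolation error and unit length defect\<close>

lemma linear_wedge: "linear (wedge a b)"
  by (rule linearI) (simp_all add: wedge_def inner_add_right algebra_simps)

text \<open>The gradient of \<open>u\<close> may be as large as the reciprocal of the element
  diameter. Freezing \<open>v\<close> and \<open>p\<close> at one point of the element leaves a
  field affine like \<open>u\<close>, which interpolation reproduces. In the rest, the large
  gradient of \<open>u\<close> is multiplied only by oscillations of \<open>v\<close> and
  \<open>p\<close>, which are of the order of the diameter; so the Lipschitz constant of the error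
  is independent of the mesh.\<close>

lemma wedge_interpolation_error:
  fixes v p u :: "'a::euclidean_space \<Rightarrow> 'b::euclidean_space"
  defines "E \<equiv> \<lambda>x. wedge (v x) (p x) (u x)"
  assumes T': "triangulation \<T>'" and sub: "\<T> \<subseteq> \<T>'" and \<Omega>: "open \<Omega>" "\<Omega> \<subseteq> \<Union>\<T>"
    and \<kappa>: "\<kappa> > 0" "\<And>K. K \<in> \<T> \<Longrightarrow> \<exists>z. cball z (\<kappa> * diameter K) \<subseteq> K" and dpos: "\<And>K. K \<in> \<T> \<Longrightarrow> diameter K > 0"
    and u: "\<And>K. K \<in> \<T> \<Longrightarrow> affine_map_on K u" "\<And>K x. K \<in> \<T> \<Longrightarrow> x \<in> K \<Longrightarrow> norm (u x) \<le> 1"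
    and v: "L-lipschitz_on UNIV v" "\<And>x. norm (v x) \<le> B" and p: "L-lipschitz_on UNIV p" "\<And>x. norm (p x) \<le> B"
    and v0: "\<And>x. x \<notin> \<Omega> \<Longrightarrow> v x = 0" and I0: "\<And>x. x \<notin> \<Omega> \<Longrightarrow> nodal_interpolant \<T>' E x = 0"
  shows "(4 * B * L * (2 / \<kappa> + 1))-lipschitz_on UNIV (\<lambda>x. E x - nodal_interpolant \<T>' E x)"
    and "0 \<le> mesh_size \<T>' \<Longrightarrow> norm (E x - nodal_interpolant \<T>' E x) \<le> 8 * B * L * mesh_size \<T>'"
proof -
  define I where "I = nodal_interpolant \<T>' E"
  define g where "g = (\<lambda>x. E x - I x)"
  have B0: "0 \<le> B" using v(2)[of undefined] norm_ge_zero order_trans by blast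
  have L0: "0 \<le> L" using lipschitz_on_nonneg[OF v(1)] .
  define C where "C = 4 * B * L"
  have C0: "0 \<le> C" using B0 L0 by (simp add: C_def)
  have I: "I \<in> S1 \<T>'" unfolding I_def by (rule nodal_interpolant_S1[OF T'])
  have loc: "norm (g x) \<le> 2 * C * diameter K \<and> norm (g x - g y) \<le> C * (2 / \<kappa> + 1) * norm (x - y)"
    if K: "K \<in> \<T>" and x: "x \<in> K" and y: "y \<in> K" for K x y
  proof -
    define d where "d = diameter K"
    have d: "d > 0" unfolding d_def by (rule dpos[OF K])
    have K': "K \<in> \<T>'" using K sub by blast
    have cc: "compact K" "convex K" using triangulationD(2,3)[OF T'] K' by auto
    have dist: "norm (x - y) \<le> d" if "x \<in> K" "y \<in> K" for x y
      unfolding d_def using diameter_bounded_bound[OF compact_imp_bounded[OF cc(1)] that] by (simp add: dist_norm)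
    obtain z where z: "cball z (\<kappa> * d) \<subseteq> K" using \<kappa>(2)[OF K] by (auto simp: d_def)
    have x0: "z \<in> K" using z \<kappa>(1) d by (auto intro: subsetD)
    define a where "a = (\<lambda>x. wedge (v z) (p z) (u x))"
    define e where "e = (\<lambda>x. E x - a x)"
    have lip: "norm (v x - v y) \<le> L * norm (x - y)" "norm (p x - p y) \<le> L * norm (x - y)" for x y
      using lipschitz_onD[OF v(1), of x y] lipschitz_onD[OF p(1), of x y] by (auto simp: dist_norm)
    have ld: "norm (v x - v z) \<le> L * d" "norm (p x - p z) \<le> L * d" if "x \<in> K" for x
      using order_trans[OF lip(1) mult_left_mono[OF dist[OF that x0] L0]] order_trans[OF lip(2) mult_left_mono[OF dist[OF that x0] L0]] by auto
    have e: "norm (e x) \<le> C * d" if "x \<in> K" for x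
    proof -
      have "norm (e x) \<le> 2 * B * 1 * norm (v x - v z) + 2 * B * 1 * norm (p x - p z) + 2 * B * B * norm (u x - u x)"
        unfolding e_def E_def a_def by (rule norm_wedge_diff_le) (use v p u(2)[OF K that] in auto)
      also have "\<dots> \<le> 2 * B * 1 * (L * d) + 2 * B * 1 * (L * d) + 2 * B * B * norm (u x - u x)"
        using B0 by (intro add_mono mult_left_mono ld that) auto
      finally show ?thesis by (simp add: C_def algebra_simps)
    qed
    have ul: "norm (u x - u y) \<le> 1 / (\<kappa> * d) * norm (x - y)"
      by (rule affine_map_on_lipschitz_ball[OF u(1)[OF K] z _ u(2)[OF K] x y]) (use \<kappa> d in auto)
    have el: "norm (e x - e y) \<le> C * (1 / \<kappa> + 1) * norm (x - y)"
    proof -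
      let ?q = "norm (u x - u y)"
      \<comment> \<open>In the first bracket small coefficients meet the increment of
        \<open>u\<close>; in the second, increments of the coefficients meet a value of
        \<open>u\<close>, which has norm at most 1.\<close>
      have "e x - e y = (wedge (v x) (p x) (u x - u y) - wedge (v z) (p z) (u x - u y)) + (wedge (v x) (p x) (u y) - wedge (v y) (p y) (u y))"
        by (simp add: e_def E_def a_def wedge_diff)
      then have "norm (e x - e y) \<le> norm (wedge (v x) (p x) (u x - u y) - wedge (v z) (p z) (u x - u y)) + norm (wedge (v x) (p x) (u y) - wedge (v y) (p y) (u y))"
        by (simp add: norm_triangle_ineq)
      also have "\<dots> \<le> (2 * B * ?q * norm (v x - v z) + 2 * B * ?q * norm (p x - p z) + 2 * B * B * norm ((u x - u y) - (u x - u y)))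
          + (2 * B * 1 * norm (v x - v y) + 2 * B * 1 * norm (p x - p y) + 2 * B * B * norm (u y - u y))"
        by (intro add_mono norm_wedge_diff_le) (use v p u(2)[OF K y] in auto)
      also have "\<dots> \<le> (2 * B * ?q * (L * d) + 2 * B * ?q * (L * d) + 2 * B * B * norm ((u x - u y) - (u x - u y)))
          + (2 * B * 1 * (L * norm (x - y)) + 2 * B * 1 * (L * norm (x - y)) + 2 * B * B * norm (u y - u y))"
        using B0 by (intro add_mono mult_left_mono ld x lip) auto
      also have "\<dots> = C * d * ?q + C * norm (x - y)" by (simp add: C_def algebra_simps)
      also have "\<dots> \<le> C * d * (1 / (\<kappa> * d) * norm (x - y)) + C * norm (x - y)"
        using C0 d by (intro add_mono mult_left_mono ul) auto
      also have "\<dots> = C * (1 / \<kappa> + 1) * norm (x - y)" using d \<kappa>(1) by (simp add: field_simps)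
      finally show ?thesis .
    qed
    \<comment> \<open>On \<open>K\<close> this is the affine interpolant of \<open>e\<close>. Its
      size is controlled by vertex values and its slope by the inverse estimate; together with
      \<open>e\<close> this accounts for the \<open>2 / \<kappa> + 1\<close> of the
      statement.\<close>
    define J where "J = (\<lambda>x. I x - a x)"
    have aff: "affine_map_on K J"
      unfolding J_def a_def by (rule affine_map_on_diff[OF S1_affine[OF I K'] affine_map_on_linear_comp[OF u(1)[OF K] linear_wedge]])
    have J: "norm (J x) \<le> C * d" if "x \<in> K" for x
    proof -
      have "norm (J x - 0) \<le> C * d"
      proof (rule affine_map_on_norm_bound[OF cc aff _ that])
        fix y assume y: "y extreme_point_of K"
        then have "J y = e y" unfolding J_def e_def I_def using nodal_interpolant_nodes[OF T' nodes_extreme[OF K']] by simp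
        then show "norm (J y - 0) \<le> C * d" using e[of y] y by (simp add: extreme_point_of_def)
      qed
      then show ?thesis by simp
    qed
    have "norm (J x - J y) \<le> (C * d) / (\<kappa> * d) * norm (x - y)"
      by (rule affine_map_on_lipschitz_ball[OF aff z _ J x y]) (use \<kappa> d in auto)
    then have Jl: "norm (J x - J y) \<le> C / \<kappa> * norm (x - y)" using d by simp
    have geq: "g x = e x - J x" for x by (simp add: g_def e_def J_def)
    have "norm (g x) \<le> norm (e x) + norm (J x)" unfolding geq by (rule norm_triangle_ineq4)
    then have "norm (g x) \<le> 2 * C * d" using e[OF x] J[OF x] by simp
    moreover have "norm (g x - g y) \<le> C * (2 / \<kappa> + 1) * norm (x - y)"
    proof -
      have "g x - g y = (e x - e y) - (J x - J y)" by (simp add: geq)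
      then have "norm (g x - g y) \<le> norm (e x - e y) + norm (J x - J y)" by (simp add: norm_triangle_ineq4)
      also have "\<dots> \<le> C * (1 / \<kappa> + 1) * norm (x - y) + C / \<kappa> * norm (x - y)" by (rule add_mono[OF el Jl])
      finally show ?thesis by (simp add: algebra_simps)
    qed
    ultimately show ?thesis by (simp add: d_def)
  qed
  have out: "g x = 0" if "x \<notin> \<Omega>" for x using v0[OF that] I0[OF that] by (simp add: g_def E_def I_def)
  \<comment> \<open>Outside the domain the error vanishes, so the complement can be added to the
    elements as one more closed piece.\<close>
  have "(C * (2 / \<kappa> + 1))-lipschitz_on UNIV g"
  proof (rule lipschitz_on_finite_closed_cover[of "insert (- \<Omega>) \<T>"])
    show "finite (insert (- \<Omega>) \<T>)" using triangulationD(1)[OF T'] sub finite_subset by auto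
    show "closed S" if "S \<in> insert (- \<Omega>) \<T>" for S
      using that \<Omega>(1) sub triangulationD(2)[OF T'] by (auto intro: compact_imp_closed)
    show "\<Union>(insert (- \<Omega>) \<T>) = UNIV" using \<Omega>(2) by auto
    show "0 \<le> C * (2 / \<kappa> + 1)" using C0 \<kappa>(1) by simp
    show "(C * (2 / \<kappa> + 1))-lipschitz_on S g" if "S \<in> insert (- \<Omega>) \<T>" for S
    proof (rule lipschitz_onI)
      fix x y assume "x \<in> S" "y \<in> S"
      then show "dist (g x) (g y) \<le> C * (2 / \<kappa> + 1) * dist x y"
        using that loc[of S x y] out[of x] out[of y] C0 \<kappa>(1) by (auto simp: dist_norm)
    qed (use C0 \<kappa>(1) in simp)
  qed
  then show "(4 * B * L * (2 / \<kappa> + 1))-lipschitz_on UNIV (\<lambda>x. E x - nodal_interpolant \<T>' E x)"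
    by (simp add: C_def g_def I_def)
  show "norm (E x - nodal_interpolant \<T>' E x) \<le> 8 * B * L * mesh_size \<T>'" if m0: "0 \<le> mesh_size \<T>'" for x
  proof (cases "x \<in> \<Omega>")
    case True
    then obtain K where K: "K \<in> \<T>" "x \<in> K" using \<Omega>(2) by blast
    have "norm (g x) \<le> 2 * C * diameter K" using loc[OF K K(2)] by simp
    also have "\<dots> \<le> 2 * C * mesh_size \<T>'"
      unfolding mesh_size_def using triangulationD(1)[OF T'] K sub C0
      by (intro mult_left_mono Max_ge) auto
    finally show ?thesis by (simp add: C_def g_def I_def)
  next
    case False
    then show ?thesis using out[OF False] m0 B0 L0 by (simp add: g_def I_def)
  qed
qed

section \<open>The unit length defect of a discrete map\<close>

lemma norm_linear_le_sum_Basis: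
  fixes A :: "'a::euclidean_space \<Rightarrow> 'b::real_normed_vector"
  assumes "linear A"
  shows "norm (A x) \<le> norm x * (\<Sum>e\<in>Basis. norm (A e))"
proof -
  have "A x = A (\<Sum>e\<in>Basis. (x \<bullet> e) *\<^sub>R e)" by (simp add: euclidean_representation)
  also have "\<dots> = (\<Sum>e\<in>Basis. (x \<bullet> e) *\<^sub>R A e)"
    by (simp add: linear_sum[OF assms] linear_cmul[OF assms])
  also have "norm \<dots> \<le> (\<Sum>e\<in>Basis. norm ((x \<bullet> e) *\<^sub>R A e))" by (rule norm_sum)
  also have "\<dots> \<le> (\<Sum>e\<in>Basis. norm x * norm (A e))"
    by (intro sum_mono) (simp add: Basis_le_norm mult_right_mono)
  finally show ?thesis by (simp add: sum_distrib_left)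
qed

text \<open>At a vertex the length is 1, so elsewhere on the element
  \<open>1 - (norm (u x))\<^sup>2\<close> is at most twice the diameter times the gradient. The
  constant gradient is recovered from translations by \<rho> along the axes, evaluated on the inner
  ball. The power of \<open>q\<close> collects \<open>DIM('a)\<close> factors from comparing volumes
  and two from comparing the squared diameter with \<open>\<rho>\<^sup>2\<close>.\<close>

lemma element_unit_defect:
  fixes K :: "'a::euclidean_space set" and u :: "'a \<Rightarrow> 'b::euclidean_space"
  assumes K: "compact K" "convex K" and aff: "affine_map_on K u" and unit: "\<And>z. z extreme_point_of K \<Longrightarrow> norm (u z) = 1"
    and u: "u \<in> L2" and z: "cball z (2 * \<rho>) \<subseteq> K" and \<rho>: "\<rho> > 0" and q: "diameter K \<le> q * \<rho>"
  shows "integrable lborel (\<lambda>x. indicator K x * (1 - (norm (u x))\<^sup>2)\<^sup>2)"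
    and "(LINT x|lborel. indicator K x * (1 - (norm (u x))\<^sup>2)\<^sup>2) \<le>
    4 * real DIM('a) * q ^ (DIM('a) + 2) * (\<Sum>e\<in>Basis. LINT x|lborel. indicator (ball z \<rho>) x * (norm (shift_diff (\<rho> *\<^sub>R e) u x))\<^sup>2)"
proof -
  have [measurable]: "u \<in> borel_measurable borel" using u by (rule L2_measurable)
  have [measurable]: "K \<in> sets borel" using K by (simp add: compact_imp_closed)
  from aff obtain A b where A: "linear A" and e: "\<And>x. x \<in> K \<Longrightarrow> u x = A x + b"
    unfolding affine_map_on_def by blast
  define d where "d = diameter K"
  have zK: "z \<in> K" using z \<rho> by (auto intro: subsetD)
  have d0: "0 \<le> d" unfolding d_def by (intro diameter_ge_0 compact_imp_bounded K)
  have q0: "0 \<le> q" using q d0 \<rho> by (auto simp: d_def zero_le_mult_iff dest: order_trans)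
  have dist: "norm (x - y) \<le> d" if "x \<in> K" "y \<in> K" for x y
    unfolding d_def using diameter_bounded_bound[OF compact_imp_bounded[OF K(1)] that] by (simp add: dist_norm)
  obtain y where y: "y extreme_point_of K"
  proof -
    have "K = convex hull {x. x extreme_point_of K}" by (rule Krein_Milman_Minkowski[OF K])
    then have "{x. x extreme_point_of K} \<noteq> {}" using zK by (metis convex_hull_empty empty_iff)
    then show thesis using that by blast
  qed
  have yK: "y \<in> K" using y by (simp add: extreme_point_of_def)
  define S where "S = (\<Sum>e\<in>Basis. (norm (A e))\<^sup>2)"
  have S0: "0 \<le> S" unfolding S_def by (rule sum_nonneg) simp
  have u1: "norm (u x) \<le> 1" if "x \<in> K" for x
    using affine_map_on_norm_bound[OF K aff, of 0 1 x] unit that by simp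
  have sq: "(1 - (norm (u x))\<^sup>2)\<^sup>2 \<le> 4 * d\<^sup>2 * (real DIM('a) * S)" if x: "x \<in> K" for x
  proof -
    have "1 - (norm (u x))\<^sup>2 = (norm (u y) - norm (u x)) * (norm (u y) + norm (u x))"
      by (simp add: unit[OF y] power2_eq_square algebra_simps)
    also have "\<dots> \<le> norm (u y - u x) * 2"
      using u1[OF x] unit[OF y] norm_triangle_ineq2[of "u y" "u x"] by (intro mult_mono) auto
    also have "u y - u x = A (y - x)" using e x yK by (simp add: linear_diff[OF A])
    also have "norm (A (y - x)) \<le> norm (y - x) * (\<Sum>e\<in>Basis. norm (A e))" by (rule norm_linear_le_sum_Basis[OF A])
    also have "\<dots> \<le> d * (\<Sum>e\<in>Basis. norm (A e))" by (intro mult_right_mono dist yK x sum_nonneg) auto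
    finally have "1 - (norm (u x))\<^sup>2 \<le> 2 * d * (\<Sum>e\<in>Basis. norm (A e))" by simp
    moreover have "0 \<le> 1 - (norm (u x))\<^sup>2" using u1[OF x] by (simp add: power_le_one)
    ultimately have "(1 - (norm (u x))\<^sup>2)\<^sup>2 \<le> (2 * d * (\<Sum>e\<in>Basis. norm (A e)))\<^sup>2" by (intro power_mono)
    also have "\<dots> = 4 * d\<^sup>2 * (\<Sum>e\<in>Basis. 1 * norm (A e))\<^sup>2" by (simp add: power_mult_distrib)
    also have "\<dots> \<le> 4 * d\<^sup>2 * ((\<Sum>e\<in>(Basis::'a set). 1\<^sup>2) * S)"
      unfolding S_def by (intro mult_left_mono Cauchy_Schwarz_ineq_sum) auto
    finally show ?thesis by simp
  qed
  define V where "V = measure lborel (ball z \<rho>)"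
  have fin: "emeasure lborel K < \<infinity>" by (rule emeasure_compact_finite[OF K(1)])
  have iK: "integrable lborel (\<lambda>x. indicator K x * (4 * d\<^sup>2 * (real DIM('a) * S)))"
    using fin by (intro integrable_mult_left) simp
  show int: "integrable lborel (\<lambda>x. indicator K x * (1 - (norm (u x))\<^sup>2)\<^sup>2)"
    by (rule Bochner_Integration.integrable_bound[OF iK])
      (use sq in \<open>auto intro!: AE_I2 simp: indicator_def intro: order_trans[OF _ abs_ge_self]\<close>)
  have "(LINT x|lborel. indicator K x * (1 - (norm (u x))\<^sup>2)\<^sup>2) \<le> (LINT x|lborel. indicator K x * (4 * d\<^sup>2 * (real DIM('a) * S)))"
    by (rule integral_mono[OF int iK]) (use sq in \<open>auto simp: indicator_def\<close>)
  also have "\<dots> = measure lborel K * (4 * d\<^sup>2 * (real DIM('a) * S))" by simp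
  \<comment> \<open>The element lies in the ball of radius \<open>q * \<rho>\<close> around
    \<open>z\<close>, whose volume is a multiple of that of the inner ball.\<close>
  also have "\<dots> \<le> (q ^ DIM('a) * V) * (4 * (q * \<rho>)\<^sup>2 * (real DIM('a) * S))"
  proof (intro mult_mono)
    have "measure lborel K \<le> measure lborel (cball z (q * \<rho>))"
    proof (rule measure_mono_fmeasurable)
      show "K \<subseteq> cball z (q * \<rho>)" using order_trans[OF dist[OF zK] q[folded d_def]] by (auto simp: dist_norm)
      show "cball z (q * \<rho>) \<in> fmeasurable lborel"
        using emeasure_lborel_cball_finite[of z "q * \<rho>"] by (auto simp: fmeasurable_def)
    qed simp
    also have "\<dots> = q ^ DIM('a) * V"
      using q0 \<rho> by (simp add: V_def content_cball content_ball power_mult_distrib)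
    finally show "measure lborel K \<le> q ^ DIM('a) * V" .
    show "d\<^sup>2 \<le> (q * \<rho>)\<^sup>2" using q d0 by (intro power_mono) (auto simp: d_def)
  qed (use q0 S0 in \<open>auto simp: V_def\<close>)
  also have "\<dots> = 4 * real DIM('a) * q ^ (DIM('a) + 2) * (\<Sum>e\<in>Basis. V * (\<rho>\<^sup>2 * (norm (A e))\<^sup>2))"
    by (simp add: S_def sum_distrib_left power_mult_distrib power_add power2_eq_square mult_ac)
  also have "(\<Sum>e\<in>Basis. V * (\<rho>\<^sup>2 * (norm (A e))\<^sup>2)) = (\<Sum>e\<in>Basis. LINT x|lborel. indicator (ball z \<rho>) x * (norm (shift_diff (\<rho> *\<^sub>R e) u x))\<^sup>2)"
  proof (rule sum.cong[OF refl])
    fix c :: 'a assume c: "c \<in> Basis"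
    have "indicator (ball z \<rho>) x * (norm (shift_diff (\<rho> *\<^sub>R c) u x))\<^sup>2 = indicator (ball z \<rho>) x * (\<rho>\<^sup>2 * (norm (A c))\<^sup>2)" for x
    proof (cases "x \<in> ball z \<rho>")
      case True
      \<comment> \<open>The ball of radius \<open>2 * \<rho>\<close> is inside the element, so
        points within \<rho> of \<open>z\<close> stay in it after a shift of length \<rho>, and the
        difference there is exactly linear.\<close>
      have "dist z (x + \<rho> *\<^sub>R c) \<le> dist z x + dist x (x + \<rho> *\<^sub>R c)" by (rule dist_triangle)
      also have "dist x (x + \<rho> *\<^sub>R c) = \<rho>" using c \<rho> by (simp add: dist_norm)
      finally have "x + \<rho> *\<^sub>R c \<in> K" "x \<in> K" using True \<rho> by (auto intro!: subsetD[OF z])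
      then have "shift_diff (\<rho> *\<^sub>R c) u x = \<rho> *\<^sub>R A c"
        using e by (simp add: shift_diff_def linear_add[OF A] linear_cmul[OF A])
      then show ?thesis using \<rho> by (simp add: power_mult_distrib)
    qed simp
    moreover have "(LINT x|lborel. indicator (ball z \<rho>) x * (\<rho>\<^sup>2 * (norm (A c))\<^sup>2)) = V * (\<rho>\<^sup>2 * (norm (A c))\<^sup>2)"
      by (simp add: V_def)
    ultimately show "V * (\<rho>\<^sup>2 * (norm (A c))\<^sup>2) = (LINT x|lborel. indicator (ball z \<rho>) x * (norm (shift_diff (\<rho> *\<^sub>R c) u x))\<^sup>2)"
      by (simp only:)
  qed
  finally show "(LINT x|lborel. indicator K x * (1 - (norm (u x))\<^sup>2)\<^sup>2) \<le>
    4 * real DIM('a) * q ^ (DIM('a) + 2) * (\<Sum>e\<in>Basis. LINT x|lborel. indicator (ball z \<rho>) x * (norm (shift_diff (\<rho> *\<^sub>R e) u x))\<^sup>2)" .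
qed

text \<open>One radius \<rho> for all elements lets a single translation serve the whole mesh; the
  inner balls are disjoint, so the local integrals sum to at most the global one. Quasiuniformity is
  what will make such a radius available.\<close>

lemma unit_defect:
  fixes \<T> :: "'a::euclidean_space set set" and u :: "'a \<Rightarrow> 'b::euclidean_space"
  assumes T: "triangulation \<T>" and aff: "\<And>K. K \<in> \<T> \<Longrightarrow> affine_map_on K u"
    and unit: "\<And>z. z \<in> nodes \<T> \<Longrightarrow> norm (u z) = 1"
    and u: "u \<in> L2" and z: "\<And>K. K \<in> \<T> \<Longrightarrow> \<exists>z. cball z (2 * \<rho>) \<subseteq> K" and \<rho>: "\<rho> > 0"
    and q: "\<And>K. K \<in> \<T> \<Longrightarrow> diameter K \<le> q * \<rho>" and q0: "0 \<le> q"
  shows "integrable lborel (\<lambda>x. indicator (\<Union>\<T>) x * (1 - (norm (u x))\<^sup>2)\<^sup>2)"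
    and "(LINT x|lborel. indicator (\<Union>\<T>) x * (1 - (norm (u x))\<^sup>2)\<^sup>2) \<le>
    4 * real DIM('a) * q ^ (DIM('a) + 2) * (\<Sum>e\<in>Basis. L2_inner (shift_diff (\<rho> *\<^sub>R e) u) (shift_diff (\<rho> *\<^sub>R e) u))"
proof -
  note D = triangulationD[OF T]
  have [measurable]: "u \<in> borel_measurable borel" using u by (rule L2_measurable)
  have [measurable]: "\<Union>\<T> \<in> sets borel"
    using D(1,2) by (intro borel_closed closed_Union) (auto intro: compact_imp_closed)
  obtain c where c: "\<And>K. K \<in> \<T> \<Longrightarrow> cball (c K) (2 * \<rho>) \<subseteq> K" using z by metis
  define C where "C = 4 * real DIM('a) * q ^ (DIM('a) + 2)"
  have C0: "0 \<le> C" using q0 by (simp add: C_def)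
  let ?f = "\<lambda>x. (1 - (norm (u x))\<^sup>2)\<^sup>2"
  note el = element_unit_defect[OF D(2) D(3) aff unit[OF nodes_extreme] u c \<rho> q]
  have isum: "integrable lborel (\<lambda>x. \<Sum>K\<in>\<T>. indicator K x * ?f x)"
    by (intro Bochner_Integration.integrable_sum el(1))
  have le: "indicator (\<Union>\<T>) x * ?f x \<le> (\<Sum>K\<in>\<T>. indicator K x * ?f x)" for x
  proof (cases "x \<in> \<Union>\<T>")
    case True
    then obtain K where K: "K \<in> \<T>" "x \<in> K" by blast
    have "indicator K x * ?f x \<le> (\<Sum>K\<in>\<T>. indicator K x * ?f x)"
      by (rule member_le_sum[OF K(1)]) (use D(1) in auto)
    then show ?thesis using K True by simp
  qed (simp add: sum_nonneg)
  show int: "integrable lborel (\<lambda>x. indicator (\<Union>\<T>) x * ?f x)"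
    by (rule Bochner_Integration.integrable_bound[OF isum])
      (use le in \<open>auto intro!: AE_I2 intro: order_trans[OF _ abs_ge_self]\<close>)
  have "(LINT x|lborel. indicator (\<Union>\<T>) x * ?f x) \<le> (LINT x|lborel. (\<Sum>K\<in>\<T>. indicator K x * ?f x))"
    by (rule integral_mono[OF int isum le])
  also have "\<dots> = (\<Sum>K\<in>\<T>. LINT x|lborel. indicator K x * ?f x)"
    by (rule Bochner_Integration.integral_sum) (rule el(1))
  also have "\<dots> \<le> (\<Sum>K\<in>\<T>. C * (\<Sum>e\<in>Basis. LINT x|lborel. indicator (ball (c K) \<rho>) x * (norm (shift_diff (\<rho> *\<^sub>R e) u x))\<^sup>2))"
    unfolding C_def by (intro sum_mono el(2))
  also have "\<dots> = C * (\<Sum>e\<in>Basis. \<Sum>K\<in>\<T>. LINT x|lborel. indicator (ball (c K) \<rho>) x * (norm (shift_diff (\<rho> *\<^sub>R e) u x))\<^sup>2)"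
    by (subst sum.swap) (simp add: sum_distrib_left)
  also have "\<dots> \<le> C * (\<Sum>e\<in>Basis. L2_inner (shift_diff (\<rho> *\<^sub>R e) u) (shift_diff (\<rho> *\<^sub>R e) u))"
  proof (intro mult_left_mono sum_mono C0)
    fix e :: 'a assume "e \<in> Basis"
    let ?g = "\<lambda>x. (norm (shift_diff (\<rho> *\<^sub>R e) u x))\<^sup>2"
    have ig: "integrable lborel ?g" by (intro L2_integrable_sq L2_shift_diff u)
    have ib: "integrable lborel (\<lambda>x. indicator (ball (c K) \<rho>) x * ?g x)" for K
      by (rule Bochner_Integration.integrable_bound[OF ig]) (auto simp: indicator_def)
    have "(\<Sum>K\<in>\<T>. LINT x|lborel. indicator (ball (c K) \<rho>) x * ?g x) = (LINT x|lborel. (\<Sum>K\<in>\<T>. indicator (ball (c K) \<rho>) x * ?g x))"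
      by (rule Bochner_Integration.integral_sum[symmetric]) (rule ib)
    also have "\<dots> \<le> (LINT x|lborel. ?g x)"
    proof (rule integral_mono[OF Bochner_Integration.integrable_sum ig])
      fix x
      have bc: "ball a \<rho> \<subseteq> cball a (2 * \<rho>)" for a :: 'a
        using \<rho> by (simp add: ball_subset_cball_iff)
      \<comment> \<open>The face \<open>K \<inter> K'\<close> contains a point interior to
        \<open>K\<close>, so it is not a proper face and equals \<open>K\<close>; the same holds
        with the elements exchanged.\<close>
      have uniq: "K = K'" if K: "K \<in> \<T>" "K' \<in> \<T>" and x: "x \<in> ball (c K) \<rho>" "x \<in> ball (c K') \<rho>" for K K'
      proof -
        have "ball (c K) \<rho> \<subseteq> K" "ball (c K') \<rho> \<subseteq> K'"
          using order_trans[OF bc c[OF K(1)]] order_trans[OF bc c[OF K(2)]] by simp_all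
        then have xi: "x \<in> interior K" "x \<in> interior K'"
          using x interior_maximal open_ball by blast+
        then have xK: "x \<in> K \<inter> K'" using interior_subset by blast
        have "K \<inter> K' = K" using face_of_disjoint_interior[OF D(5)[OF K]] xi xK by blast
        moreover have "K' \<inter> K = K'" using face_of_disjoint_interior[OF D(5)[OF K(2,1)]] xi xK by blast
        ultimately show ?thesis by blast
      qed
      show "(\<Sum>K\<in>\<T>. indicator (ball (c K) \<rho>) x * ?g x) \<le> ?g x"
      proof (cases "\<exists>K\<in>\<T>. x \<in> ball (c K) \<rho>")
        case True
        then obtain K where K: "K \<in> \<T>" "x \<in> ball (c K) \<rho>" by blast
        have "(\<Sum>K'\<in>\<T>. indicator (ball (c K') \<rho>) x * ?g x) = (\<Sum>K'\<in>\<T>. if K' = K then ?g x else 0)"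
        proof (rule sum.cong[OF refl])
          fix K' assume K': "K' \<in> \<T>"
          have "x \<notin> ball (c K') \<rho>" if "K' \<noteq> K"
            using uniq[OF K(1) K' K(2)] that by blast
          then show "indicator (ball (c K') \<rho>) x * ?g x = (if K' = K then ?g x else 0)"
            using K(2) by (cases "K' = K") simp_all
        qed
        also have "\<dots> = ?g x" using D(1) K(1) by simp
        finally show ?thesis by simp
      next
        case False
        then have "(\<Sum>K\<in>\<T>. indicator (ball (c K) \<rho>) x * ?g x) = 0" by (intro sum.neutral) auto
        then show ?thesis by simp
      qed
    qed (rule ib)
    finally show "(\<Sum>K\<in>\<T>. LINT x|lborel. indicator (ball (c K) \<rho>) x * ?g x) \<le> L2_inner (shift_diff (\<rho> *\<^sub>R e) u) (shift_diff (\<rho> *\<^sub>R e) u)"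
      by (simp add: L2_inner_self)
  qed
  finally show "(LINT x|lborel. indicator (\<Union>\<T>) x * ?f x) \<le>
    4 * real DIM('a) * q ^ (DIM('a) + 2) * (\<Sum>e\<in>Basis. L2_inner (shift_diff (\<rho> *\<^sub>R e) u) (shift_diff (\<rho> *\<^sub>R e) u))"
    unfolding C_def .
qed

section \<open>Smooth functions with compact support\<close>

text \<open>The partial derivatives are continuous and vanish off the compact support, so they are
  bounded, and the mean value inequality applies.\<close>

lemma Cc_infty_lipschitz:
  fixes f :: "'a::euclidean_space \<Rightarrow> 'b::euclidean_space"
  assumes f: "f \<in> Cc_infty S"
  obtains L B where "L-lipschitz_on UNIV f" "\<And>x. norm (f x) \<le> B"
proof -
  define C where "C = closure {x. f x \<noteq> 0}"
  have C: "compact C" using f by (simp add: Cc_infty_def C_def)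
  have "C_k (Suc 0) f" using f by (simp add: Cc_infty_def)
  then have diff: "\<And>x. f differentiable (at x)" and ce: "\<And>e. e \<in> Basis \<Longrightarrow> continuous_on UNIV (\<lambda>x. frechet_derivative f (at x) e)"
    by auto
  have fd: "(f has_derivative frechet_derivative f (at x)) (at x)" for x
    using diff by (simp add: frechet_derivative_works)
  have cont: "continuous_on UNIV f"
    using diff by (meson continuous_at_imp_continuous_on differentiable_imp_continuous_within)
  have f0: "f x = 0" if "x \<notin> C" for x using that closure_subset[of "{x. f x \<noteq> 0}"] by (auto simp: C_def)
  have d0: "frechet_derivative f (at x) = (\<lambda>_. 0)" if "x \<notin> C" for x
  proof -
    have "open (- C)" using C by (simp add: compact_imp_closed open_Compl)
    then have "(f has_derivative (\<lambda>_. 0)) (at x)"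
      by (intro has_derivative_transform_within_open[of "\<lambda>_. 0" "\<lambda>_. 0" x UNIV "- C" f]) (use that f0 in auto)
    then show ?thesis by (rule frechet_derivative_at[symmetric])
  qed
  have "\<exists>M. \<forall>x\<in>C. norm (g x) \<le> M" if "continuous_on UNIV g" for g :: "'a \<Rightarrow> 'b"
    using compact_imp_bounded[OF compact_continuous_image[OF continuous_on_subset[OF that] C]] unfolding bounded_iff by auto
  note bd = this
  obtain B where B: "\<And>x. x \<in> C \<Longrightarrow> norm (f x) \<le> B" using bd[OF cont] by blast
  have B': "norm (f x) \<le> max B 0" for x using B[of x] f0[of x] by (cases "x \<in> C") auto
  have "\<forall>e\<in>Basis. \<exists>M. \<forall>x\<in>C. norm (frechet_derivative f (at x) e) \<le> M" using bd[OF ce] by blast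
  then obtain M where M: "\<And>e x. e \<in> Basis \<Longrightarrow> x \<in> C \<Longrightarrow> norm (frechet_derivative f (at x) e) \<le> M e" by metis
  \<comment> \<open>The maximum with 0 covers points off the support, where the derivative is zero,
    and the case of an empty support, where \<open>M e\<close> may be negative.\<close>
  define L where "L = (\<Sum>e\<in>Basis. max (M e) 0)"
  have on: "onorm (frechet_derivative f (at x)) \<le> L" for x
  proof (rule onorm_le)
    fix h
    have lin: "linear (frechet_derivative f (at x))" using fd has_derivative_linear by blast
    have "norm (frechet_derivative f (at x) h) \<le> norm h * (\<Sum>e\<in>Basis. norm (frechet_derivative f (at x) e))"
      by (rule norm_linear_le_sum_Basis[OF lin])
    also have "\<dots> \<le> norm h * L"
      unfolding L_def
    proof (intro mult_left_mono sum_mono)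
      fix e :: 'a assume "e \<in> Basis"
      then show "norm (frechet_derivative f (at x) e) \<le> max (M e) 0"
        using M[of e x] d0[of x] by (cases "x \<in> C") auto
    qed simp
    finally show "norm (frechet_derivative f (at x) h) \<le> L * norm h" by (simp add: mult.commute)
  qed
  have "L-lipschitz_on UNIV f"
  proof (rule lipschitz_onI)
    fix x y
    show "dist (f x) (f y) \<le> L * dist x y"
      using differentiable_bound[of UNIV f "\<lambda>x. frechet_derivative f (at x)" L x y] fd on by (simp add: dist_norm)
  qed (simp add: L_def sum_nonneg)
  then show thesis using that B' by blast
qed

lemma Cc_infty_support:
  assumes f: "f \<in> Cc_infty S" and S: "open S"
  obtains \<delta> where "\<delta> > 0" "\<And>z x. f z \<noteq> 0 \<Longrightarrow> norm (z - x) < \<delta> \<Longrightarrow> x \<in> S"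
proof -
  define C where "C = closure {x. f x \<noteq> 0}"
  have "compact C" "C \<subseteq> S" using f by (auto simp: Cc_infty_def C_def)
  then obtain \<epsilon> where e: "\<epsilon> > 0" "(\<Union>x\<in>C. ball x \<epsilon>) \<subseteq> S"
    using compact_subset_open_imp_ball_epsilon_subset[OF _ S] by blast
  have "x \<in> S" if "f z \<noteq> 0" "norm (z - x) < \<epsilon>" for z x
  proof -
    have "z \<in> C" using that(1) closure_subset[of "{x. f x \<noteq> 0}"] by (auto simp: C_def)
    moreover have "x \<in> ball z \<epsilon>" using that(2) by (simp add: dist_norm)
    ultimately show ?thesis using e(2) by blast
  qed
  then show thesis using that e(1) by blast
qed

section \<open>Passage to the limit\<close>

text \<open>The parallelogram law.\<close>

lemma frac_form_diff_le:
  assumes f: "f \<in> frac_space s" and g: "g \<in> frac_space s"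
  shows "frac_form s (\<lambda>x. f x - g x) (\<lambda>x. f x - g x) \<le> 2 * frac_form s f f + 2 * frac_form s g g"
proof -
  have "frac_form s (\<lambda>x. f x + g x) (\<lambda>x. f x + g x) + frac_form s (\<lambda>x. f x - g x) (\<lambda>x. f x - g x) = 2 * frac_form s f f + 2 * frac_form s g g"
    by (simp add: frac_form_add_left frac_form_add_right frac_form_diff_left frac_form_diff_right f g frac_space_add frac_space_diff)
  then show ?thesis using frac_form_self_nonneg[of s "\<lambda>x. f x + g x"] by linarith
qed

lemma frac_laplacian_cong_AE:
  assumes [measurable]: "f \<in> borel_measurable borel" "g \<in> borel_measurable borel" and fg: "AE x in lborel. f x = g x"
  shows "frac_laplacian (s / 2) f = frac_laplacian (s / 2) g"
proof -
  have "L2_fourier (fcomp f i) = L2_fourier (fcomp g i)" for i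
    by (rule L2_fourier_cong_AE) (use fg in \<open>auto simp: fcomp_def elim: eventually_mono\<close>)
  then have "frac_symbol s f i = frac_symbol s g i" for i
    by (intro ext) (simp add: frac_symbol_def)
  then show ?thesis by (intro ext) (simp add: vec_eq_iff frac_laplacian_nth)
qed

lemma frac_space_cong_AE:
  assumes f: "f \<in> frac_space s" and g[measurable]: "g \<in> borel_measurable borel" and fg: "AE x in lborel. f x = g x"
  shows "g \<in> frac_space s"
proof (rule frac_spaceI)
  note D = frac_spaceD[OF f]
  have [measurable]: "f \<in> borel_measurable borel" using D(1) by (rule L2_measurable)
  show "g \<in> L2" by (rule L2_dominated[OF D(1) g, where c=1]) (use fg in \<open>auto elim: eventually_mono\<close>)
  show "integrable lborel g"
    by (rule integrable_cong_AE_imp[OF D(2)]) (use fg in \<open>auto elim: eventually_mono\<close>)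
  have "L2_fourier (fcomp f i) = L2_fourier (fcomp g i)" for i
    by (rule L2_fourier_cong_AE) (use fg in \<open>auto simp: fcomp_def elim: eventually_mono\<close>)
  then have "frac_symbol s f i = frac_symbol s g i" for i
    by (simp add: frac_symbol_def fun_eq_iff)
  then show "frac_symbol s g i \<in> L2" for i using D(3)[of i] by simp
qed

lemma norm_inner_scaleR_diff_le:
  assumes "norm a \<le> B" "norm b' \<le> B" "norm b \<le> B" "norm c' \<le> B"
  shows "norm ((a' \<bullet> b') *\<^sub>R c' - (a \<bullet> b) *\<^sub>R c) \<le> B\<^sup>2 * (norm (a' - a) + norm (b' - b) + norm (c' - c))"
proof -
  have B: "0 \<le> B" using assms norm_ge_zero order_trans by blast
  have "(a' \<bullet> b') *\<^sub>R c' - (a \<bullet> b) *\<^sub>R c = ((a' - a) \<bullet> b') *\<^sub>R c' + (a \<bullet> (b' - b)) *\<^sub>R c' + (a \<bullet> b) *\<^sub>R (c' - c)"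
    by (simp add: inner_diff_left inner_diff_right algebra_simps)
  then have "norm ((a' \<bullet> b') *\<^sub>R c' - (a \<bullet> b) *\<^sub>R c) \<le> norm (((a' - a) \<bullet> b') *\<^sub>R c') + norm ((a \<bullet> (b' - b)) *\<^sub>R c') + norm ((a \<bullet> b) *\<^sub>R (c' - c))"
    by (metis norm_triangle_mono norm_triangle_ineq order_refl)
  also have "\<dots> = \<bar>(a' - a) \<bullet> b'\<bar> * norm c' + \<bar>a \<bullet> (b' - b)\<bar> * norm c' + \<bar>a \<bullet> b\<bar> * norm (c' - c)"
    by simp
  also have "\<dots> \<le> (norm (a' - a) * B) * B + (B * norm (b' - b)) * B + (B * B) * norm (c' - c)"
    using assms B by (intro add_mono mult_mono order_trans[OF Cauchy_Schwarz_ineq2]) auto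
  finally show ?thesis by (simp add: algebra_simps power2_eq_square)
qed

text \<open>Both limits are taken here. The pointwise bound on \<open>u\<close> keeps the fields
  \<open>(w j x \<bullet> u x) *\<^sub>R v x\<close> bounded and their energies uniformly controlled
  in \<open>j\<close>.\<close>

lemma skew_test_limit_bounded:
  fixes w :: "nat \<Rightarrow> 'a::euclidean_space \<Rightarrow> real ^ 'n"
  assumes s: "0 < s" "s < 1"
    and w: "\<And>k. w k \<in> frac_space s" and K: "\<And>k. frac_form s (w k) (w k) \<le> K" and wL: "\<And>k. \<exists>L. L-lipschitz_on UNIV (w k)"
    and wB: "\<And>k x. norm (w k x) \<le> B"
    and u: "u \<in> frac_space s" and uB: "\<And>x. norm (u x) \<le> B"
    and lim: "(\<lambda>k. L2_norm (\<lambda>x. w k x - u x)) \<longlonglongrightarrow> 0"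
    and v: "Lv-lipschitz_on UNIV v" "\<And>x. norm (v x) \<le> B" "\<And>x. x \<notin> \<Omega> \<Longrightarrow> v x = 0" "\<And>x. norm x > R \<Longrightarrow> v x = 0"
    and unit: "AE x in lborel. x \<in> \<Omega> \<longrightarrow> (norm (u x))\<^sup>2 = 1" and orth: "AE x in lborel. x \<in> \<Omega> \<longrightarrow> u x \<bullet> v x = 0"
    and test: "\<And>j. (\<lambda>k. frac_form s (w k) (\<lambda>x. wedge (v x) (w j x) (w k x))) \<longlonglongrightarrow> 0"
  shows "frac_form s u v = 0"
proof -
  have B0: "0 \<le> B" using v(2)[of 0] norm_ge_zero order_trans by blast
  have vf: "v \<in> frac_space s" by (rule lipschitz_frac_space[OF s v(1,2,4)])
  note D = frac_spaceD(1)[OF w] frac_spaceD(1)[OF u] frac_spaceD(1)[OF vf]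
  have [measurable]: "w k \<in> borel_measurable borel" "u \<in> borel_measurable borel" "v \<in> borel_measurable borel" for k
    using D by (auto dest: L2_measurable)
  \<comment> \<open>The index \<open>j\<close> is frozen while \<open>k\<close> tends to infinity,
    so the Lipschitz constant of \<open>w j\<close> may depend on \<open>j\<close>.\<close>
  have zero: "frac_form s u (\<lambda>x. wedge (v x) (w j x) (u x)) = 0" for j
  proof -
    obtain Lj where Lj: "Lj-lipschitz_on UNIV (w j)" using wL by blast
    define L where "L = max Lv Lj"
    have L: "L-lipschitz_on UNIV v" "L-lipschitz_on UNIV (w j)"
      using lipschitz_on_le[OF v(1)] lipschitz_on_le[OF Lj] by (auto simp: L_def)
    have "(\<lambda>k. frac_form s (w k) (\<lambda>x. wedge (v x) (w j x) (w k x))) \<longlonglongrightarrow> frac_form s u (\<lambda>x. wedge (v x) (w j x) (u x))"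
      by (rule wedge_form_tendsto[OF s w K u lim L(1) v(2) L(2) wB
          wedge_frac_space[OF s vf w w v(2) wB wB v(4)] wedge_frac_space[OF s vf w u v(2) wB uB v(4)]])
    from LIMSEQ_unique[OF this test] show ?thesis .
  qed
  define h where "h = (\<lambda>j x. (w j x \<bullet> u x) *\<^sub>R v x)"
  have hm[measurable]: "h j \<in> borel_measurable borel" for j unfolding h_def by measurable
  have hb: "norm (h j x) \<le> B * B * B" for j x
  proof -
    have "\<bar>w j x \<bullet> u x\<bar> * norm (v x) \<le> (B * B) * B"
      using wB[of j x] uB[of x] v(2)[of x] B0
      by (intro mult_mono order_trans[OF Cauchy_Schwarz_ineq2]) auto
    then show ?thesis by (simp add: h_def)
  qed
  have h2: "h j \<in> L2" "integrable lborel (h j)" for j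
    using bounded_support_L2[OF hm hb, of R] v(4) by (auto simp: h_def)
  have hle: "norm (shift_diff y (h j) x) \<le> B\<^sup>2 * (norm (shift_diff y (w j) x) + norm (shift_diff y u x) + norm (shift_diff y v x))" for j x y
    unfolding shift_diff_def h_def by (rule norm_inner_scaleR_diff_le) (use wB uB v in auto)
  have hf: "h j \<in> frac_space s" for j
    by (rule frac_space_dominated(1)[OF s h2 w u vf _ hle]) simp
  have hE: "frac_form s (h j) (h j) \<le> 3 * (B\<^sup>2)\<^sup>2 * (K + frac_form s u u + frac_form s v v)" for j
  proof -
    have "frac_form s (h j) (h j) \<le> 3 * (B\<^sup>2)\<^sup>2 * (frac_form s (w j) (w j) + frac_form s u u + frac_form s v v)"
      by (rule frac_space_dominated(2)[OF s h2 w u vf _ hle]) simp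
    also have "\<dots> \<le> 3 * (B\<^sup>2)\<^sup>2 * (K + frac_form s u u + frac_form s v v)"
      using K[of j] by (intro mult_left_mono) auto
    finally show ?thesis .
  qed
  \<comment> \<open>Since \<open>u \<bullet> v = 0\<close> almost everywhere, the second term of the
    skew field drops out in the limit, which is not the case before it.\<close>
  have form_h: "frac_form s u (h j) = 0" for j
  proof -
    have "frac_laplacian (s / 2) (\<lambda>x. wedge (v x) (w j x) (u x)) = frac_laplacian (s / 2) (h j)"
    proof (rule frac_laplacian_cong_AE)
      show "AE x in lborel. wedge (v x) (w j x) (u x) = h j x"
        using orth
      proof eventually_elim
        case (elim x)
        have "v x \<bullet> u x = 0" using elim v(3)[of x] by (cases "x \<in> \<Omega>") (auto simp: inner_commute)
        then show ?case by (simp add: wedge_def h_def)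
      qed
    qed measurable
    then show ?thesis using zero[of j] by (simp add: frac_form_def)
  qed
  define g where "g = (\<lambda>j x. h j x - v x)"
  have gf: "g j \<in> frac_space s" for j unfolding g_def by (rule frac_space_diff[OF hf vf])
  have gE: "frac_form s (g j) (g j) \<le> 2 * (3 * (B\<^sup>2)\<^sup>2 * (K + frac_form s u u + frac_form s v v)) + 2 * frac_form s v v" for j
    unfolding g_def using frac_form_diff_le[OF hf vf, of j] hE[of j] by linarith
  \<comment> \<open>On the domain \<open>u \<bullet> u = 1\<close>, so \<open>v\<close> may be
    written as \<open>(u x \<bullet> u x) *\<^sub>R v x\<close> and \<open>g j\<close> is linear in
    \<open>w j - u\<close>; elsewhere \<open>v\<close> and \<open>g j\<close> both vanish.\<close>
  have g0: "(\<lambda>j. L2_norm (g j)) \<longlonglongrightarrow> 0"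
  proof (rule Lim_null_comparison)
    show "(\<lambda>j. B * B * L2_norm (\<lambda>x. w j x - u x)) \<longlonglongrightarrow> 0"
      using tendsto_mult_left[OF lim, of "B * B"] by simp
    show "\<forall>\<^sub>F j in sequentially. norm (L2_norm (g j)) \<le> B * B * L2_norm (\<lambda>x. w j x - u x)"
    proof (intro always_eventually allI)
      fix j
      have "L2_inner (g j) (g j) \<le> L2_inner (\<lambda>x. (B * B) *\<^sub>R (w j x - u x)) (\<lambda>x. (B * B) *\<^sub>R (w j x - u x))"
      proof (rule L2_inner_mono)
        show "(\<lambda>x. (B * B) *\<^sub>R (w j x - u x)) \<in> L2" by (intro L2_scaleR L2_diff D)
        show "g j \<in> borel_measurable borel" unfolding g_def by measurable
        show "AE x in lborel. norm (g j x) \<le> norm ((B * B) *\<^sub>R (w j x - u x))"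
          using unit
        proof eventually_elim
          case (elim x)
          show ?case
          proof (cases "x \<in> \<Omega>")
            case True
            then have "u x \<bullet> u x = 1" using elim by (simp add: power2_norm_eq_inner)
            then have "g j x = ((w j x - u x) \<bullet> u x) *\<^sub>R v x"
              by (simp add: g_def h_def inner_diff_left scaleR_diff_left)
            then have "norm (g j x) = \<bar>(w j x - u x) \<bullet> u x\<bar> * norm (v x)" by simp
            also have "\<dots> \<le> (norm (w j x - u x) * B) * B"
              using uB[of x] v(2)[of x] B0
              by (intro mult_mono order_trans[OF Cauchy_Schwarz_ineq2] mult_left_mono) auto
            finally show ?thesis using B0 by (simp add: mult_ac)
          qed (simp add: g_def h_def v(3))
        qed
      qed
      also have "\<dots> = (B * B * L2_norm (\<lambda>x. w j x - u x))\<^sup>2"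
        by (simp only: L2_inner_scaleR_left L2_inner_scaleR_right power_mult_distrib L2_norm_square) (simp add: power2_eq_square)
      finally have "L2_norm (g j) \<le> sqrt ((B * B * L2_norm (\<lambda>x. w j x - u x))\<^sup>2)"
        unfolding L2_norm_def[of "g j"] by (rule real_sqrt_le_mono)
      then show "norm (L2_norm (g j)) \<le> B * B * L2_norm (\<lambda>x. w j x - u x)" using B0 by simp
    qed
  qed
  have "(\<lambda>j. frac_form s u (g j)) \<longlonglongrightarrow> 0"
    by (rule frac_form_weak_limit_0[OF s(1) u gf gE g0])
  moreover have "frac_form s u (g j) = - frac_form s u v" for j
    unfolding g_def by (simp add: frac_form_diff_right[OF hf vf u] form_h)
  ultimately have "(\<lambda>j::nat. - frac_form s u v) \<longlonglongrightarrow> 0" by simp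
  then show ?thesis by (simp add: LIMSEQ_const_iff)
qed

theorem skew_test_limit:
  fixes w :: "nat \<Rightarrow> 'a::euclidean_space \<Rightarrow> real ^ 'n"
  assumes s: "0 < s" "s < 1"
    and w: "\<And>k. w k \<in> frac_space s" and K: "\<And>k. frac_form s (w k) (w k) \<le> K" and wL: "\<And>k. \<exists>L. L-lipschitz_on UNIV (w k)"
    and wB: "\<And>k x. norm (w k x) \<le> B"
    and u: "u \<in> frac_space s" and uB: "AE x in lborel. norm (u x) \<le> B"
    and lim: "(\<lambda>k. L2_norm (\<lambda>x. w k x - u x)) \<longlonglongrightarrow> 0"
    and v: "Lv-lipschitz_on UNIV v" "\<And>x. norm (v x) \<le> B" "\<And>x. x \<notin> \<Omega> \<Longrightarrow> v x = 0" "\<And>x. norm x > R \<Longrightarrow> v x = 0"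
    and unit: "AE x in lborel. x \<in> \<Omega> \<longrightarrow> (norm (u x))\<^sup>2 = 1" and orth: "AE x in lborel. x \<in> \<Omega> \<longrightarrow> u x \<bullet> v x = 0"
    and test: "\<And>j. (\<lambda>k. frac_form s (w k) (\<lambda>x. wedge (v x) (w j x) (w k x))) \<longlonglongrightarrow> 0"
  shows "frac_form s u v = 0"
proof -
  have B0: "0 \<le> B" using v(2)[of 0] norm_ge_zero order_trans by blast
  have um[measurable]: "u \<in> borel_measurable borel" using frac_spaceD(1)[OF u] by (rule L2_measurable)
  have wm: "w k \<in> borel_measurable borel" for k using frac_spaceD(1)[OF w] by (rule L2_measurable)
  \<comment> \<open>A representative of \<open>u\<close> that is bounded everywhere; the form does
    not see null sets.\<close>
  define u' where "u' = (\<lambda>x. if norm (u x) \<le> B then u x else 0)"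
  have u'm[measurable]: "u' \<in> borel_measurable borel" unfolding u'_def by measurable
  have ae: "AE x in lborel. u x = u' x" using uB by eventually_elim (simp add: u'_def)
  have u': "u' \<in> frac_space s" by (rule frac_space_cong_AE[OF u u'm ae])
  have "L2_norm (\<lambda>x. w k x - u x) = L2_norm (\<lambda>x. w k x - u' x)" for k
    unfolding L2_norm_def
    by (intro arg_cong[where f=sqrt] L2_inner_cong_AE) (use ae wm in \<open>auto elim: eventually_mono\<close>)
  then have lim': "(\<lambda>k. L2_norm (\<lambda>x. w k x - u' x)) \<longlonglongrightarrow> 0" using lim by simp
  have "frac_form s u' v = 0"
  proof (rule skew_test_limit_bounded[OF s w K wL wB u' _ lim' v _ _ test])
    show "norm (u' x) \<le> B" for x using B0 by (simp add: u'_def)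
    show "AE x in lborel. x \<in> \<Omega> \<longrightarrow> (norm (u' x))\<^sup>2 = 1" using ae unit by eventually_elim auto
    show "AE x in lborel. x \<in> \<Omega> \<longrightarrow> u' x \<bullet> v x = 0" using ae orth by eventually_elim auto
  qed
  then show ?thesis unfolding frac_form_def frac_laplacian_cong_AE[OF um u'm ae] .
qed

lemma frac_space_Hs:
  assumes s: "0 < s" "s < 1" and f: "f \<in> frac_space s"
  shows "f \<in> Hs s"
proof -
  note D = frac_spaceD[OF f]
  have "integrable lborel (\<lambda>\<xi>. (1 + (norm \<xi>)\<^sup>2) powr s * (norm (L2_fourier (\<lambda>y. complex_of_real (f y $ i)) \<xi>))\<^sup>2)" for i
  proof -
    define F where "F = L2_fourier (fcomp f i)"
    have F2: "F \<in> L2" unfolding F_def by (intro L2_fourier_L2 fcomp_L2 D)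
    have [measurable]: "F \<in> borel_measurable borel" using F2 by (rule L2_measurable)
    have "integrable lborel (\<lambda>\<xi>. (1 + (norm \<xi>)\<^sup>2) powr s * (norm (F \<xi>))\<^sup>2)"
    proof (rule Bochner_Integration.integrable_bound)
      show "integrable lborel (\<lambda>\<xi>. 2 * ((norm (F \<xi>))\<^sup>2 + (norm (frac_symbol s f i \<xi>))\<^sup>2))"
        by (intro integrable_mult_right Bochner_Integration.integrable_add L2_integrable_sq F2 D)
      show "AE \<xi> in lborel. norm ((1 + (norm \<xi>)\<^sup>2) powr s * (norm (F \<xi>))\<^sup>2) \<le> norm (2 * ((norm (F \<xi>))\<^sup>2 + (norm (frac_symbol s f i \<xi>))\<^sup>2))"
      proof (rule AE_I2)
        fix \<xi> :: 'a
        \<comment> \<open>With \<open>q = (norm \<xi>)\<^sup>2\<close> this uses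
          \<open>1 + q \<le> 2 * max 1 q\<close> and \<open>2 powr s \<le> 2\<close>.\<close>
        have "(1 + (norm \<xi>)\<^sup>2) powr s \<le> 2 * (1 + norm \<xi> powr (2 * s))"
        proof -
          define q where "q = (norm \<xi>)\<^sup>2"
          have q: "0 \<le> q" by (simp add: q_def)
          have "(1 + q) powr s \<le> (2 * max 1 q) powr s" using q s by (intro powr_mono2) auto
          also have "\<dots> = 2 powr s * (max 1 q) powr s" by (simp add: powr_mult)
          also have "\<dots> \<le> 2 powr 1 * (1 + q powr s)"
            using s q by (intro mult_mono powr_mono) (auto simp: max_def)
          also have "q powr s = norm \<xi> powr (2 * s)"
            by (cases "\<xi> = 0") (simp_all add: q_def powr_powr flip: powr_numeral)
          finally show ?thesis by (simp add: q_def)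
        qed
        then have "(1 + (norm \<xi>)\<^sup>2) powr s * (norm (F \<xi>))\<^sup>2 \<le> (2 * (1 + norm \<xi> powr (2 * s))) * (norm (F \<xi>))\<^sup>2"
          by (rule mult_right_mono) simp
        also have "\<dots> = 2 * ((norm (F \<xi>))\<^sup>2 + (norm (frac_symbol s f i \<xi>))\<^sup>2)"
          by (simp add: norm_frac_symbol_square F_def algebra_simps)
        finally show "norm ((1 + (norm \<xi>)\<^sup>2) powr s * (norm (F \<xi>))\<^sup>2) \<le> norm (2 * ((norm (F \<xi>))\<^sup>2 + (norm (frac_symbol s f i \<xi>))\<^sup>2))"
          by simp
      qed
    qed measurable
    then show ?thesis by (simp add: F_def fcomp_def[abs_def])
  qed
  then show ?thesis using D by (simp add: Hs_def)
qed

lemma S1_add: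
  assumes "f \<in> S1 \<T>" "g \<in> S1 \<T>"
  shows "(\<lambda>x. f x + g x) \<in> S1 \<T>"
  using assms by (auto simp: S1_def intro: continuous_on_add affine_map_on_add)

text \<open>The constant is the sum of the constants of the elements and depends on the mesh.
  Existence is all that is asked: it places each discrete map in the energy space and makes it
  usable as a frozen coefficient.\<close>

lemma S1_lipschitz:
  fixes w :: "'a::euclidean_space \<Rightarrow> 'b::euclidean_space"
  assumes T: "triangulation \<T>" and w: "w \<in> S1 \<T>" and \<Omega>: "open \<Omega>" "\<Omega> \<subseteq> \<Union>\<T>" and w0: "\<And>x. x \<notin> \<Omega> \<Longrightarrow> w x = 0"
  shows "\<exists>L. L-lipschitz_on UNIV w"
proof -
  have "\<exists>L. L-lipschitz_on K w" if "K \<in> \<T>" for K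
    using affine_map_on_lipschitz[OF S1_affine[OF w that]] by blast
  then obtain l where l: "\<And>K. K \<in> \<T> \<Longrightarrow> (l K)-lipschitz_on K w" by metis
  define L where "L = (\<Sum>K\<in>\<T>. l K)"
  have l0: "0 \<le> l K" if "K \<in> \<T>" for K using lipschitz_on_nonneg[OF l[OF that]] .
  have lL: "l K \<le> L" if "K \<in> \<T>" for K
    unfolding L_def using that l0 triangulationD(1)[OF T] by (intro member_le_sum) auto
  have L0: "0 \<le> L" unfolding L_def by (rule sum_nonneg) (rule l0)
  have "L-lipschitz_on UNIV w"
  proof (rule lipschitz_on_finite_closed_cover[of "insert (- \<Omega>) \<T>"])
    show "finite (insert (- \<Omega>) \<T>)" using triangulationD(1)[OF T] by auto
    show "closed S" if "S \<in> insert (- \<Omega>) \<T>" for S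
      using that \<Omega>(1) triangulationD(2)[OF T] by (auto intro: compact_imp_closed)
    show "\<Union>(insert (- \<Omega>) \<T>) = UNIV" using \<Omega>(2) by auto
    show "L-lipschitz_on S w" if S: "S \<in> insert (- \<Omega>) \<T>" for S
    proof (cases "S \<in> \<T>")
      case True
      then show ?thesis using lipschitz_on_le[OF l lL] by blast
    next
      case False
      then have "S = - \<Omega>" using S by blast
      then show ?thesis using w0 L0 by (intro lipschitz_onI) auto
    qed
  qed (rule L0)
  then show ?thesis by blast
qed

lemma L2_norm_norm[simp]: "L2_norm (\<lambda>x. norm (f x)) = L2_norm f"
  by (simp add: L2_norm_def L2_inner_self)

lemma L2_norm_mono:
  assumes "g \<in> L2" "f \<in> borel_measurable borel" "AE x in lborel. norm (f x) \<le> norm (g x)"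
  shows "L2_norm f \<le> L2_norm g"
  unfolding L2_norm_def by (rule real_sqrt_le_mono[OF L2_inner_mono[OF assms]])

text \<open>On \<open>S\<close> the sequence converges uniformly to \<open>N\<close>, and it equals
  \<open>N\<close> outside a ball; on a set of finite measure this is \<open>L\<^sup>2\<close>
  convergence, so the two limits agree.\<close>

lemma limit_exterior_values:
  fixes w :: "nat \<Rightarrow> 'a::euclidean_space \<Rightarrow> 'b::euclidean_space"
  assumes w: "\<And>k. w k \<in> L2" and u: "u \<in> L2" and lim: "(\<lambda>k. L2_norm (\<lambda>x. w k x - u x)) \<longlonglongrightarrow> 0"
    and S[measurable]: "S \<in> sets borel" and N: "N \<in> L2"
    and err: "\<And>k x. x \<in> S \<Longrightarrow> norm (w k x - N x) \<le> \<epsilon> k" and out: "\<And>k x. x \<in> S \<Longrightarrow> norm x > R \<Longrightarrow> w k x = N x" and \<epsilon>: "\<epsilon> \<longlonglongrightarrow> 0"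
  shows "AE x in lborel. x \<in> S \<longrightarrow> u x = N x"
proof -
  have [measurable]: "w k \<in> borel_measurable borel" "u \<in> borel_measurable borel" "N \<in> borel_measurable borel" for k
    using w u N by (auto dest: L2_measurable)
  define f where "f = (\<lambda>x. indicator S x *\<^sub>R (u x - N x))"
  have fm: "f \<in> borel_measurable borel" unfolding f_def by measurable
  have f2: "f \<in> L2" by (rule L2_dominated[OF L2_diff[OF u N] fm, where c=1]) (auto simp: f_def indicator_def)
  have i: "(\<lambda>x::'a. indicator (cball 0 R) x :: real) \<in> L2"
    using emeasure_lborel_cball_finite[of "0::'a" R] by (intro indicator_L2) auto
  have le: "L2_norm f \<le> L2_norm (\<lambda>x. w k x - u x) + \<bar>\<epsilon> k\<bar> * L2_norm (\<lambda>x::'a. indicator (cball 0 R) x :: real)" for k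
  proof -
    define g where "g = (\<lambda>x. indicator S x *\<^sub>R (w k x - N x))"
    define h where "h = (\<lambda>x. indicator S x *\<^sub>R (w k x - u x))"
    have gm: "g \<in> borel_measurable borel" "h \<in> borel_measurable borel" unfolding g_def h_def by measurable
    have g2: "g \<in> L2" by (rule L2_dominated[OF L2_diff[OF w[of k] N] gm(1), where c=1]) (auto simp: g_def indicator_def)
    have h2: "h \<in> L2" by (rule L2_dominated[OF L2_diff[OF w[of k] u] gm(2), where c=1]) (auto simp: h_def indicator_def)
    have "f = (\<lambda>x. g x - h x)" by (auto simp: f_def g_def h_def algebra_simps)
    then have "L2_norm f \<le> L2_norm g + L2_norm h" using L2_norm_triangle_diff[OF g2 h2] by simp
    also have "L2_norm h \<le> L2_norm (\<lambda>x. w k x - u x)"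
      by (rule L2_norm_mono[OF L2_diff[OF w u] gm(2)]) (auto simp: h_def indicator_def)
    also have "L2_norm g \<le> L2_norm (\<lambda>x::'a. \<epsilon> k *\<^sub>R (indicator (cball 0 R) x :: real))"
    proof (rule L2_norm_mono[OF L2_scaleR[OF i] gm(1)], intro AE_I2)
      fix x
      show "norm (g x) \<le> norm (\<epsilon> k *\<^sub>R (indicator (cball 0 R) x :: real))"
        using err[of x k] out[of x k] by (auto simp: g_def indicator_def)
    qed
    also have "\<dots> = \<bar>\<epsilon> k\<bar> * L2_norm (\<lambda>x::'a. indicator (cball 0 R) x :: real)"
      by (simp add: L2_norm_def L2_inner_scaleR_left L2_inner_scaleR_right real_sqrt_mult del: real_scaleR_def flip: mult.assoc)
    finally show ?thesis by simp
  qed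
  have "L2_norm f \<le> 0 + 0 * L2_norm (\<lambda>x::'a. indicator (cball 0 R) x :: real)"
  proof (rule LIMSEQ_le_const)
    show "(\<lambda>k. L2_norm (\<lambda>x. w k x - u x) + \<bar>\<epsilon> k\<bar> * L2_norm (\<lambda>x::'a. indicator (cball 0 R) x :: real)) \<longlonglongrightarrow> 0 + 0 * L2_norm (\<lambda>x::'a. indicator (cball 0 R) x :: real)"
      by (intro tendsto_intros lim tendsto_rabs_zero \<epsilon>)
  qed (use le in auto)
  then have "L2_norm f = 0" by (simp add: order_antisym)
  then have "AE x in lborel. f x = 0" by (rule L2_norm_eq_0_imp_AE[OF f2])
  then show ?thesis by eventually_elim (auto simp: f_def indicator_def)
qed

text \<open>Strong convergence in \<open>L\<^sup>2\<close> gives convergence of the squared lengths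
  in \<open>L\<^sup>1\<close>, by factoring the difference of squares. As \<open>S\<close> has
  finite measure, the defect also tends to zero in \<open>L\<^sup>1\<close>, and the limit defect
  must vanish.\<close>

lemma limit_unit_length:
  fixes w :: "nat \<Rightarrow> 'a::euclidean_space \<Rightarrow> 'b::euclidean_space"
  assumes w: "\<And>k. w k \<in> L2" and u: "u \<in> L2" and lim: "(\<lambda>k. L2_norm (\<lambda>x. w k x - u x)) \<longlonglongrightarrow> 0"
    and S[measurable]: "S \<in> sets borel" and fin: "emeasure lborel S < \<infinity>"
    and int: "\<And>k. integrable lborel (\<lambda>x. indicator S x * (1 - (norm (w k x))\<^sup>2)\<^sup>2)"
    and defect: "(\<lambda>k. LINT x|lborel. indicator S x * (1 - (norm (w k x))\<^sup>2)\<^sup>2) \<longlonglongrightarrow> 0"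
  shows "AE x in lborel. x \<in> S \<longrightarrow> (norm (u x))\<^sup>2 = 1"
proof -
  have [measurable]: "w k \<in> borel_measurable borel" "u \<in> borel_measurable borel" for k
    using w u by (auto dest: L2_measurable)
  define i where "i = (\<lambda>x::'a. indicator S x :: real)"
  have i2: "i \<in> L2" unfolding i_def by (rule indicator_L2[OF S fin])
  define f where "f k x = indicator S x * (1 - (norm (w k x))\<^sup>2)" for k x
  have fsq: "(norm (f k x))\<^sup>2 = indicator S x * (1 - (norm (w k x))\<^sup>2)\<^sup>2" for k x
    by (auto simp: f_def indicator_def)
  have f2: "f k \<in> L2" for k
  proof (rule L2I)
    show "f k \<in> borel_measurable borel" unfolding f_def[abs_def] by measurable
    show "integrable lborel (\<lambda>x. (norm (f k x))\<^sup>2)" unfolding fsq by (rule int)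
  qed
  have fn: "(\<lambda>k. L2_norm (f k)) \<longlonglongrightarrow> 0"
    unfolding L2_norm_def L2_inner_self fsq using tendsto_real_sqrt[OF defect] by simp
  define F where "F x = indicator S x * (1 - (norm (u x))\<^sup>2)" for x
  have iS: "integrable lborel (\<lambda>x. indicator S x :: real)" using fin by simp
  have iu: "integrable lborel (\<lambda>x. indicator S x * (norm (u x))\<^sup>2)"
    by (rule Bochner_Integration.integrable_bound[OF L2_integrable_sq[OF u]]) (auto simp: indicator_def)
  have iF: "integrable lborel F"
    unfolding F_def[abs_def] using iS iu by (simp add: right_diff_distrib)
  have le: "(LINT x|lborel. \<bar>F x\<bar>) \<le> L2_norm i * L2_norm (f k) + L2_norm (\<lambda>x. w k x - u x) * (L2_norm (\<lambda>x. w k x - u x) + 2 * L2_norm u)" for k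
  proof -
    define a where "a = (\<lambda>x. norm (w k x - u x))"
    define b where "b = (\<lambda>x. norm (w k x) + norm (u x))"
    have a2: "a \<in> L2" unfolding a_def by (intro L2_norm_L2 L2_diff w u)
    have b2: "b \<in> L2" unfolding b_def by (intro L2_add L2_norm_L2 w u)
    have pt: "\<bar>F x\<bar> \<le> i x \<bullet> norm (f k x) + a x \<bullet> b x" for x
    proof (cases "x \<in> S")
      case True
      have "\<bar>(norm (w k x))\<^sup>2 - (norm (u x))\<^sup>2\<bar> = \<bar>norm (w k x) - norm (u x)\<bar> * b x"
        by (simp add: b_def power2_eq_square square_diff_square_factored abs_mult mult.commute)
      also have "\<dots> \<le> a x * b x"
        unfolding a_def by (intro mult_right_mono norm_triangle_ineq3) (simp add: b_def)
      finally have "\<bar>(norm (w k x))\<^sup>2 - (norm (u x))\<^sup>2\<bar> \<le> a x * b x" .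
      then show ?thesis using True by (simp add: F_def f_def i_def)
    next
      case False
      then show ?thesis by (simp add: F_def f_def i_def a_def b_def)
    qed
    have "(LINT x|lborel. \<bar>F x\<bar>) \<le> (LINT x|lborel. i x \<bullet> norm (f k x) + a x \<bullet> b x)"
      using iF by (intro integral_mono integrable_abs Bochner_Integration.integrable_add L2_inner_integrable i2 L2_norm_L2 f2 a2 b2 pt)
    also have "\<dots> = L2_inner i (\<lambda>x. norm (f k x)) + L2_inner a b"
      unfolding L2_inner_def by (intro Bochner_Integration.integral_add L2_inner_integrable i2 L2_norm_L2 f2 a2 b2)
    also have "\<dots> \<le> L2_norm i * L2_norm (f k) + L2_norm a * L2_norm b"
      using L2_Cauchy_Schwarz[OF i2 L2_norm_L2[OF f2[of k]]] L2_Cauchy_Schwarz[OF a2 b2]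
      unfolding L2_norm_norm by linarith
    also have "\<dots> \<le> L2_norm i * L2_norm (f k) + L2_norm a * (L2_norm (\<lambda>x. w k x - u x) + 2 * L2_norm u)"
    proof (intro add_left_mono mult_left_mono)
      have "L2_norm b \<le> L2_norm (w k) + L2_norm u"
        unfolding b_def using L2_norm_triangle[OF L2_norm_L2[OF w] L2_norm_L2[OF u], of k] by simp
      moreover have "L2_norm (w k) \<le> L2_norm (\<lambda>x. w k x - u x) + L2_norm u"
        using L2_norm_triangle[OF L2_diff[OF w u] u, of k] by simp
      ultimately show "L2_norm b \<le> L2_norm (\<lambda>x. w k x - u x) + 2 * L2_norm u" by linarith
    qed simp
    finally show ?thesis by (simp add: a_def)
  qed
  have "(LINT x|lborel. \<bar>F x\<bar>) \<le> L2_norm i * 0 + 0 * (0 + 2 * L2_norm u)"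
  proof (rule LIMSEQ_le_const)
    show "(\<lambda>k. L2_norm i * L2_norm (f k) + L2_norm (\<lambda>x. w k x - u x) * (L2_norm (\<lambda>x. w k x - u x) + 2 * L2_norm u)) \<longlonglongrightarrow> L2_norm i * 0 + 0 * (0 + 2 * L2_norm u)"
      by (intro tendsto_intros fn lim)
  qed (use le in auto)
  then have "(LINT x|lborel. \<bar>F x\<bar>) = 0" by (intro order_antisym Bochner_Integration.integral_nonneg) auto
  then have "AE x in lborel. \<bar>F x\<bar> = 0"
    using integral_nonneg_eq_0_iff_AE[OF integrable_abs[OF iF]] by simp
  then show ?thesis by eventually_elim (auto simp: F_def indicator_def)
qed

text \<open>Combining \<open>unit_defect\<close> with \<open>shift_diff_frac_bound\<close> at step
  \<rho> yields a defect of order \<open>\<rho> powr (2 * s)\<close>, and \<rho> is proportional to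
  the mesh size.\<close>

lemma unit_defect_tendsto_0:
  fixes \<T> :: "nat \<Rightarrow> 'a::euclidean_space set set" and w :: "nat \<Rightarrow> 'a \<Rightarrow> real ^ 'n"
  assumes s: "0 < s" "s < 1" and T: "\<And>k. triangulation (\<T> k)" and cov: "\<And>k. \<Union>(\<T> k) = S"
    and aff: "\<And>k K. K \<in> \<T> k \<Longrightarrow> affine_map_on K (w k)" and unit: "\<And>k z. z \<in> nodes (\<T> k) \<Longrightarrow> norm (w k z) = 1"
    and w: "\<And>k. w k \<in> frac_space s" and M: "\<And>k. frac_form s (w k) (w k) \<le> M"
    and \<kappa>: "\<kappa> > 0" "\<And>k K. K \<in> \<T> k \<Longrightarrow> \<exists>z. cball z (\<kappa> * diameter K) \<subseteq> K"
    and h: "\<And>k. h k > 0" "h \<longlonglongrightarrow> 0" and c1: "c1 > 0" "\<And>k K. K \<in> \<T> k \<Longrightarrow> c1 * h k \<le> diameter K"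
    and c2: "\<And>k K. K \<in> \<T> k \<Longrightarrow> diameter K \<le> c2 * h k"
  shows "integrable lborel (\<lambda>x. indicator S x * (1 - (norm (w k x))\<^sup>2)\<^sup>2)"
    and "(\<lambda>k. LINT x|lborel. indicator S x * (1 - (norm (w k x))\<^sup>2)\<^sup>2) \<longlonglongrightarrow> 0"
proof -
  \<comment> \<open>Half the radius of the inscribed ball that shape regularity and the lower
    diameter bound guarantee in every element.\<close>
  define \<rho> where "\<rho> k = \<kappa> * c1 * h k / 2" for k
  \<comment> \<open>Chosen so that \<open>q * \<rho> k = max c2 0 * h k\<close>; the maximum makes
    \<open>q\<close> nonnegative whatever the sign of \<open>c2\<close>.\<close>
  define q where "q = 2 * max c2 0 / (\<kappa> * c1)"
  have q0: "0 \<le> q" using \<kappa>(1) c1(1) by (simp add: q_def)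
  have \<rho>: "\<rho> k > 0" for k using \<kappa>(1) c1(1) h(1)[of k] by (simp add: \<rho>_def)
  have z: "\<exists>z. cball z (2 * \<rho> k) \<subseteq> K" if K: "K \<in> \<T> k" for k K
  proof -
    obtain z where z: "cball z (\<kappa> * diameter K) \<subseteq> K" using \<kappa>(2)[OF K] by blast
    have "2 * \<rho> k \<le> \<kappa> * diameter K"
      using mult_left_mono[OF c1(2)[OF K], of \<kappa>] \<kappa>(1) by (simp add: \<rho>_def mult_ac)
    then have "cball z (2 * \<rho> k) \<subseteq> cball z (\<kappa> * diameter K)" by (rule subset_cball)
    then show ?thesis using z by blast
  qed
  have q: "diameter K \<le> q * \<rho> k" if K: "K \<in> \<T> k" for k K
  proof -
    have "diameter K \<le> c2 * h k" by (rule c2[OF K])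
    also have "\<dots> \<le> max c2 0 * h k" using h(1)[of k] by (intro mult_right_mono) auto
    also have "\<dots> = q * \<rho> k" using \<kappa>(1) c1(1) by (simp add: q_def \<rho>_def)
    finally show ?thesis .
  qed
  note ud = unit_defect[OF T aff unit frac_spaceD(1)[OF w] z \<rho> q q0, unfolded cov]
  show "integrable lborel (\<lambda>x. indicator S x * (1 - (norm (w k x))\<^sup>2)\<^sup>2)" by (rule ud(1))
  define C where "C = 4 * real DIM('a) * q ^ (DIM('a) + 2)"
  have C0: "0 \<le> C" using q0 by (simp add: C_def)
  have \<rho>0: "(\<lambda>k. \<rho> k) \<longlonglongrightarrow> 0"
    using tendsto_mult_left[OF h(2), of "\<kappa> * c1 / 2"] by (simp add: \<rho>_def)
  show "(\<lambda>k. LINT x|lborel. indicator S x * (1 - (norm (w k x))\<^sup>2)\<^sup>2) \<longlonglongrightarrow> 0"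
  proof (rule Lim_null_comparison)
    have "((\<lambda>k. \<rho> k powr (2 * s)) \<longlongrightarrow> 0) sequentially"
      by (rule tendsto_zero_powrI[OF \<rho>0 tendsto_const]) (use s \<rho> in \<open>auto intro!: always_eventually less_imp_le\<close>)
    then show "(\<lambda>k. C * (real DIM('a) * (4 * \<rho> k powr (2 * s) * M))) \<longlonglongrightarrow> 0"
      using tendsto_mult_left[of "\<lambda>k. \<rho> k powr (2 * s)" 0 sequentially "C * real DIM('a) * 4 * M"] by (simp add: mult_ac)
    show "\<forall>\<^sub>F k in sequentially. norm (LINT x|lborel. indicator S x * (1 - (norm (w k x))\<^sup>2)\<^sup>2) \<le> C * (real DIM('a) * (4 * \<rho> k powr (2 * s) * M))"
    proof (intro always_eventually allI)
      fix k
      have "0 \<le> (LINT x|lborel. indicator S x * (1 - (norm (w k x))\<^sup>2)\<^sup>2)"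
        by (rule Bochner_Integration.integral_nonneg) simp
      then have "norm (LINT x|lborel. indicator S x * (1 - (norm (w k x))\<^sup>2)\<^sup>2) = (LINT x|lborel. indicator S x * (1 - (norm (w k x))\<^sup>2)\<^sup>2)"
        by simp
      also have "\<dots> \<le> C * (\<Sum>e\<in>(Basis :: 'a set). L2_inner (shift_diff (\<rho> k *\<^sub>R e) (w k)) (shift_diff (\<rho> k *\<^sub>R e) (w k)))"
        unfolding C_def by (rule ud(2))
      also have "\<dots> \<le> C * (\<Sum>e\<in>(Basis :: 'a set). 4 * \<rho> k powr (2 * s) * M)"
      proof (intro mult_left_mono sum_mono C0)
        fix e :: 'a assume e: "e \<in> Basis"
        have "L2_inner (shift_diff (\<rho> k *\<^sub>R e) (w k)) (shift_diff (\<rho> k *\<^sub>R e) (w k)) \<le> 4 * norm (\<rho> k *\<^sub>R e) powr (2 * s) * frac_form s (w k) (w k)"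
          by (rule shift_diff_frac_bound[OF s w])
        also have "norm (\<rho> k *\<^sub>R e) = \<rho> k" using e \<rho>[of k] by simp
        also have "4 * \<rho> k powr (2 * s) * frac_form s (w k) (w k) \<le> 4 * \<rho> k powr (2 * s) * M"
          by (intro mult_left_mono M) simp
        finally show "L2_inner (shift_diff (\<rho> k *\<^sub>R e) (w k)) (shift_diff (\<rho> k *\<^sub>R e) (w k)) \<le> 4 * \<rho> k powr (2 * s) * M" .
      qed
      finally show "norm (LINT x|lborel. indicator S x * (1 - (norm (w k x))\<^sup>2)\<^sup>2) \<le> C * (real DIM('a) * (4 * \<rho> k powr (2 * s) * M))"
        by simp
    qed
  qed
qed

theorem proposition5p1:
  fixes \<Omega> \<Omega>' :: "(real ^ 'd) set"
    and Nv u :: "real ^ 'd \<Rightarrow> real ^ 'n"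
    and s c :: real
    and h :: "nat \<Rightarrow> real"
    and \<T> \<T>' :: "nat \<Rightarrow> (real ^ 'd) set set"
    and uh :: "nat \<Rightarrow> real ^ 'd \<Rightarrow> real ^ 'n"
  assumes "CARD('n) \<ge> 2"
    and "0 < s" and "s < 1"
    and "bounded_polyhedral_domain \<Omega>" and "Lipschitz_boundary \<Omega>"
    and "bounded_polyhedral_domain \<Omega>'" and "closure \<Omega> \<subseteq> \<Omega>'"
    and "Nv \<in> Cc_infty \<Omega>'" and "\<forall>x\<in>frontier \<Omega>. norm (Nv x) = 1"
    and "\<And>k. h k > 0" and "h \<longlonglongrightarrow> 0"
    and "\<And>k. conforming_triangulation \<Omega> (\<T> k)"
    and "uniformly_shape_regular \<T>" and "quasiuniform h \<T>"
    and "\<And>k. conforming_triangulation \<Omega>' (\<T>' k)" and "\<And>k. \<T> k \<subseteq> \<T>' k"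
    and "uniformly_shape_regular \<T>'" and "(\<lambda>k. mesh_size (\<T>' k)) \<longlonglongrightarrow> 0"
    and "\<And>k. discrete_fractional_harmonic_map s \<Omega> (\<T> k) (\<T>' k) Nv (uh k)"
    and "\<And>k. L2_norm (frac_laplacian (s / 2) (uh k)) \<le> c"
    and "weak_accumulation_point uh u"
  shows "u \<in> admissible s \<Omega> Nv \<and>
    (\<forall>v\<in>Cc_infty \<Omega>. (AE x in lborel. x \<in> \<Omega> \<longrightarrow> u x \<bullet> v x = 0) \<longrightarrow>
       L2_inner (frac_laplacian (s / 2) u) (frac_laplacian (s / 2) v) = 0)"
proof -

  \<comment> \<open>The subsequence and its meshes\<close>
  note s = \<open>0 < s\<close> \<open>s < 1\<close>
  have \<Omega>: "open \<Omega>" "bounded \<Omega>" and \<Omega>': "open \<Omega>'" "bounded \<Omega>'" "\<Omega>' \<noteq> {}"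
    using assms(4,6) by (auto simp: bounded_polyhedral_domain_def)
  have sub\<Omega>: "\<Omega> \<subseteq> \<Omega>'" using assms(7) closure_subset by blast
  obtain R where "\<And>x. x \<in> \<Omega>' \<Longrightarrow> norm x \<le> R"
    using \<Omega>'(2) by (auto simp: bounded_iff)
  then have R: "x \<notin> \<Omega>'" if "norm x > R" for x
    using that by fastforce
  obtain LN BN where LN: "LN-lipschitz_on UNIV Nv" and BN: "\<And>x. norm (Nv x) \<le> BN"
    using Cc_infty_lipschitz[OF assms(8)] by blast
  have LN0: "0 \<le> LN" by (rule lipschitz_on_nonneg[OF LN])
  obtain \<delta> where \<delta>: "\<delta> > 0" "\<And>z x. Nv z \<noteq> 0 \<Longrightarrow> norm (z - x) < \<delta> \<Longrightarrow> x \<in> \<Omega>'"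
    using Cc_infty_support[OF assms(8) \<Omega>'(1)] by blast
  have Nv0: "Nv x = 0" if "x \<notin> \<Omega>'" for x using \<delta>(2)[of x x] \<delta>(1) that by auto
  obtain r where r: "strict_mono r" "weakly_converges_L2 (uh \<circ> r) u"
    using assms(21) by (auto simp: weak_accumulation_point_def)
  have "\<forall>\<^sub>F k in sequentially. mesh_size (\<T>' k) < \<delta>"
    using order_tendstoD(2)[OF assms(18) \<delta>(1)] .
  then obtain N0 where N0: "\<And>k. k \<ge> N0 \<Longrightarrow> mesh_size (\<T>' k) < \<delta>" by (auto simp: eventually_sequentially)
  \<comment> \<open>Skipping \<open>N0\<close> members makes every mesh finer than \<delta>, so the
    interpolated exterior data vanish outside the larger domain for all \<open>k\<close>.\<close>
  define \<iota> where "\<iota> k = r (k + N0)" for k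
  have \<iota>N: "\<iota> k \<ge> N0" for k using seq_suble[OF r(1), of "k + N0"] by (simp add: \<iota>_def)
  have \<iota>: "strict_mono \<iota>" using r(1) by (auto simp: strict_mono_def \<iota>_def)
  define w where "w k = uh (\<iota> k)" for k
  define m where "m k = mesh_size (\<T>' (\<iota> k))" for k
  have m\<delta>: "m k < \<delta>" for k unfolding m_def by (rule N0[OF \<iota>N])
  have m0: "m \<longlonglongrightarrow> 0" using LIMSEQ_subseq_LIMSEQ[OF assms(18) \<iota>] by (simp add: m_def[abs_def] o_def)
  have h0: "(\<lambda>k. h (\<iota> k)) \<longlonglongrightarrow> 0" using LIMSEQ_subseq_LIMSEQ[OF assms(11) \<iota>] by (simp add: o_def)
  have weak: "weakly_converges_L2 w u"
    unfolding weakly_converges_L2_def w_def \<iota>_def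
    using r(2) LIMSEQ_ignore_initial_segment[where k=N0]
    by (auto simp: weakly_converges_L2_def o_def)
  have T: "triangulation (\<T> k)" "\<Union>(\<T> k) = closure \<Omega>" for k
    using assms(12)[of k] by (auto simp: conforming_triangulation_def)
  have T': "triangulation (\<T>' k)" "\<Union>(\<T>' k) = closure \<Omega>'" for k
    using assms(15)[of k] by (auto simp: conforming_triangulation_def)
  have cov': "\<Omega>' \<subseteq> \<Union>(\<T>' k)" for k using T'(2) closure_subset by metis
  have cov: "\<Omega> \<subseteq> \<Union>(\<T> k)" for k using T(2) closure_subset by metis
  have mpos: "0 \<le> m k" for k
  proof -
    obtain x where "x \<in> \<Union>(\<T>' (\<iota> k))" using \<Omega>'(3) cov' by blast
    then obtain K where "K \<in> \<T>' (\<iota> k)" "x \<in> K" by blast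
    from mesh_size_dist[OF T'(1) this this(2)] show ?thesis by (simp add: m_def)
  qed

  \<comment> \<open>Uniform bounds for the discrete maps\<close>
  define I where "I k f = nodal_interpolant (\<T>' (\<iota> k)) f" for k and f :: "real ^ 'd \<Rightarrow> real ^ 'n"
  have IS1: "I k f \<in> S1 (\<T>' (\<iota> k))" for k f unfolding I_def by (rule nodal_interpolant_S1[OF T'(1)])
  have Inode: "I k f z = f z" if "z \<in> nodes (\<T>' (\<iota> k))" for k f z
    unfolding I_def by (rule nodal_interpolant_nodes[OF T'(1) that])
  have n1: "norm x = 1" if "(norm x)\<^sup>2 = 1" for x :: "real ^ 'n"
    using that norm_ge_zero[of x] by (simp only: power2_eq_1_iff) linarith
  have dadm: "w k \<in> discrete_admissible \<Omega> (\<T> (\<iota> k)) (\<T>' (\<iota> k)) Nv" for k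
    using assms(19)[of "\<iota> k"] by (simp add: discrete_fractional_harmonic_map_def w_def)
  have adm: "(\<lambda>x. w k x - I k Nv x) \<in> S1_0 \<Omega> (\<T>' (\<iota> k))" for k
    using dadm[of k] by (simp add: discrete_admissible_def I_def)
  have wunit: "norm (w k z) = 1" if "z \<in> nodes (\<T> (\<iota> k))" for k z
    using dadm[of k] that by (intro n1) (simp add: discrete_admissible_def)
  have orth: "L2_inner (frac_laplacian (s / 2) (w k)) (frac_laplacian (s / 2) v) = 0"
    if "v \<in> discrete_tangent \<Omega> (\<T> (\<iota> k)) (\<T>' (\<iota> k)) (w k)" for k v
    using assms(19)[of "\<iota> k"] that by (simp add: discrete_fractional_harmonic_map_def w_def)
  have wS1: "w k \<in> S1 (\<T>' (\<iota> k))" for k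
    using S1_add[of "\<lambda>x. w k x - I k Nv x" "\<T>' (\<iota> k)" "I k Nv"] adm[of k] IS1 by (simp add: S1_0_def)
  have wI: "w k x = I k Nv x" if "x \<notin> \<Omega>" for k x
    using adm[of k] that by (simp add: S1_0_def)
  have I0: "I k Nv x = 0" if "x \<notin> \<Omega>'" for k x
    unfolding I_def by (rule nodal_interpolant_vanishes[OF T'(1) \<delta>(2) m\<delta>[unfolded m_def] that])
  have w0: "w k x = 0" if "x \<notin> \<Omega>'" for k x using wI[of x k] I0[OF that] that sub\<Omega> by auto
  have wR: "w k x = 0" if "norm x > R" for k x by (rule w0[OF R[OF that]])
  have wT: "affine_map_on K (w k)" if "K \<in> \<T> (\<iota> k)" for k K
    using S1_affine[OF wS1] assms(16) that by blast
  \<comment> \<open>Nodal values have length 1, and an affine function stays in the unit ball if its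
    vertex values do.\<close>
  have w1: "norm (w k x) \<le> 1" if K: "K \<in> \<T> (\<iota> k)" and x: "x \<in> K" for k K x
  proof -
    have "norm (w k x - 0) \<le> 1"
      by (rule S1_norm_bound[OF T'(1) wS1 _ _ x])
        (use K assms(16) wunit nodes_extreme in \<open>fastforce+\<close>)
    then show ?thesis by simp
  qed
  \<comment> \<open>The 1 covers the domain, \<open>BN\<close> the exterior, where the discrete map
    is the interpolant of the data.\<close>
  define B where "B = max 1 BN"
  have wB: "norm (w k x) \<le> B" for k x
  proof (cases "x \<in> \<Omega>")
    case True
    then obtain K where "K \<in> \<T> (\<iota> k)" "x \<in> K" using cov by blast
    then show ?thesis using w1 by (fastforce simp: B_def)
  next
    case False
    show ?thesis
    proof (cases "x \<in> \<Omega>'")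
      case True
      then obtain K where K: "K \<in> \<T>' (\<iota> k)" "x \<in> K" using cov' by blast
      have "norm (I k Nv x - 0) \<le> BN"
      proof (rule S1_norm_bound[OF T'(1) IS1 K(1) _ K(2)])
        fix z assume "z extreme_point_of K"
        then show "norm (I k Nv z - 0) \<le> BN" using Inode[OF nodes_extreme[OF K(1)]] BN by simp
      qed
      then show ?thesis using wI[OF False] by (simp add: B_def)
    qed (simp add: w0 B_def)
  qed
  have wL: "\<exists>L. L-lipschitz_on UNIV (w k)" for k
    by (rule S1_lipschitz[OF T'(1) wS1 \<Omega>'(1) cov' w0])
  have wf: "w k \<in> frac_space s" for k
  proof -
    obtain L where "L-lipschitz_on UNIV (w k)" using wL by blast
    then show ?thesis by (rule lipschitz_frac_space[OF s _ wB[of k] wR[of _ k]])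
  qed
  have wE: "frac_form s (w k) (w k) \<le> c\<^sup>2" for k
  proof -
    have "frac_form s (w k) (w k) = (L2_norm (frac_laplacian (s / 2) (uh (\<iota> k))))\<^sup>2"
      by (simp add: frac_form_def L2_norm_square w_def)
    also have "\<dots> \<le> c\<^sup>2" using assms(20) by (intro power_mono) auto
    finally show ?thesis .
  qed

  \<comment> \<open>Strong convergence and the constraints on the limit\<close>
  note W = weakly_converges_L2D[OF weak]
  have uf: "u \<in> frac_space s"
    by (rule weak_limit_frac_space(1)[OF s weak wf wE wR wB])
  have strong: "(\<lambda>k. L2_norm (\<lambda>x. w k x - u x)) \<longlonglongrightarrow> 0"
    by (rule weak_limit_frac_space(2)[OF s weak wf wE wR wB])
  have NvB: "norm (Nv x) \<le> B" for x using BN[of x] by (simp add: B_def)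
  have NvR: "Nv x = 0" if "norm x > R" for x by (rule Nv0[OF R[OF that]])
  have Nvf: "Nv \<in> frac_space s" by (rule lipschitz_frac_space[OF s LN NvB NvR])
  \<comment> \<open>The interpolation error of the data is at most slope times mesh size, and both
    fields vanish beyond radius \<open>R\<close>.\<close>
  have ext: "AE x in lborel. x \<in> - \<Omega> \<longrightarrow> u x = Nv x"
  proof (rule limit_exterior_values[OF W(1) W(2) strong _ frac_spaceD(1)[OF Nvf]])
    show "- \<Omega> \<in> sets borel" using \<Omega>(1) by auto
    show "(\<lambda>k. LN * m k) \<longlonglongrightarrow> 0" using tendsto_mult_left[OF m0, of LN] by simp
    show "w k x = Nv x" if "norm x > R" for k x using wR[OF that] NvR[OF that] by simp
    show "norm (w k x - Nv x) \<le> LN * m k" if "x \<in> - \<Omega>" for k x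
    proof (cases "x \<in> \<Omega>'")
      case True
      then have "x \<in> \<Union>(\<T>' (\<iota> k))" using cov' by blast
      from nodal_interpolant_error[OF T'(1) LN this] show ?thesis using wI[of x k] that by (simp add: I_def m_def)
    next
      case False
      then show ?thesis using w0[OF False] Nv0[OF False] LN0 mpos by simp
    qed
  qed
  obtain \<kappa> where \<kappa>: "\<kappa> > 0" "\<And>k K. K \<in> \<T> k \<Longrightarrow> \<exists>z. cball z (\<kappa> * diameter K) \<subseteq> K"
    using assms(13) by (auto simp: uniformly_shape_regular_def)
  obtain c1 c2 where cc: "c1 > 0" "\<And>k K. K \<in> \<T> k \<Longrightarrow> c1 * h k \<le> diameter K" "\<And>k K. K \<in> \<T> k \<Longrightarrow> diameter K \<le> c2 * h k"
    using assms(14) unfolding quasiuniform_def by metis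
  have dpos: "diameter K > 0" if "K \<in> \<T> k" for k K
    using cc(2)[OF that] cc(1) assms(10)[of k] by (auto intro: less_le_trans[OF mult_pos_pos])
  \<comment> \<open>Stated on the closure because that is the union of the elements on which the
    defect is measured.\<close>
  have unit: "AE x in lborel. x \<in> closure \<Omega> \<longrightarrow> (norm (u x))\<^sup>2 = 1"
  proof (rule limit_unit_length[OF W(1) W(2) strong])
    show "closure \<Omega> \<in> sets borel" by simp
    show "emeasure lborel (closure \<Omega>) < \<infinity>"
      using \<Omega>(2) by (intro emeasure_compact_finite) (simp add: compact_closure)
    note ud = unit_defect_tendsto_0[where \<T>="\<lambda>k. \<T> (\<iota> k)" and h="\<lambda>k. h (\<iota> k)", OF s T(1) T(2) wT wunit wf wE \<kappa>(1) \<kappa>(2) assms(10) h0 cc(1) cc(2) cc(3)]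
    show "integrable lborel (\<lambda>x. indicator (closure \<Omega>) x * (1 - (norm (w k x))\<^sup>2)\<^sup>2)" for k by (rule ud(1))
    show "(\<lambda>k. LINT x|lborel. indicator (closure \<Omega>) x * (1 - (norm (w k x))\<^sup>2)\<^sup>2) \<longlonglongrightarrow> 0" by (rule ud(2))
  qed
  have unit\<Omega>: "AE x in lborel. x \<in> \<Omega> \<longrightarrow> (norm (u x))\<^sup>2 = 1"
    using unit by eventually_elim (use closure_subset in auto)
  have uB: "AE x in lborel. norm (u x) \<le> B"
    using unit\<Omega> ext
  proof eventually_elim
    case (elim x)
    show ?case
    proof (cases "x \<in> \<Omega>")
      case True
      then have "norm (u x) = 1" using elim by (intro n1) simp
      then show ?thesis by (simp add: B_def)
    qed (use elim NvB in simp)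
  qed
  have "(\<lambda>x. u x - Nv x) \<in> Hs s" by (rule frac_space_Hs[OF s frac_space_diff[OF uf Nvf]])
  moreover have "AE x in lborel. x \<notin> \<Omega> \<longrightarrow> u x - Nv x = 0" using ext by eventually_elim simp
  ultimately have "u \<in> admissible s \<Omega> Nv" using unit\<Omega> by (simp add: admissible_def Hs_tilde_def)

  \<comment> \<open>The limit equation\<close>
  moreover have "L2_inner (frac_laplacian (s / 2) u) (frac_laplacian (s / 2) v) = 0"
    if v: "v \<in> Cc_infty \<Omega>" and ov: "AE x in lborel. x \<in> \<Omega> \<longrightarrow> u x \<bullet> v x = 0" for v
  proof -
    obtain Lv Bv where Lv: "Lv-lipschitz_on UNIV v" and Bv: "\<And>x. norm (v x) \<le> Bv"
      using Cc_infty_lipschitz[OF v] by blast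
    obtain \<eta> where \<eta>: "\<eta> > 0" "\<And>z x. v z \<noteq> 0 \<Longrightarrow> norm (z - x) < \<eta> \<Longrightarrow> x \<in> \<Omega>"
      using Cc_infty_support[OF v \<Omega>(1)] by blast
    have v0: "v x = 0" if "x \<notin> \<Omega>" for x using \<eta>(2)[of x x] \<eta>(1) that by auto
    have vR: "v x = 0" if "norm x > R" for x using v0 R[OF that] sub\<Omega> by blast
    define B' where "B' = max B Bv"
    have B': "norm (w k x) \<le> B'" "norm (v x) \<le> B'" for k x
      using wB[of k x] Bv[of x] by (auto simp: B'_def)
    have uB': "AE x in lborel. norm (u x) \<le> B'" using uB by eventually_elim (simp add: B'_def)
    have vf: "v \<in> frac_space s" by (rule lipschitz_frac_space[OF s Lv Bv vR])
    \<comment> \<open>From \<open>N1\<close> on, the mesh is finer than the distance \<eta> that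
      keeps the support of \<open>v\<close> inside the domain, so interpolants of fields carried by
      \<open>v\<close> vanish outside it.\<close>
    have "\<forall>\<^sub>F k in sequentially. m k < \<eta>" using order_tendstoD(2)[OF m0 \<eta>(1)] .
    then obtain N1 where N1: "\<And>k. k \<ge> N1 \<Longrightarrow> m k < \<eta>" by (auto simp: eventually_sequentially)
    \<comment> \<open>The skew field itself is not a finite element function. Its interpolant is an
      admissible test field, so the form sees only the interpolation error, whose energy tends to
      zero.\<close>
    have test: "(\<lambda>k. frac_form s (w k) (\<lambda>x. wedge (v x) (w j x) (w k x))) \<longlonglongrightarrow> 0" for j
    proof (rule LIMSEQ_offset[where k=N1])
      obtain Lj where Lj: "Lj-lipschitz_on UNIV (w j)" using wL by blast
      define L where "L = max Lv Lj"
      have L: "L-lipschitz_on UNIV v" "L-lipschitz_on UNIV (w j)"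
        using lipschitz_on_le[OF Lv] lipschitz_on_le[OF Lj] by (auto simp: L_def)
      define E where "E k = (\<lambda>x. wedge (v x) (w j x) (w k x))" for k
      define g where "g k = (\<lambda>x. E k x - I k (E k) x)" for k
      have Ef: "E k \<in> frac_space s" for k
        unfolding E_def by (rule wedge_frac_space[OF s vf wf wf B'(2) B'(1) B'(1) vR])
      have IE0: "I k (E k) x = 0" if "k \<ge> N1" "x \<notin> \<Omega>" for k x
        unfolding I_def
      proof (rule nodal_interpolant_vanishes[OF T'(1) _ N1[OF that(1), unfolded m_def] that(2)])
        fix z x assume z: "E k z \<noteq> 0" "norm (z - x) < \<eta>"
        have "v z \<noteq> 0"
        proof
          assume "v z = 0"
          then show False using z(1) by (simp add: E_def)
        qed
        then show "x \<in> \<Omega>" using \<eta>(2) z(2) by blast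
      qed
      have err: "(4 * B' * L * (2 / \<kappa> + 1))-lipschitz_on UNIV (g k)" "norm (g k x) \<le> 8 * B' * L * m k" if k: "k \<ge> N1" for k x
      proof -
        have IE0': "nodal_interpolant (\<T>' (\<iota> k)) (\<lambda>x. wedge (v x) (w j x) (w k x)) x = 0" if "x \<notin> \<Omega>" for x
          using IE0[OF k that] by (simp add: I_def E_def)
        note we = wedge_interpolation_error[OF T'(1) assms(16) \<Omega>(1) cov \<kappa>(1) \<kappa>(2) dpos wT w1 L(1) B'(2) L(2) B'(1) v0 IE0']
        show "(4 * B' * L * (2 / \<kappa> + 1))-lipschitz_on UNIV (g k)"
          using we(1) by (simp add: g_def E_def I_def)
        show "norm (g k x) \<le> 8 * B' * L * m k"
          using we(2) mpos[of k] by (simp add: g_def E_def I_def m_def)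
      qed
      have g0: "g k x = 0" if "k \<ge> N1" "norm x > R" for k x
      proof -
        have "x \<notin> \<Omega>" using R[OF that(2)] sub\<Omega> by blast
        then show ?thesis using IE0[OF that(1)] v0 by (simp add: g_def E_def)
      qed
      have gf: "g k \<in> frac_space s" if "k \<ge> N1" for k
        by (rule lipschitz_frac_space[OF s err(1)[OF that] err(2)[OF that] g0[OF that]])
      \<comment> \<open>Tangency is required at nodes only, where the interpolant coincides with the
        skew field and hence is orthogonal to \<open>w k\<close>.\<close>
      have eq: "frac_form s (w k) (E k) = frac_form s (w k) (g k)" if k: "k \<ge> N1" for k
      proof -
        have "I k (E k) \<in> discrete_tangent \<Omega> (\<T> (\<iota> k)) (\<T>' (\<iota> k)) (w k)"
          unfolding discrete_tangent_def S1_0_def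
        proof (safe intro!: IS1)
          show "I k (E k) x = 0" if "x \<notin> \<Omega>" for x by (rule IE0[OF k that])
          fix z assume "z \<in> nodes (\<T> (\<iota> k))"
          then have "z \<in> nodes (\<T>' (\<iota> k))" using assms(16) by (auto simp: nodes_def)
          then show "I k (E k) z \<bullet> w k z = 0" by (simp add: Inode E_def inner_commute)
        qed
        then have "frac_form s (w k) (I k (E k)) = 0" unfolding frac_form_def by (rule orth)
        moreover have "I k (E k) = (\<lambda>x. E k x - g k x)" by (simp add: g_def)
        ultimately show ?thesis using frac_form_diff_right[OF Ef gf[OF k] wf, of k] by simp
      qed
      have "(\<lambda>k. frac_form s (g (k + N1)) (g (k + N1))) \<longlonglongrightarrow> 0"
      proof (rule frac_form_lipschitz_tendsto_0[OF s])
        show "(4 * B' * L * (2 / \<kappa> + 1))-lipschitz_on UNIV (g (k + N1))" for k by (rule err(1)[OF le_add2])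
        show "norm (g (k + N1) x) \<le> 8 * B' * L * m (k + N1)" for k x by (rule err(2)[OF le_add2])
        show "g (k + N1) x = 0" if "norm x > R" for k x by (rule g0[OF le_add2 that])
        show "(\<lambda>k. 8 * B' * L * m (k + N1)) \<longlonglongrightarrow> 0"
          using tendsto_mult_left[OF LIMSEQ_ignore_initial_segment[OF m0, of N1], of "8 * B' * L"] by simp
      qed
      then have "(\<lambda>k. \<bar>c\<bar> * sqrt (frac_form s (g (k + N1)) (g (k + N1)))) \<longlonglongrightarrow> \<bar>c\<bar> * sqrt 0"
        by (intro tendsto_mult_left tendsto_real_sqrt)
      then have lim: "(\<lambda>k. \<bar>c\<bar> * sqrt (frac_form s (g (k + N1)) (g (k + N1)))) \<longlonglongrightarrow> 0" by simp
      show "(\<lambda>k. frac_form s (w (k + N1)) (\<lambda>x. wedge (v x) (w j x) (w (k + N1) x))) \<longlonglongrightarrow> 0"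
      proof (rule Lim_null_comparison[OF _ lim], intro always_eventually allI)
        fix k
        have "\<bar>frac_form s (w (k + N1)) (E (k + N1))\<bar> \<le> sqrt (frac_form s (w (k + N1)) (w (k + N1))) * sqrt (frac_form s (g (k + N1)) (g (k + N1)))"
          unfolding eq[OF le_add2] by (rule frac_form_Cauchy_Schwarz[OF wf gf[OF le_add2]])
        also have "\<dots> \<le> \<bar>c\<bar> * sqrt (frac_form s (g (k + N1)) (g (k + N1)))"
          using real_sqrt_le_mono[OF wE] by (intro mult_right_mono) auto
        finally show "norm (frac_form s (w (k + N1)) (\<lambda>x. wedge (v x) (w j x) (w (k + N1) x))) \<le> \<bar>c\<bar> * sqrt (frac_form s (g (k + N1)) (g (k + N1)))"
          by (simp add: E_def)
      qed
    qed
    have "frac_form s u v = 0"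
      by (rule skew_test_limit[OF s wf wE wL B'(1) uf uB' strong Lv B'(2) v0 vR unit\<Omega> ov test])
    then show ?thesis by (simp add: frac_form_def)
  qed
  ultimately show ?thesis by blast
qed

end
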